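(* Let $\sigma:Z\to W$ be a purely odd submersion of smooth superschemes over $S$. Then the functor $\sigma_+:\mathcal D_Z\text{-mod}\to\mathcal D_W\text{-mod}$ is exact and preserves tensor products. It takes $\mathcal D_Z$-modules that are locally free as $\mathcal O_Z$-modules to locally free $\mathcal O_W$-modules, and preserves rank.
   Context: Base: $S=\operatorname{Spec}(\Lambda)$, where $\Lambda$ is a fixed supercommutative finite-dimensional nilpotent extension of $\mathbb C$. Superschemes and morphisms are over $S$; dimensions, tangent sheaves, differentials and differential operators are relative to $S$. One may work in the Zariski or the complex topology. $\mathcal D$-modules: for $Z$ smooth over $S$, $\mathcal D_Z$ is the sheaf of linear differential operators on $\mathcal O_Z$, $\mathcal T_Z$ the tangent sheaf. A $\mathcal D_Z$-module is a ($\mathbb Z_2$-graded) sheaf of $\mathcal O_Z$-modules $\mathcal F$ with a flat connection $\nabla$; $\nabla_v$ denotes the action of a vector field $v$. Tensor products of $\mathcal D_Z$-modules are taken over $\mathcal O_Z$, with the usual tensor product connection (similarly on $W$). Ranks are of the form $p|q$ (locally free of rank $p|q$ means locally isomorphic to $\mathcal O_Z^{p|q}$). A submersion $\sigma:Z\to W$ is purely odd if its fibers have dimension $(0|n)$ for some $n$; $Z$ and $W$ then have the same underlying topological space, $\sigma$ is the identity on it, and locally $\mathcal O_Z=\mathcal O_W[\theta_1,\dots,\theta_n]$ with odd fiber coordinates $\theta_i$. Let $\mathcal T_\sigma\subset\mathcal T_Z$ be the vertical tangent sheaf (kernel of $\mathcal T_Z\to\sigma^*\mathcal T_W$). Then $\sigma_+(\mathcal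 F)=\sigma_*(\operatorname{ann}(\mathcal T_\sigma))$, where $\operatorname{ann}(\mathcal T_\sigma)\subset\mathcal F$ is the subsheaf of sections killed by $\nabla_v$ for all $v\in\mathcal T_\sigma$; a vector field on $W$ acts on it through any local lift to a vector field on $Z$. *)

theory Defs
  imports
    "HOL-Analysis.Analysis"
    "HOL-Algebra.Ideal"
    "HOL-Algebra.Module"
    "HOL-Library.Z2"
    "HOL-Library.Poly_Mapping"
begin

section \<open>Superrings, superalgebras and supermodules\<close>

text \<open>Parities are elements of the two-element field \<^typ>\<open>bit\<close>. Rings and modules are given by
  the records of HOL-Algebra, extended by a family of homogeneous parts. In the record for
  supermodules, the fields \<open>mult\<close> and \<open>one\<close> (inherited from the HOL-Algebra record for modules)
  play no role.\<close>

record 'a superring = "'a ring" +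
  gr :: "bit \<Rightarrow> 'a set"

record ('a, 'k) superalg = "'a superring" +
  base :: "'k \<Rightarrow> 'a"

record ('a, 'm) supermod = "('a, 'm) module" +
  mgr :: "bit \<Rightarrow> 'm set"

definition is_grading :: "('a, 'r) ring_scheme \<Rightarrow> (bit \<Rightarrow> 'a set) \<Rightarrow> bool" where
  "is_grading R g \<longleftrightarrow>
     (\<forall>i. subgroup (g i) (add_monoid R)) \<and>
     (\<forall>x\<in>carrier R. \<exists>!ab. ab \<in> g 0 \<times> g 1 \<and> x = fst ab \<oplus>\<^bsub>R\<^esub> snd ab)"

text \<open>\<open>ksgn R i j x\<close> is the Koszul sign $(-1)^{ij}$ times \<open>x\<close>.\<close>

definition ksgn :: "('a, 'r) ring_scheme \<Rightarrow> bit \<Rightarrow> bit \<Rightarrow> 'a \<Rightarrow> 'a" where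
  "ksgn R i j x = (if i = 1 \<and> j = 1 then \<ominus>\<^bsub>R\<^esub> x else x)"

definition supercomm_ring :: "('a, 'r) superring_scheme \<Rightarrow> bool" where
  "supercomm_ring R \<longleftrightarrow>
     ring R \<and> is_grading R (gr R) \<and> \<one>\<^bsub>R\<^esub> \<in> gr R 0 \<and>
     (\<forall>i j. \<forall>a\<in>gr R i. \<forall>b\<in>gr R j.
        a \<otimes>\<^bsub>R\<^esub> b \<in> gr R (i + j) \<and> a \<otimes>\<^bsub>R\<^esub> b = ksgn R i j (b \<otimes>\<^bsub>R\<^esub> a))"

definition superring_hom :: "('a, 'r) superring_scheme \<Rightarrow> ('b, 's) superring_scheme \<Rightarrow> ('a \<Rightarrow> 'b) \<Rightarrow> bool" where
  "superring_hom R S h \<longleftrightarrow> h \<in> ring_hom R S \<and> (\<forall>i. h ` gr R i \<subseteq> gr S i)"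

definition superalgebra :: "('k, 'r) superring_scheme \<Rightarrow> ('a, 'k, 's) superalg_scheme \<Rightarrow> bool" where
  "superalgebra K A \<longleftrightarrow> supercomm_ring A \<and> superring_hom K A (base A)"

definition superalg_hom ::
    "('k, 'r) superring_scheme \<Rightarrow> ('a, 'k, 's) superalg_scheme \<Rightarrow> ('b, 'k, 't) superalg_scheme \<Rightarrow>
     ('a \<Rightarrow> 'b) \<Rightarrow> bool" where
  "superalg_hom K A B h \<longleftrightarrow>
     superring_hom A B h \<and> (\<forall>l\<in>carrier K. h (base A l) = base B l)"

text \<open>Left supermodules. The corresponding right action is $m a = (-1)^{|a||m|} a m$.\<close>

definition supermodule :: "('a, 'r) superring_scheme \<Rightarrow> ('a, 'm, 's) supermod_scheme \<Rightarrow> bool" where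
  "supermodule R M \<longleftrightarrow>
     abelian_group M \<and> is_grading M (mgr M) \<and>
     (\<forall>a\<in>carrier R. \<forall>m\<in>carrier M. a \<odot>\<^bsub>M\<^esub> m \<in> carrier M) \<and>
     (\<forall>a\<in>carrier R. \<forall>b\<in>carrier R. \<forall>m\<in>carrier M.
        (a \<oplus>\<^bsub>R\<^esub> b) \<odot>\<^bsub>M\<^esub> m = a \<odot>\<^bsub>M\<^esub> m \<oplus>\<^bsub>M\<^esub> b \<odot>\<^bsub>M\<^esub> m \<and>
        (a \<otimes>\<^bsub>R\<^esub> b) \<odot>\<^bsub>M\<^esub> m = a \<odot>\<^bsub>M\<^esub> (b \<odot>\<^bsub>M\<^esub> m)) \<and>
     (\<forall>a\<in>carrier R. \<forall>m\<in>carrier M. \<forall>n\<in>carrier M.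
        a \<odot>\<^bsub>M\<^esub> (m \<oplus>\<^bsub>M\<^esub> n) = a \<odot>\<^bsub>M\<^esub> m \<oplus>\<^bsub>M\<^esub> a \<odot>\<^bsub>M\<^esub> n) \<and>
     (\<forall>m\<in>carrier M. \<one>\<^bsub>R\<^esub> \<odot>\<^bsub>M\<^esub> m = m) \<and>
     (\<forall>i j. \<forall>a\<in>gr R i. \<forall>m\<in>mgr M j. a \<odot>\<^bsub>M\<^esub> m \<in> mgr M (i + j))"

definition mpart :: "('a, 'm, 's) supermod_scheme \<Rightarrow> bit \<Rightarrow> 'm \<Rightarrow> 'm" where
  "mpart M i m = (THE y. y \<in> mgr M i \<and> (\<exists>z\<in>mgr M (i + 1). m = y \<oplus>\<^bsub>M\<^esub> z))"

text \<open>Derivations of parity \<open>i\<close> of a superalgebra over \<open>K\<close>, relative to \<open>K\<close>.\<close>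

definition derivation ::
    "('k, 'r) superring_scheme \<Rightarrow> ('a, 'k, 's) superalg_scheme \<Rightarrow> bit \<Rightarrow> ('a \<Rightarrow> 'a) \<Rightarrow> bool" where
  "derivation K A i d \<longleftrightarrow>
     (\<forall>j. d ` gr A j \<subseteq> gr A (i + j)) \<and>
     (\<forall>a\<in>carrier A. d a \<in> carrier A) \<and>
     (\<forall>a\<in>carrier A. \<forall>b\<in>carrier A. d (a \<oplus>\<^bsub>A\<^esub> b) = d a \<oplus>\<^bsub>A\<^esub> d b) \<and>
     (\<forall>l\<in>carrier K. d (base A l) = \<zero>\<^bsub>A\<^esub>) \<and>
     (\<forall>j. \<forall>a\<in>gr A j. \<forall>b\<in>carrier A.
        d (a \<otimes>\<^bsub>A\<^esub> b) = d a \<otimes>\<^bsub>A\<^esub> b \<oplus>\<^bsub>A\<^esub> ksgn A i j (a \<otimes>\<^bsub>A\<^esub> d b))"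

definition lprod :: "('a, 'r) ring_scheme \<Rightarrow> 'a list \<Rightarrow> 'a" where
  "lprod R xs = foldr (\<lambda>x y. x \<otimes>\<^bsub>R\<^esub> y) xs \<one>\<^bsub>R\<^esub>"

text \<open>The monomial $\theta_{i_1}\cdots\theta_{i_k}$ for $I = \{i_1 < \dots < i_k\}$.\<close>

definition odd_monom :: "('a, 'r) ring_scheme \<Rightarrow> (nat \<Rightarrow> 'a) \<Rightarrow> nat set \<Rightarrow> 'a" where
  "odd_monom R \<theta> I = lprod R (map \<theta> (sorted_list_of_set I))"


section \<open>The base\<close>

definition complex_superring :: "complex superring" where
  "complex_superring =
     \<lparr>carrier = UNIV, mult = (*), one = 1, zero = 0, add = (+),
      gr = (\<lambda>i. if i = 0 then UNIV else {0})\<rparr>"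

text \<open>A supercommutative finite-dimensional nilpotent extension of the complex numbers.\<close>

definition nilpotent_extension :: "('l, complex) superalg \<Rightarrow> bool" where
  "nilpotent_extension \<Lambda> \<longleftrightarrow>
     superalgebra complex_superring \<Lambda> \<and>
     (\<exists>B. finite B \<and> B \<subseteq> carrier \<Lambda> \<and>
        (\<forall>x\<in>carrier \<Lambda>. \<exists>c. x = (\<Oplus>\<^bsub>\<Lambda>\<^esub>b\<in>B. base \<Lambda> (c b) \<otimes>\<^bsub>\<Lambda>\<^esub> b))) \<and>
     (\<exists>\<epsilon>. superring_hom \<Lambda> complex_superring \<epsilon> \<and> (\<forall>c. \<epsilon> (base \<Lambda> c) = c) \<and>
        (\<exists>n. \<forall>xs. length xs = n \<and> set xs \<subseteq> a_kernel \<Lambda> complex_superring \<epsilon> \<longrightarrow>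
           lprod \<Lambda> xs = \<zero>\<^bsub>\<Lambda>\<^esub>))"


section \<open>Superspaces over the base\<close>

text \<open>A superspace over \<open>\<Lambda>\<close> consists of a topological space \<open>space Z\<close> and a sheaf of supercommutative
  \<open>\<Lambda>\<close>-superalgebras, with sections \<open>sec Z U\<close> and restriction maps \<open>res Z U V\<close> for open sets
  \<open>V \<subseteq> U\<close>. Values of \<open>sec\<close> and \<open>res\<close> at sets that are not open are irrelevant.\<close>

record ('z, 'a, 'l) superspace =
  space :: "'z topology"
  sec :: "'z set \<Rightarrow> ('a, 'l) superalg"
  res :: "'z set \<Rightarrow> 'z set \<Rightarrow> 'a \<Rightarrow> 'a"

definition set_sheaf :: "'z topology \<Rightarrow> ('z set \<Rightarrow> 's set) \<Rightarrow> ('z set \<Rightarrow> 'z set \<Rightarrow> 's \<Rightarrow> 's) \<Rightarrow> bool" where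
  "set_sheaf X S r \<longleftrightarrow>
     (\<forall>U V. openin X U \<and> openin X V \<and> V \<subseteq> U \<longrightarrow> (\<forall>s\<in>S U. r U V s \<in> S V)) \<and>
     (\<forall>U. openin X U \<longrightarrow> (\<forall>s\<in>S U. r U U s = s)) \<and>
     (\<forall>U V W. openin X U \<and> openin X V \<and> openin X W \<and> W \<subseteq> V \<and> V \<subseteq> U \<longrightarrow>
        (\<forall>s\<in>S U. r V W (r U V s) = r U W s)) \<and>
     (\<forall>\<U>. (\<forall>V\<in>\<U>. openin X V) \<longrightarrow>
        (\<forall>s\<in>S (\<Union>\<U>). \<forall>t\<in>S (\<Union>\<U>). (\<forall>V\<in>\<U>. r (\<Union>\<U>) V s = r (\<Union>\<U>) V t) \<longrightarrow> s = t)) \<and>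
     (\<forall>\<U> f. (\<forall>V\<in>\<U>. openin X V \<and> f V \<in> S V) \<and>
          (\<forall>V\<in>\<U>. \<forall>V'\<in>\<U>. r V (V \<inter> V') (f V) = r V' (V \<inter> V') (f V')) \<longrightarrow>
        (\<exists>s\<in>S (\<Union>\<U>). \<forall>V\<in>\<U>. r (\<Union>\<U>) V s = f V))"

definition is_superspace :: "('l, complex) superalg \<Rightarrow> ('z, 'a, 'l) superspace \<Rightarrow> bool" where
  "is_superspace \<Lambda> Z \<longleftrightarrow>
     (\<forall>U. openin (space Z) U \<longrightarrow> superalgebra \<Lambda> (sec Z U)) \<and>
     (\<forall>U V. openin (space Z) U \<and> openin (space Z) V \<and> V \<subseteq> U \<longrightarrow>
        superalg_hom \<Lambda> (sec Z U) (sec Z V) (res Z U V)) \<and>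
     set_sheaf (space Z) (\<lambda>U. carrier (sec Z U)) (res Z)"

definition restrict_to :: "('z, 'a, 'l) superspace \<Rightarrow> 'z set \<Rightarrow> ('z, 'a, 'l) superspace" where
  "restrict_to Z U = Z\<lparr>space := subtopology (space Z) U\<rparr>"

text \<open>A morphism from \<open>Z\<close> to \<open>W\<close> consists of a continuous map \<open>pt\<close> and ring homomorphisms \<open>com V\<close>
  from the sections over \<open>V\<close> to the sections over the preimage of \<open>V\<close>. The last condition of
  \<open>superspace_mor\<close> says that the induced maps on stalks are local.\<close>

record ('z, 'w, 'a, 'b) smor =
  pt :: "'z \<Rightarrow> 'w"
  com :: "'w set \<Rightarrow> 'b \<Rightarrow> 'a"

definition pre :: "('z, 'a, 'l) superspace \<Rightarrow> ('z, 'w, 'a, 'b) smor \<Rightarrow> 'w set \<Rightarrow> 'z set" where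
  "pre Z \<sigma> V = {z \<in> topspace (space Z). pt \<sigma> z \<in> V}"

definition superspace_mor ::
    "('l, complex) superalg \<Rightarrow> ('z, 'a, 'l) superspace \<Rightarrow> ('w, 'b, 'l) superspace \<Rightarrow>
     ('z, 'w, 'a, 'b) smor \<Rightarrow> bool" where
  "superspace_mor \<Lambda> Z W \<sigma> \<longleftrightarrow>
     continuous_map (space Z) (space W) (pt \<sigma>) \<and>
     (\<forall>V. openin (space W) V \<longrightarrow>
        superalg_hom \<Lambda> (sec W V) (sec Z (pre Z \<sigma> V)) (com \<sigma> V)) \<and>
     (\<forall>V V'. openin (space W) V \<and> openin (space W) V' \<and> V' \<subseteq> V \<longrightarrow>
        (\<forall>b\<in>carrier (sec W V).
           com \<sigma> V' (res W V V' b) = res Z (pre Z \<sigma> V) (pre Z \<sigma> V') (com \<sigma> V b))) \<and>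
     (\<forall>V U. openin (space W) V \<and> openin (space Z) U \<and> U \<subseteq> pre Z \<sigma> V \<longrightarrow>
        (\<forall>b\<in>carrier (sec W V).
           res Z (pre Z \<sigma> V) U (com \<sigma> V b) \<in> Units (sec Z U) \<longrightarrow>
           (\<forall>z\<in>U. \<exists>V'. openin (space W) V' \<and> pt \<sigma> z \<in> V' \<and> V' \<subseteq> V \<and>
              res W V V' b \<in> Units (sec W V'))))"

text \<open>\<open>odd_projection Z W \<sigma> n\<close>: the morphism \<open>\<sigma>\<close> is, up to an isomorphism over \<open>W\<close>, the projection to \<open>W\<close>
  of the product of \<open>W\<close> and an affine space of dimension \<open>0|n\<close>; that is, the underlying map is a
  homeomorphism and $\mathcal O_Z = \mathcal O_W[\theta_1,\dots,\theta_n]$ with odd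
  coordinates $\theta_i$ (globally on \<open>W\<close>).\<close>

definition odd_projection ::
    "('z, 'a, 'l) superspace \<Rightarrow> ('w, 'b, 'l) superspace \<Rightarrow> ('z, 'w, 'a, 'b) smor \<Rightarrow> nat \<Rightarrow> bool" where
  "odd_projection Z W \<sigma> n \<longleftrightarrow>
     homeomorphic_map (space Z) (space W) (pt \<sigma>) \<and>
     (\<exists>\<theta>. (\<forall>i<n. \<theta> i \<in> gr (sec Z (topspace (space Z))) 1) \<and>
        (\<forall>V. openin (space W) V \<longrightarrow>
           (\<forall>s\<in>carrier (sec Z (pre Z \<sigma> V)).
              \<exists>!c. c \<in> Pow {..<n} \<rightarrow>\<^sub>E carrier (sec W V) \<and>
                 s = (\<Oplus>\<^bsub>sec Z (pre Z \<sigma> V)\<^esub>I\<in>Pow {..<n}.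
                        com \<sigma> V (c I) \<otimes>\<^bsub>sec Z (pre Z \<sigma> V)\<^esub>
                        odd_monom (sec Z (pre Z \<sigma> V))
                          (\<lambda>i. res Z (topspace (space Z)) (pre Z \<sigma> V) (\<theta> i)) I))))"

definition purely_odd_submersion ::
    "('l, complex) superalg \<Rightarrow> ('z, 'a, 'l) superspace \<Rightarrow> ('w, 'b, 'l) superspace \<Rightarrow>
     ('z, 'w, 'a, 'b) smor \<Rightarrow> bool" where
  "purely_odd_submersion \<Lambda> Z W \<sigma> \<longleftrightarrow>
     superspace_mor \<Lambda> Z W \<sigma> \<and>
     homeomorphic_map (space Z) (space W) (pt \<sigma>) \<and>
     (\<exists>n. \<forall>w\<in>topspace (space W). \<exists>V. openin (space W) V \<and> w \<in> V \<and>
        odd_projection (restrict_to Z (pre Z \<sigma> V)) (restrict_to W V) \<sigma> n)"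


section \<open>Smooth superschemes over the base\<close>

subsection \<open>Zariski topology\<close>

text \<open>Prime ideals of a supercommutative ring. For rings in which 2 is invertible they contain all
  odd elements, and correspond bijectively to the prime ideals of the even part.\<close>

definition prime_spectrum :: "('a, 'r) ring_scheme \<Rightarrow> 'a set set" where
  "prime_spectrum R = {P. ideal P R \<and> P \<noteq> carrier R \<and>
     (\<forall>a\<in>carrier R. \<forall>b\<in>carrier R. a \<otimes>\<^bsub>R\<^esub> b \<in> P \<longrightarrow> a \<in> P \<or> b \<in> P)}"

definition zariski_topology :: "('a, 'r) ring_scheme \<Rightarrow> 'a set topology" where
  "zariski_topology R = topology_generated_by ((\<lambda>f. {P \<in> prime_spectrum R. f \<notin> P}) ` carrier R)"

definition is_localization ::
    "('a, 'r) ring_scheme \<Rightarrow> 'a \<Rightarrow> ('b, 's) ring_scheme \<Rightarrow> ('a \<Rightarrow> 'b) \<Rightarrow> bool" where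
  "is_localization R f S h \<longleftrightarrow>
     h \<in> ring_hom R S \<and> h f \<in> Units S \<and>
     (\<forall>s\<in>carrier S. \<exists>n. \<exists>a\<in>carrier R. h (f [^]\<^bsub>R\<^esub> (n::nat)) \<otimes>\<^bsub>S\<^esub> s = h a) \<and>
     (\<forall>a\<in>carrier R. h a = \<zero>\<^bsub>S\<^esub> \<longrightarrow> (\<exists>n. f [^]\<^bsub>R\<^esub> (n::nat) \<otimes>\<^bsub>R\<^esub> a = \<zero>\<^bsub>R\<^esub>))"

text \<open>\<open>Z\<close> is the spectrum of its ring \<open>R\<close> of global sections: the underlying space is the prime
  spectrum of \<open>R\<close>, and the ring of sections over the distinguished open set of an even \<open>f\<close> is the
  localization of \<open>R\<close> at \<open>f\<close>.\<close>

definition affine_superscheme :: "('z, 'a, 'l) superspace \<Rightarrow> bool" where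
  "affine_superscheme Z \<longleftrightarrow>
     (let X = topspace (space Z); R = sec Z X in
      \<exists>h. homeomorphic_map (space Z) (zariski_topology R) h \<and>
          (\<forall>f\<in>gr R 0. let D = {z \<in> X. f \<notin> h z} in is_localization R f (sec Z D) (res Z X D)))"

text \<open>\<open>P\<close> is the polynomial superalgebra
  $\Lambda[x_0,\dots,x_{N-1}\,|\,\theta_0,\dots,\theta_{q-1}]$. The monomials are indexed by pairs of
  a list of exponents and a subset of $\{0,\dots,q-1\}$.\<close>

definition poly_index :: "nat \<Rightarrow> nat \<Rightarrow> (nat list \<times> nat set) set" where
  "poly_index N q = {\<alpha>. length \<alpha> = N} \<times> Pow {..<q}"

definition poly_monom :: "('p, 'r) ring_scheme \<Rightarrow> (nat \<Rightarrow> 'p) \<Rightarrow> (nat \<Rightarrow> 'p) \<Rightarrow> nat list \<times> nat set \<Rightarrow> 'p" where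
  "poly_monom P x \<theta> k =
     lprod P (map (\<lambda>i. x i [^]\<^bsub>P\<^esub> (fst k ! i)) [0..<length (fst k)]) \<otimes>\<^bsub>P\<^esub> odd_monom P \<theta> (snd k)"

definition polynomial_superalgebra ::
    "('l, complex) superalg \<Rightarrow> ('p, 'l) superalg \<Rightarrow> nat \<Rightarrow> nat \<Rightarrow> (nat \<Rightarrow> 'p) \<Rightarrow> (nat \<Rightarrow> 'p) \<Rightarrow> bool" where
  "polynomial_superalgebra \<Lambda> P N q x \<theta> \<longleftrightarrow>
     superalgebra \<Lambda> P \<and> (\<forall>i<N. x i \<in> gr P 0) \<and> (\<forall>j<q. \<theta> j \<in> gr P 1) \<and>
     (\<forall>s\<in>carrier P. \<exists>!c. c \<in> poly_index N q \<rightarrow>\<^sub>E carrier \<Lambda> \<and>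
        finite {k \<in> poly_index N q. c k \<noteq> \<zero>\<^bsub>\<Lambda>\<^esub>} \<and>
        s = (\<Oplus>\<^bsub>P\<^esub>k\<in>{k \<in> poly_index N q. c k \<noteq> \<zero>\<^bsub>\<Lambda>\<^esub>}. base P (c k) \<otimes>\<^bsub>P\<^esub> poly_monom P x \<theta> k))"

text \<open>\<open>A\<close> is a standard smooth \<open>\<Lambda>\<close>-superalgebra of relative dimension \<open>p|q\<close>: it is isomorphic to
  $\Lambda[x_0,\dots,x_{p+c-1}\,|\,\theta_0,\dots,\theta_{q-1}]/(f_0,\dots,f_{c-1})$ with even $f_i$
  such that the matrix $(\partial f_i/\partial x_j)_{i,j<c}$ is invertible over the even part of
  \<open>A\<close>. Here \<open>D j\<close> is the partial derivative $\partial/\partial x_j$ and \<open>g\<close> is the inverse matrix. The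
  bound variable \<open>P\<close> has a type in which a copy of the polynomial superalgebra (in terms of
  coefficients) is available.\<close>

definition standard_smooth ::
    "('l, complex) superalg \<Rightarrow> ('a, 'l) superalg \<Rightarrow> nat \<Rightarrow> nat \<Rightarrow> bool" where
  "standard_smooth \<Lambda> A p q \<longleftrightarrow>
     (\<exists>c (P :: (nat list \<times> nat set \<Rightarrow> 'l, 'l) superalg) x \<theta> f \<pi> D g.
        polynomial_superalgebra \<Lambda> P (p + c) q x \<theta> \<and>
        (\<forall>i<c. f i \<in> gr P 0) \<and>
        superalg_hom \<Lambda> P A \<pi> \<and> \<pi> ` carrier P = carrier A \<and>
        a_kernel P A \<pi> = Idl\<^bsub>P\<^esub> (f ` {..<c}) \<and>
        (\<forall>j<c. derivation \<Lambda> P 0 (D j) \<and>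
           (\<forall>i<p + c. D j (x i) = (if i = j then \<one>\<^bsub>P\<^esub> else \<zero>\<^bsub>P\<^esub>)) \<and>
           (\<forall>i<q. D j (\<theta> i) = \<zero>\<^bsub>P\<^esub>)) \<and>
        (\<forall>i<c. \<forall>j<c. g i j \<in> gr A 0) \<and>
        (\<forall>i<c. \<forall>k<c. (\<Oplus>\<^bsub>A\<^esub>j\<in>{..<c}. \<pi> (D j (f i)) \<otimes>\<^bsub>A\<^esub> g j k) =
           (if i = k then \<one>\<^bsub>A\<^esub> else \<zero>\<^bsub>A\<^esub>)))"

definition smooth_zariski :: "('l, complex) superalg \<Rightarrow> ('z, 'a, 'l) superspace \<Rightarrow> bool" where
  "smooth_zariski \<Lambda> Z \<longleftrightarrow>
     (\<forall>z\<in>topspace (space Z). \<exists>U p q. openin (space Z) U \<and> z \<in> U \<and>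
        affine_superscheme (restrict_to Z U) \<and> standard_smooth \<Lambda> (sec Z U) p q)"

subsection \<open>Complex topology\<close>

definition cn_topology :: "nat \<Rightarrow> (nat \<Rightarrow> complex) topology" where
  "cn_topology p = product_topology (\<lambda>_. euclidean) {..<p}"

text \<open>Holomorphic functions of \<open>p\<close> variables: complex differentiable at each point.\<close>

definition holomorphic_cn :: "nat \<Rightarrow> (nat \<Rightarrow> complex) set \<Rightarrow> ((nat \<Rightarrow> complex) \<Rightarrow> complex) \<Rightarrow> bool" where
  "holomorphic_cn p U f \<longleftrightarrow>
     (\<forall>z\<in>U. \<exists>d :: nat \<Rightarrow> complex. \<forall>e>0. \<exists>r>0. \<forall>y\<in>U. (\<forall>i<p. norm (y i - z i) < r) \<longrightarrow>
        norm (f y - f z - (\<Sum>i<p. d i * (y i - z i))) \<le> e * (\<Sum>i<p. norm (y i - z i)))"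

definition linear_functional :: "('l, complex) superalg \<Rightarrow> ('l \<Rightarrow> complex) \<Rightarrow> bool" where
  "linear_functional \<Lambda> u \<longleftrightarrow>
     (\<forall>x\<in>carrier \<Lambda>. \<forall>y\<in>carrier \<Lambda>. u (x \<oplus>\<^bsub>\<Lambda>\<^esub> y) = u x + u y) \<and>
     (\<forall>c. \<forall>x\<in>carrier \<Lambda>. u (base \<Lambda> c \<otimes>\<^bsub>\<Lambda>\<^esub> x) = c * u x)"

definition holomorphic_sections ::
    "('l, complex) superalg \<Rightarrow> nat \<Rightarrow> (nat \<Rightarrow> complex) set \<Rightarrow> ((nat \<Rightarrow> complex) \<Rightarrow> 'l) set" where
  "holomorphic_sections \<Lambda> p U =
     {s \<in> U \<rightarrow>\<^sub>E carrier \<Lambda>. \<forall>u. linear_functional \<Lambda> u \<longrightarrow> holomorphic_cn p U (\<lambda>z. u (s z))}"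

text \<open>The product over the complex numbers of an open subset \<open>V\<close> of complex affine \<open>p\<close>-space and the base.
  Since \<open>\<Lambda>\<close> is finite-dimensional, the sections of its structure sheaf are the \<open>\<Lambda>\<close>-valued
  holomorphic functions.\<close>

definition cn_superspace ::
    "('l, complex) superalg \<Rightarrow> nat \<Rightarrow> (nat \<Rightarrow> complex) set \<Rightarrow>
     (nat \<Rightarrow> complex, (nat \<Rightarrow> complex) \<Rightarrow> 'l, 'l) superspace" where
  "cn_superspace \<Lambda> p V =
     \<lparr>space = subtopology (cn_topology p) V,
      sec = (\<lambda>U. \<lparr>carrier = holomorphic_sections \<Lambda> p U,
                  mult = (\<lambda>s t. \<lambda>z\<in>U. s z \<otimes>\<^bsub>\<Lambda>\<^esub> t z),
                  one = (\<lambda>z\<in>U. \<one>\<^bsub>\<Lambda>\<^esub>),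
                  zero = (\<lambda>z\<in>U. \<zero>\<^bsub>\<Lambda>\<^esub>),
                  add = (\<lambda>s t. \<lambda>z\<in>U. s z \<oplus>\<^bsub>\<Lambda>\<^esub> t z),
                  gr = (\<lambda>i. {s \<in> holomorphic_sections \<Lambda> p U. \<forall>z\<in>U. s z \<in> gr \<Lambda> i}),
                  base = (\<lambda>l. \<lambda>z\<in>U. l)\<rparr>),
      res = (\<lambda>U U' s. restrict s U')\<rparr>"

definition smooth_complex :: "('l, complex) superalg \<Rightarrow> ('z, 'a, 'l) superspace \<Rightarrow> bool" where
  "smooth_complex \<Lambda> Z \<longleftrightarrow>
     (\<forall>z\<in>topspace (space Z). \<exists>U p q V \<phi>. openin (space Z) U \<and> z \<in> U \<and>
        openin (cn_topology p) V \<and>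
        superspace_mor \<Lambda> (restrict_to Z U) (cn_superspace \<Lambda> p V) \<phi> \<and>
        odd_projection (restrict_to Z U) (cn_superspace \<Lambda> p V) \<phi> q)"

datatype which_topology = Zariski_Topology | Complex_Topology

definition smooth_superscheme ::
    "which_topology \<Rightarrow> ('l, complex) superalg \<Rightarrow> ('z, 'a, 'l) superspace \<Rightarrow> bool" where
  "smooth_superscheme \<tau> \<Lambda> Z \<longleftrightarrow>
     is_superspace \<Lambda> Z \<and>
     (case \<tau> of Zariski_Topology \<Rightarrow> smooth_zariski \<Lambda> Z | Complex_Topology \<Rightarrow> smooth_complex \<Lambda> Z)"


section \<open>Sheaves of modules and D-modules\<close>

record ('z, 'a, 'm) omod =
  msec :: "'z set \<Rightarrow> ('a, 'm) supermod"
  mres :: "'z set \<Rightarrow> 'z set \<Rightarrow> 'm \<Rightarrow> 'm"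

definition omodule :: "('z, 'a, 'l) superspace \<Rightarrow> ('z, 'a, 'm, 'r) omod_scheme \<Rightarrow> bool" where
  "omodule Z F \<longleftrightarrow>
     (\<forall>U. openin (space Z) U \<longrightarrow> supermodule (sec Z U) (msec F U)) \<and>
     (\<forall>U V. openin (space Z) U \<and> openin (space Z) V \<and> V \<subseteq> U \<longrightarrow>
        (\<forall>m\<in>carrier (msec F U). \<forall>n\<in>carrier (msec F U).
           mres F U V (m \<oplus>\<^bsub>msec F U\<^esub> n) = mres F U V m \<oplus>\<^bsub>msec F V\<^esub> mres F U V n) \<and>
        (\<forall>a\<in>carrier (sec Z U). \<forall>m\<in>carrier (msec F U).
           mres F U V (a \<odot>\<^bsub>msec F U\<^esub> m) = res Z U V a \<odot>\<^bsub>msec F V\<^esub> mres F U V m) \<and>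
        (\<forall>i. mres F U V ` mgr (msec F U) i \<subseteq> mgr (msec F V) i)) \<and>
     set_sheaf (space Z) (\<lambda>U. carrier (msec F U)) (mres F)"

text \<open>Vector fields over \<open>U\<close> are families \<open>v\<close> indexed by the open subsets \<open>V\<close> of \<open>U\<close>, where \<open>v V\<close> acts on
  the sections over \<open>V\<close>. They are made extensional by \<open>vf_ext\<close>, so that equality of vector fields is
  equality of the functions representing them.\<close>

type_synonym ('z, 'a) vf = "'z set \<Rightarrow> 'a \<Rightarrow> 'a"

definition vf_ext :: "('z, 'a, 'l) superspace \<Rightarrow> 'z set \<Rightarrow> ('z, 'a) vf \<Rightarrow> ('z, 'a) vf" where
  "vf_ext Z U v = (\<lambda>V. if openin (space Z) V \<and> V \<subseteq> U then restrict (v V) (carrier (sec Z V)) else (\<lambda>_. undefined))"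

definition hom_vf :: "('l, complex) superalg \<Rightarrow> ('z, 'a, 'l) superspace \<Rightarrow> 'z set \<Rightarrow> bit \<Rightarrow> ('z, 'a) vf set" where
  "hom_vf \<Lambda> Z U i = {v. vf_ext Z U v = v \<and>
     (\<forall>V. openin (space Z) V \<and> V \<subseteq> U \<longrightarrow> derivation \<Lambda> (sec Z V) i (v V)) \<and>
     (\<forall>V V'. openin (space Z) V \<and> openin (space Z) V' \<and> V' \<subseteq> V \<and> V \<subseteq> U \<longrightarrow>
        (\<forall>a\<in>carrier (sec Z V). v V' (res Z V V' a) = res Z V V' (v V a)))}"

definition vf_add :: "('z, 'a, 'l) superspace \<Rightarrow> 'z set \<Rightarrow> ('z, 'a) vf \<Rightarrow> ('z, 'a) vf \<Rightarrow> ('z, 'a) vf" where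
  "vf_add Z U v w = vf_ext Z U (\<lambda>V a. v V a \<oplus>\<^bsub>sec Z V\<^esub> w V a)"

definition tangent :: "('l, complex) superalg \<Rightarrow> ('z, 'a, 'l) superspace \<Rightarrow> ('z, 'a, ('z, 'a) vf) omod" where
  "tangent \<Lambda> Z =
     \<lparr>msec = (\<lambda>U.
        \<lparr>carrier = {vf_add Z U v w | v w. v \<in> hom_vf \<Lambda> Z U 0 \<and> w \<in> hom_vf \<Lambda> Z U 1},
         mult = undefined, one = undefined,
         zero = vf_ext Z U (\<lambda>V a. \<zero>\<^bsub>sec Z V\<^esub>),
         add = vf_add Z U,
         smult = (\<lambda>b v. vf_ext Z U (\<lambda>V a. res Z U V b \<otimes>\<^bsub>sec Z V\<^esub> v V a)),
         mgr = hom_vf \<Lambda> Z U\<rparr>),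
      mres = (\<lambda>U V v. vf_ext Z V v)\<rparr>"

text \<open>The supercommutator of vector fields of parities \<open>i\<close> and \<open>j\<close>.\<close>

definition vf_bracket ::
    "('z, 'a, 'l) superspace \<Rightarrow> 'z set \<Rightarrow> bit \<Rightarrow> bit \<Rightarrow> ('z, 'a) vf \<Rightarrow> ('z, 'a) vf \<Rightarrow> ('z, 'a) vf" where
  "vf_bracket Z U i j v w =
     vf_ext Z U (\<lambda>V a. v V (w V a) \<ominus>\<^bsub>sec Z V\<^esub> ksgn (sec Z V) i j (w V (v V a)))"

text \<open>A D-module is a sheaf of modules with a flat connection; \<open>conn F U v m\<close> is $\nabla_v m$ for a vector
  field \<open>v\<close> and a section \<open>m\<close> over \<open>U\<close>.\<close>

record ('z, 'a, 'm) dmod = "('z, 'a, 'm) omod" +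
  conn :: "'z set \<Rightarrow> ('z, 'a) vf \<Rightarrow> 'm \<Rightarrow> 'm"

definition dmodule :: "('l, complex) superalg \<Rightarrow> ('z, 'a, 'l) superspace \<Rightarrow> ('z, 'a, 'm) dmod \<Rightarrow> bool" where
  "dmodule \<Lambda> Z F \<longleftrightarrow>
     omodule Z F \<and>
     (\<forall>U. openin (space Z) U \<longrightarrow>
        (let A = sec Z U; M = msec F U; T = msec (tangent \<Lambda> Z) U in
         (\<forall>v\<in>carrier T. \<forall>m\<in>carrier M. conn F U v m \<in> carrier M) \<and>
         (\<forall>v\<in>carrier T. \<forall>m\<in>carrier M. \<forall>n\<in>carrier M.
            conn F U v (m \<oplus>\<^bsub>M\<^esub> n) = conn F U v m \<oplus>\<^bsub>M\<^esub> conn F U v n) \<and>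
         (\<forall>v\<in>carrier T. \<forall>w\<in>carrier T. \<forall>m\<in>carrier M.
            conn F U (v \<oplus>\<^bsub>T\<^esub> w) m = conn F U v m \<oplus>\<^bsub>M\<^esub> conn F U w m) \<and>
         (\<forall>a\<in>carrier A. \<forall>v\<in>carrier T. \<forall>m\<in>carrier M.
            conn F U (a \<odot>\<^bsub>T\<^esub> v) m = a \<odot>\<^bsub>M\<^esub> conn F U v m) \<and>
         (\<forall>i j. \<forall>v\<in>mgr T i. \<forall>m\<in>mgr M j. conn F U v m \<in> mgr M (i + j)) \<and>
         (\<forall>i j. \<forall>v\<in>mgr T i. \<forall>a\<in>gr A j. \<forall>m\<in>carrier M.
            conn F U v (a \<odot>\<^bsub>M\<^esub> m) = v U a \<odot>\<^bsub>M\<^esub> m \<oplus>\<^bsub>M\<^esub> ksgn M i j (a \<odot>\<^bsub>M\<^esub> conn F U v m)) \<and>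
         (\<forall>i j. \<forall>v\<in>mgr T i. \<forall>w\<in>mgr T j. \<forall>m\<in>carrier M.
            conn F U (vf_bracket Z U i j v w) m =
              conn F U v (conn F U w m) \<ominus>\<^bsub>M\<^esub> ksgn M i j (conn F U w (conn F U v m))) \<and>
         (\<forall>V. openin (space Z) V \<and> V \<subseteq> U \<longrightarrow> (\<forall>v\<in>carrier T. \<forall>m\<in>carrier M.
            mres F U V (conn F U v m) = conn F V (mres (tangent \<Lambda> Z) U V v) (mres F U V m)))))"

subsection \<open>Morphisms and exactness\<close>

text \<open>Morphisms are families of even maps on sections.\<close>

definition omod_mor ::
    "('z, 'a, 'l) superspace \<Rightarrow> ('z, 'a, 'm, 'r) omod_scheme \<Rightarrow> ('z, 'a, 'n, 's) omod_scheme \<Rightarrow>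
     ('z set \<Rightarrow> 'm \<Rightarrow> 'n) \<Rightarrow> bool" where
  "omod_mor Z F G f \<longleftrightarrow>
     (\<forall>U. openin (space Z) U \<longrightarrow>
        (\<forall>m\<in>carrier (msec F U). f U m \<in> carrier (msec G U)) \<and>
        (\<forall>m\<in>carrier (msec F U). \<forall>n\<in>carrier (msec F U).
           f U (m \<oplus>\<^bsub>msec F U\<^esub> n) = f U m \<oplus>\<^bsub>msec G U\<^esub> f U n) \<and>
        (\<forall>a\<in>carrier (sec Z U). \<forall>m\<in>carrier (msec F U).
           f U (a \<odot>\<^bsub>msec F U\<^esub> m) = a \<odot>\<^bsub>msec G U\<^esub> f U m) \<and>
        (\<forall>i. f U ` mgr (msec F U) i \<subseteq> mgr (msec G U) i)) \<and>
     (\<forall>U V. openin (space Z) U \<and> openin (space Z) V \<and> V \<subseteq> U \<longrightarrow>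
        (\<forall>m\<in>carrier (msec F U). f V (mres F U V m) = mres G U V (f U m)))"

definition omod_iso ::
    "('z, 'a, 'l) superspace \<Rightarrow> ('z, 'a, 'm, 'r) omod_scheme \<Rightarrow> ('z, 'a, 'n, 's) omod_scheme \<Rightarrow>
     ('z set \<Rightarrow> 'm \<Rightarrow> 'n) \<Rightarrow> bool" where
  "omod_iso Z F G f \<longleftrightarrow>
     omod_mor Z F G f \<and>
     (\<forall>U. openin (space Z) U \<longrightarrow>
        bij_betw (f U) (carrier (msec F U)) (carrier (msec G U)) \<and>
        (\<forall>i. f U ` mgr (msec F U) i = mgr (msec G U) i))"

definition dmod_mor ::
    "('l, complex) superalg \<Rightarrow> ('z, 'a, 'l) superspace \<Rightarrow> ('z, 'a, 'm) dmod \<Rightarrow> ('z, 'a, 'n) dmod \<Rightarrow>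
     ('z set \<Rightarrow> 'm \<Rightarrow> 'n) \<Rightarrow> bool" where
  "dmod_mor \<Lambda> Z F G f \<longleftrightarrow>
     omod_mor Z F G f \<and>
     (\<forall>U. openin (space Z) U \<longrightarrow>
        (\<forall>v\<in>carrier (msec (tangent \<Lambda> Z) U). \<forall>m\<in>carrier (msec F U).
           f U (conn F U v m) = conn G U v (f U m)))"

definition dmod_iso ::
    "('l, complex) superalg \<Rightarrow> ('z, 'a, 'l) superspace \<Rightarrow> ('z, 'a, 'm) dmod \<Rightarrow> ('z, 'a, 'n) dmod \<Rightarrow>
     ('z set \<Rightarrow> 'm \<Rightarrow> 'n) \<Rightarrow> bool" where
  "dmod_iso \<Lambda> Z F G f \<longleftrightarrow> dmod_mor \<Lambda> Z F G f \<and> omod_iso Z F G f"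

text \<open>$0 \to F \to G \to H \to 0$ is an exact sequence of sheaves.\<close>

definition short_exact ::
    "('z, 'a, 'l) superspace \<Rightarrow> ('z, 'a, 'm) dmod \<Rightarrow> ('z, 'a, 'n) dmod \<Rightarrow> ('z, 'a, 'k) dmod \<Rightarrow>
     ('z set \<Rightarrow> 'm \<Rightarrow> 'n) \<Rightarrow> ('z set \<Rightarrow> 'n \<Rightarrow> 'k) \<Rightarrow> bool" where
  "short_exact Z F G H f g \<longleftrightarrow>
     (\<forall>U. openin (space Z) U \<longrightarrow>
        inj_on (f U) (carrier (msec F U)) \<and>
        (\<forall>s\<in>carrier (msec G U). g U s = \<zero>\<^bsub>msec H U\<^esub> \<longleftrightarrow>
           (\<forall>x\<in>U. \<exists>V. openin (space Z) V \<and> x \<in> V \<and> V \<subseteq> U \<and>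
              (\<exists>t\<in>carrier (msec F V). f V t = mres G U V s))) \<and>
        (\<forall>s\<in>carrier (msec H U).
           \<forall>x\<in>U. \<exists>V. openin (space Z) V \<and> x \<in> V \<and> V \<subseteq> U \<and>
              (\<exists>t\<in>carrier (msec G V). g V t = mres H U V s)))"

subsection \<open>Locally free modules\<close>

definition free_omod :: "('z, 'a, 'l) superspace \<Rightarrow> nat \<Rightarrow> nat \<Rightarrow> ('z, 'a, nat \<Rightarrow> 'a) omod" where
  "free_omod Z p q =
     \<lparr>msec = (\<lambda>U. let A = sec Z U in
        \<lparr>carrier = {..<p + q} \<rightarrow>\<^sub>E carrier A,
         mult = undefined, one = undefined,
         zero = (\<lambda>k\<in>{..<p + q}. \<zero>\<^bsub>A\<^esub>),
         add = (\<lambda>c d. \<lambda>k\<in>{..<p + q}. c k \<oplus>\<^bsub>A\<^esub> d k),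
         smult = (\<lambda>a c. \<lambda>k\<in>{..<p + q}. a \<otimes>\<^bsub>A\<^esub> c k),
         mgr = (\<lambda>i. \<Pi>\<^sub>E k\<in>{..<p + q}. gr A (if k < p then i else i + 1))\<rparr>),
      mres = (\<lambda>U V c. \<lambda>k\<in>{..<p + q}. res Z U V (c k))\<rparr>"

definition free_near :: "('z, 'a, 'l) superspace \<Rightarrow> ('z, 'a, 'm, 'r) omod_scheme \<Rightarrow> 'z \<Rightarrow> nat \<Rightarrow> nat \<Rightarrow> bool" where
  "free_near Z F z p q \<longleftrightarrow>
     (\<exists>U f. openin (space Z) U \<and> z \<in> U \<and>
        omod_iso (restrict_to Z U) F (free_omod (restrict_to Z U) p q) f)"

definition locally_free :: "('z, 'a, 'l) superspace \<Rightarrow> ('z, 'a, 'm, 'r) omod_scheme \<Rightarrow> bool" where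
  "locally_free Z F \<longleftrightarrow> (\<forall>z\<in>topspace (space Z). \<exists>p q. free_near Z F z p q)"

definition locally_free_of_rank ::
    "('z, 'a, 'l) superspace \<Rightarrow> ('z, 'a, 'm, 'r) omod_scheme \<Rightarrow> nat \<Rightarrow> nat \<Rightarrow> bool" where
  "locally_free_of_rank Z F p q \<longleftrightarrow> (\<forall>z\<in>topspace (space Z). free_near Z F z p q)"

subsection \<open>Tensor products\<close>

text \<open>The tensor product of supermodules: the quotient of the free abelian group on the pairs \<open>(m, n)\<close> by
  the subgroup \<open>tensor_rel\<close>, whose generators express biadditivity and $m a \otimes n = m \otimes a n$.
  Its elements are represented as cosets.\<close>

inductive_set tensor_rel ::
    "('a, 'r) superring_scheme \<Rightarrow> ('a, 'm, 's) supermod_scheme \<Rightarrow> ('a, 'n, 't) supermod_scheme \<Rightarrow>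
     ('m \<times> 'n \<Rightarrow>\<^sub>0 int) set"
  for R M N where
    zero: "0 \<in> tensor_rel R M N"
  | diff: "x \<in> tensor_rel R M N \<Longrightarrow> y \<in> tensor_rel R M N \<Longrightarrow> x - y \<in> tensor_rel R M N"
  | add_left: "m \<in> carrier M \<Longrightarrow> m' \<in> carrier M \<Longrightarrow> n \<in> carrier N \<Longrightarrow>
      frag_of (m \<oplus>\<^bsub>M\<^esub> m', n) - frag_of (m, n) - frag_of (m', n) \<in> tensor_rel R M N"
  | add_right: "m \<in> carrier M \<Longrightarrow> n \<in> carrier N \<Longrightarrow> n' \<in> carrier N \<Longrightarrow>
      frag_of (m, n \<oplus>\<^bsub>N\<^esub> n') - frag_of (m, n) - frag_of (m, n') \<in> tensor_rel R M N"
  | balanced: "a \<in> gr R i \<Longrightarrow> m \<in> mgr M j \<Longrightarrow> n \<in> carrier N \<Longrightarrow>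
      frag_of (ksgn M i j (a \<odot>\<^bsub>M\<^esub> m), n) - frag_of (m, a \<odot>\<^bsub>N\<^esub> n) \<in> tensor_rel R M N"

definition tensor_frags ::
    "('a, 'm, 's) supermod_scheme \<Rightarrow> ('a, 'n, 't) supermod_scheme \<Rightarrow> ('m \<times> 'n \<Rightarrow>\<^sub>0 int) set" where
  "tensor_frags M N = {c. Poly_Mapping.keys c \<subseteq> carrier M \<times> carrier N}"

definition tensor_class ::
    "('a, 'r) superring_scheme \<Rightarrow> ('a, 'm, 's) supermod_scheme \<Rightarrow> ('a, 'n, 't) supermod_scheme \<Rightarrow>
     ('m \<times> 'n \<Rightarrow>\<^sub>0 int) \<Rightarrow> ('m \<times> 'n \<Rightarrow>\<^sub>0 int) set" where
  "tensor_class R M N c = {c' \<in> tensor_frags M N. c' - c \<in> tensor_rel R M N}"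

definition tensor_supermod ::
    "('a, 'r) superring_scheme \<Rightarrow> ('a, 'm, 's) supermod_scheme \<Rightarrow> ('a, 'n, 't) supermod_scheme \<Rightarrow>
     ('a, ('m \<times> 'n \<Rightarrow>\<^sub>0 int) set) supermod" where
  "tensor_supermod R M N =
     \<lparr>carrier = tensor_class R M N ` tensor_frags M N,
      mult = undefined, one = undefined,
      zero = tensor_class R M N 0,
      add = (\<lambda>X Y. \<Union>c\<in>X. \<Union>d\<in>Y. tensor_class R M N (c + d)),
      smult = (\<lambda>a X. \<Union>c\<in>X. tensor_class R M N (frag_extend (\<lambda>(m, n). frag_of (a \<odot>\<^bsub>M\<^esub> m, n)) c)),
      mgr = (\<lambda>i. tensor_class R M N `
               {c. Poly_Mapping.keys c \<subseteq> (\<Union>j. mgr M j \<times> mgr N (i + j))})\<rparr>"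

text \<open>The presheaf of tensor products of sections, with the tensor product connection
  $\nabla_v(m \otimes n) = \nabla_v m \otimes n + (-1)^{|v||m|} m \otimes \nabla_v n$, extended to
  inhomogeneous \<open>v\<close> and \<open>m\<close> by means of their homogeneous parts.\<close>

definition tensor_conn_frag ::
    "('l, complex) superalg \<Rightarrow> ('z, 'a, 'l) superspace \<Rightarrow> ('z, 'a, 'm) dmod \<Rightarrow> ('z, 'a, 'n) dmod \<Rightarrow>
     'z set \<Rightarrow> ('z, 'a) vf \<Rightarrow> ('m \<times> 'n \<Rightarrow>\<^sub>0 int) \<Rightarrow> ('m \<times> 'n \<Rightarrow>\<^sub>0 int)" where
  "tensor_conn_frag \<Lambda> Z F G U v =
     frag_extend (\<lambda>(m, n). frag_of (conn F U v m, n) +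
       (\<Sum>i\<in>{0, 1}. \<Sum>j\<in>{0, 1}. frag_cmul (if i = 1 \<and> j = 1 then -1 else 1)
          (frag_of (mpart (msec F U) j m, conn G U (mpart (msec (tangent \<Lambda> Z) U) i v) n))))"

definition tensor_presheaf ::
    "('l, complex) superalg \<Rightarrow> ('z, 'a, 'l) superspace \<Rightarrow> ('z, 'a, 'm) dmod \<Rightarrow> ('z, 'a, 'n) dmod \<Rightarrow>
     ('z, 'a, ('m \<times> 'n \<Rightarrow>\<^sub>0 int) set) dmod" where
  "tensor_presheaf \<Lambda> Z F G =
     \<lparr>msec = (\<lambda>U. tensor_supermod (sec Z U) (msec F U) (msec G U)),
      mres = (\<lambda>U V X. \<Union>c\<in>X. tensor_class (sec Z V) (msec F V) (msec G V)
                (frag_extend (\<lambda>(m, n). frag_of (mres F U V m, mres G U V n)) c)),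
      conn = (\<lambda>U v X. \<Union>c\<in>X. tensor_class (sec Z U) (msec F U) (msec G U)
                (tensor_conn_frag \<Lambda> Z F G U v c))\<rparr>"

text \<open>Sheafification. The germ at \<open>x\<close> of a section \<open>t\<close> over \<open>V\<close> is represented as an equivalence class of
  pairs, and sections of the associated sheaf over \<open>U\<close> are families of germs that are locally given by
  sections of the presheaf. Operations on such families are defined by \<open>germwise\<close>: the relation
  \<open>Q V t\<close> says that \<open>t\<close> is obtained by applying the operation to sections of the presheaf over \<open>V\<close>
  that represent the arguments.\<close>

definition germ ::
    "'z topology \<Rightarrow> ('z, 'a, 'p) dmod \<Rightarrow> 'z \<Rightarrow> 'z set \<Rightarrow> 'p \<Rightarrow> ('z set \<times> 'p) set" where
  "germ X P x V t =
     {(V', t'). openin X V' \<and> x \<in> V' \<and> t' \<in> carrier (msec P V') \<and>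
        (\<exists>W. openin X W \<and> x \<in> W \<and> W \<subseteq> V \<inter> V' \<and> mres P V W t = mres P V' W t')}"

definition represents ::
    "'z topology \<Rightarrow> ('z, 'a, 'p) dmod \<Rightarrow> 'z set \<Rightarrow> 'p \<Rightarrow> ('z \<Rightarrow> ('z set \<times> 'p) set) \<Rightarrow> bool" where
  "represents X P V t s \<longleftrightarrow> t \<in> carrier (msec P V) \<and> (\<forall>y\<in>V. s y = germ X P y V t)"

definition germwise ::
    "'z topology \<Rightarrow> ('z, 'a, 'p) dmod \<Rightarrow> 'z set \<Rightarrow> ('z set \<Rightarrow> 'p \<Rightarrow> bool) \<Rightarrow>
     'z \<Rightarrow> ('z set \<times> 'p) set" where
  "germwise X P U Q =
     (\<lambda>x\<in>U. THE g. \<exists>V t. openin X V \<and> x \<in> V \<and> V \<subseteq> U \<and> Q V t \<and> g = germ X P x V t)"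

definition sheafification ::
    "('l, complex) superalg \<Rightarrow> ('z, 'a, 'l) superspace \<Rightarrow> ('z, 'a, 'p) dmod \<Rightarrow>
     ('z, 'a, 'z \<Rightarrow> ('z set \<times> 'p) set) dmod" where
  "sheafification \<Lambda> Z P =
     (let X = space Z; rep = represents X P in
      \<lparr>msec = (\<lambda>U.
         \<lparr>carrier = {s \<in> extensional U. \<forall>x\<in>U. \<exists>V t. openin X V \<and> x \<in> V \<and> V \<subseteq> U \<and> rep V t s},
          mult = undefined, one = undefined,
          zero = germwise X P U (\<lambda>V t. t = \<zero>\<^bsub>msec P V\<^esub>),
          add = (\<lambda>s s'. germwise X P U (\<lambda>V t. \<exists>a b. rep V a s \<and> rep V b s' \<and> t = a \<oplus>\<^bsub>msec P V\<^esub> b)),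
          smult = (\<lambda>r s. germwise X P U (\<lambda>V t. \<exists>a. rep V a s \<and> t = res Z U V r \<odot>\<^bsub>msec P V\<^esub> a)),
          mgr = (\<lambda>i. {s \<in> extensional U. \<forall>x\<in>U. \<exists>V t. openin X V \<and> x \<in> V \<and> V \<subseteq> U \<and>
                    rep V t s \<and> t \<in> mgr (msec P V) i})\<rparr>),
       mres = (\<lambda>U V s. restrict s V),
       conn = (\<lambda>U v s. germwise X P U
                 (\<lambda>V t. \<exists>a. rep V a s \<and> t = conn P V (mres (tangent \<Lambda> Z) U V v) a))\<rparr>)"

definition tensor_dmod ::
    "('l, complex) superalg \<Rightarrow> ('z, 'a, 'l) superspace \<Rightarrow> ('z, 'a, 'm) dmod \<Rightarrow> ('z, 'a, 'n) dmod \<Rightarrow>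
     ('z, 'a, 'z \<Rightarrow> ('z set \<times> ('m \<times> 'n \<Rightarrow>\<^sub>0 int) set) set) dmod" where
  "tensor_dmod \<Lambda> Z F G = sheafification \<Lambda> Z (tensor_presheaf \<Lambda> Z F G)"

text \<open>The section $m \otimes n$ of the tensor product sheaf.\<close>

definition pure_tensor ::
    "('l, complex) superalg \<Rightarrow> ('z, 'a, 'l) superspace \<Rightarrow> ('z, 'a, 'm) dmod \<Rightarrow> ('z, 'a, 'n) dmod \<Rightarrow>
     'z set \<Rightarrow> 'm \<Rightarrow> 'n \<Rightarrow> 'z \<Rightarrow> ('z set \<times> ('m \<times> 'n \<Rightarrow>\<^sub>0 int) set) set" where
  "pure_tensor \<Lambda> Z F G U m n =
     (\<lambda>x\<in>U. germ (space Z) (tensor_presheaf \<Lambda> Z F G) x U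
        (tensor_class (sec Z U) (msec F U) (msec G U) (frag_of (m, n))))"


section \<open>The functor\<close>

text \<open>Sections of the vertical tangent sheaf over \<open>U\<close>: the vector fields that annihilate all functions pulled
  back from \<open>W\<close>.\<close>

definition vertical ::
    "('l, complex) superalg \<Rightarrow> ('z, 'a, 'l) superspace \<Rightarrow> ('w, 'b, 'l) superspace \<Rightarrow> ('z, 'w, 'a, 'b) smor \<Rightarrow>
     'z set \<Rightarrow> ('z, 'a) vf set" where
  "vertical \<Lambda> Z W \<sigma> U = {v \<in> carrier (msec (tangent \<Lambda> Z) U).
     \<forall>V. openin (space W) V \<longrightarrow> (\<forall>b\<in>carrier (sec W V).
       v (U \<inter> pre Z \<sigma> V) (res Z (pre Z \<sigma> V) (U \<inter> pre Z \<sigma> V) (com \<sigma> V b)) = \<zero>\<^bsub>sec Z (U \<inter> pre Z \<sigma> V)\<^esub>)}"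

definition ann_vertical ::
    "('l, complex) superalg \<Rightarrow> ('z, 'a, 'l) superspace \<Rightarrow> ('w, 'b, 'l) superspace \<Rightarrow> ('z, 'w, 'a, 'b) smor \<Rightarrow>
     ('z, 'a, 'm) dmod \<Rightarrow> 'z set \<Rightarrow> 'm set" where
  "ann_vertical \<Lambda> Z W \<sigma> F U = {m \<in> carrier (msec F U).
     \<forall>V. openin (space Z) V \<and> V \<subseteq> U \<longrightarrow>
       (\<forall>v\<in>vertical \<Lambda> Z W \<sigma> V. conn F V v (mres F U V m) = \<zero>\<^bsub>msec F V\<^esub>)}"

text \<open>\<open>v'\<close> is a lift over \<open>U\<close> of the vector field \<open>v\<close> over \<open>V\<close>.\<close>

definition local_lift ::
    "('l, complex) superalg \<Rightarrow> ('z, 'a, 'l) superspace \<Rightarrow> ('w, 'b, 'l) superspace \<Rightarrow> ('z, 'w, 'a, 'b) smor \<Rightarrow>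
     'w set \<Rightarrow> ('w, 'b) vf \<Rightarrow> 'z set \<Rightarrow> ('z, 'a) vf \<Rightarrow> bool" where
  "local_lift \<Lambda> Z W \<sigma> V v U v' \<longleftrightarrow>
     openin (space Z) U \<and> U \<subseteq> pre Z \<sigma> V \<and> v' \<in> carrier (msec (tangent \<Lambda> Z) U) \<and>
     (\<forall>V'. openin (space W) V' \<and> V' \<subseteq> V \<longrightarrow> (\<forall>b\<in>carrier (sec W V').
        v' (U \<inter> pre Z \<sigma> V') (res Z (pre Z \<sigma> V') (U \<inter> pre Z \<sigma> V') (com \<sigma> V' b)) =
        res Z (pre Z \<sigma> V') (U \<inter> pre Z \<sigma> V') (com \<sigma> V' (v V' b))))"

text \<open>A lift of a vector field on \<open>W\<close> need only exist locally, so the action of \<open>v\<close> is the section that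
  restricts to $\nabla_{v'} m$ for every local lift \<open>v'\<close>.\<close>

definition dplus ::
    "('l, complex) superalg \<Rightarrow> ('z, 'a, 'l) superspace \<Rightarrow> ('w, 'b, 'l) superspace \<Rightarrow> ('z, 'w, 'a, 'b) smor \<Rightarrow>
     ('z, 'a, 'm) dmod \<Rightarrow> ('w, 'b, 'm) dmod" where
  "dplus \<Lambda> Z W \<sigma> F =
     \<lparr>msec = (\<lambda>V. let U = pre Z \<sigma> V; M = msec F U; N = ann_vertical \<Lambda> Z W \<sigma> F U in
        \<lparr>carrier = N,
         mult = undefined, one = undefined,
         zero = \<zero>\<^bsub>M\<^esub>,
         add = add M,
         smult = (\<lambda>b m. com \<sigma> V b \<odot>\<^bsub>M\<^esub> m),
         mgr = (\<lambda>i. mgr M i \<inter> N)\<rparr>),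
      mres = (\<lambda>V V'. mres F (pre Z \<sigma> V) (pre Z \<sigma> V')),
      conn = (\<lambda>V v m. THE n. n \<in> ann_vertical \<Lambda> Z W \<sigma> F (pre Z \<sigma> V) \<and>
                (\<forall>U v'. local_lift \<Lambda> Z W \<sigma> V v U v' \<longrightarrow>
                   conn F U v' (mres F (pre Z \<sigma> V) U m) = mres F (pre Z \<sigma> V) U n))\<rparr>"

definition dplus_mor ::
    "('z, 'a, 'l) superspace \<Rightarrow> ('z, 'w, 'a, 'b) smor \<Rightarrow> ('z set \<Rightarrow> 'm \<Rightarrow> 'n) \<Rightarrow> 'w set \<Rightarrow> 'm \<Rightarrow> 'n" where
  "dplus_mor Z \<sigma> f = (\<lambda>V. f (pre Z \<sigma> V))"

end

theory Submission
 imports Defs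
begin

text \<open>All assertions are local on \<open>W\<close>, and locally $\mathcal O_Z = \mathcal O_W[\theta_1,\dots,\theta_n]$.
 In such coordinates the vertical vector fields are the combinations of the partial derivatives
 $\partial_i$ with $\partial_i\theta_j = \delta_{ij}$. They are odd, anticommute and square to zero, so for
 a flat connection the operators $\nabla_{\partial_i}$ on a module anticommute and square to zero as
 well, and
 \[ P = (1 - \theta_n\nabla_{\partial_n}) \cdots (1 - \theta_1\nabla_{\partial_1}) \]
 is a projection onto the sections killed by all vertical vector fields (\<open>proj_ann\<close>, \<open>proj_fix\<close>). It
 preserves parity, commutes with horizontal maps (\<open>oddproj_natural\<close>), and is semilinear over the
 augmentation $\mathcal O_Z \to \mathcal O_W$, $\theta_i \mapsto 0$ (\<open>aug\<close>).

 Exactness (\<open>dplus_exact\<close>) holds because $P$ turns a local preimage of an annihilated section into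
 an annihilated preimage. If the module is free over $\mathcal O_Z$ with a given basis, then $P$
 applied to the basis yields a basis of the annihilated sections over $\mathcal O_W$, with the same
 parities, because every section differs from its projection by multiples of the $\theta_i$
 (\<open>free_over_frame\<close>, \<open>dplus_free_near\<close>). For tensor products, the inclusions of the annihilated
 sections induce a map from the tensor product over $\mathcal O_W$ to the tensor product over
 $\mathcal O_Z$. Applying $P$ to both factors maps relations over $\mathcal O_Z$ to relations over
 $\mathcal O_W$, which gives injectivity (\<open>te_frame\<close>); and an element that is killed by the
 $\nabla_{\partial_i}$ does not change when $P$ is applied to both factors, which gives surjectivity
 (\<open>surj_frame\<close>, \<open>dplus_tensor\<close>).

 A vector field on \<open>W\<close> lifts to \<open>Z\<close> in coordinates by letting it act trivially on the $\theta_i$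
 (\<open>lift_near\<close>). Two lifts differ by a vertical field, and the bracket of a lift and a vertical field is
 vertical; so the action of a lift on annihilated sections is well-defined, is again annihilated,
 and is flat (\<open>dconn\<close>, \<open>dplus_dmodule\<close>).\<close>

section \<open>Graded abelian groups and supermodules\<close>

definition hpart :: "('a, 'r) ring_scheme => (bit => 'a set) => bit => 'a => 'a" where
 "hpart G g i x = (THE y. y \<in> g i & (\<exists>z\<in>g (i + 1). x = y \<oplus>\<^bsub>G\<^esub> z))"

text \<open>For odd \<open>i\<close> this is the parity involution, which multiplies odd elements by \<open>-1\<close>. It
 replaces the Koszul sign $(-1)^{i|x|}$ by an expression that is additive in \<open>x\<close>, so that sign
 rules can be stated for inhomogeneous elements.\<close>

definition ptwist :: "('a, 'r) ring_scheme => (bit => 'a set) => bit => 'a => 'a" where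
 "ptwist G g i x = (if i = 1 then hpart G g 0 x \<ominus>\<^bsub>G\<^esub> hpart G g 1 x else x)"

lemma mpart_eq_hpart: "mpart M i m = hpart M (mgr M) i m"
 by (simp add: mpart_def hpart_def)

lemma bit_cases: "(i::bit) = 0 \<or> i = 1"
 by (cases i) auto

lemma bit_add_self [simp]: "(i::bit) + i = 0" "i + (i + j) = j" "i + j + j = i"
 by (cases i; cases j; simp)+

lemma (in abelian_group) neg_unique:
 "x \<in> carrier G ==> y \<in> carrier G ==> x \<oplus> y = \<zero> ==> y = \<ominus> x"
 using minus_equality[of y x] a_comm by metis

lemma (in abelian_group) neg_zero [simp]: "\<ominus> \<zero> = \<zero>"
 using neg_unique[of \<zero> \<zero>] by simp

lemmas (in abelian_group) abelian_group_simprules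
 [algebra abelian_group "zero G" "add G" "a_inv G" "a_minus G"] =
 a_closed zero_closed a_inv_closed minus_closed a_assoc l_zero l_neg a_comm minus_eq
 r_zero r_neg r_neg2 r_neg1 minus_add minus_minus neg_zero a_lcomm

lemma (in abelian_group) ksgn_closed [simp]: "x \<in> carrier G ==> ksgn G i j x \<in> carrier G"
 by (simp add: ksgn_def)

locale graded_group = abelian_group G for G (structure) +
 fixes g :: "bit => 'a set"
 assumes grading: "is_grading G g"
begin

lemma part_subgroup: "subgroup (g i) (add_monoid G)"
 using grading by (simp add: is_grading_def)

lemma g_closed: "x \<in> g i ==> x \<in> carrier G"
 using subgroup.subset[OF part_subgroup] by auto

lemma g_zero [simp]: "\<zero> \<in> g i"
 using subgroup.one_closed[OF part_subgroup] by simp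

lemma g_add: "x \<in> g i ==> y \<in> g i ==> x \<oplus> y \<in> g i"
 using subgroup.m_closed[OF part_subgroup] by simp

lemma g_neg: "x \<in> g i ==> \<ominus> x \<in> g i"
 using subgroup.m_inv_closed[OF part_subgroup] by (simp add: a_inv_def)

lemma g_minus: "x \<in> g i ==> y \<in> g i ==> x \<ominus> y \<in> g i"
 by (simp add: a_minus_def g_add g_neg)

lemma g_ksgn: "x \<in> g k ==> ksgn G i j x \<in> g k"
 by (simp add: ksgn_def g_neg)

lemma ex1_parts: "x \<in> carrier G ==> \<exists>!ab. ab \<in> g 0 \<times> g 1 & x = fst ab \<oplus> snd ab"
 using grading by (simp add: is_grading_def)

lemma parts_unique:
 assumes "a \<in> g i" "b \<in> g (i + 1)" "a' \<in> g i" "b' \<in> g (i + 1)" "a \<oplus> b = a' \<oplus> b'"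
 shows "a = a' & b = b'"
proof -
 have c: "a \<in> carrier G" "b \<in> carrier G" "a' \<in> carrier G" "b' \<in> carrier G"
 using assms g_closed by auto
 have *: "a = a' & b = b'" if "a \<in> g 0" "b \<in> g 1" "a' \<in> g 0" "b' \<in> g 1" "a \<oplus> b = a' \<oplus> b'" for a b a' b'
 proof -
 have "a \<oplus> b \<in> carrier G" using that g_closed by auto
 from ex1_parts[OF this] obtain p where
 "ALL ab. ab \<in> g 0 \<times> g 1 & a \<oplus> b = fst ab \<oplus> snd ab --> ab = p" by (rule ex1E)
 from this[rule_format, of "(a, b)"] this[rule_format, of "(a', b')"] that show ?thesis by simp
 qed
 consider "i = 0" | "i = 1" using bit_cases by auto
 then show ?thesis
 proof cases
 case 1
 then show ?thesis using *[of a b a' b'] assms by simp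
 next
 case 2
 have "b \<oplus> a = b' \<oplus> a'" using assms(5) c a_comm by simp
 then show ?thesis using *[of b a b' a'] assms 2 by simp
 qed
qed

lemma obtain_parts:
 assumes "x \<in> carrier G"
 obtains a b where "a \<in> g i" "b \<in> g (i + 1)" "x = a \<oplus> b"
proof -
 obtain a b where ab: "a \<in> g 0" "b \<in> g 1" "x = a \<oplus> b"
 proof -
 from ex1_implies_ex[OF ex1_parts[OF assms]] obtain ab where
 "ab \<in> g 0 \<times> g 1 & x = fst ab \<oplus> snd ab" by (rule exE)
 then show thesis using that[of "fst ab" "snd ab"] by (simp add: mem_Times_iff)
 qed
 then have "x = b \<oplus> a" using g_closed a_comm by blast
 then show thesis using that ab bit_cases[of i] by auto
qed

abbreviation "prt \<equiv> hpart G g"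
abbreviation "tw \<equiv> ptwist G g"

lemma part_eqI:
 assumes "a \<in> g i" "b \<in> g (i + 1)" "x = a \<oplus> b"
 shows "prt i x = a"
 unfolding hpart_def using assms parts_unique by (intro the_equality) blast+

lemma part_in: "x \<in> carrier G ==> prt i x \<in> g i"
 by (metis obtain_parts part_eqI)

lemma part_closed [simp]: "x \<in> carrier G ==> prt i x \<in> carrier G"
 using part_in g_closed by blast

lemma part_sum: "x \<in> carrier G ==> prt i x \<oplus> prt (i + 1) x = x"
proof -
 assume x: "x \<in> carrier G"
 obtain a b where ab: "a \<in> g i" "b \<in> g (i + 1)" "x = a \<oplus> b" using obtain_parts[OF x] .
 have "prt i x = a" using ab by (rule part_eqI)
 moreover have "prt (i + 1) x = b"
 proof (rule part_eqI)
 show "a \<in> g (i + 1 + 1)" using ab bit_cases[of i] by auto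
 show "x = b \<oplus> a" using ab g_closed a_comm by blast
 qed (use ab in auto)
 ultimately show ?thesis using ab by simp
qed

lemma part_sum01: "x \<in> carrier G ==> prt 0 x \<oplus> prt 1 x = x"
 using part_sum[of x 0] by simp

lemma part_of: "x \<in> g i ==> prt j x = (if j = i then x else \<zero>)"
proof -
 assume x: "x \<in> g i"
 have "prt i x = x" using x g_closed by (intro part_eqI[where b=\<zero>]) auto
 moreover have "j ~= i ==> prt j x = \<zero>"
 using x g_closed by (intro part_eqI[where b=x]) (cases i; cases j; auto)+
 ultimately show ?thesis by auto
qed

lemma g_disjoint: "x \<in> g i ==> x \<in> g (i + 1) ==> x = \<zero>"
 using part_of[of x i i] part_of[of x "i + 1" i] by (cases i) auto

lemma part_add: "x \<in> carrier G ==> y \<in> carrier G ==> prt i (x \<oplus> y) = prt i x \<oplus> prt i y"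
proof -
 assume xy: "x \<in> carrier G" "y \<in> carrier G"
 have "x \<oplus> y = (prt i x \<oplus> prt (i+1) x) \<oplus> (prt i y \<oplus> prt (i+1) y)"
 using xy part_sum by simp
 also have "\<dots> = (prt i x \<oplus> prt i y) \<oplus> (prt (i+1) x \<oplus> prt (i+1) y)"
 using xy by (simp add: a_ac)
 finally show ?thesis
 by (rule part_eqI[rotated 2]) (simp_all add: xy part_in g_add)
qed

lemma part_zero [simp]: "prt i \<zero> = \<zero>"
 using part_of[of \<zero> 0 i] by simp

lemma graded_induct [consumes 1, case_names hom add]:
 assumes "x \<in> carrier G" "!!i x. x \<in> g i ==> P x"
 "!!x y. x \<in> carrier G ==> y \<in> carrier G ==> P x ==> P y ==> P (x \<oplus> y)"
 shows "P x"
 by (metis assms part_in part_sum01 part_closed)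

lemma tw_closed [simp]: "x \<in> carrier G ==> tw i x \<in> carrier G"
 by (simp add: ptwist_def)

lemma tw_0 [simp]: "tw 0 x = x"
 by (simp add: ptwist_def)

lemma tw_of: "x \<in> g j ==> tw i x = ksgn G i j x"
 using bit_cases[of j] g_closed by (auto simp: ptwist_def ksgn_def part_of a_minus_def)

lemma tw_in: "x \<in> g j ==> tw i x \<in> g j"
 by (auto simp: tw_of ksgn_def g_neg)

lemma tw_add: "x \<in> carrier G ==> y \<in> carrier G ==> tw i (x \<oplus> y) = tw i x \<oplus> tw i y"
 by (auto simp: ptwist_def part_add a_minus_def minus_add a_ac)

lemma tw_zero [simp]: "tw i \<zero> = \<zero>"
 by (simp add: tw_of[OF g_zero[of 0]] ksgn_def)

lemma tw_tw [simp]: "x \<in> carrier G ==> tw i (tw i x) = x"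
proof (induction rule: graded_induct)
 case (hom j x)
 then have "tw i (tw i x) = ksgn G i j (ksgn G i j x)"
 using tw_of tw_in by metis
 then show ?case using hom g_closed by (simp add: ksgn_def)
qed (simp add: tw_add)

end

lemma graded_groupI:
 fixes G (structure)
 assumes "abelian_group G" "!!i. subgroup (g i) (add_monoid G)"
 "!!x. x \<in> carrier G ==> EX a b. a \<in> g 0 & b \<in> g 1 & x = a \<oplus> b"
 "!!x. x \<in> g 0 ==> x \<in> g 1 ==> x = \<zero>"
 shows "graded_group G g"
proof -
 interpret abelian_group G by fact
 have sub: "g i <= carrier G" for i using subgroup.subset[OF assms(2)] by auto
 have "\<exists>!ab. ab \<in> g 0 \<times> g 1 & x = fst ab \<oplus> snd ab" if x: "x \<in> carrier G" for x
 proof -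
 obtain a b where ab: "a \<in> g 0" "b \<in> g 1" "x = a \<oplus> b" using assms(3)[OF x] by blast
 have "a' = a & b' = b" if ab': "a' \<in> g 0" "b' \<in> g 1" "x = a' \<oplus> b'" for a' b'
 proof -
 have c: "a \<in> carrier G" "b \<in> carrier G" "a' \<in> carrier G" "b' \<in> carrier G"
 using ab ab' sub by auto
 have m: "a \<ominus> a' \<in> g 0" "b' \<ominus> b \<in> g 1"
 using subgroup.m_closed[OF assms(2)] subgroup.m_inv_closed[OF assms(2)] ab ab'
 by (auto simp: a_minus_def a_inv_def)
 have "a \<ominus> a' = (a \<oplus> b) \<ominus> (a' \<oplus> b)" using c by algebra
 also have "\<dots> = (a' \<oplus> b') \<ominus> (a' \<oplus> b)" using ab ab' by simp
 also have "\<dots> = b' \<ominus> b" using c by algebra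
 finally have e: "a \<ominus> a' = b' \<ominus> b" .
 then have "a \<ominus> a' = \<zero>" "b' \<ominus> b = \<zero>" using assms(4)[of "a \<ominus> a'"] m by simp_all
 have "a = (a \<ominus> a') \<oplus> a'" "b' = (b' \<ominus> b) \<oplus> b" using c by algebra+
 then show ?thesis using c \<open>a \<ominus> a' = \<zero>\<close> \<open>b' \<ominus> b = \<zero>\<close> by simp
 qed
 note uniq = this
 show ?thesis
 proof (rule ex1I[of _ "(a, b)"])
 fix p assume "p \<in> g 0 \<times> g 1 & x = fst p \<oplus> snd p"
 then show "p = (a, b)" using uniq[of "fst p" "snd p"] by (simp add: mem_Times_iff prod_eq_iff)
 qed (simp add: ab(1,2), rule ab(3))
 qed
 then show ?thesis using assms by unfold_locales (simp add: is_grading_def)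
qed

locale superring = ring R for R (structure) +
 assumes supercomm: "supercomm_ring R"
begin

sublocale gr: graded_group R "gr R"
 using supercomm by unfold_locales (simp add: supercomm_ring_def)

lemma one_even: "\<one> \<in> gr R 0"
 using supercomm by (simp add: supercomm_ring_def)

lemma mult_gr: "a \<in> gr R i ==> b \<in> gr R j ==> a \<otimes> b \<in> gr R (i + j)"
 using supercomm unfolding supercomm_ring_def by blast

lemma supercommute: "a \<in> gr R i ==> b \<in> gr R j ==> a \<otimes> b = ksgn R i j (b \<otimes> a)"
 using supercomm unfolding supercomm_ring_def by blast

lemma supercommute_tw: "a \<in> gr R i ==> b \<in> carrier R ==> a \<otimes> b = gr.tw i b \<otimes> a"
proof -
 assume a: "a \<in> gr R i" and b: "b \<in> carrier R"
 have ac: "a \<in> carrier R" using a gr.g_closed by auto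
 from b show ?thesis
 proof (induction rule: gr.graded_induct)
 case (hom j b)
 have "b \<in> carrier R" using hom gr.g_closed by auto
 then have "ksgn R i j (b \<otimes> a) = gr.tw i b \<otimes> a"
 using ac by (simp add: gr.tw_of[OF hom] ksgn_def l_minus)
 then show ?case using supercommute[OF a hom] by simp
 qed (use ac in \<open>simp add: gr.tw_add r_distr l_distr\<close>)
qed

end

lemma superringI: "supercomm_ring R ==> superring R"
 by (rule superring.intro) (auto simp only: supercomm_ring_def intro: superring_axioms.intro)

locale supmod = superring R + M: graded_group M "mgr M"
 for R :: "('a, 'r) superring_scheme" (structure) and M :: "('a, 'm, 's) supermod_scheme" (structure) +
 assumes supermod: "supermodule R M"
begin

lemma smult_closed [simp]: "a \<in> carrier R ==> m \<in> carrier M ==> a \<odot>\<^bsub>M\<^esub> m \<in> carrier M"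
 using supermod by (simp add: supermodule_def)

lemma smult_l_distr:
 "a \<in> carrier R ==> b \<in> carrier R ==> m \<in> carrier M ==> (a \<oplus> b) \<odot>\<^bsub>M\<^esub> m = a \<odot>\<^bsub>M\<^esub> m \<oplus>\<^bsub>M\<^esub> b \<odot>\<^bsub>M\<^esub> m"
 using supermod by (simp add: supermodule_def)

lemma smult_assoc:
 "a \<in> carrier R ==> b \<in> carrier R ==> m \<in> carrier M ==> (a \<otimes> b) \<odot>\<^bsub>M\<^esub> m = a \<odot>\<^bsub>M\<^esub> (b \<odot>\<^bsub>M\<^esub> m)"
 using supermod by (simp add: supermodule_def)

lemma smult_r_distr:
 "a \<in> carrier R ==> m \<in> carrier M ==> n \<in> carrier M ==> a \<odot>\<^bsub>M\<^esub> (m \<oplus>\<^bsub>M\<^esub> n) = a \<odot>\<^bsub>M\<^esub> m \<oplus>\<^bsub>M\<^esub> a \<odot>\<^bsub>M\<^esub> n"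
 using supermod by (simp add: supermodule_def)

lemma smult_one [simp]: "m \<in> carrier M ==> \<one> \<odot>\<^bsub>M\<^esub> m = m"
 using supermod by (simp add: supermodule_def)

lemma smult_gr: "a \<in> gr R i ==> m \<in> mgr M j ==> a \<odot>\<^bsub>M\<^esub> m \<in> mgr M (i + j)"
 using supermod by (simp add: supermodule_def)

lemma smult_r_null [simp]: "a \<in> carrier R ==> a \<odot>\<^bsub>M\<^esub> \<zero>\<^bsub>M\<^esub> = \<zero>\<^bsub>M\<^esub>"
 using smult_r_distr[of a "\<zero>\<^bsub>M\<^esub>" "\<zero>\<^bsub>M\<^esub>"]
 by simp

lemma smult_l_null [simp]: "m \<in> carrier M ==> \<zero> \<odot>\<^bsub>M\<^esub> m = \<zero>\<^bsub>M\<^esub>"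
 using smult_l_distr[of "\<zero>" "\<zero>" m]
 by simp

lemma smult_r_minus: "a \<in> carrier R ==> m \<in> carrier M ==> a \<odot>\<^bsub>M\<^esub> (\<ominus>\<^bsub>M\<^esub> m) = \<ominus>\<^bsub>M\<^esub> (a \<odot>\<^bsub>M\<^esub> m)"
 by (rule M.neg_unique) (simp_all flip: smult_r_distr add: M.r_neg)

lemma smult_l_minus: "a \<in> carrier R ==> m \<in> carrier M ==> (\<ominus> a) \<odot>\<^bsub>M\<^esub> m = \<ominus>\<^bsub>M\<^esub> (a \<odot>\<^bsub>M\<^esub> m)"
 by (rule M.neg_unique) (simp_all flip: smult_l_distr add: r_neg)

lemma smult_ksgn: "a \<in> carrier R ==> m \<in> carrier M ==> ksgn R i j a \<odot>\<^bsub>M\<^esub> m = ksgn M i j (a \<odot>\<^bsub>M\<^esub> m)"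
 by (simp add: ksgn_def smult_l_minus)

lemma tw_smult:
 assumes "a \<in> carrier R" "m \<in> carrier M"
 shows "M.tw i (a \<odot>\<^bsub>M\<^esub> m) = gr.tw i a \<odot>\<^bsub>M\<^esub> M.tw i m"
 using assms(1)
proof (induction rule: gr.graded_induct)
 case (hom j a)
 note a = hom
 have ac: "a \<in> carrier R" using a gr.g_closed by auto
 from assms(2) show ?case
 proof (induction rule: M.graded_induct)
 case (hom k m)
 have "m \<in> carrier M" using hom M.g_closed by auto
 then show ?case using smult_gr[OF a hom] ac bit_cases[of i] bit_cases[of j] bit_cases[of k]
 by (auto simp: M.tw_of[OF smult_gr[OF a hom]] M.tw_of[OF hom] gr.tw_of[OF a] ksgn_def
 smult_r_minus smult_l_minus)
 qed (use ac in \<open>simp add: M.tw_add smult_r_distr\<close>)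
qed (use assms in \<open>simp add: gr.tw_add smult_l_distr M.tw_add\<close>)

end

lemma supmodI: "supercomm_ring R ==> supermodule R M ==> supmod R M"
 by (intro supmod.intro superringI supmod_axioms.intro graded_group.intro graded_group_axioms.intro)
 (auto simp only: supermodule_def)

subsection \<open>The regular module\<close>

definition regmod :: "('a, 'r) superring_scheme => ('a, 'a) supermod" where
 "regmod R = \<lparr>carrier = carrier R, mult = undefined, one = undefined, zero = \<zero>\<^bsub>R\<^esub>, add = add R,
 smult = mult R, mgr = gr R\<rparr>"

lemma regmod_simps [simp]:
 "carrier (regmod R) = carrier R" "\<zero>\<^bsub>regmod R\<^esub> = \<zero>\<^bsub>R\<^esub>" "add (regmod R) = add R"
 "smult (regmod R) = mult R" "mgr (regmod R) = gr R"
 by (simp_all add: regmod_def)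

text \<open>Negatives depend only on the additive structure, whatever the type of the surrounding record.\<close>

lemma a_inv_cong:
 assumes "carrier G = carrier H" "add G = add H" "zero G = zero H"
 shows "a_inv G = a_inv H"
 by (simp add: fun_eq_iff a_inv_def m_inv_def assms)

lemma regmod_neg [simp]: "a_inv (regmod R) = a_inv R" "a_minus (regmod R) = a_minus R"
 "ksgn (regmod R) = ksgn R"
proof -
 show a: "a_inv (regmod R) = a_inv R" by (rule a_inv_cong) auto
 show "a_minus (regmod R) = a_minus R" by (simp add: fun_eq_iff a_minus_def a)
 show "ksgn (regmod R) = ksgn R" by (simp add: fun_eq_iff ksgn_def a)
qed

lemma is_grading_cong:
 assumes "carrier G = carrier H" "add G = add H" "zero G = zero H"
 shows "is_grading G = is_grading H"
 by (auto simp: fun_eq_iff is_grading_def subgroup_def m_inv_def assms)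

lemma (in abelian_group) abelian_group_cong:
 assumes "carrier G = carrier H" "add G = add H" "zero G = zero H"
 shows "abelian_group H"
 using l_neg a_assoc a_comm by (intro abelian_groupI) (auto simp flip: assms)

context superring
begin

lemma regmod_supmod: "supmod R (regmod R)"
proof (rule supmodI)
 have "abelian_group (regmod R)" by (rule abelian_group_cong) auto
 moreover have "is_grading (regmod R) (gr R)"
 using gr.grading is_grading_cong[of "regmod R" R] by simp
 ultimately show "supermodule R (regmod R)"
 using mult_gr[of _ 0 _ 0] mult_gr[of _ 0 _ 1] mult_gr[of _ 1 _ 0] mult_gr[of _ 1 _ 1]
 by (auto simp: supermodule_def l_distr r_distr m_assoc)
qed (rule supercomm)

sublocale reg: supmod R "regmod R"
 rewrites "carrier (regmod R) = carrier R" and "\<zero>\<^bsub>regmod R\<^esub> = \<zero>\<^bsub>R\<^esub>" and "add (regmod R) = add R"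
 and "smult (regmod R) = mult R" and "mgr (regmod R) = gr R" and "a_inv (regmod R) = a_inv R"
 and "a_minus (regmod R) = a_minus R" and "ksgn (regmod R) = ksgn R"
 by (rule regmod_supmod) simp_all

lemma hpart_regmod [simp]: "hpart (regmod R) (gr R) = hpart R (gr R)"
 "ptwist (regmod R) (gr R) = ptwist R (gr R)"
proof -
 show h: "hpart (regmod R) (gr R) = hpart R (gr R)"
 by (simp add: fun_eq_iff hpart_def)
 show "ptwist (regmod R) (gr R) = ptwist R (gr R)"
 by (simp add: fun_eq_iff ptwist_def h)
qed

lemma tw_mult: "a \<in> carrier R ==> b \<in> carrier R ==> gr.tw i (a \<otimes> b) = gr.tw i a \<otimes> gr.tw i b"
 using reg.tw_smult by simp

end

section \<open>Adjoining odd coordinates to a supercommutative ring\<close>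

lemma (in abelian_group) minus_zero_iff:
 "x \<in> carrier G ==> y \<in> carrier G ==> x \<ominus> y = \<zero> \<longleftrightarrow> x = y"
proof
 assume c: "x \<in> carrier G" "y \<in> carrier G" and "x \<ominus> y = \<zero>"
 moreover have "x = (x \<ominus> y) \<oplus> y" using c by algebra
 ultimately show "x = y" by simp
qed (simp add: a_minus_def r_neg)

lemma lprod_snoc:
 assumes "monoid R" "set xs <= carrier R" "y \<in> carrier R"
 shows "lprod R (xs @ [y]) = lprod R xs \<otimes>\<^bsub>R\<^esub> y"
proof -
 interpret monoid R by fact
 have "lprod R xs \<in> carrier R & lprod R (xs @ [y]) = lprod R xs \<otimes>\<^bsub>R\<^esub> y"
 using assms(2,3) by (induction xs) (auto simp: lprod_def m_assoc)
 then show ?thesis by simp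
qed

lemma lprod_closed: "monoid R ==> set xs <= carrier R ==> lprod R xs \<in> carrier R"
 by (induction xs) (auto simp: lprod_def monoid.m_closed)

lemma odd_monom_insert:
 assumes "monoid R" "I <= {..<k}" "!!i. i <= k ==> et i \<in> carrier R"
 shows "odd_monom R et (insert k I) = odd_monom R et I \<otimes>\<^bsub>R\<^esub> et k"
proof -
 have fin: "finite I" and nk: "k \<notin> I" using assms(2) finite_subset by auto
 have "sorted_list_of_set (insert k I) = insort k (sorted_list_of_set I)"
 using fin nk by simp
 also have "\<dots> = sorted_list_of_set I @ [k]"
 using assms(2) fin by (intro sorted_insort_is_snoc) auto
 finally have *: "sorted_list_of_set (insert k I) = sorted_list_of_set I @ [k]" .
 have th: "et x \<in> carrier R" if "x \<in> I" for x using assms that by force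
 show ?thesis
 unfolding * odd_monom_def using assms fin th by (auto intro!: lprod_snoc)
qed

text \<open>The identity behind the extension of a derivation from \<open>C\<close> to \<open>C \<oplus> Cet\<close>: the variables stand
 for the values of the derivation and of the parity involutions on the components of two elements.\<close>

lemma (in ring) leibniz_step:
 assumes c: "a \<in> carrier R" "b \<in> carrier R" "a' \<in> carrier R" "b' \<in> carrier R"
 "x' \<in> carrier R" "y' \<in> carrier R" "X \<in> carrier R" "Y \<in> carrier R" "Y' \<in> carrier R"
 "S \<in> carrier R" "U \<in> carrier R" "K \<in> carrier R" "et \<in> carrier R" "\<beta> \<in> carrier R" "\<phi> \<in> carrier R"
 and e: "et \<otimes> x' = S \<otimes> et" "et \<otimes> (y' \<otimes> et) = \<zero>" "\<beta> \<otimes> x' = K \<otimes> \<beta>" "\<phi> \<otimes> a' = U \<otimes> et"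
 "\<phi> \<otimes> (b' \<otimes> et) = \<zero>" "\<phi> \<otimes> (Y' \<otimes> \<beta>) = \<ominus> (\<beta> \<otimes> (y' \<otimes> et))"
 shows "(a \<otimes> x' \<oplus> X \<otimes> a') \<oplus> ((a \<otimes> y' \<oplus> X \<otimes> b') \<oplus> (b \<otimes> S \<oplus> Y \<otimes> U)) \<otimes> et \<oplus> (X \<otimes> Y' \<oplus> Y \<otimes> K) \<otimes> \<beta> =
 (a \<oplus> b \<otimes> et \<oplus> Y \<otimes> \<beta>) \<otimes> (x' \<oplus> y' \<otimes> et) \<oplus> (X \<oplus> Y \<otimes> \<phi>) \<otimes> (a' \<oplus> b' \<otimes> et \<oplus> Y' \<otimes> \<beta>)"
proof -
 have 1: "(a \<oplus> b \<otimes> et \<oplus> Y \<otimes> \<beta>) \<otimes> (x' \<oplus> y' \<otimes> et) =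
 a \<otimes> x' \<oplus> a \<otimes> y' \<otimes> et \<oplus> b \<otimes> (et \<otimes> x') \<oplus> b \<otimes> (et \<otimes> (y' \<otimes> et)) \<oplus> Y \<otimes> (\<beta> \<otimes> x') \<oplus> Y \<otimes> (\<beta> \<otimes> (y' \<otimes> et))"
 using c by algebra
 have 2: "(X \<oplus> Y \<otimes> \<phi>) \<otimes> (a' \<oplus> b' \<otimes> et \<oplus> Y' \<otimes> \<beta>) =
 X \<otimes> a' \<oplus> X \<otimes> b' \<otimes> et \<oplus> X \<otimes> Y' \<otimes> \<beta> \<oplus> Y \<otimes> (\<phi> \<otimes> a') \<oplus> Y \<otimes> (\<phi> \<otimes> (b' \<otimes> et)) \<oplus> Y \<otimes> (\<phi> \<otimes> (Y' \<otimes> \<beta>))"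
 using c by algebra
 show ?thesis unfolding 1 2 e using c by algebra
qed

locale odd_ext = A: superring A + B: superring B
 for A :: "('b, 'r) superring_scheme" and B :: "('a, 's) superring_scheme" +
 fixes h :: "'b => 'a" and et :: "nat => 'a" and n :: nat
 assumes hom: "superring_hom A B h"
 and theta_odd: "i < n ==> et i \<in> gr B 1"
 and expansion: "s \<in> carrier B ==> \<exists>!c. c \<in> Pow {..<n} \<rightarrow>\<^sub>E carrier A &
 s = (\<Oplus>\<^bsub>B\<^esub>I\<in>Pow {..<n}. h (c I) \<otimes>\<^bsub>B\<^esub> odd_monom B et I)"
 and half: "\<exists>u\<in>carrier B. u \<oplus>\<^bsub>B\<^esub> u = \<one>\<^bsub>B\<^esub>"
begin

lemma theta_closed [simp]: "i < n ==> et i \<in> carrier B"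
 using theta_odd B.gr.g_closed by blast

lemma h_ring_hom: "h \<in> ring_hom A B"
 using hom by (simp add: superring_hom_def)

lemma h_closed [simp]: "a \<in> carrier A ==> h a \<in> carrier B"
 using ring_hom_closed[OF h_ring_hom] .

lemma h_gr: "a \<in> gr A i ==> h a \<in> gr B i"
 using hom by (auto simp: superring_hom_def)

lemma h_add: "a \<in> carrier A ==> b \<in> carrier A ==> h (a \<oplus>\<^bsub>A\<^esub> b) = h a \<oplus>\<^bsub>B\<^esub> h b"
 using ring_hom_add[OF h_ring_hom] .

lemma h_mult: "a \<in> carrier A ==> b \<in> carrier A ==> h (a \<otimes>\<^bsub>A\<^esub> b) = h a \<otimes>\<^bsub>B\<^esub> h b"
 using ring_hom_mult[OF h_ring_hom] .

lemma h_one [simp]: "h \<one>\<^bsub>A\<^esub> = \<one>\<^bsub>B\<^esub>"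
 using ring_hom_one[OF h_ring_hom] .

lemma h_zero [simp]: "h \<zero>\<^bsub>A\<^esub> = \<zero>\<^bsub>B\<^esub>"
 using ring_hom_zero[OF h_ring_hom A.ring_axioms B.ring_axioms] .

lemma h_neg: "a \<in> carrier A ==> h (\<ominus>\<^bsub>A\<^esub> a) = \<ominus>\<^bsub>B\<^esub> h a"
 by (rule B.neg_unique) (simp_all flip: h_add add: A.r_neg)

lemma double_zero: "x \<in> carrier B ==> x \<oplus>\<^bsub>B\<^esub> x = \<zero>\<^bsub>B\<^esub> ==> x = \<zero>\<^bsub>B\<^esub>"
proof -
 assume x: "x \<in> carrier B" "x \<oplus>\<^bsub>B\<^esub> x = \<zero>\<^bsub>B\<^esub>"
 obtain u where u: "u \<in> carrier B" "u \<oplus>\<^bsub>B\<^esub> u = \<one>\<^bsub>B\<^esub>" using half by auto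
 have "x = (u \<oplus>\<^bsub>B\<^esub> u) \<otimes>\<^bsub>B\<^esub> x" using u x by simp
 also have "\<dots> = u \<otimes>\<^bsub>B\<^esub> (x \<oplus>\<^bsub>B\<^esub> x)" using u(1) x(1) by (simp add: B.l_distr B.r_distr)
 finally show ?thesis using x u by simp
qed

lemma odd_square: "x \<in> gr B 1 ==> x \<otimes>\<^bsub>B\<^esub> x = \<zero>\<^bsub>B\<^esub>"
proof -
 assume x: "x \<in> gr B 1"
 then have c: "x \<in> carrier B" using B.gr.g_closed by blast
 have "x \<otimes>\<^bsub>B\<^esub> x = \<ominus>\<^bsub>B\<^esub> (x \<otimes>\<^bsub>B\<^esub> x)" using B.supercommute[OF x x] by (simp add: ksgn_def)
 then have "x \<otimes>\<^bsub>B\<^esub> x \<oplus>\<^bsub>B\<^esub> x \<otimes>\<^bsub>B\<^esub> x = \<zero>\<^bsub>B\<^esub>" using c B.r_neg by (metis B.m_closed)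
 then show ?thesis using c double_zero[OF B.m_closed[OF c c]] by blast
qed

subsection \<open>The tower of subrings\<close>

definition comb :: "nat => (nat set => 'b) => 'a" where
 "comb k c = (\<Oplus>\<^bsub>B\<^esub>I\<in>Pow {..<k}. h (c I) \<otimes>\<^bsub>B\<^esub> odd_monom B et I)"

lemma monom_closed: "I <= {..<n} ==> odd_monom B et I \<in> carrier B"
 unfolding odd_monom_def using finite_subset[of I "{..<n}"]
 by (intro lprod_closed) (auto simp: B.is_monoid)

lemma comb_Suc:
 assumes "k < n" "!!I. I <= {..<Suc k} ==> c I \<in> carrier A"
 shows "comb (Suc k) c = comb k c \<oplus>\<^bsub>B\<^esub> comb k (\<lambda>I. c (insert k I)) \<otimes>\<^bsub>B\<^esub> et k"
proof -
 let ?t = "\<lambda>I. h (c I) \<otimes>\<^bsub>B\<^esub> odd_monom B et I"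
 have t: "?t I \<in> carrier B" if "I <= {..<Suc k}" for I
 using that assms monom_closed[of I] by force
 have sub: "I <= {..<Suc k}" "insert k I <= {..<Suc k}" if "I <= {..<k}" for I using that by auto
 have t': "h (c (insert k I)) \<otimes>\<^bsub>B\<^esub> odd_monom B et I \<in> carrier B" if "I <= {..<k}" for I
 using assms(2)[OF sub(2)[OF that]] assms(1) monom_closed[of I] that by fastforce
 have P: "Pow {..<Suc k} = Pow {..<k} \<union> insert k ` Pow {..<k}"
 by (simp add: lessThan_Suc Pow_insert)
 have "finsum B ?t (Pow {..<k} \<union> insert k ` Pow {..<k}) =
 finsum B ?t (Pow {..<k}) \<oplus>\<^bsub>B\<^esub> finsum B ?t (insert k ` Pow {..<k})"
 proof (rule B.finsum_Un_disjoint)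
 show "Pow {..<k} \<inter> insert k ` Pow {..<k} = {}" by blast
 show "?t \<in> Pow {..<k} \<rightarrow> carrier B" by (rule Pi_I) (rule t, rule sub(1), simp)
 show "?t \<in> insert k ` Pow {..<k} \<rightarrow> carrier B"
 by (rule Pi_I, erule imageE, hypsubst) (rule t, rule sub(2), simp)
 qed simp_all
 then have "comb (Suc k) c = comb k c \<oplus>\<^bsub>B\<^esub> finsum B ?t (insert k ` Pow {..<k})"
 by (simp only: comb_def P)
 also have "finsum B ?t (insert k ` Pow {..<k}) = finsum B (\<lambda>I. ?t (insert k I)) (Pow {..<k})"
 proof (rule B.finsum_reindex[of ?t])
 show "inj_on (insert k) (Pow {..<k})"
 proof (rule inj_onI)
 fix I J assume "I \<in> Pow {..<k}" "J \<in> Pow {..<k}" "insert k I = insert k J"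
 moreover from this have "k \<notin> I" "k \<notin> J" by auto
 ultimately show "I = J" by (simp add: insert_ident)
 qed
 show "?t \<in> insert k ` Pow {..<k} \<rightarrow> carrier B"
 by (rule Pi_I, erule imageE, hypsubst) (rule t, rule sub(2), simp)
 qed
 also have "\<dots> = (\<Oplus>\<^bsub>B\<^esub>I\<in>Pow {..<k}. (h (c (insert k I)) \<otimes>\<^bsub>B\<^esub> odd_monom B et I) \<otimes>\<^bsub>B\<^esub> et k)"
 proof (rule B.finsum_cong')
 fix I assume I: "I \<in> Pow {..<k}"
 then have "I <= {..<n}" "I <= {..<k}" using assms by force+
 then show "?t (insert k I) = (h (c (insert k I)) \<otimes>\<^bsub>B\<^esub> odd_monom B et I) \<otimes>\<^bsub>B\<^esub> et k"
 using I assms odd_monom_insert[OF B.is_monoid, of I k et] sub(2)[of I] monom_closed[of I]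
 by (simp add: B.m_assoc)
 next
 show "(\<lambda>I. (h (c (insert k I)) \<otimes>\<^bsub>B\<^esub> odd_monom B et I) \<otimes>\<^bsub>B\<^esub> et k) \<in> Pow {..<k} \<rightarrow> carrier B"
 using assms by (auto intro!: B.m_closed[OF t'])
 qed simp
 also have "\<dots> = comb k (\<lambda>I. c (insert k I)) \<otimes>\<^bsub>B\<^esub> et k"
 unfolding comb_def using assms t' by (subst B.finsum_ldistr) auto
 finally show ?thesis .
qed

lemma comb_term_closed: "k <= n ==> I <= {..<k} ==> c I \<in> carrier A ==>
 h (c I) \<otimes>\<^bsub>B\<^esub> odd_monom B et I \<in> carrier B"
 using monom_closed[of I] by fastforce

lemma comb_closed: "k <= n ==> (!!I. I <= {..<k} ==> c I \<in> carrier A) ==> comb k c \<in> carrier B"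
 unfolding comb_def by (rule B.finsum_closed, rule Pi_I) (simp add: comb_term_closed)

lemma comb_cong: "k <= n ==> (!!I. I <= {..<k} ==> d I \<in> carrier A) ==> (!!I. I <= {..<k} ==> c I = d I) ==>
 comb k c = comb k d"
 unfolding comb_def by (rule B.finsum_cong'[OF refl], rule Pi_I) (simp_all add: comb_term_closed)

lemma comb_zero: "k <= n ==> (!!I. I <= {..<k} ==> c I = \<zero>\<^bsub>A\<^esub>) ==> comb k c = \<zero>\<^bsub>B\<^esub>"
proof -
 assume k: "k <= n" and c: "!!I. I <= {..<k} ==> c I = \<zero>\<^bsub>A\<^esub>"
 have "comb k c = comb k (\<lambda>_. \<zero>\<^bsub>A\<^esub>)" using k c by (intro comb_cong) auto
 also have "\<dots> = (\<Oplus>\<^bsub>B\<^esub>I\<in>Pow {..<k}. \<zero>\<^bsub>B\<^esub>)"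
 unfolding comb_def
 proof (rule B.finsum_cong'[OF refl])
 fix I assume "I \<in> Pow {..<k}"
 then have "I <= {..<n}" using k by force
 then show "h \<zero>\<^bsub>A\<^esub> \<otimes>\<^bsub>B\<^esub> odd_monom B et I = \<zero>\<^bsub>B\<^esub>" using monom_closed[of I] by simp
 qed simp
 also have "\<dots> = \<zero>\<^bsub>B\<^esub>" by simp
 finally show ?thesis .
qed

lemma comb_extend:
 assumes "k + m <= n" "!!I. I <= {..<k} ==> c I \<in> carrier A" "!!I. \<not> I <= {..<k} ==> c I = \<zero>\<^bsub>A\<^esub>"
 shows "comb (k + m) c = comb k c"
 using assms(1)
proof (induction m)
 case (Suc m)
 have c: "c I \<in> carrier A" for I using assms(2,3)[of I] by (cases "I <= {..<k}") auto
 have "comb (k + m) (\<lambda>I. c (insert (k + m) I)) = \<zero>\<^bsub>B\<^esub>"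
 using Suc.prems by (intro comb_zero assms(3)) auto
 then show ?case using Suc comb_Suc[of "k + m" c] c comb_closed[of "k + m" c] by simp
qed simp

lemma comb_n_inj:
 assumes "!!I. I <= {..<n} ==> c I \<in> carrier A" "comb n c = \<zero>\<^bsub>B\<^esub>" "I <= {..<n}"
 shows "c I = \<zero>\<^bsub>A\<^esub>"
proof -
 let ?r = "\<lambda>c. restrict c (Pow {..<n})"
 have "comb n (?r c) = \<zero>\<^bsub>B\<^esub>" using comb_cong[of n c "?r c"] assms by (simp add: subset_iff)
 then have 1: "\<zero>\<^bsub>B\<^esub> = (\<Oplus>\<^bsub>B\<^esub>I\<in>Pow {..<n}. h (?r c I) \<otimes>\<^bsub>B\<^esub> odd_monom B et I)"
 by (simp only: comb_def)
 have "comb n (?r (\<lambda>_. \<zero>\<^bsub>A\<^esub>)) = \<zero>\<^bsub>B\<^esub>" by (rule comb_zero) auto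
 then have 2: "\<zero>\<^bsub>B\<^esub> = (\<Oplus>\<^bsub>B\<^esub>I\<in>Pow {..<n}. h (?r (\<lambda>_. \<zero>\<^bsub>A\<^esub>) I) \<otimes>\<^bsub>B\<^esub> odd_monom B et I)"
 by (simp only: comb_def)
 from expansion[OF B.zero_closed] obtain p where
 p: "ALL c. c \<in> Pow {..<n} \<rightarrow>\<^sub>E carrier A & \<zero>\<^bsub>B\<^esub> = (\<Oplus>\<^bsub>B\<^esub>I\<in>Pow {..<n}. h (c I) \<otimes>\<^bsub>B\<^esub> odd_monom B et I) --> c = p"
 by (rule ex1E)
 have 3: "?r c \<in> Pow {..<n} \<rightarrow>\<^sub>E carrier A" "?r (\<lambda>_. \<zero>\<^bsub>A\<^esub>) \<in> Pow {..<n} \<rightarrow>\<^sub>E carrier A"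
 using assms(1) by auto
 have "?r c = p" by (rule p[rule_format], rule conjI, rule 3(1), rule 1)
 moreover have "?r (\<lambda>_. \<zero>\<^bsub>A\<^esub>) = p" by (rule p[rule_format], rule conjI, rule 3(2), rule 2)
 ultimately have "?r c I = ?r (\<lambda>_. \<zero>\<^bsub>A\<^esub>) I" by simp
 then show ?thesis using assms(3) by simp
qed

primrec tower :: "nat => 'a set" where
 "tower 0 = h ` carrier A"
| "tower (Suc k) = {x \<oplus>\<^bsub>B\<^esub> y \<otimes>\<^bsub>B\<^esub> et k | x y. x \<in> tower k & y \<in> tower k}"

lemma tower_comb: "k <= n ==> x \<in> tower k ==> EX c. (ALL I. I <= {..<k} --> c I \<in> carrier A) &
 (ALL I. \<not> I <= {..<k} --> c I = \<zero>\<^bsub>A\<^esub>) & x = comb k c"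
proof (induction k arbitrary: x)
 case 0
 then obtain a where a: "a \<in> carrier A" "x = h a" by auto
 then have "x = comb 0 (\<lambda>I. if I = {} then a else \<zero>\<^bsub>A\<^esub>)"
 by (simp add: comb_def odd_monom_def lprod_def Pow_def B.finsum_insert[of "{}"])
 then show ?case using a by (intro exI[of _ "\<lambda>I. if I = {} then a else \<zero>\<^bsub>A\<^esub>"]) auto
next
 case (Suc k)
 then obtain y z where yz: "y \<in> tower k" "z \<in> tower k" "x = y \<oplus>\<^bsub>B\<^esub> z \<otimes>\<^bsub>B\<^esub> et k" by auto
 obtain c where c: "!!I. I <= {..<k} ==> c I \<in> carrier A" "y = comb k c"
 using Suc.IH[OF _ yz(1)] Suc.prems by auto
 obtain d where d: "!!I. I <= {..<k} ==> d I \<in> carrier A" "z = comb k d"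
 using Suc.IH[OF _ yz(2)] Suc.prems by auto
 define e where "e = (\<lambda>I. if I <= {..<k} then c I else if I <= {..<Suc k} then d (I - {k}) else \<zero>\<^bsub>A\<^esub>)"
 have e: "e I \<in> carrier A" for I
 unfolding e_def using c(1) d(1)[of "I - {k}"] by (auto simp: lessThan_Suc)
 have "comb (Suc k) e = comb k e \<oplus>\<^bsub>B\<^esub> comb k (\<lambda>I. e (insert k I)) \<otimes>\<^bsub>B\<^esub> et k"
 using Suc.prems e by (intro comb_Suc) auto
 also have "comb k e = y" using Suc.prems c
 by (auto intro!: comb_cong simp: e_def)
 also have "comb k (\<lambda>I. e (insert k I)) = z"
 proof -
 have "e (insert k I) = d I" if "I <= {..<k}" for I
 proof -
 have "\<not> insert k I <= {..<k}" "insert k I <= {..<Suc k}" "insert k I - {k} = I" using that by auto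
 then show ?thesis by (simp add: e_def)
 qed
 then show ?thesis using Suc.prems d by (auto intro!: comb_cong)
 qed
 finally have "x = comb (Suc k) e" using yz by simp
 moreover have "e I = \<zero>\<^bsub>A\<^esub>" if "\<not> I <= {..<Suc k}" for I
 using that by (auto simp: e_def lessThan_Suc)
 ultimately show ?case using e by blast
qed

lemma tower_closed: "k <= n ==> x \<in> tower k ==> x \<in> carrier B"
 using tower_comb comb_closed by blast

lemma comb_in_tower: "k <= n ==> (!!I. I <= {..<k} ==> c I \<in> carrier A) ==> comb k c \<in> tower k"
proof (induction k arbitrary: c)
 case 0
 then have "comb 0 c = h (c {})"
 by (simp add: comb_def odd_monom_def lprod_def Pow_def B.finsum_insert[of "{}"])
 then show ?case using 0 by auto
next
 case (Suc k)
 have sub: "I <= {..<Suc k}" "insert k I <= {..<Suc k}" if "I <= {..<k}" for I using that by auto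
 have "comb k c \<in> tower k" "comb k (\<lambda>I. c (insert k I)) \<in> tower k"
 using Suc sub by (auto intro!: Suc.IH)
 then show ?case using Suc.prems comb_Suc[of k c] by auto
qed

lemma tower_n: "tower n = carrier B"
proof
 show "carrier B <= tower n"
 proof
 fix s assume "s \<in> carrier B"
 from ex1_implies_ex[OF expansion[OF this]] obtain c where
 c: "c \<in> Pow {..<n} \<rightarrow>\<^sub>E carrier A & s = (\<Oplus>\<^bsub>B\<^esub>I\<in>Pow {..<n}. h (c I) \<otimes>\<^bsub>B\<^esub> odd_monom B et I)" by (rule exE)
 then have "s = comb n c" by (simp add: comb_def)
 then show "s \<in> tower n" using comb_in_tower[of n c] c by auto
 qed
qed (use tower_closed in auto)

lemma h_inj: "a \<in> carrier A ==> h a = \<zero>\<^bsub>B\<^esub> ==> a = \<zero>\<^bsub>A\<^esub>"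
proof -
 assume a: "a \<in> carrier A" "h a = \<zero>\<^bsub>B\<^esub>"
 let ?c = "\<lambda>I::nat set. if I <= {..<0} then a else \<zero>\<^bsub>A\<^esub>"
 have "comb 0 ?c = h a"
 using a(1) by (simp add: comb_def odd_monom_def lprod_def Pow_def B.finsum_insert[of "{}"])
 then have "comb n ?c = \<zero>\<^bsub>B\<^esub>" using comb_extend[of 0 n ?c] a by simp
 then have "?c {} = \<zero>\<^bsub>A\<^esub>" using a by (intro comb_n_inj) auto
 then show ?thesis by simp
qed

lemma inj_h: "inj_on h (carrier A)"
proof (rule inj_onI)
 fix a b assume ab: "a \<in> carrier A" "b \<in> carrier A" "h a = h b"
 then have "h (a \<ominus>\<^bsub>A\<^esub> b) = \<zero>\<^bsub>B\<^esub>" by (simp add: a_minus_def h_add h_neg B.r_neg)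
 then have "a \<ominus>\<^bsub>A\<^esub> b = \<zero>\<^bsub>A\<^esub>" using ab h_inj by simp
 then show "a = b" using ab by (simp add: A.minus_zero_iff)
qed

lemma h_gr_iff: "a \<in> carrier A ==> h a \<in> gr B i \<longleftrightarrow> a \<in> gr A i"
proof
 assume a: "a \<in> carrier A" and ha: "h a \<in> gr B i"
 have "h a = h (A.gr.prt i a) \<oplus>\<^bsub>B\<^esub> h (A.gr.prt (i + 1) a)"
 using h_add[of "A.gr.prt i a" "A.gr.prt (i + 1) a"] A.gr.part_sum[OF a, of i] a
 by (simp only: A.gr.part_closed)
 then have "B.gr.prt i (h a) = h (A.gr.prt i a)"
 using a A.gr.part_in h_gr by (intro B.gr.part_eqI) auto
 then have "h a = h (A.gr.prt i a)" using B.gr.part_of[OF ha, of i] by simp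
 then have "a = A.gr.prt i a" using a inj_h by (simp add: inj_on_eq_iff)
 then show "a \<in> gr A i" using a A.gr.part_in by metis
qed (rule h_gr)

lemma tower_diff: "k <= n ==> x \<in> tower k ==> y \<in> tower k ==> x \<ominus>\<^bsub>B\<^esub> y \<in> tower k"
proof (induction k arbitrary: x y)
 case 0
 then obtain a b where "a \<in> carrier A" "b \<in> carrier A" "x = h a" "y = h b" by auto
 then show ?case by (auto simp: a_minus_def simp flip: h_add h_neg)
next
 case (Suc k)
 then obtain a b a' b' where e: "a \<in> tower k" "b \<in> tower k" "a' \<in> tower k" "b' \<in> tower k"
 "x = a \<oplus>\<^bsub>B\<^esub> b \<otimes>\<^bsub>B\<^esub> et k" "y = a' \<oplus>\<^bsub>B\<^esub> b' \<otimes>\<^bsub>B\<^esub> et k" by auto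
 have c: "a \<in> carrier B" "b \<in> carrier B" "a' \<in> carrier B" "b' \<in> carrier B" "et k \<in> carrier B"
 using e Suc.prems tower_closed[of k] by auto
 have "x \<ominus>\<^bsub>B\<^esub> y = (a \<ominus>\<^bsub>B\<^esub> a') \<oplus>\<^bsub>B\<^esub> (b \<ominus>\<^bsub>B\<^esub> b') \<otimes>\<^bsub>B\<^esub> et k"
 unfolding e(5,6) using c by algebra
 then show ?case using Suc e by auto
qed

lemma zero_in_tower: "k <= n ==> \<zero>\<^bsub>B\<^esub> \<in> tower k"
 using comb_in_tower[of k "\<lambda>_. \<zero>\<^bsub>A\<^esub>"] comb_zero[of k "\<lambda>_. \<zero>\<^bsub>A\<^esub>"] by auto

lemma tower_mono: "k < n ==> x \<in> tower k ==> x \<in> tower (Suc k)"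
proof -
 assume k: "k < n" and x: "x \<in> tower k"
 have "x = x \<oplus>\<^bsub>B\<^esub> \<zero>\<^bsub>B\<^esub> \<otimes>\<^bsub>B\<^esub> et k" using k x tower_closed[of k x] by simp
 then show ?thesis using x k zero_in_tower[of k] unfolding tower.simps
 by (intro CollectI exI[of _ x] exI[of _ "\<zero>\<^bsub>B\<^esub>"]) simp
qed

lemma theta_in_tower: "k < n ==> et k \<in> tower (Suc k)"
proof -
 assume k: "k < n"
 have "\<one>\<^bsub>B\<^esub> \<in> tower k"
 using k
 proof (induction k)
 case 0
 show ?case using h_one by (auto intro: rev_image_eqI)
 qed (use tower_mono in auto)
 moreover have "et k = \<zero>\<^bsub>B\<^esub> \<oplus>\<^bsub>B\<^esub> \<one>\<^bsub>B\<^esub> \<otimes>\<^bsub>B\<^esub> et k" using k by simp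
 ultimately show ?thesis using k zero_in_tower[of k] unfolding tower.simps
 by (intro CollectI exI[of _ "\<one>\<^bsub>B\<^esub>"] exI[of _ "\<zero>\<^bsub>B\<^esub>"]) simp
qed

lemma tower_add: "k <= n ==> x \<in> tower k ==> y \<in> tower k ==> x \<oplus>\<^bsub>B\<^esub> y \<in> tower k"
proof -
 assume a: "k <= n" "x \<in> tower k" "y \<in> tower k"
 then have c: "x \<in> carrier B" "y \<in> carrier B" using tower_closed by auto
 have "x \<oplus>\<^bsub>B\<^esub> y = x \<ominus>\<^bsub>B\<^esub> (\<zero>\<^bsub>B\<^esub> \<ominus>\<^bsub>B\<^esub> y)" using c by algebra
 then show ?thesis using tower_diff zero_in_tower a by simp
qed

text \<open>A relation \<open>x + yet\<^sub>k = 0\<close> over the \<open>k\<close>-th subring is a relation between distinct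
 monomials.\<close>

lemma tower_relation:
 assumes "k < n" "x \<in> tower k" "y \<in> tower k" "x \<oplus>\<^bsub>B\<^esub> y \<otimes>\<^bsub>B\<^esub> et k = \<zero>\<^bsub>B\<^esub>"
 shows "x = \<zero>\<^bsub>B\<^esub> & y = \<zero>\<^bsub>B\<^esub>"
proof -
 obtain c where c: "!!I. I <= {..<k} ==> c I \<in> carrier A" "x = comb k c"
 using tower_comb[of k x] assms by auto
 obtain d where d: "!!I. I <= {..<k} ==> d I \<in> carrier A" "y = comb k d"
 using tower_comb[of k y] assms by auto
 define e where "e = (\<lambda>I. if I <= {..<k} then c I else if I <= {..<Suc k} then d (I - {k}) else \<zero>\<^bsub>A\<^esub>)"
 have e: "e I \<in> carrier A" for I
 unfolding e_def using c(1) d(1)[of "I - {k}"] by (auto simp: lessThan_Suc)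
 have ed: "e (insert k I) = d I" if "I <= {..<k}" for I
 proof -
 have "\<not> insert k I <= {..<k}" "insert k I <= {..<Suc k}" "insert k I - {k} = I" using that by auto
 then show ?thesis by (simp add: e_def)
 qed
 have ec: "e I = c I" if "I <= {..<k}" for I using that by (simp add: e_def)
 have "comb (Suc k) e = comb k e \<oplus>\<^bsub>B\<^esub> comb k (\<lambda>I. e (insert k I)) \<otimes>\<^bsub>B\<^esub> et k"
 using assms e by (intro comb_Suc) auto
 also have "comb k e = x" using assms c ec by (auto intro!: comb_cong)
 also have "comb k (\<lambda>I. e (insert k I)) = y" using assms d ed by (auto intro!: comb_cong)
 finally have "comb (Suc k) e = \<zero>\<^bsub>B\<^esub>" using assms by simp
 moreover have "comb (Suc k + (n - Suc k)) e = comb (Suc k) e"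
 using assms(1) e by (intro comb_extend) (auto simp: e_def lessThan_Suc)
 ultimately have "comb n e = \<zero>\<^bsub>B\<^esub>" using assms(1) by simp
 then have z: "e I = \<zero>\<^bsub>A\<^esub>" if "I <= {..<n}" for I 
 using comb_n_inj[of e I] e that \<open>comb n e = \<zero>\<^bsub>B\<^esub>\<close> by simp
 have sub: "I <= {..<n}" "insert k I <= {..<n}" if "I <= {..<k}" for I using that assms(1) by force+
 have "c I = \<zero>\<^bsub>A\<^esub>" "d I = \<zero>\<^bsub>A\<^esub>" if "I <= {..<k}" for I
 using z[OF sub(1)[OF that]] z[OF sub(2)[OF that]] ec[OF that] ed[OF that] by simp_all
 then show ?thesis using assms(1) by (auto simp: c(2) d(2) intro!: comb_zero)
qed

lemma tower_unique:
 assumes "k < n" "x \<in> tower k" "y \<in> tower k" "x' \<in> tower k" "y' \<in> tower k"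
 "x \<oplus>\<^bsub>B\<^esub> y \<otimes>\<^bsub>B\<^esub> et k = x' \<oplus>\<^bsub>B\<^esub> y' \<otimes>\<^bsub>B\<^esub> et k"
 shows "x = x'" "y = y'"
proof -
 have c: "x \<in> carrier B" "y \<in> carrier B" "x' \<in> carrier B" "y' \<in> carrier B" "et k \<in> carrier B"
 using assms tower_closed[of k] by auto
 have "(x \<ominus>\<^bsub>B\<^esub> x') \<oplus>\<^bsub>B\<^esub> (y \<ominus>\<^bsub>B\<^esub> y') \<otimes>\<^bsub>B\<^esub> et k =
 (x \<oplus>\<^bsub>B\<^esub> y \<otimes>\<^bsub>B\<^esub> et k) \<ominus>\<^bsub>B\<^esub> (x' \<oplus>\<^bsub>B\<^esub> y' \<otimes>\<^bsub>B\<^esub> et k)" using c by algebra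
 also have "\<dots> = \<zero>\<^bsub>B\<^esub>" unfolding assms(6) using c by algebra
 finally have "x \<ominus>\<^bsub>B\<^esub> x' = \<zero>\<^bsub>B\<^esub> & y \<ominus>\<^bsub>B\<^esub> y' = \<zero>\<^bsub>B\<^esub>"
 using assms tower_diff by (intro tower_relation) auto
 then show "x = x'" "y = y'" using c by (simp_all add: B.minus_zero_iff)
qed

lemma gen_induct [consumes 1, case_names base mult add]:
 assumes "x \<in> carrier B" "!!a. a \<in> carrier A ==> P (h a)"
 "!!x j. x \<in> carrier B ==> P x ==> j < n ==> P (x \<otimes>\<^bsub>B\<^esub> et j)"
 "!!x y. x \<in> carrier B ==> y \<in> carrier B ==> P x ==> P y ==> P (x \<oplus>\<^bsub>B\<^esub> y)"
 shows "P x"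
proof -
 have "k <= n ==> x \<in> tower k ==> P x" for k x
 proof (induction k arbitrary: x)
 case (Suc k)
 then obtain y z where "y \<in> tower k" "z \<in> tower k" "x = y \<oplus>\<^bsub>B\<^esub> z \<otimes>\<^bsub>B\<^esub> et k" by auto
 then show ?case using Suc assms(3,4) tower_closed[of k] by simp
 qed (use assms(2) in auto)
 then show ?thesis using assms(1) tower_n by blast
qed

subsection \<open>Extension of derivations\<close>

lemma tower_part: "k <= n ==> x \<in> tower k ==> B.gr.prt i x \<in> tower k"
proof (induction k arbitrary: x i)
 case 0
 then obtain a where a: "a \<in> carrier A" "x = h a" by auto
 have "h a = h (A.gr.prt i a) \<oplus>\<^bsub>B\<^esub> h (A.gr.prt (i + 1) a)"
 using h_add[of "A.gr.prt i a" "A.gr.prt (i + 1) a"] A.gr.part_sum[OF a(1), of i] a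
 by (simp only: A.gr.part_closed)
 then have "B.gr.prt i (h a) = h (A.gr.prt i a)"
 using a A.gr.part_in h_gr by (intro B.gr.part_eqI) auto
 then show ?case using a by auto
next
 case (Suc k)
 then obtain y z where yz: "y \<in> tower k" "z \<in> tower k" "x = y \<oplus>\<^bsub>B\<^esub> z \<otimes>\<^bsub>B\<^esub> et k" by auto
 have c: "y \<in> carrier B" "z \<in> carrier B" "et k \<in> carrier B" using yz Suc.prems tower_closed[of k] by auto
 have "B.gr.prt i x = B.gr.prt i y \<oplus>\<^bsub>B\<^esub> B.gr.prt i (z \<otimes>\<^bsub>B\<^esub> et k)"
 using c by (simp add: yz B.gr.part_add)
 also have "B.gr.prt i (z \<otimes>\<^bsub>B\<^esub> et k) = B.gr.prt (i + 1) z \<otimes>\<^bsub>B\<^esub> et k"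
 proof (rule B.gr.part_eqI)
 have th: "et k \<in> gr B 1" using Suc.prems theta_odd by simp
 show "B.gr.prt (i + 1) z \<otimes>\<^bsub>B\<^esub> et k \<in> gr B i"
 using B.mult_gr[OF B.gr.part_in[OF c(2), of "i + 1"] th] by (simp only: bit_add_self)
 show "B.gr.prt i z \<otimes>\<^bsub>B\<^esub> et k \<in> gr B (i + 1)"
 using B.mult_gr[OF B.gr.part_in[OF c(2)] th] .
 show "z \<otimes>\<^bsub>B\<^esub> et k = B.gr.prt (i + 1) z \<otimes>\<^bsub>B\<^esub> et k \<oplus>\<^bsub>B\<^esub> B.gr.prt i z \<otimes>\<^bsub>B\<^esub> et k"
 using B.gr.part_sum[OF c(2), of "i + 1"] B.l_distr[of "B.gr.prt (i + 1) z" "B.gr.prt i z" "et k"] c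
 by (simp only: bit_add_self B.gr.part_closed)
 qed
 finally show ?case using Suc yz by auto
qed

lemma tower_tw: "k <= n ==> x \<in> tower k ==> B.gr.tw i x \<in> tower k"
 by (simp add: ptwist_def tower_diff tower_part)

lemma swap_theta: "k < n ==> x \<in> carrier B ==> et k \<otimes>\<^bsub>B\<^esub> x = B.gr.tw 1 x \<otimes>\<^bsub>B\<^esub> et k"
 using B.supercommute_tw theta_odd by blast

lemma theta_theta: "k < n ==> x \<in> carrier B ==> et k \<otimes>\<^bsub>B\<^esub> (x \<otimes>\<^bsub>B\<^esub> et k) = \<zero>\<^bsub>B\<^esub>"
 using swap_theta[of k x] odd_square[OF theta_odd[of k]] B.m_assoc[of "et k" x "et k"]
 by (simp add: B.m_assoc)

lemma tower_product:
 assumes "k < n" "x \<in> carrier B" "y \<in> carrier B" "x' \<in> carrier B" "y' \<in> carrier B"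
 shows "(x \<oplus>\<^bsub>B\<^esub> y \<otimes>\<^bsub>B\<^esub> et k) \<otimes>\<^bsub>B\<^esub> (x' \<oplus>\<^bsub>B\<^esub> y' \<otimes>\<^bsub>B\<^esub> et k) =
 x \<otimes>\<^bsub>B\<^esub> x' \<oplus>\<^bsub>B\<^esub> (x \<otimes>\<^bsub>B\<^esub> y' \<oplus>\<^bsub>B\<^esub> y \<otimes>\<^bsub>B\<^esub> B.gr.tw 1 x') \<otimes>\<^bsub>B\<^esub> et k"
proof -
 have t: "et k \<in> carrier B" "B.gr.tw 1 x' \<in> carrier B" using assms by auto
 have "(x \<oplus>\<^bsub>B\<^esub> y \<otimes>\<^bsub>B\<^esub> et k) \<otimes>\<^bsub>B\<^esub> (x' \<oplus>\<^bsub>B\<^esub> y' \<otimes>\<^bsub>B\<^esub> et k) = x \<otimes>\<^bsub>B\<^esub> x' \<oplus>\<^bsub>B\<^esub> x \<otimes>\<^bsub>B\<^esub> y' \<otimes>\<^bsub>B\<^esub> et k \<oplus>\<^bsub>B\<^esub>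
 y \<otimes>\<^bsub>B\<^esub> (et k \<otimes>\<^bsub>B\<^esub> x') \<oplus>\<^bsub>B\<^esub> y \<otimes>\<^bsub>B\<^esub> (et k \<otimes>\<^bsub>B\<^esub> (y' \<otimes>\<^bsub>B\<^esub> et k))" using assms t by algebra
 also have "\<dots> = x \<otimes>\<^bsub>B\<^esub> x' \<oplus>\<^bsub>B\<^esub> x \<otimes>\<^bsub>B\<^esub> y' \<otimes>\<^bsub>B\<^esub> et k \<oplus>\<^bsub>B\<^esub> y \<otimes>\<^bsub>B\<^esub> (B.gr.tw 1 x' \<otimes>\<^bsub>B\<^esub> et k)"
 unfolding theta_theta[OF assms(1,5)] swap_theta[OF assms(1,4)] using assms t by simp
 also have "\<dots> = x \<otimes>\<^bsub>B\<^esub> x' \<oplus>\<^bsub>B\<^esub> (x \<otimes>\<^bsub>B\<^esub> y' \<oplus>\<^bsub>B\<^esub> y \<otimes>\<^bsub>B\<^esub> B.gr.tw 1 x') \<otimes>\<^bsub>B\<^esub> et k" using assms t by algebra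
 finally show ?thesis .
qed

lemma tower_mult: "k <= n ==> x \<in> tower k ==> y \<in> tower k ==> x \<otimes>\<^bsub>B\<^esub> y \<in> tower k"
proof (induction k arbitrary: x y)
 case 0
 then show ?case by (auto simp flip: h_mult)
next
 case (Suc k)
 then obtain a b a' b' where e: "a \<in> tower k" "b \<in> tower k" "a' \<in> tower k" "b' \<in> tower k"
 "x = a \<oplus>\<^bsub>B\<^esub> b \<otimes>\<^bsub>B\<^esub> et k" "y = a' \<oplus>\<^bsub>B\<^esub> b' \<otimes>\<^bsub>B\<^esub> et k" by auto
 have "x \<otimes>\<^bsub>B\<^esub> y = a \<otimes>\<^bsub>B\<^esub> a' \<oplus>\<^bsub>B\<^esub> (a \<otimes>\<^bsub>B\<^esub> b' \<oplus>\<^bsub>B\<^esub> b \<otimes>\<^bsub>B\<^esub> B.gr.tw 1 a') \<otimes>\<^bsub>B\<^esub> et k"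
 unfolding e(5,6) using e Suc.prems tower_closed[of k] by (intro tower_product) auto
 moreover have "a \<otimes>\<^bsub>B\<^esub> a' \<in> tower k" "a \<otimes>\<^bsub>B\<^esub> b' \<oplus>\<^bsub>B\<^esub> b \<otimes>\<^bsub>B\<^esub> B.gr.tw 1 a' \<in> tower k"
 using Suc.prems(1) e(1-4) Suc.IH tower_tw[of k a' 1] by (simp_all add: tower_add)
 ultimately show ?case by auto
qed

text \<open>\<open>tderiv k i D\<close>: the map \<open>D\<close> is a derivation of parity \<open>i\<close> from the \<open>k\<close>-th subring to \<open>B\<close>.\<close>

definition tderiv :: "nat => bit => ('a => 'a) => bool" where
 "tderiv k i D \<longleftrightarrow> (\<forall>x\<in>tower k. D x \<in> carrier B) &
 (\<forall>x\<in>tower k. \<forall>y\<in>tower k. D (x \<oplus>\<^bsub>B\<^esub> y) = D x \<oplus>\<^bsub>B\<^esub> D y) &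
 (ALL j. \<forall>x\<in>tower k \<inter> gr B j. D x \<in> gr B (i + j)) &
 (\<forall>x\<in>tower k. \<forall>y\<in>tower k. D (x \<otimes>\<^bsub>B\<^esub> y) = D x \<otimes>\<^bsub>B\<^esub> y \<oplus>\<^bsub>B\<^esub> B.gr.tw i x \<otimes>\<^bsub>B\<^esub> D y)"

lemma tderiv_tw:
 assumes D: "tderiv k i D" and k: "k <= n" and x: "x \<in> tower k"
 shows "B.gr.tw 1 (D x) = ksgn B i 1 (D (B.gr.tw 1 x))"
proof -
 have c: "x \<in> carrier B" using k x tower_closed by blast
 let ?a = "B.gr.prt 0 x" and ?b = "B.gr.prt 1 x"
 have t: "?a \<in> tower k" "?b \<in> tower k" using k x tower_part by auto
 have nb: "\<ominus>\<^bsub>B\<^esub> ?b \<in> tower k"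
 using tower_diff[OF k zero_in_tower[OF k] t(2)] c by (simp add: a_minus_def)
 have cD: "D ?a \<in> carrier B" "D ?b \<in> carrier B" "D (\<ominus>\<^bsub>B\<^esub> ?b) \<in> carrier B" "D \<zero>\<^bsub>B\<^esub> \<in> carrier B"
 using D t nb zero_in_tower[OF k] by (auto simp: tderiv_def)
 have "D \<zero>\<^bsub>B\<^esub> = D \<zero>\<^bsub>B\<^esub> \<oplus>\<^bsub>B\<^esub> D \<zero>\<^bsub>B\<^esub>"
 using D zero_in_tower[OF k] unfolding tderiv_def by (metis B.l_zero B.zero_closed)
 then have D0: "D \<zero>\<^bsub>B\<^esub> = \<zero>\<^bsub>B\<^esub>" using cD by simp
 have "D (?b \<oplus>\<^bsub>B\<^esub> \<ominus>\<^bsub>B\<^esub> ?b) = D ?b \<oplus>\<^bsub>B\<^esub> D (\<ominus>\<^bsub>B\<^esub> ?b)"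
 using D t nb unfolding tderiv_def by blast
 then have Dn: "D (\<ominus>\<^bsub>B\<^esub> ?b) = \<ominus>\<^bsub>B\<^esub> D ?b" using c cD D0 by (intro B.neg_unique) (auto simp: B.r_neg)
 have g: "D ?a \<in> gr B i" "D ?b \<in> gr B (i + 1)"
 using D t B.gr.part_in[OF c, of 0] B.gr.part_in[OF c, of 1]
 unfolding tderiv_def by (metis IntI add.right_neutral)+
 have "D x = D (?a \<oplus>\<^bsub>B\<^esub> ?b)" using B.gr.part_sum01[OF c] by simp
 also have "\<dots> = D ?a \<oplus>\<^bsub>B\<^esub> D ?b" using D t unfolding tderiv_def by blast
 finally have 1: "D x = D ?a \<oplus>\<^bsub>B\<^esub> D ?b" .
 have "D (B.gr.tw 1 x) = D (?a \<oplus>\<^bsub>B\<^esub> \<ominus>\<^bsub>B\<^esub> ?b)" by (simp add: ptwist_def a_minus_def)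
 also have "\<dots> = D ?a \<oplus>\<^bsub>B\<^esub> \<ominus>\<^bsub>B\<^esub> D ?b" using D t nb Dn unfolding tderiv_def by metis
 finally have 2: "D (B.gr.tw 1 x) = D ?a \<oplus>\<^bsub>B\<^esub> \<ominus>\<^bsub>B\<^esub> D ?b" .
 show ?thesis unfolding 1 2 using cD bit_cases[of i]
 by (auto simp: B.gr.tw_add B.gr.tw_of[OF g(1)] B.gr.tw_of[OF g(2)] ksgn_def B.minus_add B.minus_minus)
qed

theorem extend_derivation:
 assumes d: "!!a. a \<in> carrier A ==> d a \<in> carrier B"
 and d_add: "!!a b. a \<in> carrier A ==> b \<in> carrier A ==> d (a \<oplus>\<^bsub>A\<^esub> b) = d a \<oplus>\<^bsub>B\<^esub> d b"
 and d_gr: "!!j a. a \<in> gr A j ==> d a \<in> gr B (i + j)"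
 and d_mult: "!!a b. a \<in> carrier A ==> b \<in> carrier A ==>
 d (a \<otimes>\<^bsub>A\<^esub> b) = d a \<otimes>\<^bsub>B\<^esub> h b \<oplus>\<^bsub>B\<^esub> B.gr.tw i (h a) \<otimes>\<^bsub>B\<^esub> d b"
 and beta: "!!j. j < n ==> \<beta> j \<in> gr B (i + 1)"
 and k: "k <= n"
 shows "EX D. tderiv k i D & (\<forall>a\<in>carrier A. D (h a) = d a) & (\<forall>j<k. D (et j) = \<beta> j)"
 using k
proof (induction k)
 case 0
 define D where "D = (\<lambda>x. d (the_inv_into (carrier A) h x))"
 have Dh: "D (h a) = d a" if "a \<in> carrier A" for a
 using the_inv_into_f_f[OF inj_h that] by (simp add: D_def)
 have "tderiv 0 i D"
 unfolding tderiv_def tower.simps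
 proof (intro conjI allI ballI)
 fix j x assume "x \<in> h ` carrier A \<inter> gr B j"
 then obtain a where a: "a \<in> carrier A" "x = h a" "h a \<in> gr B j" by auto
 then show "D x \<in> gr B (i + j)" using d_gr[of a j] h_gr_iff Dh by simp
 next
 fix x y assume "x \<in> h ` carrier A" "y \<in> h ` carrier A"
 then obtain a b where a: "a \<in> carrier A" "x = h a" "b \<in> carrier A" "y = h b" by auto
 have "D (x \<oplus>\<^bsub>B\<^esub> y) = d (a \<oplus>\<^bsub>A\<^esub> b)" "D (x \<otimes>\<^bsub>B\<^esub> y) = d (a \<otimes>\<^bsub>A\<^esub> b)"
 using a by (simp_all add: Dh flip: h_add h_mult)
 then show "D (x \<oplus>\<^bsub>B\<^esub> y) = D x \<oplus>\<^bsub>B\<^esub> D y" "D (x \<otimes>\<^bsub>B\<^esub> y) = D x \<otimes>\<^bsub>B\<^esub> y \<oplus>\<^bsub>B\<^esub> B.gr.tw i x \<otimes>\<^bsub>B\<^esub> D y"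
 using a d_add d_mult Dh by simp_all
 qed (use d Dh in auto)
 then show ?case using Dh by auto
next
 case (Suc k)
 then obtain D where D: "tderiv k i D" and Dh: "!!a. a \<in> carrier A ==> D (h a) = d a"
 and Dt: "!!j. j < k ==> D (et j) = \<beta> j" by auto
 have k: "k < n" "k <= n" using Suc.prems by auto
 have D1: "!!x. x \<in> tower k ==> D x \<in> carrier B"
 and D2: "!!x y. x \<in> tower k ==> y \<in> tower k ==> D (x \<oplus>\<^bsub>B\<^esub> y) = D x \<oplus>\<^bsub>B\<^esub> D y"
 and D3: "!!j x. x \<in> tower k ==> x \<in> gr B j ==> D x \<in> gr B (i + j)"
 and D4: "!!x y. x \<in> tower k ==> y \<in> tower k ==>
 D (x \<otimes>\<^bsub>B\<^esub> y) = D x \<otimes>\<^bsub>B\<^esub> y \<oplus>\<^bsub>B\<^esub> B.gr.tw i x \<otimes>\<^bsub>B\<^esub> D y"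
 using D unfolding tderiv_def by blast+
 have th: "et k \<in> gr B 1" "et k \<in> carrier B" using k theta_odd by auto
 have be: "\<beta> k \<in> gr B (i + 1)" "\<beta> k \<in> carrier B" using k beta B.gr.g_closed by blast+
 have cl: "!!x. x \<in> tower k ==> x \<in> carrier B" using tower_closed[OF k(2)] .
 define val where "val = (\<lambda>x y. D x \<oplus>\<^bsub>B\<^esub> D y \<otimes>\<^bsub>B\<^esub> et k \<oplus>\<^bsub>B\<^esub> B.gr.tw i y \<otimes>\<^bsub>B\<^esub> \<beta> k)"
 define E where "E = (\<lambda>z. THE w. \<exists>x\<in>tower k. \<exists>y\<in>tower k. z = x \<oplus>\<^bsub>B\<^esub> y \<otimes>\<^bsub>B\<^esub> et k & w = val x y)"
 have E: "E (x \<oplus>\<^bsub>B\<^esub> y \<otimes>\<^bsub>B\<^esub> et k) = val x y" if "x \<in> tower k" "y \<in> tower k" for x y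
 unfolding E_def using that tower_unique[OF k(1) that] by (intro the_equality) blast+
 have valc: "val x y \<in> carrier B" if "x \<in> tower k" "y \<in> tower k" for x y
 using that D1 cl th be by (simp add: val_def)
 have D0: "D \<zero>\<^bsub>B\<^esub> = \<zero>\<^bsub>B\<^esub>"
 using D2[of "\<zero>\<^bsub>B\<^esub>" "\<zero>\<^bsub>B\<^esub>"] zero_in_tower[OF k(2)] D1[of "\<zero>\<^bsub>B\<^esub>"] by simp
 have Ex: "E x = D x" if "x \<in> tower k" for x
 using E[OF that zero_in_tower[OF k(2)]] that cl D1 D0 th be by (simp add: val_def)
 have one: "\<one>\<^bsub>B\<^esub> \<in> tower k"
 using k(2)
 proof (induction k)
 case 0
 show ?case using h_one by (auto intro: rev_image_eqI)
 qed (use tower_mono in auto)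
 have D_one: "D \<one>\<^bsub>B\<^esub> = \<zero>\<^bsub>B\<^esub>"
 using D4[OF one one] D1[OF one] B.gr.tw_of[OF B.one_even, of i] by (simp add: ksgn_def)
 have "E (et k) = \<beta> k"
 using E[OF zero_in_tower[OF k(2)] one] D_one D0 th be B.gr.tw_of[OF B.one_even, of i]
 by (simp add: val_def ksgn_def)
 moreover have "E (et j) = \<beta> j" if "j < k" for j
 proof -
 have "m <= k ==> x \<in> tower (Suc j) ==> Suc j <= m ==> x \<in> tower m" for m x
 proof (induction m)
 case (Suc m)
 then show ?case using tower_mono[of m x] k by (cases "m = j") auto
 qed simp
 from this[of k "et j"] have "et j \<in> tower k" using theta_in_tower[of j] that k by simp
 then show ?thesis using Ex Dt that by simp
 qed
 moreover have "E (h a) = d a" if "a \<in> carrier A" for a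
 proof -
 have "m <= k ==> h a \<in> tower m" for m
 proof (induction m)
 case (Suc m)
 then show ?case using tower_mono[of m "h a"] k by auto
 qed (use that in auto)
 from this[of k] show ?thesis using Ex Dh that by simp
 qed
 moreover have "tderiv (Suc k) i E"
 unfolding tderiv_def
 proof (intro conjI allI ballI)
 fix z assume "z \<in> tower (Suc k)"
 then show "E z \<in> carrier B" using E valc by auto
 next
 fix z z' assume "z \<in> tower (Suc k)" "z' \<in> tower (Suc k)"
 then obtain x y x' y' where z: "x \<in> tower k" "y \<in> tower k" "x' \<in> tower k" "y' \<in> tower k"
 "z = x \<oplus>\<^bsub>B\<^esub> y \<otimes>\<^bsub>B\<^esub> et k" "z' = x' \<oplus>\<^bsub>B\<^esub> y' \<otimes>\<^bsub>B\<^esub> et k" by auto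
 have c: "x \<in> carrier B" "y \<in> carrier B" "x' \<in> carrier B" "y' \<in> carrier B"
 "D x \<in> carrier B" "D y \<in> carrier B" "D x' \<in> carrier B" "D y' \<in> carrier B" using z cl D1 by auto
 have "z \<oplus>\<^bsub>B\<^esub> z' = (x \<oplus>\<^bsub>B\<^esub> x') \<oplus>\<^bsub>B\<^esub> (y \<oplus>\<^bsub>B\<^esub> y') \<otimes>\<^bsub>B\<^esub> et k" unfolding z using c th by algebra
 then have "E (z \<oplus>\<^bsub>B\<^esub> z') = val (x \<oplus>\<^bsub>B\<^esub> x') (y \<oplus>\<^bsub>B\<^esub> y')"
 using E tower_add z k(2) by simp
 also have "\<dots> = (D x \<oplus>\<^bsub>B\<^esub> D x') \<oplus>\<^bsub>B\<^esub> (D y \<oplus>\<^bsub>B\<^esub> D y') \<otimes>\<^bsub>B\<^esub> et k \<oplus>\<^bsub>B\<^esub>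
 (B.gr.tw i y \<oplus>\<^bsub>B\<^esub> B.gr.tw i y') \<otimes>\<^bsub>B\<^esub> \<beta> k"
 using z c by (simp add: val_def D2 B.gr.tw_add)
 also have "\<dots> = val x y \<oplus>\<^bsub>B\<^esub> val x' y'"
 unfolding val_def using c th be B.gr.tw_closed[OF c(2), of i] B.gr.tw_closed[OF c(4), of i] by algebra
 finally show "E (z \<oplus>\<^bsub>B\<^esub> z') = E z \<oplus>\<^bsub>B\<^esub> E z'" using E z by simp
 let ?t = "B.gr.tw i" and ?s = "B.gr.tw 1"
 have tt: "?t x \<in> carrier B" "?t y \<in> carrier B" "?t y' \<in> carrier B" "?s x' \<in> carrier B"
 "?t (et k) \<in> carrier B" "?t (?s x') \<in> carrier B" "D (?s x') \<in> carrier B"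
 "?s x' \<in> tower k" "?t y' \<in> tower k"
 using c th z k tower_tw D1 by auto
 have i1: "B.gr.tw (i + 1) w = ?t (?s w)" if "w \<in> carrier B" for w
 using that bit_cases[of i] by auto
 have e1: "et k \<otimes>\<^bsub>B\<^esub> x' = ?s x' \<otimes>\<^bsub>B\<^esub> et k" using swap_theta k c by auto
 have e2: "et k \<otimes>\<^bsub>B\<^esub> (y' \<otimes>\<^bsub>B\<^esub> et k) = \<zero>\<^bsub>B\<^esub>" using theta_theta k c by auto
 have e3: "\<beta> k \<otimes>\<^bsub>B\<^esub> x' = ?t (?s x') \<otimes>\<^bsub>B\<^esub> \<beta> k" using B.supercommute_tw[OF be(1) c(3)] i1[OF c(3)] by simp
 have tth: "?t (et k) = ksgn B i 1 (et k)" using B.gr.tw_of[OF th(1)] .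
 have e4: "?t (et k) \<otimes>\<^bsub>B\<^esub> D x' = D (?s x') \<otimes>\<^bsub>B\<^esub> et k"
 unfolding tth using swap_theta[OF k(1) c(7)] tderiv_tw[OF D k(2) z(3)] bit_cases[of i] th c tt
 by (auto simp: ksgn_def B.l_minus B.minus_minus)
 have e5: "?t (et k) \<otimes>\<^bsub>B\<^esub> (D y' \<otimes>\<^bsub>B\<^esub> et k) = \<zero>\<^bsub>B\<^esub>"
 unfolding tth using theta_theta[OF k(1) c(8)] c th by (simp add: ksgn_def B.l_minus)
 have e6: "?t (et k) \<otimes>\<^bsub>B\<^esub> (?t y' \<otimes>\<^bsub>B\<^esub> \<beta> k) = \<ominus>\<^bsub>B\<^esub> (\<beta> k \<otimes>\<^bsub>B\<^esub> (y' \<otimes>\<^bsub>B\<^esub> et k))"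
 proof -
 have a: "\<beta> k \<otimes>\<^bsub>B\<^esub> y' = ?t (?s y') \<otimes>\<^bsub>B\<^esub> \<beta> k" using B.supercommute_tw[OF be(1) c(4)] i1[OF c(4)] by simp
 have b: "et k \<otimes>\<^bsub>B\<^esub> ?t y' = ?s (?t y') \<otimes>\<^bsub>B\<^esub> et k" using swap_theta k tt by auto
 have st: "?s (?t y') = ?t (?s y')" using bit_cases[of i] by auto
 have bt: "\<beta> k \<otimes>\<^bsub>B\<^esub> et k = ksgn B (i + 1) 1 (et k \<otimes>\<^bsub>B\<^esub> \<beta> k)"
 using B.supercommute[OF be(1) th(1)] .
 have ts: "?t (?s y') \<in> carrier B" using c by simp
 have "\<beta> k \<otimes>\<^bsub>B\<^esub> (y' \<otimes>\<^bsub>B\<^esub> et k) = ?t (?s y') \<otimes>\<^bsub>B\<^esub> (\<beta> k \<otimes>\<^bsub>B\<^esub> et k)"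
 using a be c th ts by (simp flip: B.m_assoc)
 moreover have "et k \<otimes>\<^bsub>B\<^esub> (?t y' \<otimes>\<^bsub>B\<^esub> \<beta> k) = ?t (?s y') \<otimes>\<^bsub>B\<^esub> (et k \<otimes>\<^bsub>B\<^esub> \<beta> k)"
 using b st be tt th ts by (simp flip: B.m_assoc)
 ultimately show ?thesis unfolding tth bt using bit_cases[of i] be th tt ts
 by (auto simp: ksgn_def B.l_minus B.r_minus B.minus_minus)
 qed
 have "z \<otimes>\<^bsub>B\<^esub> z' = x \<otimes>\<^bsub>B\<^esub> x' \<oplus>\<^bsub>B\<^esub> (x \<otimes>\<^bsub>B\<^esub> y' \<oplus>\<^bsub>B\<^esub> y \<otimes>\<^bsub>B\<^esub> ?s x') \<otimes>\<^bsub>B\<^esub> et k"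
 unfolding z using c k by (intro tower_product) auto
 then have "E (z \<otimes>\<^bsub>B\<^esub> z') = val (x \<otimes>\<^bsub>B\<^esub> x') (x \<otimes>\<^bsub>B\<^esub> y' \<oplus>\<^bsub>B\<^esub> y \<otimes>\<^bsub>B\<^esub> ?s x')"
 using E[of "x \<otimes>\<^bsub>B\<^esub> x'" "x \<otimes>\<^bsub>B\<^esub> y' \<oplus>\<^bsub>B\<^esub> y \<otimes>\<^bsub>B\<^esub> ?s x'"] tower_add tower_mult z tt k(2) by simp
 also have "\<dots> = (D x \<otimes>\<^bsub>B\<^esub> x' \<oplus>\<^bsub>B\<^esub> ?t x \<otimes>\<^bsub>B\<^esub> D x') \<oplus>\<^bsub>B\<^esub> ((D x \<otimes>\<^bsub>B\<^esub> y' \<oplus>\<^bsub>B\<^esub> ?t x \<otimes>\<^bsub>B\<^esub> D y') \<oplus>\<^bsub>B\<^esub>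
 (D y \<otimes>\<^bsub>B\<^esub> ?s x' \<oplus>\<^bsub>B\<^esub> ?t y \<otimes>\<^bsub>B\<^esub> D (?s x'))) \<otimes>\<^bsub>B\<^esub> et k \<oplus>\<^bsub>B\<^esub>
 (?t x \<otimes>\<^bsub>B\<^esub> ?t y' \<oplus>\<^bsub>B\<^esub> ?t y \<otimes>\<^bsub>B\<^esub> ?t (?s x')) \<otimes>\<^bsub>B\<^esub> \<beta> k"
 unfolding val_def using z tt c k(2)
 by (simp add: D2 D4 tower_mult B.gr.tw_add B.tw_mult)
 also have "\<dots> = (D x \<oplus>\<^bsub>B\<^esub> D y \<otimes>\<^bsub>B\<^esub> et k \<oplus>\<^bsub>B\<^esub> ?t y \<otimes>\<^bsub>B\<^esub> \<beta> k) \<otimes>\<^bsub>B\<^esub> (x' \<oplus>\<^bsub>B\<^esub> y' \<otimes>\<^bsub>B\<^esub> et k) \<oplus>\<^bsub>B\<^esub>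
 (?t x \<oplus>\<^bsub>B\<^esub> ?t y \<otimes>\<^bsub>B\<^esub> ?t (et k)) \<otimes>\<^bsub>B\<^esub> (D x' \<oplus>\<^bsub>B\<^esub> D y' \<otimes>\<^bsub>B\<^esub> et k \<oplus>\<^bsub>B\<^esub> ?t y' \<otimes>\<^bsub>B\<^esub> \<beta> k)"
 by (rule B.leibniz_step) (fact c tt th be e1 e2 e3 e4 e5 e6)+
 also have "\<dots> = E z \<otimes>\<^bsub>B\<^esub> z' \<oplus>\<^bsub>B\<^esub> ?t z \<otimes>\<^bsub>B\<^esub> E z'"
 using E z c th by (simp add: val_def B.gr.tw_add B.tw_mult)
 finally show "E (z \<otimes>\<^bsub>B\<^esub> z') = E z \<otimes>\<^bsub>B\<^esub> z' \<oplus>\<^bsub>B\<^esub> ?t z \<otimes>\<^bsub>B\<^esub> E z'" .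
 next
 fix j z assume "z \<in> tower (Suc k) \<inter> gr B j"
 then obtain x y where z: "x \<in> tower k" "y \<in> tower k" "z = x \<oplus>\<^bsub>B\<^esub> y \<otimes>\<^bsub>B\<^esub> et k" "z \<in> gr B j" by auto
 have c: "x \<in> carrier B" "y \<in> carrier B" using z cl by auto
 let ?x = "B.gr.prt j x" and ?y = "B.gr.prt (j + 1) y"
 have "B.gr.prt j (y \<otimes>\<^bsub>B\<^esub> et k) = ?y \<otimes>\<^bsub>B\<^esub> et k"
 proof (rule B.gr.part_eqI)
 show "?y \<otimes>\<^bsub>B\<^esub> et k \<in> gr B j"
 using B.mult_gr[OF B.gr.part_in[OF c(2), of "j + 1"] th(1)] by (simp only: bit_add_self)
 show "B.gr.prt j y \<otimes>\<^bsub>B\<^esub> et k \<in> gr B (j + 1)"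
 using B.mult_gr[OF B.gr.part_in[OF c(2)] th(1)] .
 show "y \<otimes>\<^bsub>B\<^esub> et k = ?y \<otimes>\<^bsub>B\<^esub> et k \<oplus>\<^bsub>B\<^esub> B.gr.prt j y \<otimes>\<^bsub>B\<^esub> et k"
 using B.gr.part_sum[OF c(2), of "j + 1"] B.l_distr[of "B.gr.prt (j + 1) y" "B.gr.prt j y" "et k"] c th
 by (simp only: bit_add_self B.gr.part_closed)
 qed
 then have "B.gr.prt j z = ?x \<oplus>\<^bsub>B\<^esub> ?y \<otimes>\<^bsub>B\<^esub> et k" using c th by (simp only: z(3) B.gr.part_add B.m_closed)
 then have "z = ?x \<oplus>\<^bsub>B\<^esub> ?y \<otimes>\<^bsub>B\<^esub> et k" using B.gr.part_of[OF z(4), of j] by simp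
 then have "E z = val ?x ?y" using E tower_part z(1,2) k by simp
 moreover have "D ?x \<in> gr B (i + j)" using D3 tower_part z k B.gr.part_in c by simp
 moreover have "D ?y \<otimes>\<^bsub>B\<^esub> et k \<in> gr B (i + (j + 1) + 1)"
 using D3[OF tower_part[OF k(2) z(2), of "j + 1"] B.gr.part_in[OF c(2)]] th by (intro B.mult_gr)
 moreover have "B.gr.tw i ?y \<otimes>\<^bsub>B\<^esub> \<beta> k \<in> gr B ((j + 1) + (i + 1))"
 using B.gr.tw_in[OF B.gr.part_in[OF c(2), of "j + 1"]] be by (intro B.mult_gr)
 moreover have "i + (j + 1) + 1 = i + j" "(j + 1) + (i + 1) = i + j"
 using bit_cases[of i] bit_cases[of j] by auto
 ultimately show "E z \<in> gr B (i + j)" unfolding val_def by (simp only: B.gr.g_add)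
 qed
 ultimately show ?case using less_Suc_eq by auto
qed

end

section \<open>Modules with odd partial derivatives\<close>

locale odd_ring = superring R for R :: "('a, 'r) superring_scheme" (structure) +
 fixes et :: "nat => 'a" and D :: "nat => 'a => 'a" and n :: nat
 assumes theta_odd: "j < n ==> et j \<in> gr R 1"
 and half: "\<exists>u\<in>carrier R. u \<oplus> u = \<one>"
 and D_closed [simp]: "j < n ==> a \<in> carrier R ==> D j a \<in> carrier R"
 and D_add: "j < n ==> a \<in> carrier R ==> b \<in> carrier R ==> D j (a \<oplus> b) = D j a \<oplus> D j b"
 and D_mult: "j < n ==> a \<in> carrier R ==> b \<in> carrier R ==>
 D j (a \<otimes> b) = D j a \<otimes> b \<oplus> gr.tw 1 a \<otimes> D j b"
 and D_odd: "j < n ==> a \<in> gr R p ==> D j a \<in> gr R (1 + p)"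
 and D_theta: "i < n ==> j < n ==> D j (et i) = (if i = j then \<one> else \<zero>)"
 and D_anti: "i < n ==> j < n ==> a \<in> carrier R ==> D i (D j a) = \<ominus> D j (D i a)"

locale odd_module = supmod R M + odd_ring R et D n
 for R :: "('a, 'r) superring_scheme" (structure) and M :: "('a, 'm, 's) supermod_scheme" (structure)
 and et D n +
 fixes E :: "nat => 'm => 'm"
 assumes E_closed [simp]: "j < n ==> m \<in> carrier M ==> E j m \<in> carrier M"
 and E_add: "j < n ==> m \<in> carrier M ==> m' \<in> carrier M ==> E j (m \<oplus>\<^bsub>M\<^esub> m') = E j m \<oplus>\<^bsub>M\<^esub> E j m'"
 and E_smult: "j < n ==> a \<in> carrier R ==> m \<in> carrier M ==>
 E j (a \<odot>\<^bsub>M\<^esub> m) = D j a \<odot>\<^bsub>M\<^esub> m \<oplus>\<^bsub>M\<^esub> gr.tw 1 a \<odot>\<^bsub>M\<^esub> E j m"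
 and E_odd: "j < n ==> m \<in> mgr M p ==> E j m \<in> mgr M (1 + p)"
 and E_anti: "i < n ==> j < n ==> m \<in> carrier M ==> E i (E j m) = \<ominus>\<^bsub>M\<^esub> E j (E i m)"

lemma (in odd_ring) regmod_odd_module: "odd_module R (regmod R) et D n D"
proof -
 interpret supmod R "regmod R" by (rule regmod_supmod)
 show ?thesis
 by (unfold_locales; unfold regmod_simps regmod_neg)
 (rule D_closed D_add D_mult D_odd D_anti; assumption)+
qed

text \<open>The product of the operators $1 - \theta_j \partial_j$ for $j < k$.\<close>

primrec oddproj ::
 "('a, 'm, 's) supermod_scheme => (nat => 'a) => (nat => 'm => 'm) => nat => 'm => 'm" where
 "oddproj M et E 0 m = m"
| "oddproj M et E (Suc k) m = oddproj M et E k m \<ominus>\<^bsub>M\<^esub> et k \<odot>\<^bsub>M\<^esub> E k (oddproj M et E k m)"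

context odd_module
begin

abbreviation "P \<equiv> oddproj M et E"

lemma theta_closed [simp]: "j < n ==> et j \<in> carrier R"
 using theta_odd gr.g_closed by blast

lemma E_zero [simp]: "j < n ==> E j \<zero>\<^bsub>M\<^esub> = \<zero>\<^bsub>M\<^esub>"
 using E_add[of j "\<zero>\<^bsub>M\<^esub>" "\<zero>\<^bsub>M\<^esub>"] by simp

lemma E_neg: "j < n ==> m \<in> carrier M ==> E j (\<ominus>\<^bsub>M\<^esub> m) = \<ominus>\<^bsub>M\<^esub> E j m"
 by (rule M.neg_unique) (simp_all flip: E_add add: M.r_neg)

lemma E_minus: "j < n ==> m \<in> carrier M ==> m' \<in> carrier M ==> E j (m \<ominus>\<^bsub>M\<^esub> m') = E j m \<ominus>\<^bsub>M\<^esub> E j m'"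
 by (simp add: a_minus_def E_add E_neg)

lemma double_zero:
 assumes "m \<in> carrier M" "m \<oplus>\<^bsub>M\<^esub> m = \<zero>\<^bsub>M\<^esub>" shows "m = \<zero>\<^bsub>M\<^esub>"
proof -
 obtain u where u: "u \<in> carrier R" "u \<oplus> u = \<one>" using half by auto
 have "m = (u \<oplus> u) \<odot>\<^bsub>M\<^esub> m" using u assms by simp
 also have "\<dots> = u \<odot>\<^bsub>M\<^esub> (m \<oplus>\<^bsub>M\<^esub> m)" using u(1) assms(1) by (simp add: smult_l_distr smult_r_distr)
 finally show ?thesis using assms u by simp
qed

lemma E_E: "j < n ==> m \<in> carrier M ==> E j (E j m) = \<zero>\<^bsub>M\<^esub>"
proof -
 assume j: "j < n" "m \<in> carrier M"
 have "E j (E j m) \<oplus>\<^bsub>M\<^esub> E j (E j m) = E j (E j m) \<oplus>\<^bsub>M\<^esub> \<ominus>\<^bsub>M\<^esub> E j (E j m)"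
 using E_anti[OF j(1) j(1) j(2)] by simp
 also have "\<dots> = \<zero>\<^bsub>M\<^esub>" using j by (simp add: M.r_neg)
 finally show ?thesis using j double_zero[of "E j (E j m)"] by simp
qed

lemma tw_theta: "j < n ==> gr.tw 1 (et j) = \<ominus> et j"
 using gr.tw_of[OF theta_odd] by (simp add: ksgn_def)

lemma E_theta:
 "i < n ==> j < n ==> m \<in> carrier M ==>
 E j (et i \<odot>\<^bsub>M\<^esub> m) = (if i = j then m \<ominus>\<^bsub>M\<^esub> et i \<odot>\<^bsub>M\<^esub> E j m else \<ominus>\<^bsub>M\<^esub> (et i \<odot>\<^bsub>M\<^esub> E j m))"
 by (simp add: E_smult D_theta tw_theta smult_l_minus a_minus_def)

lemma E_step:
 assumes "j < n" "k < n" "m \<in> carrier M"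
 shows "E j (m \<ominus>\<^bsub>M\<^esub> et k \<odot>\<^bsub>M\<^esub> E k m) =
 (if j = k then \<zero>\<^bsub>M\<^esub> else E j m \<ominus>\<^bsub>M\<^esub> et k \<odot>\<^bsub>M\<^esub> E k (E j m))"
proof (cases "j = k")
 case True
 have c: "E k m \<in> carrier M" using assms by simp
 have "E k (m \<ominus>\<^bsub>M\<^esub> et k \<odot>\<^bsub>M\<^esub> E k m) = E k m \<ominus>\<^bsub>M\<^esub> (E k m \<ominus>\<^bsub>M\<^esub> et k \<odot>\<^bsub>M\<^esub> \<zero>\<^bsub>M\<^esub>)"
 using assms by (simp add: E_minus E_theta E_E)
 also have "\<dots> = \<zero>\<^bsub>M\<^esub>" using assms c by (simp add: a_minus_def M.r_neg)
 finally show ?thesis using True by simp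
next
 case False
 have "E j (m \<ominus>\<^bsub>M\<^esub> et k \<odot>\<^bsub>M\<^esub> E k m) = E j m \<ominus>\<^bsub>M\<^esub> \<ominus>\<^bsub>M\<^esub> (et k \<odot>\<^bsub>M\<^esub> E j (E k m))"
 using assms False by (simp add: E_minus E_theta)
 also have "\<dots> = E j m \<ominus>\<^bsub>M\<^esub> et k \<odot>\<^bsub>M\<^esub> E k (E j m)"
 unfolding E_anti[OF assms] using assms by (simp add: smult_r_minus M.minus_minus)
 finally show ?thesis using False by simp
qed

lemma P_closed [simp]: "k <= n ==> m \<in> carrier M ==> P k m \<in> carrier M"
 by (induction k) auto

lemma P_add: "k <= n ==> m \<in> carrier M ==> m' \<in> carrier M ==> P k (m \<oplus>\<^bsub>M\<^esub> m') = P k m \<oplus>\<^bsub>M\<^esub> P k m'"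
proof (induction k)
 case (Suc k)
 have "P k m \<in> carrier M" "P k m' \<in> carrier M" "E k (P k m) \<in> carrier M" "E k (P k m') \<in> carrier M"
 "et k \<odot>\<^bsub>M\<^esub> E k (P k m) \<in> carrier M" "et k \<odot>\<^bsub>M\<^esub> E k (P k m') \<in> carrier M"
 using Suc.prems by auto
 then show ?case using Suc
 by (simp add: E_add smult_r_distr a_minus_def M.minus_add M.a_ac)
qed simp

lemma P_gr: "k <= n ==> m \<in> mgr M i ==> P k m \<in> mgr M i"
proof (induction k)
 case (Suc k)
 then have "et k \<odot>\<^bsub>M\<^esub> E k (P k m) \<in> mgr M (1 + (1 + i))"
 by (intro smult_gr theta_odd E_odd) auto
 then have "et k \<odot>\<^bsub>M\<^esub> E k (P k m) \<in> mgr M i" by (simp only: bit_add_self)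
 then show ?case using Suc M.g_minus by simp
qed simp

lemma P_fix: "k <= n ==> m \<in> carrier M ==> (!!j. j < k ==> E j m = \<zero>\<^bsub>M\<^esub>) ==> P k m = m"
 by (induction k) (simp_all add: a_minus_def)

lemma E_P: "j < k ==> k <= n ==> m \<in> carrier M ==> E j (P k m) = \<zero>\<^bsub>M\<^esub>"
proof (induction k)
 case (Suc k)
 then show ?case
 by (cases "j = k") (simp_all add: E_step, simp add: a_minus_def)
qed simp

end

text \<open>Since $\theta_k^2 = 0$, the operator $1 - \theta_k\partial_k$ is multiplicative.\<close>

context odd_module
begin

interpretation ring: odd_module R "regmod R" et D n D
 rewrites "carrier (regmod R) = carrier R" and "\<zero>\<^bsub>regmod R\<^esub> = \<zero>\<^bsub>R\<^esub>" and "add (regmod R) = add R"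
 and "smult (regmod R) = mult R" and "mgr (regmod R) = gr R" and "a_inv (regmod R) = a_inv R"
 and "a_minus (regmod R) = a_minus R" and "ksgn (regmod R) = ksgn R"
 by (rule regmod_odd_module) simp_all

abbreviation "PR \<equiv> oddproj (regmod R) et D"

lemmas PR_closed = ring.P_closed and PR_gr = ring.P_gr and PR_fix = ring.P_fix and D_PR = ring.E_P
 and PR_add = ring.P_add and D_step = ring.E_step

lemma theta_swap: "k < n ==> a \<in> carrier R ==> m \<in> carrier M ==>
 et k \<odot>\<^bsub>M\<^esub> (a \<odot>\<^bsub>M\<^esub> m) = gr.tw 1 a \<odot>\<^bsub>M\<^esub> (et k \<odot>\<^bsub>M\<^esub> m)"
 using supercommute_tw[OF theta_odd] by (simp flip: smult_assoc)

lemma theta_theta: "k < n ==> m \<in> carrier M ==> et k \<odot>\<^bsub>M\<^esub> (et k \<odot>\<^bsub>M\<^esub> m) = \<zero>\<^bsub>M\<^esub>"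
proof -
 assume k: "k < n" "m \<in> carrier M"
 have "et k \<odot>\<^bsub>M\<^esub> (et k \<odot>\<^bsub>M\<^esub> m) = \<ominus>\<^bsub>M\<^esub> (et k \<odot>\<^bsub>M\<^esub> (et k \<odot>\<^bsub>M\<^esub> m))"
 using theta_swap[of k "et k" m] k by (simp add: tw_theta smult_l_minus)
 then have "et k \<odot>\<^bsub>M\<^esub> (et k \<odot>\<^bsub>M\<^esub> m) \<oplus>\<^bsub>M\<^esub> et k \<odot>\<^bsub>M\<^esub> (et k \<odot>\<^bsub>M\<^esub> m) =
 et k \<odot>\<^bsub>M\<^esub> (et k \<odot>\<^bsub>M\<^esub> m) \<oplus>\<^bsub>M\<^esub> \<ominus>\<^bsub>M\<^esub> (et k \<odot>\<^bsub>M\<^esub> (et k \<odot>\<^bsub>M\<^esub> m))" by (rule arg_cong)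
 also have "\<dots> = \<zero>\<^bsub>M\<^esub>" using k by (simp add: M.r_neg)
 finally show ?thesis using k double_zero[of "et k \<odot>\<^bsub>M\<^esub> (et k \<odot>\<^bsub>M\<^esub> m)"] by simp
qed

lemma step_smult:
 assumes "k < n" "a \<in> carrier R" "m \<in> carrier M"
 shows "a \<odot>\<^bsub>M\<^esub> m \<ominus>\<^bsub>M\<^esub> et k \<odot>\<^bsub>M\<^esub> E k (a \<odot>\<^bsub>M\<^esub> m) =
 (a \<ominus> et k \<otimes> D k a) \<odot>\<^bsub>M\<^esub> (m \<ominus>\<^bsub>M\<^esub> et k \<odot>\<^bsub>M\<^esub> E k m)"
proof -
 let ?x = "et k \<odot>\<^bsub>M\<^esub> (D k a \<odot>\<^bsub>M\<^esub> m)" and ?y = "a \<odot>\<^bsub>M\<^esub> (et k \<odot>\<^bsub>M\<^esub> E k m)"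
 have c: "a \<odot>\<^bsub>M\<^esub> m \<in> carrier M" "?x \<in> carrier M" "?y \<in> carrier M" "D k a \<in> carrier R" "E k m \<in> carrier M"
 "et k \<in> carrier R" "gr.tw 1 a \<in> carrier R" "gr.tw 1 (D k a) \<in> carrier R"
 using assms by auto
 have "et k \<odot>\<^bsub>M\<^esub> E k (a \<odot>\<^bsub>M\<^esub> m) = ?x \<oplus>\<^bsub>M\<^esub> et k \<odot>\<^bsub>M\<^esub> (gr.tw 1 a \<odot>\<^bsub>M\<^esub> E k m)"
 using assms c by (simp add: E_smult smult_r_distr)
 also have "et k \<odot>\<^bsub>M\<^esub> (gr.tw 1 a \<odot>\<^bsub>M\<^esub> E k m) = ?y"
 using theta_swap[OF assms(1) c(7) c(5)] assms by simp
 finally have 1: "et k \<odot>\<^bsub>M\<^esub> E k (a \<odot>\<^bsub>M\<^esub> m) = ?x \<oplus>\<^bsub>M\<^esub> ?y" .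
 have "et k \<odot>\<^bsub>M\<^esub> (D k a \<odot>\<^bsub>M\<^esub> (et k \<odot>\<^bsub>M\<^esub> E k m)) = gr.tw 1 (D k a) \<odot>\<^bsub>M\<^esub> (et k \<odot>\<^bsub>M\<^esub> (et k \<odot>\<^bsub>M\<^esub> E k m))"
 using assms c by (intro theta_swap) auto
 also have "\<dots> = \<zero>\<^bsub>M\<^esub>" using assms c by (simp add: theta_theta)
 finally have 2: "et k \<odot>\<^bsub>M\<^esub> (D k a \<odot>\<^bsub>M\<^esub> (et k \<odot>\<^bsub>M\<^esub> E k m)) = \<zero>\<^bsub>M\<^esub>" .
 have "(a \<ominus> et k \<otimes> D k a) \<odot>\<^bsub>M\<^esub> (m \<ominus>\<^bsub>M\<^esub> et k \<odot>\<^bsub>M\<^esub> E k m) =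
 a \<odot>\<^bsub>M\<^esub> m \<oplus>\<^bsub>M\<^esub> \<ominus>\<^bsub>M\<^esub> ?x \<oplus>\<^bsub>M\<^esub> (\<ominus>\<^bsub>M\<^esub> ?y \<oplus>\<^bsub>M\<^esub> et k \<odot>\<^bsub>M\<^esub> (D k a \<odot>\<^bsub>M\<^esub> (et k \<odot>\<^bsub>M\<^esub> E k m)))"
 using assms c by (simp add: a_minus_def smult_l_distr smult_r_distr smult_l_minus smult_r_minus smult_assoc M.minus_add M.a_ac)
 also have "\<dots> = a \<odot>\<^bsub>M\<^esub> m \<ominus>\<^bsub>M\<^esub> (?x \<oplus>\<^bsub>M\<^esub> ?y)" unfolding 2 using c(1-3) by (simp add: a_minus_def M.minus_add M.a_ac)
 finally show ?thesis unfolding 1 by simp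
qed

lemma P_smult: "k <= n ==> a \<in> carrier R ==> m \<in> carrier M ==> P k (a \<odot>\<^bsub>M\<^esub> m) = PR k a \<odot>\<^bsub>M\<^esub> P k m"
proof (induction k)
 case (Suc k)
 then have IH: "P k (a \<odot>\<^bsub>M\<^esub> m) = PR k a \<odot>\<^bsub>M\<^esub> P k m" by simp
 show ?case using step_smult[of k "PR k a" "P k m"] Suc.prems PR_closed[of k a] by (simp add: IH)
qed simp

lemma PR_theta: "k <= n ==> j < n ==> PR k (et j) = (if j < k then \<zero> else et j)"
proof (induction k)
 case (Suc k)
 then show ?case
 by (cases "j = k") (auto simp: D_theta a_minus_def r_neg ring.E_zero)
qed simp

lemma P_theta: "j < n ==> m \<in> carrier M ==> P n (et j \<odot>\<^bsub>M\<^esub> m) = \<zero>\<^bsub>M\<^esub>"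
 by (simp add: P_smult PR_theta)

end

text \<open>A linear map need not commute with the partial derivatives, but the projection does not see
 multiples of the $\theta_j$, by which an element differs from its projection.\<close>

lemma oddproj_linear:
 fixes R (structure)
 assumes "odd_module R M et D n E" "odd_module R N et D n E'"
 and f: "!!m. m \<in> carrier M ==> f m \<in> carrier N"
 "!!m m'. m \<in> carrier M ==> m' \<in> carrier M ==> f (m \<oplus>\<^bsub>M\<^esub> m') = f m \<oplus>\<^bsub>N\<^esub> f m'"
 "!!a m. a \<in> carrier R ==> m \<in> carrier M ==> f (a \<odot>\<^bsub>M\<^esub> m) = a \<odot>\<^bsub>N\<^esub> f m"
 and m: "m \<in> carrier M" and k: "k <= n"
 shows "oddproj N et E' n (f (oddproj M et E k m)) = oddproj N et E' n (f m)"
 using k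
proof (induction k)
 case (Suc k)
 interpret M: odd_module R M et D n E by fact
 interpret N: odd_module R N et D n E' by fact
 let ?x = "M.P k m"
 let ?y = "\<ominus>\<^bsub>M\<^esub> E k ?x"
 have c: "?x \<in> carrier M" "E k ?x \<in> carrier M" "?y \<in> carrier M" "et k \<in> carrier R" using Suc.prems m by auto
 have "f (M.P (Suc k) m) = f (?x \<oplus>\<^bsub>M\<^esub> et k \<odot>\<^bsub>M\<^esub> ?y)"
 using c by (simp add: a_minus_def M.smult_r_minus)
 also have "\<dots> = f ?x \<oplus>\<^bsub>N\<^esub> et k \<odot>\<^bsub>N\<^esub> f ?y" using c f by simp
 finally have "N.P n (f (M.P (Suc k) m)) = N.P n (f ?x) \<oplus>\<^bsub>N\<^esub> N.P n (et k \<odot>\<^bsub>N\<^esub> f ?y)"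
 using c f by (simp add: N.P_add)
 then show ?case using Suc c f m by (simp add: N.P_theta)
qed simp

lemma oddproj_natural:
 assumes "odd_module R M et D n E" "odd_module R N et D n E'"
 and f: "!!m. m \<in> carrier M ==> f m \<in> carrier N"
 "!!m m'. m \<in> carrier M ==> m' \<in> carrier M ==> f (m \<oplus>\<^bsub>M\<^esub> m') = f m \<oplus>\<^bsub>N\<^esub> f m'"
 "!!a m. a \<in> carrier R ==> m \<in> carrier M ==> f (a \<odot>\<^bsub>M\<^esub> m) = a \<odot>\<^bsub>N\<^esub> f m"
 "!!j m. j < n ==> m \<in> carrier M ==> f (E j m) = E' j (f m)"
 and m: "m \<in> carrier M" and k: "k <= n"
 shows "f (oddproj M et E k m) = oddproj N et E' k (f m)"
 using k
proof (induction k)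
 case (Suc k)
 interpret M: odd_module R M et D n E by fact
 interpret N: odd_module R N et D n E' by fact
 let ?x = "M.P k m"
 have c: "?x \<in> carrier M" "E k ?x \<in> carrier M" "et k \<odot>\<^bsub>M\<^esub> E k ?x \<in> carrier M" "et k \<in> carrier R"
 using Suc.prems m by auto
 have f0: "f \<zero>\<^bsub>M\<^esub> = \<zero>\<^bsub>N\<^esub>" using f(2)[of "\<zero>\<^bsub>M\<^esub>" "\<zero>\<^bsub>M\<^esub>"] f(1)[of "\<zero>\<^bsub>M\<^esub>"] by simp
 have "f (\<ominus>\<^bsub>M\<^esub> (et k \<odot>\<^bsub>M\<^esub> E k ?x)) = \<ominus>\<^bsub>N\<^esub> f (et k \<odot>\<^bsub>M\<^esub> E k ?x)"
 using c f(1) f(2)[of "et k \<odot>\<^bsub>M\<^esub> E k ?x" "\<ominus>\<^bsub>M\<^esub> (et k \<odot>\<^bsub>M\<^esub> E k ?x)"] f0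
 by (intro N.M.neg_unique) (auto simp: M.M.r_neg)
 then show ?case using Suc c f by (simp add: a_minus_def)
qed simp

section \<open>Superspaces, vector fields and D-modules\<close>

lemma superring_hom_part:
 assumes "superring A" "superring B" "superring_hom A B h" "a \<in> carrier A"
 shows "h (hpart A (gr A) i a) = hpart B (gr B) i (h a)"
 and "h (\<ominus>\<^bsub>A\<^esub> a) = \<ominus>\<^bsub>B\<^esub> h a"
 and "h (ptwist A (gr A) i a) = ptwist B (gr B) i (h a)"
proof -
 interpret A: superring A by fact
 interpret B: superring B by fact
 have hr: "h \<in> ring_hom A B" using assms(3) by (simp add: superring_hom_def)
 have g: "x \<in> gr A j ==> h x \<in> gr B j" for x j using assms(3) by (auto simp: superring_hom_def)
 have neg: "h (\<ominus>\<^bsub>A\<^esub> a) = \<ominus>\<^bsub>B\<^esub> h a" if "a \<in> carrier A" for a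
 proof (rule B.neg_unique)
 show "h a \<oplus>\<^bsub>B\<^esub> h (\<ominus>\<^bsub>A\<^esub> a) = \<zero>\<^bsub>B\<^esub>"
 using that ring_hom_add[OF hr, of a "\<ominus>\<^bsub>A\<^esub> a"] ring_hom_zero[OF hr A.ring_axioms B.ring_axioms]
 by (simp add: A.r_neg)
 qed (use that ring_hom_closed[OF hr] in auto)
 show "h (\<ominus>\<^bsub>A\<^esub> a) = \<ominus>\<^bsub>B\<^esub> h a" using neg assms by auto
 have part: "h (hpart A (gr A) i a) = hpart B (gr B) i (h a)" for i
 proof (rule B.gr.part_eqI[symmetric])
 show "h a = h (A.gr.prt i a) \<oplus>\<^bsub>B\<^esub> h (A.gr.prt (i + 1) a)"
 using ring_hom_add[OF hr, of "A.gr.prt i a" "A.gr.prt (i + 1) a"] A.gr.part_sum[OF assms(4), of i] assms(4)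
 by (simp only: A.gr.part_closed)
 qed (use assms(4) A.gr.part_in g in auto)
 then show "h (hpart A (gr A) i a) = hpart B (gr B) i (h a)" .
 show "h (ptwist A (gr A) i a) = ptwist B (gr B) i (h a)"
 using assms(4) ring_hom_add[OF hr, of "A.gr.prt 0 a" "\<ominus>\<^bsub>A\<^esub> A.gr.prt 1 a"]
 by (auto simp: ptwist_def a_minus_def neg part)
qed

lemma derivation_leibniz:
 assumes "superring A" "derivation K A i d" "a \<in> carrier A" "b \<in> carrier A"
 shows "d (a \<otimes>\<^bsub>A\<^esub> b) = d a \<otimes>\<^bsub>A\<^esub> b \<oplus>\<^bsub>A\<^esub> ptwist A (gr A) i a \<otimes>\<^bsub>A\<^esub> d b"
proof -
 interpret A: superring A by fact
 have d: "!!a. a \<in> carrier A ==> d a \<in> carrier A"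
 "!!a b. a \<in> carrier A ==> b \<in> carrier A ==> d (a \<oplus>\<^bsub>A\<^esub> b) = d a \<oplus>\<^bsub>A\<^esub> d b"
 "!!j a b. a \<in> gr A j ==> b \<in> carrier A ==>
 d (a \<otimes>\<^bsub>A\<^esub> b) = d a \<otimes>\<^bsub>A\<^esub> b \<oplus>\<^bsub>A\<^esub> ksgn A i j (a \<otimes>\<^bsub>A\<^esub> d b)"
 using assms(2) unfolding derivation_def by blast+
 from assms(3) show ?thesis
 proof (induction rule: A.gr.graded_induct)
 case (hom j a)
 then have "a \<in> carrier A" using A.gr.g_closed by auto
 then show ?case using d(1)[OF assms(4)] d(3)[OF hom assms(4)] assms(4)
 by (simp add: A.gr.tw_of[OF hom] ksgn_def A.l_minus)
 next
 case (add x y)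
 have c: "d x \<in> carrier A" "d y \<in> carrier A" "d b \<in> carrier A" using add d assms by auto
 have "d ((x \<oplus>\<^bsub>A\<^esub> y) \<otimes>\<^bsub>A\<^esub> b) = d (x \<otimes>\<^bsub>A\<^esub> b) \<oplus>\<^bsub>A\<^esub> d (y \<otimes>\<^bsub>A\<^esub> b)"
 using add assms(4) d(2) by (simp add: A.l_distr)
 also have "\<dots> = (d x \<oplus>\<^bsub>A\<^esub> d y) \<otimes>\<^bsub>A\<^esub> b \<oplus>\<^bsub>A\<^esub> (A.gr.tw i x \<oplus>\<^bsub>A\<^esub> A.gr.tw i y) \<otimes>\<^bsub>A\<^esub> d b"
 unfolding add.IH using c add.hyps assms(4) A.gr.tw_closed[of x i] A.gr.tw_closed[of y i] by algebra
 finally show ?case using add d(2) by (simp add: A.gr.tw_add)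
 qed
qed

subsection \<open>Sections\<close>

lemma set_sheafD:
 assumes "set_sheaf X S r"
 shows "!!U V s. openin X U ==> openin X V ==> V <= U ==> s \<in> S U ==> r U V s \<in> S V"
 and "!!U s. openin X U ==> s \<in> S U ==> r U U s = s"
 and "!!U V W s. openin X U ==> openin X V ==> openin X W ==> W <= V ==> V <= U ==> s \<in> S U ==>
 r V W (r U V s) = r U W s"
proof -
 note s = assms[unfolded set_sheaf_def]
 show "!!U V s. openin X U ==> openin X V ==> V <= U ==> s \<in> S U ==> r U V s \<in> S V"
 using s[THEN conjunct1] by blast
 show "!!U s. openin X U ==> s \<in> S U ==> r U U s = s"
 using s[THEN conjunct2, THEN conjunct1] by blast
 show "!!U V W s. openin X U ==> openin X V ==> openin X W ==> W <= V ==> V <= U ==> s \<in> S U ==>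
 r V W (r U V s) = r U W s"
 using s[THEN conjunct2, THEN conjunct2, THEN conjunct1] by blast
qed

text \<open>Separatedness and gluing in terms of the points of an open set.\<close>

lemma sheaf_eqI:
 assumes S: "set_sheaf X S r" and U: "openin X U" and s: "s \<in> S U" and t: "t \<in> S U"
 and loc: "!!x. x \<in> U ==> EX V. openin X V & x \<in> V & V <= U & r U V s = r U V t"
 shows "s = t"
proof -
 let ?C = "{V. openin X V & V <= U & r U V s = r U V t}"
 have e: "\<Union>?C = U" using loc by auto
 have "\<forall>\<U>. (\<forall>V\<in>\<U>. openin X V) -->
 (\<forall>s\<in>S (\<Union>\<U>). \<forall>t\<in>S (\<Union>\<U>). (\<forall>V\<in>\<U>. r (\<Union>\<U>) V s = r (\<Union>\<U>) V t) --> s = t)"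
 using S[unfolded set_sheaf_def] by (elim conjE)
 from this[rule_format, of ?C s t] show ?thesis unfolding e using s t by blast
qed

lemma sheaf_glue:
 assumes S: "set_sheaf X S r" and U: "openin X U"
 and loc: "!!x. x \<in> U ==> EX V s. openin X V & x \<in> V & V <= U & s \<in> S V & Q V s"
 and compat: "!!V s V' s'. openin X V ==> V <= U ==> s \<in> S V ==> Q V s ==>
 openin X V' ==> V' <= U ==> s' \<in> S V' ==> Q V' s' ==> r V (V \<inter> V') s = r V' (V \<inter> V') s'"
 shows "\<exists>s\<in>S U. ALL V t. openin X V --> V <= U --> t \<in> S V --> Q V t --> r U V s = t"
proof -
 let ?C = "{V. openin X V & V <= U & (\<exists>s\<in>S V. Q V s)}"
 define f where "f V = (SOME s. s \<in> S V & Q V s)" for V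
 have f: "f V \<in> S V & Q V (f V)" if "V \<in> ?C" for V
 proof -
 from that have "EX s. s \<in> S V & Q V s" by blast
 then show ?thesis unfolding f_def by (rule someI_ex)
 qed
 have e: "\<Union>?C = U"
 proof
 show "U <= \<Union>?C"
 proof
 fix x assume "x \<in> U"
 from loc[OF this] show "x \<in> \<Union>?C" by blast
 qed
 qed auto
 have "\<forall>\<U> f. (\<forall>V\<in>\<U>. openin X V & f V \<in> S V) &
 (\<forall>V\<in>\<U>. \<forall>V'\<in>\<U>. r V (V \<inter> V') (f V) = r V' (V \<inter> V') (f V')) -->
 (\<exists>s\<in>S (\<Union>\<U>). \<forall>V\<in>\<U>. r (\<Union>\<U>) V s = f V)"
 using S[unfolded set_sheaf_def] by (elim conjE)
 from this[rule_format, of ?C f]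
 have "\<exists>s\<in>S U. \<forall>V\<in>?C. r U V s = f V" unfolding e
 proof
 show "(\<forall>V\<in>?C. openin X V & f V \<in> S V) &
 (\<forall>V\<in>?C. \<forall>V'\<in>?C. r V (V \<inter> V') (f V) = r V' (V \<inter> V') (f V'))"
 proof (intro conjI ballI)
 fix V V' assume V: "V \<in> ?C" "V' \<in> ?C"
 show "r V (V \<inter> V') (f V) = r V' (V \<inter> V') (f V')"
 using compat[of V "f V" V' "f V'"] f[OF V(1)] f[OF V(2)] V by simp
 qed (use f in auto)
 qed blast
 then obtain s where s: "s \<in> S U" "!!V. V \<in> ?C ==> r U V s = f V" by blast
 have "r U V s = t" if t: "openin X V" "V <= U" "t \<in> S V" "Q V t" for V t
 proof -
 have V: "V \<in> ?C" using t by blast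
 have "r V V (f V) = r V V t" using compat[of V "f V" V t] f[OF V] t by simp
 then have "f V = t" using set_sheafD(2)[OF S t(1)] f[OF V] t(3) by simp
 then show ?thesis using s(2)[OF V] by simp
 qed
 then show ?thesis using s(1) by blast
qed

locale sspace =
 fixes S0 :: "('l, complex) superalg" and Z :: "('z, 'a, 'l) superspace"
 assumes sspace: "is_superspace S0 Z"
begin

abbreviation opn :: "'z set => bool" where "opn \<equiv> openin (space Z)"
abbreviation Sc :: "'z set => 'a set" where "Sc U \<equiv> carrier (sec Z U)"
abbreviation tws :: "'z set => bit => 'a => 'a" where "tws U \<equiv> ptwist (sec Z U) (gr (sec Z U))"
abbreviation T :: "'z set => ('a, ('z, 'a) vf) supermod" where "T U \<equiv> msec (tangent S0 Z) U"

lemma superalg: "opn U ==> superalgebra S0 (sec Z U)"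
 using sspace by (simp add: is_superspace_def)

lemma sring: "opn U ==> superring (sec Z U)"
 using superalg superringI unfolding superalgebra_def by blast

lemma res_hom: "opn U ==> opn V ==> V <= U ==> superalg_hom S0 (sec Z U) (sec Z V) (res Z U V)"
 using sspace by (simp add: is_superspace_def)

lemma res_shom: "opn U ==> opn V ==> V <= U ==> superring_hom (sec Z U) (sec Z V) (res Z U V)"
 using res_hom by (simp add: superalg_hom_def)

lemma res_rhom: "opn U ==> opn V ==> V <= U ==> res Z U V \<in> ring_hom (sec Z U) (sec Z V)"
 using res_shom by (simp add: superring_hom_def)

lemma sheaf: "set_sheaf (space Z) Sc (res Z)"
 using sspace by (simp add: is_superspace_def)

lemma res_closed: "opn U ==> opn V ==> V <= U ==> a \<in> Sc U ==> res Z U V a \<in> Sc V"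
 using ring_hom_closed[OF res_rhom] .

lemma res_add: "opn U ==> opn V ==> V <= U ==> a \<in> Sc U ==> b \<in> Sc U ==>
 res Z U V (a \<oplus>\<^bsub>sec Z U\<^esub> b) = res Z U V a \<oplus>\<^bsub>sec Z V\<^esub> res Z U V b"
 using ring_hom_add[OF res_rhom] .

lemma res_mult: "opn U ==> opn V ==> V <= U ==> a \<in> Sc U ==> b \<in> Sc U ==>
 res Z U V (a \<otimes>\<^bsub>sec Z U\<^esub> b) = res Z U V a \<otimes>\<^bsub>sec Z V\<^esub> res Z U V b"
 using ring_hom_mult[OF res_rhom] .

lemma res_one: "opn U ==> opn V ==> V <= U ==> res Z U V \<one>\<^bsub>sec Z U\<^esub> = \<one>\<^bsub>sec Z V\<^esub>"
 using ring_hom_one[OF res_rhom] .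

lemma res_zero: "opn U ==> opn V ==> V <= U ==> res Z U V \<zero>\<^bsub>sec Z U\<^esub> = \<zero>\<^bsub>sec Z V\<^esub>"
 using ring_hom_zero[OF res_rhom] sring superring.axioms(1) by blast

lemma res_gr: "opn U ==> opn V ==> V <= U ==> a \<in> gr (sec Z U) i ==> res Z U V a \<in> gr (sec Z V) i"
 using res_shom unfolding superring_hom_def by blast

lemma res_tw: "opn U ==> opn V ==> V <= U ==> a \<in> Sc U ==> res Z U V (tws U i a) = tws V i (res Z U V a)"
 using superring_hom_part(3)[OF sring sring res_shom] by blast

lemma res_neg: "opn U ==> opn V ==> V <= U ==> a \<in> Sc U ==> res Z U V (\<ominus>\<^bsub>sec Z U\<^esub> a) = \<ominus>\<^bsub>sec Z V\<^esub> res Z U V a"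
 using superring_hom_part(2)[OF sring sring res_shom] by blast

lemmas res_id = set_sheafD(2)[OF sheaf] and res_res = set_sheafD(3)[OF sheaf]

subsection \<open>Vector fields\<close>

lemma vf_ext_apply [simp]: "opn V ==> V <= U ==> a \<in> Sc V ==> vf_ext Z U v V a = v V a"
 by (simp add: vf_ext_def)

lemma vf_ext_vf_ext [simp]: "V <= U ==> vf_ext Z V (vf_ext Z U v) = vf_ext Z V v"
 by (auto simp: vf_ext_def fun_eq_iff)

lemma vf_ext_cong: "(!!V a. opn V ==> V <= U ==> a \<in> Sc V ==> v V a = w V a) ==> vf_ext Z U v = vf_ext Z U w"
 by (auto simp: vf_ext_def fun_eq_iff restrict_def)

lemma vf_eqI:
 "vf_ext Z U v = v ==> vf_ext Z U w = w ==>
 (!!V a. opn V ==> V <= U ==> a \<in> Sc V ==> v V a = w V a) ==> v = w"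
 using vf_ext_cong by metis

lemma tangent_simps [simp]:
 "mgr (T U) = hom_vf S0 Z U" "add (T U) = vf_add Z U" "\<zero>\<^bsub>T U\<^esub> = vf_ext Z U (\<lambda>V a. \<zero>\<^bsub>sec Z V\<^esub>)"
 "smult (T U) = (\<lambda>b v. vf_ext Z U (\<lambda>V a. res Z U V b \<otimes>\<^bsub>sec Z V\<^esub> v V a))"
 "mres (tangent S0 Z) U V v = vf_ext Z V v"
 by (simp_all add: tangent_def)

lemma carrier_T: "carrier (T U) = {vf_add Z U v w | v w. v \<in> hom_vf S0 Z U 0 & w \<in> hom_vf S0 Z U 1}"
 by (simp add: tangent_def)

lemma hom_vf_ext: "v \<in> hom_vf S0 Z U i ==> vf_ext Z U v = v"
 by (simp add: hom_vf_def)

lemma hom_vf_deriv: "v \<in> hom_vf S0 Z U i ==> opn V ==> V <= U ==> derivation S0 (sec Z V) i (v V)"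
 by (simp add: hom_vf_def)

lemma hom_vf_res: "v \<in> hom_vf S0 Z U i ==> opn V ==> opn V' ==> V' <= V ==> V <= U ==> a \<in> Sc V ==>
 v V' (res Z V V' a) = res Z V V' (v V a)"
 by (simp add: hom_vf_def)

lemma hom_vfI:
 assumes "vf_ext Z U v = v"
 "!!V. opn V ==> V <= U ==> derivation S0 (sec Z V) i (v V)"
 "!!V V' a. opn V ==> opn V' ==> V' <= V ==> V <= U ==> a \<in> Sc V ==> v V' (res Z V V' a) = res Z V V' (v V a)"
 shows "v \<in> hom_vf S0 Z U i"
 using assms by (simp add: hom_vf_def)

lemma derivationD:
 assumes "derivation S0 (sec Z V) i d" "opn V"
 shows "!!a. a \<in> Sc V ==> d a \<in> Sc V"
 and "!!a b. a \<in> Sc V ==> b \<in> Sc V ==> d (a \<oplus>\<^bsub>sec Z V\<^esub> b) = d a \<oplus>\<^bsub>sec Z V\<^esub> d b"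
 and "!!a j. a \<in> gr (sec Z V) j ==> d a \<in> gr (sec Z V) (i + j)"
 and "!!a b. a \<in> Sc V ==> b \<in> Sc V ==>
 d (a \<otimes>\<^bsub>sec Z V\<^esub> b) = d a \<otimes>\<^bsub>sec Z V\<^esub> b \<oplus>\<^bsub>sec Z V\<^esub> tws V i a \<otimes>\<^bsub>sec Z V\<^esub> d b"
 and "!!l. l \<in> carrier S0 ==> d (base (sec Z V) l) = \<zero>\<^bsub>sec Z V\<^esub>"
 and "d \<zero>\<^bsub>sec Z V\<^esub> = \<zero>\<^bsub>sec Z V\<^esub>"
proof -
 interpret R: superring "sec Z V" using sring assms by blast
 show c: "!!a. a \<in> Sc V ==> d a \<in> Sc V"
 and a: "!!a b. a \<in> Sc V ==> b \<in> Sc V ==> d (a \<oplus>\<^bsub>sec Z V\<^esub> b) = d a \<oplus>\<^bsub>sec Z V\<^esub> d b"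
 and "!!a j. a \<in> gr (sec Z V) j ==> d a \<in> gr (sec Z V) (i + j)"
 and "!!l. l \<in> carrier S0 ==> d (base (sec Z V) l) = \<zero>\<^bsub>sec Z V\<^esub>"
 using assms(1) unfolding derivation_def by blast+
 show "!!a b. a \<in> Sc V ==> b \<in> Sc V ==>
 d (a \<otimes>\<^bsub>sec Z V\<^esub> b) = d a \<otimes>\<^bsub>sec Z V\<^esub> b \<oplus>\<^bsub>sec Z V\<^esub> tws V i a \<otimes>\<^bsub>sec Z V\<^esub> d b"
 using derivation_leibniz[OF R.superring_axioms assms(1)] .
 show "d \<zero>\<^bsub>sec Z V\<^esub> = \<zero>\<^bsub>sec Z V\<^esub>"
 using a[of "\<zero>\<^bsub>sec Z V\<^esub>" "\<zero>\<^bsub>sec Z V\<^esub>"] c[of "\<zero>\<^bsub>sec Z V\<^esub>"] by simp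
qed

lemma derivationI:
 assumes "opn V" "!!a. a \<in> Sc V ==> d a \<in> Sc V"
 and "!!a b. a \<in> Sc V ==> b \<in> Sc V ==> d (a \<oplus>\<^bsub>sec Z V\<^esub> b) = d a \<oplus>\<^bsub>sec Z V\<^esub> d b"
 and "!!a j. a \<in> gr (sec Z V) j ==> d a \<in> gr (sec Z V) (i + j)"
 and l: "!!a b. a \<in> Sc V ==> b \<in> Sc V ==>
 d (a \<otimes>\<^bsub>sec Z V\<^esub> b) = d a \<otimes>\<^bsub>sec Z V\<^esub> b \<oplus>\<^bsub>sec Z V\<^esub> tws V i a \<otimes>\<^bsub>sec Z V\<^esub> d b"
 and "!!l. l \<in> carrier S0 ==> d (base (sec Z V) l) = \<zero>\<^bsub>sec Z V\<^esub>"
 shows "derivation S0 (sec Z V) i d"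
proof -
 interpret R: superring "sec Z V" using sring assms(1) by blast
 have "d (a \<otimes>\<^bsub>sec Z V\<^esub> b) = d a \<otimes>\<^bsub>sec Z V\<^esub> b \<oplus>\<^bsub>sec Z V\<^esub> ksgn (sec Z V) i j (a \<otimes>\<^bsub>sec Z V\<^esub> d b)"
 if "a \<in> gr (sec Z V) j" "b \<in> Sc V" for a b j
 using l[of a b] that R.gr.g_closed[OF that(1)] R.gr.tw_of[OF that(1)] assms(2)[of b]
 by (simp add: ksgn_def R.l_minus)
 then show ?thesis unfolding derivation_def using assms(2,3,4,6) by blast
qed

lemma hom_vf_add:
 assumes "v \<in> hom_vf S0 Z U i" "w \<in> hom_vf S0 Z U i"
 shows "vf_add Z U v w \<in> hom_vf S0 Z U i"
proof (rule hom_vfI)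
 fix V assume V: "opn V" "V <= U"
 interpret R: superring "sec Z V" using sring V by blast
 note d = derivationD[OF hom_vf_deriv[OF assms(1) V] V(1)]
 note e = derivationD[OF hom_vf_deriv[OF assms(2) V] V(1)]
 have A: "vf_add Z U v w V a = v V a \<oplus>\<^bsub>sec Z V\<^esub> w V a" if "a \<in> Sc V" for a
 using that V by (simp add: vf_add_def)
 have b: "base (sec Z V) l \<in> Sc V" if "l \<in> carrier S0" for l
 using superalg[OF V(1)] that unfolding superalgebra_def superring_hom_def ring_hom_def by auto
 show "derivation S0 (sec Z V) i (vf_add Z U v w V)"
 proof (rule derivationI[OF V(1)])
 fix a b assume c: "a \<in> Sc V" "b \<in> Sc V"
 have cc: "v V a \<in> Sc V" "v V b \<in> Sc V" "w V a \<in> Sc V" "w V b \<in> Sc V" "tws V i a \<in> Sc V" using c d e by auto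
 show "vf_add Z U v w V (a \<oplus>\<^bsub>sec Z V\<^esub> b) = vf_add Z U v w V a \<oplus>\<^bsub>sec Z V\<^esub> vf_add Z U v w V b"
 using c cc by (simp add: A d(2) e(2) R.a_ac)
 have "vf_add Z U v w V (a \<otimes>\<^bsub>sec Z V\<^esub> b) = (v V a \<otimes>\<^bsub>sec Z V\<^esub> b \<oplus>\<^bsub>sec Z V\<^esub> tws V i a \<otimes>\<^bsub>sec Z V\<^esub> v V b) \<oplus>\<^bsub>sec Z V\<^esub>
 (w V a \<otimes>\<^bsub>sec Z V\<^esub> b \<oplus>\<^bsub>sec Z V\<^esub> tws V i a \<otimes>\<^bsub>sec Z V\<^esub> w V b)"
 using c cc by (simp add: A d(4) e(4))
 also have "\<dots> = (v V a \<oplus>\<^bsub>sec Z V\<^esub> w V a) \<otimes>\<^bsub>sec Z V\<^esub> b \<oplus>\<^bsub>sec Z V\<^esub> tws V i a \<otimes>\<^bsub>sec Z V\<^esub> (v V b \<oplus>\<^bsub>sec Z V\<^esub> w V b)"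
 using c cc by algebra
 finally show "vf_add Z U v w V (a \<otimes>\<^bsub>sec Z V\<^esub> b) =
 vf_add Z U v w V a \<otimes>\<^bsub>sec Z V\<^esub> b \<oplus>\<^bsub>sec Z V\<^esub> tws V i a \<otimes>\<^bsub>sec Z V\<^esub> vf_add Z U v w V b"
 using c by (simp add: A)
 next
 fix a j assume a: "a \<in> gr (sec Z V) j"
 show "vf_add Z U v w V a \<in> gr (sec Z V) (i + j)"
 unfolding A[OF R.gr.g_closed[OF a]] using d(3)[OF a] e(3)[OF a] by (rule R.gr.g_add)
 qed (use A d e b in \<open>auto\<close>)
next
 fix V V' a assume V: "opn V" "opn V'" "V' <= V" "V <= U" "a \<in> Sc V"
 then show "vf_add Z U v w V' (res Z V V' a) = res Z V V' (vf_add Z U v w V a)"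
 using res_closed hom_vf_res[OF assms(1)] hom_vf_res[OF assms(2)]
 derivationD(1)[OF hom_vf_deriv[OF assms(1) V(1,4)] V(1)]
 derivationD(1)[OF hom_vf_deriv[OF assms(2) V(1,4)] V(1)]
 by (simp add: vf_add_def res_add)
qed (simp add: vf_add_def)

lemma base_closed: "opn V ==> l \<in> carrier S0 ==> base (sec Z V) l \<in> Sc V"
 using superalg[of V] unfolding superalgebra_def superring_hom_def ring_hom_def by auto

lemma hom_vf_smult:
 assumes "opn U" "b \<in> gr (sec Z U) k" "v \<in> hom_vf S0 Z U i"
 shows "b \<odot>\<^bsub>T U\<^esub> v \<in> hom_vf S0 Z U (k + i)"
 unfolding tangent_simps
proof (rule hom_vfI)
 let ?w = "vf_ext Z U (\<lambda>V a. res Z U V b \<otimes>\<^bsub>sec Z V\<^esub> v V a)"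
 show "vf_ext Z U ?w = ?w" by simp
 fix V assume V: "opn V" "V <= U"
 interpret R: superring "sec Z V" using sring V by blast
 note d = derivationD[OF hom_vf_deriv[OF assms(3) V] V(1)]
 let ?b = "res Z U V b"
 have bg: "?b \<in> gr (sec Z V) k" and b: "?b \<in> Sc V" using res_gr[OF assms(1) V assms(2)] R.gr.g_closed by auto
 have A: "?w V a = ?b \<otimes>\<^bsub>sec Z V\<^esub> v V a" if "a \<in> Sc V" for a
 using that V by simp
 show "derivation S0 (sec Z V) (k + i) (?w V)"
 proof (rule derivationI[OF V(1)])
 fix x y assume c: "x \<in> Sc V" "y \<in> Sc V"
 have cc: "v V x \<in> Sc V" "v V y \<in> Sc V" "tws V i x \<in> Sc V" "tws V (k + i) x \<in> Sc V" using c d by auto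
 show "?w V (x \<oplus>\<^bsub>sec Z V\<^esub> y) = ?w V x \<oplus>\<^bsub>sec Z V\<^esub> ?w V y"
 using c cc b by (simp only: A d(2) R.r_distr R.a_closed)
 have sw: "?b \<otimes>\<^bsub>sec Z V\<^esub> tws V i x = tws V (k + i) x \<otimes>\<^bsub>sec Z V\<^esub> ?b"
 using R.supercommute_tw[OF bg cc(3)] c bit_cases[of k] bit_cases[of i] by auto
 have "?w V (x \<otimes>\<^bsub>sec Z V\<^esub> y) = ?b \<otimes>\<^bsub>sec Z V\<^esub> v V x \<otimes>\<^bsub>sec Z V\<^esub> y \<oplus>\<^bsub>sec Z V\<^esub> (?b \<otimes>\<^bsub>sec Z V\<^esub> tws V i x) \<otimes>\<^bsub>sec Z V\<^esub> v V y"
 using c cc b by (simp add: A d(4) R.r_distr R.m_assoc)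
 then show "?w V (x \<otimes>\<^bsub>sec Z V\<^esub> y) = ?w V x \<otimes>\<^bsub>sec Z V\<^esub> y \<oplus>\<^bsub>sec Z V\<^esub> tws V (k + i) x \<otimes>\<^bsub>sec Z V\<^esub> ?w V y"
 unfolding sw using c cc b by (simp only: A R.m_assoc R.m_closed)
 next
 fix a j assume a: "a \<in> gr (sec Z V) j"
 show "?w V a \<in> gr (sec Z V) (k + i + j)"
 unfolding A[OF R.gr.g_closed[OF a]] add.assoc using R.mult_gr[OF bg d(3)[OF a]] .
 qed (use A d b base_closed[OF V(1)] in auto)
next
 fix V V' a assume V: "opn V" "opn V'" "V' <= V" "V <= U" "a \<in> Sc V"
 have "b \<in> Sc U"
 proof -
 interpret R: superring "sec Z U" using sring assms by blast
 show ?thesis using assms R.gr.g_closed by blast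
 qed
 then show "vf_ext Z U (\<lambda>V a. res Z U V b \<otimes>\<^bsub>sec Z V\<^esub> v V a) V' (res Z V V' a) =
 res Z V V' (vf_ext Z U (\<lambda>V a. res Z U V b \<otimes>\<^bsub>sec Z V\<^esub> v V a) V a)"
 using V res_closed hom_vf_res[OF assms(3)] assms(1)
 derivationD(1)[OF hom_vf_deriv[OF assms(3) V(1,4)] V(1)] res_res[of U V V' b]
 by (simp add: res_mult)
qed

end

lemma (in abelian_group) idem_zero: "x \<in> carrier G ==> x = x \<oplus> x ==> x = \<zero>"
 by (metis a_inv_closed a_assoc r_neg r_zero)

context sspace
begin

lemma hom_vf_apply:
 assumes "v \<in> hom_vf S0 Z U i" "opn V" "V <= U"
 shows "!!a. a \<in> Sc V ==> v V a \<in> Sc V"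
 and "!!a b. a \<in> Sc V ==> b \<in> Sc V ==> v V (a \<oplus>\<^bsub>sec Z V\<^esub> b) = v V a \<oplus>\<^bsub>sec Z V\<^esub> v V b"
 and "!!a j. a \<in> gr (sec Z V) j ==> v V a \<in> gr (sec Z V) (i + j)"
 and "!!a b. a \<in> Sc V ==> b \<in> Sc V ==>
 v V (a \<otimes>\<^bsub>sec Z V\<^esub> b) = v V a \<otimes>\<^bsub>sec Z V\<^esub> b \<oplus>\<^bsub>sec Z V\<^esub> tws V i a \<otimes>\<^bsub>sec Z V\<^esub> v V b"
 and "!!l. l \<in> carrier S0 ==> v V (base (sec Z V) l) = \<zero>\<^bsub>sec Z V\<^esub>"
 and "v V \<zero>\<^bsub>sec Z V\<^esub> = \<zero>\<^bsub>sec Z V\<^esub>"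
 using derivationD[OF hom_vf_deriv[OF assms] assms(2)] by blast+

lemma vf_add_apply: "opn V ==> V <= U ==> a \<in> Sc V ==> vf_add Z U v w V a = v V a \<oplus>\<^bsub>sec Z V\<^esub> w V a"
 by (simp add: vf_add_def)

lemma vf_add_ext [simp]: "vf_ext Z U (vf_add Z U v w) = vf_add Z U v w"
 by (simp add: vf_add_def)

lemma T_cases:
 assumes "u \<in> carrier (T U)"
 obtains v w where "v \<in> hom_vf S0 Z U 0" "w \<in> hom_vf S0 Z U 1" "u = vf_add Z U v w"
 using assms by (auto simp: carrier_T)

lemma T_ext: "u \<in> carrier (T U) ==> vf_ext Z U u = u"
 by (elim T_cases) simp

lemma T_apply:
 assumes "u \<in> carrier (T U)" "opn V" "V <= U"
 shows "!!a. a \<in> Sc V ==> u V a \<in> Sc V"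
 and "!!a b. a \<in> Sc V ==> b \<in> Sc V ==> u V (a \<oplus>\<^bsub>sec Z V\<^esub> b) = u V a \<oplus>\<^bsub>sec Z V\<^esub> u V b"
 and "!!l. l \<in> carrier S0 ==> u V (base (sec Z V) l) = \<zero>\<^bsub>sec Z V\<^esub>"
 and "u V \<zero>\<^bsub>sec Z V\<^esub> = \<zero>\<^bsub>sec Z V\<^esub>"
proof -
 obtain v w where vw: "v \<in> hom_vf S0 Z U 0" "w \<in> hom_vf S0 Z U 1" "u = vf_add Z U v w"
 using assms(1) by (rule T_cases)
 interpret R: superring "sec Z V" using sring assms by blast
 note d = hom_vf_apply[OF vw(1) assms(2,3)] and e = hom_vf_apply[OF vw(2) assms(2,3)]
 show "!!a. a \<in> Sc V ==> u V a \<in> Sc V"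
 "!!a b. a \<in> Sc V ==> b \<in> Sc V ==> u V (a \<oplus>\<^bsub>sec Z V\<^esub> b) = u V a \<oplus>\<^bsub>sec Z V\<^esub> u V b"
 "!!l. l \<in> carrier S0 ==> u V (base (sec Z V) l) = \<zero>\<^bsub>sec Z V\<^esub>"
 "u V \<zero>\<^bsub>sec Z V\<^esub> = \<zero>\<^bsub>sec Z V\<^esub>"
 using assms base_closed by (auto simp: vw(3) vf_add_apply d e R.a_ac)
qed

lemma T_res:
 assumes "u \<in> carrier (T U)" "opn V" "opn V'" "V' <= V" "V <= U" "a \<in> Sc V"
 shows "u V' (res Z V V' a) = res Z V V' (u V a)"
proof -
 obtain v w where vw: "v \<in> hom_vf S0 Z U 0" "w \<in> hom_vf S0 Z U 1" "u = vf_add Z U v w"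
 using assms(1) by (rule T_cases)
 have "V' <= U" using assms by auto
 then show ?thesis
 using assms res_closed hom_vf_res[OF vw(1)] hom_vf_res[OF vw(2)]
 hom_vf_apply(1)[OF vw(1) assms(2,5)] hom_vf_apply(1)[OF vw(2) assms(2,5)]
 by (simp add: vw(3) vf_add_apply res_add)
qed

lemma zero_hom_vf: "vf_ext Z U (\<lambda>V a. \<zero>\<^bsub>sec Z V\<^esub>) \<in> hom_vf S0 Z U i"
proof (rule hom_vfI)
 fix V assume V: "opn V" "V <= U"
 interpret R: superring "sec Z V" using sring V by blast
 show "derivation S0 (sec Z V) i (vf_ext Z U (\<lambda>V a. \<zero>\<^bsub>sec Z V\<^esub>) V)"
 using V base_closed R.gr.g_closed by (intro derivationI) auto
qed (auto simp: res_closed res_zero)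

lemma hom_vf_in_T: "v \<in> hom_vf S0 Z U i ==> v \<in> carrier (T U)"
proof -
 assume v: "v \<in> hom_vf S0 Z U i"
 let ?z = "vf_ext Z U (\<lambda>V a. \<zero>\<^bsub>sec Z V\<^esub>)"
 have "v = vf_add Z U v ?z" "v = vf_add Z U ?z v"
 proof -
 have "v V a = vf_add Z U v ?z V a & v V a = vf_add Z U ?z v V a" if V: "opn V" "V <= U" "a \<in> Sc V" for V a
 proof -
 interpret R: superring "sec Z V" using sring V by blast
 show ?thesis using V hom_vf_apply(1)[OF v V] by (simp add: vf_add_apply)
 qed
 note e = this
 show "v = vf_add Z U v ?z"
 by (rule vf_eqI[OF hom_vf_ext[OF v] vf_add_ext]) (rule e[THEN conjunct1])
 show "v = vf_add Z U ?z v"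
 by (rule vf_eqI[OF hom_vf_ext[OF v] vf_add_ext]) (rule e[THEN conjunct2])
 qed
 then show ?thesis using v zero_hom_vf[of U] bit_cases[of i] unfolding carrier_T by blast
qed

lemma T_add_closed:
 assumes U: "opn U" and "u \<in> carrier (T U)" "u' \<in> carrier (T U)"
 shows "vf_add Z U u u' \<in> carrier (T U)"
proof -
 obtain v w where vw: "v \<in> hom_vf S0 Z U 0" "w \<in> hom_vf S0 Z U 1" "u = vf_add Z U v w"
 using assms(2) by (rule T_cases)
 obtain v' w' where vw': "v' \<in> hom_vf S0 Z U 0" "w' \<in> hom_vf S0 Z U 1" "u' = vf_add Z U v' w'"
 using assms(3) by (rule T_cases)
 have "vf_add Z U u u' = vf_add Z U (vf_add Z U v v') (vf_add Z U w w')"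
 proof (rule vf_eqI)
 fix V a assume V: "opn V" "V <= U" "a \<in> Sc V"
 interpret R: superring "sec Z V" using sring V by blast
 show "vf_add Z U u u' V a = vf_add Z U (vf_add Z U v v') (vf_add Z U w w') V a"
 using V hom_vf_apply(1)[OF vw(1) V] hom_vf_apply(1)[OF vw(2) V] hom_vf_apply(1)[OF vw'(1) V]
 hom_vf_apply(1)[OF vw'(2) V] by (simp add: vf_add_apply vw vw' R.a_ac)
 qed auto
 then show ?thesis using hom_vf_add[OF vw(1) vw'(1)] hom_vf_add[OF vw(2) vw'(2)] unfolding carrier_T by blast
qed

lemma neg_hom_vf:
 assumes "opn U" "v \<in> hom_vf S0 Z U i"
 shows "\<exists>w\<in>hom_vf S0 Z U i. vf_add Z U w v = \<zero>\<^bsub>T U\<^esub>"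
proof -
 interpret U: superring "sec Z U" using sring assms by blast
 let ?e = "\<ominus>\<^bsub>sec Z U\<^esub> \<one>\<^bsub>sec Z U\<^esub>"
 have "?e \<odot>\<^bsub>T U\<^esub> v \<in> hom_vf S0 Z U (0 + i)"
 by (rule hom_vf_smult[OF assms(1) U.gr.g_neg[OF U.one_even] assms(2)])
 moreover have "vf_add Z U (?e \<odot>\<^bsub>T U\<^esub> v) v = \<zero>\<^bsub>T U\<^esub>"
 proof (rule vf_eqI)
 fix V a assume V: "opn V" "V <= U" "a \<in> Sc V"
 interpret R: superring "sec Z V" using sring V by blast
 show "vf_add Z U (?e \<odot>\<^bsub>T U\<^esub> v) v V a = \<zero>\<^bsub>T U\<^esub> V a"
 using V assms hom_vf_apply(1)[OF assms(2) V]
 by (simp add: vf_add_apply res_neg res_one R.l_minus R.l_neg)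
 qed auto
 ultimately show ?thesis unfolding add_0 by blast
qed

lemma T_abelian_group: "opn U ==> abelian_group (T U)"
proof (rule abelian_groupI; unfold tangent_simps)
 assume U: "opn U"
 let ?z = "vf_ext Z U (\<lambda>V a. \<zero>\<^bsub>sec Z V\<^esub>)"
 show "?z \<in> carrier (T U)" using zero_hom_vf hom_vf_in_T by blast
 fix x y assume x: "x \<in> carrier (T U)"
 have g: "superring (sec Z V)" if "opn V" for V using sring that .
 show "vf_add Z U ?z x = x"
 proof (rule vf_eqI)
 fix V a assume V: "opn V" "V <= U" "a \<in> Sc V"
 interpret R: superring "sec Z V" using g V by blast
 show "vf_add Z U ?z x V a = x V a" using V T_apply(1)[OF x V] by (simp add: vf_add_apply)
 qed (simp_all add: T_ext[OF x])
 show "\<exists>y\<in>carrier (T U). vf_add Z U y x = ?z"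
 proof -
 obtain v w where vw: "v \<in> hom_vf S0 Z U 0" "w \<in> hom_vf S0 Z U 1" "x = vf_add Z U v w"
 using x by (rule T_cases)
 obtain v' where v': "v' \<in> hom_vf S0 Z U 0" "vf_add Z U v' v = ?z" using neg_hom_vf[OF U vw(1)] by auto
 obtain w' where w': "w' \<in> hom_vf S0 Z U 1" "vf_add Z U w' w = ?z" using neg_hom_vf[OF U vw(2)] by auto
 have "vf_add Z U (vf_add Z U v' w') x = ?z"
 proof (rule vf_eqI)
 fix V a assume V: "opn V" "V <= U" "a \<in> Sc V"
 interpret R: superring "sec Z V" using g V by blast
 have c: "v V a \<in> Sc V" "w V a \<in> Sc V" "v' V a \<in> Sc V" "w' V a \<in> Sc V"
 using V vw v' w' hom_vf_apply(1) by blast+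
 have "vf_add Z U v' v V a = ?z V a" "vf_add Z U w' w V a = ?z V a" using v' w' by auto
 then have z: "v' V a \<oplus>\<^bsub>sec Z V\<^esub> v V a = \<zero>\<^bsub>sec Z V\<^esub>" "w' V a \<oplus>\<^bsub>sec Z V\<^esub> w V a = \<zero>\<^bsub>sec Z V\<^esub>"
 using V by (simp_all add: vf_add_apply)
 have "vf_add Z U (vf_add Z U v' w') x V a =
 (v' V a \<oplus>\<^bsub>sec Z V\<^esub> v V a) \<oplus>\<^bsub>sec Z V\<^esub> (w' V a \<oplus>\<^bsub>sec Z V\<^esub> w V a)"
 using V c by (simp add: vf_add_apply vw(3) R.a_ac)
 then show "vf_add Z U (vf_add Z U v' w') x V a = ?z V a" using V z by simp
 qed auto
 moreover have "vf_add Z U v' w' \<in> carrier (T U)"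
 using v' w' by (auto simp: carrier_T)
 ultimately show ?thesis by blast
 qed
 assume y: "y \<in> carrier (T U)"
 show "vf_add Z U x y \<in> carrier (T U)" using T_add_closed U x y by blast
 show "vf_add Z U x y = vf_add Z U y x"
 proof (rule vf_eqI)
 fix V a assume V: "opn V" "V <= U" "a \<in> Sc V"
 interpret R: superring "sec Z V" using g V by blast
 show "vf_add Z U x y V a = vf_add Z U y x V a"
 using V T_apply(1)[OF x V] T_apply(1)[OF y V] by (simp add: vf_add_apply R.a_comm)
 qed auto
 fix z assume zz: "z \<in> carrier (T U)"
 show "vf_add Z U (vf_add Z U x y) z = vf_add Z U x (vf_add Z U y z)"
 proof (rule vf_eqI)
 fix V a assume V: "opn V" "V <= U" "a \<in> Sc V"
 interpret R: superring "sec Z V" using g V by blast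
 show "vf_add Z U (vf_add Z U x y) z V a = vf_add Z U x (vf_add Z U y z) V a"
 using V T_apply(1)[OF x V] T_apply(1)[OF y V] T_apply(1)[OF zz V] by (simp add: vf_add_apply R.a_assoc)
 qed auto
qed

lemma hom_vf_disjoint:
 assumes "v \<in> hom_vf S0 Z U 0" "v \<in> hom_vf S0 Z U 1"
 shows "v = \<zero>\<^bsub>T U\<^esub>"
proof (rule vf_eqI)
 fix V a assume V: "opn V" "V <= U" "a \<in> Sc V"
 interpret R: superring "sec Z V" using sring V by blast
 note d = hom_vf_apply[OF assms(1) V(1,2)] and e = hom_vf_apply[OF assms(2) V(1,2)]
 from V(3) have "v V a = \<zero>\<^bsub>sec Z V\<^esub>"
 proof (induction rule: R.gr.graded_induct)
 case (hom j a)
 have "v V a \<in> gr (sec Z V) j" using d(3)[OF hom] unfolding add_0 .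
 moreover have "v V a \<in> gr (sec Z V) (j + 1)" using e(3)[OF hom] unfolding add.commute[of j] .
 ultimately show ?case by (rule R.gr.g_disjoint)
 qed (simp add: d(2))
 then show "v V a = \<zero>\<^bsub>T U\<^esub> V a" using V by simp
qed (use assms hom_vf_ext in auto)

lemma T_graded: "opn U ==> graded_group (T U) (hom_vf S0 Z U)"
proof (rule graded_groupI)
 assume U: "opn U"
 interpret abelian_group "T U" using T_abelian_group U .
 show "abelian_group (T U)" by unfold_locales
 fix i
 show "subgroup (hom_vf S0 Z U i) (add_monoid (T U))"
 proof (rule add.subgroupI)
 show "hom_vf S0 Z U i <= carrier (T U)" using hom_vf_in_T by blast
 show "hom_vf S0 Z U i ~= {}" using zero_hom_vf by blast
 fix a assume a: "a \<in> hom_vf S0 Z U i"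
 obtain w where w: "w \<in> hom_vf S0 Z U i" "vf_add Z U w a = \<zero>\<^bsub>T U\<^esub>" using neg_hom_vf[OF U a] by auto
 then have "\<ominus>\<^bsub>T U\<^esub> a = w" using a hom_vf_in_T by (intro minus_equality) (simp_all only: tangent_simps)
 then show "\<ominus>\<^bsub>T U\<^esub> a \<in> hom_vf S0 Z U i" using w by simp
 fix b assume "b \<in> hom_vf S0 Z U i"
 then show "a \<oplus>\<^bsub>T U\<^esub> b \<in> hom_vf S0 Z U i" using a hom_vf_add by simp
 qed
next
 fix x assume "x \<in> carrier (T U)"
 then show "EX a b. a \<in> hom_vf S0 Z U 0 & b \<in> hom_vf S0 Z U 1 & x = a \<oplus>\<^bsub>T U\<^esub> b"
 unfolding carrier_T tangent_simps by blast
qed (rule hom_vf_disjoint)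

abbreviation Tpart :: "'z set => bit => ('z, 'a) vf => ('z, 'a) vf" where
 "Tpart U i v \<equiv> hpart (T U) (hom_vf S0 Z U) i v"

lemma Tpart_in: "opn U ==> v \<in> carrier (T U) ==> Tpart U i v \<in> hom_vf S0 Z U i"
 using graded_group.part_in[OF T_graded] .

lemma Tpart_apply: "opn U ==> v \<in> carrier (T U) ==> opn V ==> V <= U ==> a \<in> Sc V ==>
 v V a = Tpart U 0 v V a \<oplus>\<^bsub>sec Z V\<^esub> Tpart U 1 v V a"
 using graded_group.part_sum01[OF T_graded, of U v] vf_add_apply[of V U a "Tpart U 0 v" "Tpart U 1 v"]
 by simp

lemma hom_vf_restrict: "v \<in> hom_vf S0 Z U i ==> V <= U ==> vf_ext Z V v \<in> hom_vf S0 Z V i"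
proof (rule hom_vfI)
 assume v: "v \<in> hom_vf S0 Z U i" "V <= U"
 fix V' assume V': "opn V'" "V' <= V"
 then have d: "derivation S0 (sec Z V') i (v V')" using hom_vf_deriv[OF v(1)] v(2) by blast
 interpret R: superring "sec Z V'" using sring V' by blast
 note d = derivationD[OF d V'(1)]
 show "derivation S0 (sec Z V') i (vf_ext Z V v V')"
 using V' d base_closed[OF V'(1)] R.gr.g_closed by (intro derivationI) auto
next
 assume v: "v \<in> hom_vf S0 Z U i" "V <= U"
 fix V1 V2 a assume V: "opn V1" "opn V2" "V2 <= V1" "V1 <= V" "a \<in> Sc V1"
 moreover have "V2 <= V" using V by auto
 ultimately show "vf_ext Z V v V2 (res Z V1 V2 a) = res Z V1 V2 (vf_ext Z V v V1 a)"
 using hom_vf_res[OF v(1) V(1,2,3) _ V(5)] v(2) res_closed[OF V(1,2,3,5)] by auto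
qed simp

lemma vf_add_restrict: "V <= U ==> vf_ext Z V (vf_add Z U v w) = vf_add Z V (vf_ext Z V v) (vf_ext Z V w)"
 unfolding vf_add_def by (simp, rule vf_ext_cong) simp

lemma T_restrict: "v \<in> carrier (T U) ==> V <= U ==> vf_ext Z V v \<in> carrier (T V)"
proof (elim T_cases)
 fix u w assume V: "V <= U" and u: "u \<in> hom_vf S0 Z U 0" "w \<in> hom_vf S0 Z U 1" "v = vf_add Z U u w"
 show "vf_ext Z V v \<in> carrier (T V)"
 unfolding u(3) vf_add_restrict[OF V] carrier_T using hom_vf_restrict[OF _ V] u by blast
qed

lemma Tpart_restrict:
 assumes "opn U" "opn V" "V <= U" "v \<in> carrier (T U)"
 shows "Tpart V i (vf_ext Z V v) = vf_ext Z V (Tpart U i v)"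
proof (rule graded_group.part_eqI[OF T_graded[OF assms(2)]])
 interpret g: graded_group "T U" "hom_vf S0 Z U" using T_graded assms by blast
 have p: "vf_ext Z V (Tpart U k v) \<in> hom_vf S0 Z V k" for k
 using hom_vf_restrict[OF Tpart_in[OF assms(1,4)] assms(3)] .
 show "vf_ext Z V (Tpart U i v) \<in> hom_vf S0 Z V i" "vf_ext Z V (Tpart U (i + 1) v) \<in> hom_vf S0 Z V (i + 1)"
 by (rule p)+
 show "vf_ext Z V v = vf_ext Z V (Tpart U i v) \<oplus>\<^bsub>T V\<^esub> vf_ext Z V (Tpart U (i + 1) v)"
 using g.part_sum[OF assms(4), of i] vf_add_restrict[OF assms(3), of "Tpart U i v" "Tpart U (i + 1) v"]
 by (simp only: tangent_simps)
qed

lemma T_smult_closed: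
 assumes U: "opn U" and b: "b \<in> Sc U" and v: "v \<in> carrier (T U)"
 shows "b \<odot>\<^bsub>T U\<^esub> v \<in> carrier (T U)"
proof -
 interpret U: superring "sec Z U" using sring U .
 interpret g: graded_group "T U" "hom_vf S0 Z U" using T_graded U by blast
 have 1: "x \<odot>\<^bsub>T U\<^esub> v \<in> carrier (T U)" if x: "x \<in> gr (sec Z U) k" for x k
 proof -
 have "x \<odot>\<^bsub>T U\<^esub> v = (x \<odot>\<^bsub>T U\<^esub> g.prt 0 v) \<oplus>\<^bsub>T U\<^esub> (x \<odot>\<^bsub>T U\<^esub> g.prt 1 v)"
 unfolding tangent_simps
 proof (rule vf_eqI)
 fix V a assume V: "opn V" "V <= U" "a \<in> Sc V"
 interpret R: superring "sec Z V" using sring V by blast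
 have c: "g.prt 0 v V a \<in> Sc V" "g.prt 1 v V a \<in> Sc V" "res Z U V x \<in> Sc V"
 using hom_vf_apply(1)[OF Tpart_in[OF U v] V] res_closed U.gr.g_closed[OF x] U V by auto
 show "vf_ext Z U (\<lambda>V a. res Z U V x \<otimes>\<^bsub>sec Z V\<^esub> v V a) V a =
 vf_add Z U (vf_ext Z U (\<lambda>V a. res Z U V x \<otimes>\<^bsub>sec Z V\<^esub> g.prt 0 v V a))
 (vf_ext Z U (\<lambda>V a. res Z U V x \<otimes>\<^bsub>sec Z V\<^esub> g.prt 1 v V a)) V a"
 using V c Tpart_apply[OF U v V] by (simp add: vf_add_apply R.r_distr)
 qed auto
 moreover have "x \<odot>\<^bsub>T U\<^esub> g.prt i v \<in> carrier (T U)" for i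
 using hom_vf_smult[OF U x Tpart_in[OF U v]] hom_vf_in_T by blast
 ultimately show ?thesis by (simp only: g.a_closed)
 qed
 have "b \<odot>\<^bsub>T U\<^esub> v = (U.gr.prt 0 b \<odot>\<^bsub>T U\<^esub> v) \<oplus>\<^bsub>T U\<^esub> (U.gr.prt 1 b \<odot>\<^bsub>T U\<^esub> v)"
 unfolding tangent_simps
 proof (rule vf_eqI)
 fix V a assume V: "opn V" "V <= U" "a \<in> Sc V"
 interpret R: superring "sec Z V" using sring V by blast
 have "res Z U V b = res Z U V (U.gr.prt 0 b) \<oplus>\<^bsub>sec Z V\<^esub> res Z U V (U.gr.prt 1 b)"
 using U.gr.part_sum01[OF b] res_add[OF U V(1,2), of "U.gr.prt 0 b" "U.gr.prt 1 b"] b by simp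
 then show "vf_ext Z U (\<lambda>V a. res Z U V b \<otimes>\<^bsub>sec Z V\<^esub> v V a) V a =
 vf_add Z U (vf_ext Z U (\<lambda>V a. res Z U V (U.gr.prt 0 b) \<otimes>\<^bsub>sec Z V\<^esub> v V a))
 (vf_ext Z U (\<lambda>V a. res Z U V (U.gr.prt 1 b) \<otimes>\<^bsub>sec Z V\<^esub> v V a)) V a"
 using V b U res_closed T_apply(1)[OF v V] by (simp add: vf_add_apply R.l_distr)
 qed auto
 then show ?thesis using 1[OF U.gr.part_in[OF b]] by (simp only: g.a_closed)
qed

lemma bracket_apply: "opn V ==> V <= U ==> a \<in> Sc V ==>
 vf_bracket Z U i j v w V a = v V (w V a) \<ominus>\<^bsub>sec Z V\<^esub> ksgn (sec Z V) i j (w V (v V a))"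
 by (simp add: vf_bracket_def)

lemma hom_vf_tw:
 assumes "v \<in> hom_vf S0 Z U i" "opn V" "V <= U" "a \<in> Sc V"
 shows "tws V k (v V a) = ksgn (sec Z V) k i (v V (tws V k a))"
proof -
 interpret R: superring "sec Z V" using sring assms by blast
 note d = hom_vf_apply[OF assms(1-3)]
 have neg: "v V (\<ominus>\<^bsub>sec Z V\<^esub> x) = \<ominus>\<^bsub>sec Z V\<^esub> v V x" if "x \<in> Sc V" for x
 using that d(1,6) by (intro R.neg_unique) (simp_all flip: d(2) add: R.r_neg)
 from assms(4) show ?thesis
 proof (induction rule: R.gr.graded_induct)
 case (hom j a)
 have "a \<in> Sc V" using hom R.gr.g_closed by blast
 then show ?case using d(1) R.gr.tw_of[OF hom, of k] R.gr.tw_of[OF d(3)[OF hom], of k]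
 bit_cases[of k] bit_cases[of i] bit_cases[of j] by (auto simp: ksgn_def neg)
 next
 case (add x y)
 then show ?case using d(1) by (simp add: d(2) R.gr.tw_add) (simp add: ksgn_def R.minus_add)
 qed
qed

lemma bracket_hom_vf:
 assumes v: "v \<in> hom_vf S0 Z U i" and w: "w \<in> hom_vf S0 Z U j"
 shows "vf_bracket Z U i j v w \<in> hom_vf S0 Z U (i + j)"
proof (rule hom_vfI)
 show "vf_ext Z U (vf_bracket Z U i j v w) = vf_bracket Z U i j v w" by (simp add: vf_bracket_def)
 fix V assume V: "opn V" "V <= U"
 interpret R: superring "sec Z V" using sring V by blast
 note d = hom_vf_apply[OF v V] and e = hom_vf_apply[OF w V]
 let ?b = "vf_bracket Z U i j v w V"
 have A: "?b a = v V (w V a) \<ominus>\<^bsub>sec Z V\<^esub> ksgn (sec Z V) i j (w V (v V a))" if "a \<in> Sc V" for a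
 using bracket_apply[OF V that] .
 show "derivation S0 (sec Z V) (i + j) ?b"
 proof (rule derivationI[OF V(1)])
 fix a b assume c: "a \<in> Sc V" "b \<in> Sc V"
 let ?da = "v V a" and ?ea = "w V a" and ?db = "v V b" and ?eb = "w V b"
 have cc: "?da \<in> Sc V" "?ea \<in> Sc V" "?db \<in> Sc V" "?eb \<in> Sc V" using c d e by auto
 have ccc: "v V ?ea \<in> Sc V" "w V ?da \<in> Sc V" "v V ?eb \<in> Sc V" "w V ?db \<in> Sc V"
 "v V (tws V j a) \<in> Sc V" "w V (tws V i a) \<in> Sc V" "tws V i (tws V j a) \<in> Sc V"
 "tws V i ?ea \<in> Sc V" "tws V j ?da \<in> Sc V" "tws V j (tws V i a) \<in> Sc V" "tws V j a \<in> Sc V" "tws V i a \<in> Sc V"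
 "tws V (i + j) a \<in> Sc V" using c cc d e by auto
 show "?b (a \<oplus>\<^bsub>sec Z V\<^esub> b) = ?b a \<oplus>\<^bsub>sec Z V\<^esub> ?b b"
 using c cc ccc by (simp add: A d(2) e(2) ksgn_def a_minus_def R.minus_add R.a_ac)
 have t: "tws V i (tws V j a) = tws V (i + j) a" "tws V j (tws V i a) = tws V (i + j) a"
 using bit_cases[of i] bit_cases[of j] c by auto
 have 1: "v V (w V (a \<otimes>\<^bsub>sec Z V\<^esub> b)) = (v V ?ea \<otimes>\<^bsub>sec Z V\<^esub> b \<oplus>\<^bsub>sec Z V\<^esub> tws V i ?ea \<otimes>\<^bsub>sec Z V\<^esub> ?db) \<oplus>\<^bsub>sec Z V\<^esub>
 (v V (tws V j a) \<otimes>\<^bsub>sec Z V\<^esub> ?eb \<oplus>\<^bsub>sec Z V\<^esub> tws V (i + j) a \<otimes>\<^bsub>sec Z V\<^esub> v V ?eb)"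
 using c cc ccc by (simp add: d(2,4) e(4) t)
 have 2: "w V (v V (a \<otimes>\<^bsub>sec Z V\<^esub> b)) = (w V ?da \<otimes>\<^bsub>sec Z V\<^esub> b \<oplus>\<^bsub>sec Z V\<^esub> tws V j ?da \<otimes>\<^bsub>sec Z V\<^esub> ?eb) \<oplus>\<^bsub>sec Z V\<^esub>
 (w V (tws V i a) \<otimes>\<^bsub>sec Z V\<^esub> ?db \<oplus>\<^bsub>sec Z V\<^esub> tws V (i + j) a \<otimes>\<^bsub>sec Z V\<^esub> w V ?db)"
 using c cc ccc by (simp add: e(2,4) d(4) t)
 have 3: "tws V i ?ea = ksgn (sec Z V) i j (w V (tws V i a))" "v V (tws V j a) = ksgn (sec Z V) i j (tws V j ?da)"
 using hom_vf_tw[OF w V c(1), of i] hom_vf_tw[OF v V c(1), of j] ccc by (auto simp: ksgn_def R.minus_minus)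
 show "?b (a \<otimes>\<^bsub>sec Z V\<^esub> b) = ?b a \<otimes>\<^bsub>sec Z V\<^esub> b \<oplus>\<^bsub>sec Z V\<^esub> tws V (i + j) a \<otimes>\<^bsub>sec Z V\<^esub> ?b b"
 proof (cases "i = 1 & j = 1")
 case True
 then have k: "ksgn (sec Z V) i j x = \<ominus>\<^bsub>sec Z V\<^esub> x" for x by (simp add: ksgn_def)
 have "?b (a \<otimes>\<^bsub>sec Z V\<^esub> b) = v V (w V (a \<otimes>\<^bsub>sec Z V\<^esub> b)) \<ominus>\<^bsub>sec Z V\<^esub> \<ominus>\<^bsub>sec Z V\<^esub> w V (v V (a \<otimes>\<^bsub>sec Z V\<^esub> b))"
 using c by (simp add: A k)
 also have "\<dots> = (v V ?ea \<ominus>\<^bsub>sec Z V\<^esub> \<ominus>\<^bsub>sec Z V\<^esub> w V ?da) \<otimes>\<^bsub>sec Z V\<^esub> b \<oplus>\<^bsub>sec Z V\<^esub>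
 tws V (i + j) a \<otimes>\<^bsub>sec Z V\<^esub> (v V ?eb \<ominus>\<^bsub>sec Z V\<^esub> \<ominus>\<^bsub>sec Z V\<^esub> w V ?db)"
 unfolding 1 2 3 k using c cc ccc by algebra
 finally show ?thesis using c by (simp only: A k)
 next
 case False
 then have k: "ksgn (sec Z V) i j x = x" for x by (auto simp: ksgn_def)
 have "?b (a \<otimes>\<^bsub>sec Z V\<^esub> b) = v V (w V (a \<otimes>\<^bsub>sec Z V\<^esub> b)) \<ominus>\<^bsub>sec Z V\<^esub> w V (v V (a \<otimes>\<^bsub>sec Z V\<^esub> b))"
 using c by (simp add: A k)
 also have "\<dots> = (v V ?ea \<ominus>\<^bsub>sec Z V\<^esub> w V ?da) \<otimes>\<^bsub>sec Z V\<^esub> b \<oplus>\<^bsub>sec Z V\<^esub>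
 tws V (i + j) a \<otimes>\<^bsub>sec Z V\<^esub> (v V ?eb \<ominus>\<^bsub>sec Z V\<^esub> w V ?db)"
 unfolding 1 2 3 k using c cc ccc by algebra
 finally show ?thesis using c by (simp only: A k)
 qed
 next
 fix a k assume a: "a \<in> gr (sec Z V) k"
 have "v V (w V a) \<in> gr (sec Z V) (i + (j + k))" "w V (v V a) \<in> gr (sec Z V) (j + (i + k))"
 using d(3)[OF e(3)[OF a]] e(3)[OF d(3)[OF a]] .
 then have "v V (w V a) \<in> gr (sec Z V) (i + j + k)" "w V (v V a) \<in> gr (sec Z V) (i + j + k)"
 by (simp_all only: add_ac)
 then show "?b a \<in> gr (sec Z V) (i + j + k)"
 unfolding A[OF R.gr.g_closed[OF a]] by (intro R.gr.g_minus R.gr.g_ksgn)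
 qed (use A d e base_closed[OF V(1)] in \<open>auto simp: ksgn_def a_minus_def\<close>)
next
 fix V V' a assume V: "opn V" "opn V'" "V' <= V" "V <= U" "a \<in> Sc V"
 then have "V' <= U" by auto
 interpret R: superring "sec Z V" using sring V by blast
 have c: "v V a \<in> Sc V" "w V a \<in> Sc V" "v V (w V a) \<in> Sc V" "w V (v V a) \<in> Sc V"
 using hom_vf_apply(1)[OF v V(1,4)] hom_vf_apply(1)[OF w V(1,4)] V by auto
 have "res Z V V' (v V (w V a) \<ominus>\<^bsub>sec Z V\<^esub> ksgn (sec Z V) i j (w V (v V a))) =
 res Z V V' (v V (w V a)) \<ominus>\<^bsub>sec Z V'\<^esub> ksgn (sec Z V') i j (res Z V V' (w V (v V a)))"
 using V c by (simp add: a_minus_def ksgn_def res_add res_neg)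
 then show "vf_bracket Z U i j v w V' (res Z V V' a) = res Z V V' (vf_bracket Z U i j v w V a)"
 using V \<open>V' <= U\<close> c res_closed hom_vf_res[OF v V(1-4)] hom_vf_res[OF w V(1-4)]
 by (simp add: bracket_apply)
qed

end

subsection \<open>D-modules\<close>

locale dmodl = sspace S0 Z for S0 :: "('l, complex) superalg" and Z :: "('z, 'a, 'l) superspace" +
 fixes F :: "('z, 'a, 'm) dmod"
 assumes dmodule: "dmodule S0 Z F"
begin

abbreviation Mc :: "'z set => 'm set" where "Mc U \<equiv> carrier (msec F U)"

lemma omod: "omodule Z F"
 using dmodule unfolding dmodule_def by blast

lemma msheaf: "set_sheaf (space Z) Mc (mres F)"
 using omod[unfolded omodule_def, THEN conjunct2, THEN conjunct2] .

lemma smod: "opn U ==> supmod (sec Z U) (msec F U)"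
 using omod[unfolded omodule_def, THEN conjunct1] superring.supercomm[OF sring] by (intro supmodI) auto

lemmas mres_closed = set_sheafD(1)[OF msheaf] and mres_id = set_sheafD(2)[OF msheaf]
 and mres_mres = set_sheafD(3)[OF msheaf]

lemma mresD:
 assumes "opn U" "opn V" "V <= U"
 shows mres_add: "m \<in> Mc U ==> n \<in> Mc U ==>
 mres F U V (m \<oplus>\<^bsub>msec F U\<^esub> n) = mres F U V m \<oplus>\<^bsub>msec F V\<^esub> mres F U V n"
 and mres_smult: "a \<in> Sc U ==> m \<in> Mc U ==>
 mres F U V (a \<odot>\<^bsub>msec F U\<^esub> m) = res Z U V a \<odot>\<^bsub>msec F V\<^esub> mres F U V m"
 and mres_gr: "m \<in> mgr (msec F U) i ==> mres F U V m \<in> mgr (msec F V) i"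
proof -
 have "(\<forall>m\<in>Mc U. \<forall>n\<in>Mc U. mres F U V (m \<oplus>\<^bsub>msec F U\<^esub> n) = mres F U V m \<oplus>\<^bsub>msec F V\<^esub> mres F U V n) &
 (\<forall>a\<in>Sc U. \<forall>m\<in>Mc U. mres F U V (a \<odot>\<^bsub>msec F U\<^esub> m) = res Z U V a \<odot>\<^bsub>msec F V\<^esub> mres F U V m) &
 (ALL i. mres F U V ` mgr (msec F U) i <= mgr (msec F V) i)"
 by (rule omod[unfolded omodule_def, THEN conjunct2, THEN conjunct1, THEN spec, THEN spec, THEN mp])
 (intro conjI assms)
 then show "m \<in> Mc U ==> n \<in> Mc U ==>
 mres F U V (m \<oplus>\<^bsub>msec F U\<^esub> n) = mres F U V m \<oplus>\<^bsub>msec F V\<^esub> mres F U V n"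
 and "a \<in> Sc U ==> m \<in> Mc U ==>
 mres F U V (a \<odot>\<^bsub>msec F U\<^esub> m) = res Z U V a \<odot>\<^bsub>msec F V\<^esub> mres F U V m"
 and "m \<in> mgr (msec F U) i ==> mres F U V m \<in> mgr (msec F V) i"
 by (simp_all add: image_subset_iff)
qed

lemma mres_zero: "opn U ==> opn V ==> V <= U ==> mres F U V \<zero>\<^bsub>msec F U\<^esub> = \<zero>\<^bsub>msec F V\<^esub>"
proof -
 assume U: "opn U" "opn V" "V <= U"
 interpret U: supmod "sec Z U" "msec F U" using smod U by blast
 interpret V: supmod "sec Z V" "msec F V" using smod U by blast
 show ?thesis using mres_add[OF U U.M.zero_closed U.M.zero_closed] mres_closed[OF U U.M.zero_closed] by simp
qed

lemma mres_neg: "opn U ==> opn V ==> V <= U ==> m \<in> Mc U ==>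
 mres F U V (\<ominus>\<^bsub>msec F U\<^esub> m) = \<ominus>\<^bsub>msec F V\<^esub> mres F U V m"
proof -
 assume U: "opn U" "opn V" "V <= U" and m: "m \<in> Mc U"
 interpret U: supmod "sec Z U" "msec F U" using smod U by blast
 interpret V: supmod "sec Z V" "msec F V" using smod U by blast
 show ?thesis
 using U m mres_closed mres_zero by (intro V.M.neg_unique) (simp_all flip: mres_add add: U.M.r_neg)
qed

lemma mres_part: "opn U ==> opn V ==> V <= U ==> m \<in> Mc U ==>
 mres F U V (mpart (msec F U) i m) = mpart (msec F V) i (mres F U V m)"
proof -
 assume U: "opn U" "opn V" "V <= U" and m: "m \<in> Mc U"
 interpret U: supmod "sec Z U" "msec F U" using smod U by blast
 interpret V: supmod "sec Z V" "msec F V" using smod U by blast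
 have "mres F U V m = mres F U V (U.M.prt i m) \<oplus>\<^bsub>msec F V\<^esub> mres F U V (U.M.prt (i + 1) m)"
 using mres_add[OF U, of "U.M.prt i m" "U.M.prt (i + 1) m"] U.M.part_sum[OF m, of i] m
 by (simp only: U.M.part_closed)
 then show ?thesis unfolding mpart_eq_hpart
 using mres_gr[OF U U.M.part_in[OF m]] by (intro V.M.part_eqI[symmetric])
qed

lemma connD:
 assumes U: "opn U"
 shows conn_closed: "!!v m. v \<in> carrier (T U) ==> m \<in> Mc U ==> conn F U v m \<in> Mc U"
 and conn_add: "!!v m n. v \<in> carrier (T U) ==> m \<in> Mc U ==> n \<in> Mc U ==>
 conn F U v (m \<oplus>\<^bsub>msec F U\<^esub> n) = conn F U v m \<oplus>\<^bsub>msec F U\<^esub> conn F U v n"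
 and conn_vadd: "!!v w m. v \<in> carrier (T U) ==> w \<in> carrier (T U) ==> m \<in> Mc U ==>
 conn F U (v \<oplus>\<^bsub>T U\<^esub> w) m = conn F U v m \<oplus>\<^bsub>msec F U\<^esub> conn F U w m"
 and conn_smult: "!!a v m. a \<in> Sc U ==> v \<in> carrier (T U) ==> m \<in> Mc U ==>
 conn F U (a \<odot>\<^bsub>T U\<^esub> v) m = a \<odot>\<^bsub>msec F U\<^esub> conn F U v m"
 and conn_gr: "!!i j v m. v \<in> hom_vf S0 Z U i ==> m \<in> mgr (msec F U) j ==> conn F U v m \<in> mgr (msec F U) (i + j)"
 and conn_leibniz0: "!!i j v a m. v \<in> hom_vf S0 Z U i ==> a \<in> gr (sec Z U) j ==> m \<in> Mc U ==>
 conn F U v (a \<odot>\<^bsub>msec F U\<^esub> m) =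
 v U a \<odot>\<^bsub>msec F U\<^esub> m \<oplus>\<^bsub>msec F U\<^esub> ksgn (msec F U) i j (a \<odot>\<^bsub>msec F U\<^esub> conn F U v m)"
 and conn_bracket: "!!i j v w m. v \<in> hom_vf S0 Z U i ==> w \<in> hom_vf S0 Z U j ==> m \<in> Mc U ==>
 conn F U (vf_bracket Z U i j v w) m = conn F U v (conn F U w m) \<ominus>\<^bsub>msec F U\<^esub>
 ksgn (msec F U) i j (conn F U w (conn F U v m))"
 and conn_res: "!!V v m. opn V ==> V <= U ==> v \<in> carrier (T U) ==> m \<in> Mc U ==>
 mres F U V (conn F U v m) = conn F V (vf_ext Z V v) (mres F U V m)"
proof -
 note d = dmodule[unfolded dmodule_def Let_def, THEN conjunct2, rule_format, OF U, unfolded tangent_simps(1,5)]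
 show "!!v m. v \<in> carrier (T U) ==> m \<in> Mc U ==> conn F U v m \<in> Mc U"
 using d[THEN conjunct1] by blast
 show "!!v m n. v \<in> carrier (T U) ==> m \<in> Mc U ==> n \<in> Mc U ==>
 conn F U v (m \<oplus>\<^bsub>msec F U\<^esub> n) = conn F U v m \<oplus>\<^bsub>msec F U\<^esub> conn F U v n"
 using d[THEN conjunct2, THEN conjunct1] by blast
 note d = d[THEN conjunct2, THEN conjunct2]
 show "!!v w m. v \<in> carrier (T U) ==> w \<in> carrier (T U) ==> m \<in> Mc U ==>
 conn F U (v \<oplus>\<^bsub>T U\<^esub> w) m = conn F U v m \<oplus>\<^bsub>msec F U\<^esub> conn F U w m"
 using d[THEN conjunct1] by blast
 show "!!a v m. a \<in> Sc U ==> v \<in> carrier (T U) ==> m \<in> Mc U ==>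
 conn F U (a \<odot>\<^bsub>T U\<^esub> v) m = a \<odot>\<^bsub>msec F U\<^esub> conn F U v m"
 using d[THEN conjunct2, THEN conjunct1] by blast
 note d = d[THEN conjunct2, THEN conjunct2]
 show "!!i j v m. v \<in> hom_vf S0 Z U i ==> m \<in> mgr (msec F U) j ==> conn F U v m \<in> mgr (msec F U) (i + j)"
 using d[THEN conjunct1] by blast
 show "!!i j v a m. v \<in> hom_vf S0 Z U i ==> a \<in> gr (sec Z U) j ==> m \<in> Mc U ==>
 conn F U v (a \<odot>\<^bsub>msec F U\<^esub> m) =
 v U a \<odot>\<^bsub>msec F U\<^esub> m \<oplus>\<^bsub>msec F U\<^esub> ksgn (msec F U) i j (a \<odot>\<^bsub>msec F U\<^esub> conn F U v m)"
 using d[THEN conjunct2, THEN conjunct1] by blast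
 note d = d[THEN conjunct2, THEN conjunct2]
 show "!!i j v w m. v \<in> hom_vf S0 Z U i ==> w \<in> hom_vf S0 Z U j ==> m \<in> Mc U ==>
 conn F U (vf_bracket Z U i j v w) m = conn F U v (conn F U w m) \<ominus>\<^bsub>msec F U\<^esub>
 ksgn (msec F U) i j (conn F U w (conn F U v m))"
 using d[THEN conjunct1] by blast
 show "!!V v m. opn V ==> V <= U ==> v \<in> carrier (T U) ==> m \<in> Mc U ==>
 mres F U V (conn F U v m) = conn F V (vf_ext Z V v) (mres F U V m)"
 using d[THEN conjunct2] by blast
qed

lemma conn_leibniz:
 assumes U: "opn U" and v: "v \<in> hom_vf S0 Z U i" and a: "a \<in> Sc U" and m: "m \<in> Mc U"
 shows "conn F U v (a \<odot>\<^bsub>msec F U\<^esub> m) =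
 v U a \<odot>\<^bsub>msec F U\<^esub> m \<oplus>\<^bsub>msec F U\<^esub> tws U i a \<odot>\<^bsub>msec F U\<^esub> conn F U v m"
proof -
 interpret supmod "sec Z U" "msec F U" using smod U .
 have vT: "v \<in> carrier (T U)" using hom_vf_in_T v .
 note d = hom_vf_apply[OF v U order_refl]
 have cm: "conn F U v m \<in> Mc U" using conn_closed U vT m by blast
 from a show ?thesis
 proof (induction rule: gr.graded_induct)
 case (hom j a)
 have "a \<in> Sc U" using hom gr.g_closed by blast
 then show ?case using conn_leibniz0[OF U v hom m] cm by (simp add: gr.tw_of[OF hom] smult_ksgn)
 next
 case (add x y)
 have c: "v U x \<in> Sc U" "v U y \<in> Sc U" "tws U i x \<in> Sc U" "tws U i y \<in> Sc U" using add d by auto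
 have "conn F U v ((x \<oplus>\<^bsub>sec Z U\<^esub> y) \<odot>\<^bsub>msec F U\<^esub> m) =
 (v U x \<odot>\<^bsub>msec F U\<^esub> m \<oplus>\<^bsub>msec F U\<^esub> tws U i x \<odot>\<^bsub>msec F U\<^esub> conn F U v m) \<oplus>\<^bsub>msec F U\<^esub>
 (v U y \<odot>\<^bsub>msec F U\<^esub> m \<oplus>\<^bsub>msec F U\<^esub> tws U i y \<odot>\<^bsub>msec F U\<^esub> conn F U v m)"
 using add m by (simp add: smult_l_distr conn_add[OF U vT])
 also have "\<dots> = (v U x \<oplus>\<^bsub>sec Z U\<^esub> v U y) \<odot>\<^bsub>msec F U\<^esub> m \<oplus>\<^bsub>msec F U\<^esub>
 (tws U i x \<oplus>\<^bsub>sec Z U\<^esub> tws U i y) \<odot>\<^bsub>msec F U\<^esub> conn F U v m"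
 using c m cm smult_closed[OF c(1) m] smult_closed[OF c(2) m] smult_closed[OF c(3) cm] smult_closed[OF c(4) cm]
 by (simp add: smult_l_distr M.a_ac)
 finally show ?case using add by (simp add: d(2) gr.tw_add)
 qed
qed

lemma conn_zero: "opn U ==> v \<in> carrier (T U) ==> conn F U v \<zero>\<^bsub>msec F U\<^esub> = \<zero>\<^bsub>msec F U\<^esub>"
proof -
 assume U: "opn U" "v \<in> carrier (T U)"
 interpret supmod "sec Z U" "msec F U" using smod U by blast
 show ?thesis using conn_add[OF U M.zero_closed M.zero_closed] conn_closed[OF U M.zero_closed] by simp
qed

lemma conn_vzero: "opn U ==> m \<in> Mc U ==> conn F U \<zero>\<^bsub>T U\<^esub> m = \<zero>\<^bsub>msec F U\<^esub>"
proof -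
 assume U: "opn U" and m: "m \<in> Mc U"
 interpret supmod "sec Z U" "msec F U" using smod U by blast
 interpret T: abelian_group "T U" using T_abelian_group U .
 show ?thesis using conn_vadd[OF U T.zero_closed T.zero_closed m] conn_closed[OF U T.zero_closed m]
 by (intro M.idem_zero) (simp_all only: T.l_zero[OF T.zero_closed])
qed

lemma conn_parts: "opn U ==> v \<in> carrier (T U) ==> m \<in> Mc U ==>
 conn F U v m = conn F U (Tpart U 0 v) m \<oplus>\<^bsub>msec F U\<^esub> conn F U (Tpart U 1 v) m"
 using conn_vadd[of U "Tpart U 0 v" "Tpart U 1 v" m] graded_group.part_sum01[OF T_graded, of U v]
 hom_vf_in_T[OF Tpart_in] by (simp only: )

end

section \<open>Purely odd submersions in local coordinates\<close>

lemma (in odd_ext) extend_derivation_total: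
 assumes "!!a. a \<in> carrier A ==> d a \<in> carrier B"
 and "!!a b. a \<in> carrier A ==> b \<in> carrier A ==> d (a \<oplus>\<^bsub>A\<^esub> b) = d a \<oplus>\<^bsub>B\<^esub> d b"
 and "!!j a. a \<in> gr A j ==> d a \<in> gr B (i + j)"
 and "!!a b. a \<in> carrier A ==> b \<in> carrier A ==>
 d (a \<otimes>\<^bsub>A\<^esub> b) = d a \<otimes>\<^bsub>B\<^esub> h b \<oplus>\<^bsub>B\<^esub> B.gr.tw i (h a) \<otimes>\<^bsub>B\<^esub> d b"
 and "!!j. j < n ==> \<beta> j \<in> gr B (i + 1)"
 shows "EX D. (\<forall>x\<in>carrier B. D x \<in> carrier B) &
 (\<forall>x\<in>carrier B. \<forall>y\<in>carrier B. D (x \<oplus>\<^bsub>B\<^esub> y) = D x \<oplus>\<^bsub>B\<^esub> D y) &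
 (ALL j. \<forall>x\<in>gr B j. D x \<in> gr B (i + j)) &
 (\<forall>x\<in>carrier B. \<forall>y\<in>carrier B. D (x \<otimes>\<^bsub>B\<^esub> y) = D x \<otimes>\<^bsub>B\<^esub> y \<oplus>\<^bsub>B\<^esub> B.gr.tw i x \<otimes>\<^bsub>B\<^esub> D y) &
 (\<forall>a\<in>carrier A. D (h a) = d a) & (\<forall>j<n. D (et j) = \<beta> j)"
proof -
 from extend_derivation[of d i \<beta> n, OF assms order_refl] obtain D where
 D: "tderiv n i D" "\<forall>a\<in>carrier A. D (h a) = d a" "\<forall>j<n. D (et j) = \<beta> j" by auto
 have e: "carrier B \<inter> gr B j = gr B j" for j using B.gr.g_closed by blast
 show ?thesis using D unfolding tderiv_def tower_n e by blast
qed

locale osub = Z: sspace S0 Z + W: sspace S0 W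
 for S0 :: "('l, complex) superalg" and Z :: "('z, 'a, 'l) superspace" and W :: "('w, 'b, 'l) superspace" +
 fixes sg :: "('z, 'w, 'a, 'b) smor"
 assumes nil: "nilpotent_extension S0" and sub: "purely_odd_submersion S0 Z W sg"
begin

abbreviation pr :: "'w set => 'z set" where "pr V \<equiv> pre Z sg V"
abbreviation dn :: "'z set => 'w set" where "dn U \<equiv> pt sg ` U"

lemma mor: "superspace_mor S0 Z W sg"
 using sub by (simp add: purely_odd_submersion_def)

lemma homeo: "homeomorphic_map (space Z) (space W) (pt sg)"
 using sub by (simp add: purely_odd_submersion_def)

lemma inj_pt: "inj_on (pt sg) (topspace (space Z))" and surj_pt: "pt sg ` topspace (space Z) = topspace (space W)"
 using homeomorphic_eq_everything_map[of "space Z" "space W" "pt sg"] homeo by auto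

lemma pre_open: "W.opn V ==> Z.opn (pr V)"
 unfolding pre_def
 by (rule openin_continuous_map_preimage[OF mor[unfolded superspace_mor_def, THEN conjunct1]])

lemma dn_open: "Z.opn U ==> W.opn (dn U)"
 using homeomorphic_imp_open_map[OF homeo] by (simp add: open_map_def)

lemma pre_dn: "Z.opn U ==> pr (dn U) = U"
 using openin_subset[of "space Z" U] inj_pt by (auto simp: pre_def inj_on_def)

lemma dn_pre: "W.opn V ==> dn (pr V) = V"
 using openin_subset[of "space W" V] surj_pt by (auto simp: pre_def)

lemma pre_mono: "V <= V' ==> pr V <= pr V'"
 by (auto simp: pre_def)

lemma pre_subset_iff: "W.opn V ==> pr V <= pr V' ==> V <= V'"
proof -
 assume V: "W.opn V" "pr V <= pr V'"
 have "V = dn (pr V)" using dn_pre[OF V(1)] by simp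
 also have "\<dots> <= dn (pr V')" using V(2) by blast
 also have "\<dots> <= V'" by (auto simp: pre_def)
 finally show "V <= V'" .
qed

lemma pre_Int: "pr (V \<inter> V') = pr V \<inter> pr V'"
 by (auto simp: pre_def)

lemma open_pre_cases: "Z.opn U ==> (!!V. W.opn V ==> U = pr V ==> P) ==> P"
 using dn_open pre_dn by metis

lemma com_salg: "W.opn V ==> superalg_hom S0 (sec W V) (sec Z (pr V)) (com sg V)"
 using mor[unfolded superspace_mor_def, THEN conjunct2, THEN conjunct1] by blast

lemma com_shom: "W.opn V ==> superring_hom (sec W V) (sec Z (pr V)) (com sg V)"
 using com_salg by (simp add: superalg_hom_def)

lemma com_closed: "W.opn V ==> b \<in> W.Sc V ==> com sg V b \<in> Z.Sc (pr V)"
 using ring_hom_closed com_shom unfolding superring_hom_def by metis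

lemma com_gr: "W.opn V ==> b \<in> gr (sec W V) i ==> com sg V b \<in> gr (sec Z (pr V)) i"
 using com_shom unfolding superring_hom_def by blast

lemma com_base: "W.opn V ==> l \<in> carrier S0 ==> com sg V (base (sec W V) l) = base (sec Z (pr V)) l"
 using com_salg by (simp add: superalg_hom_def)

lemma com_res: "W.opn V ==> W.opn V' ==> V' <= V ==> b \<in> W.Sc V ==>
 com sg V' (res W V V' b) = res Z (pr V) (pr V') (com sg V b)"
 using mor[unfolded superspace_mor_def, THEN conjunct2, THEN conjunct2, THEN conjunct1] by blast

lemma com_add: "W.opn V ==> a \<in> W.Sc V ==> b \<in> W.Sc V ==>
 com sg V (a \<oplus>\<^bsub>sec W V\<^esub> b) = com sg V a \<oplus>\<^bsub>sec Z (pr V)\<^esub> com sg V b"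
 using ring_hom_add com_shom unfolding superring_hom_def by metis

lemma com_mult: "W.opn V ==> a \<in> W.Sc V ==> b \<in> W.Sc V ==>
 com sg V (a \<otimes>\<^bsub>sec W V\<^esub> b) = com sg V a \<otimes>\<^bsub>sec Z (pr V)\<^esub> com sg V b"
 using ring_hom_mult com_shom unfolding superring_hom_def by metis

lemma com_one: "W.opn V ==> com sg V \<one>\<^bsub>sec W V\<^esub> = \<one>\<^bsub>sec Z (pr V)\<^esub>"
 using ring_hom_one com_shom unfolding superring_hom_def by metis

lemma com_zero: "W.opn V ==> com sg V \<zero>\<^bsub>sec W V\<^esub> = \<zero>\<^bsub>sec Z (pr V)\<^esub>"
 using ring_hom_zero com_shom W.sring Z.sring pre_open unfolding superring_hom_def superring_def by metis

lemma com_tw: "W.opn V ==> b \<in> W.Sc V ==> com sg V (W.tws V i b) = Z.tws (pr V) i (com sg V b)"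
 using superring_hom_part(3)[OF W.sring Z.sring com_shom] pre_open by blast

lemma com_ksgn: "W.opn V ==> b \<in> W.Sc V ==>
 com sg V (ksgn (sec W V) i j b) = ksgn (sec Z (pr V)) i j (com sg V b)"
 using superring_hom_part(2)[OF W.sring Z.sring com_shom] pre_open by (auto simp: ksgn_def)

lemma half: "Z.opn U ==> \<exists>u\<in>Z.Sc U. u \<oplus>\<^bsub>sec Z U\<^esub> u = \<one>\<^bsub>sec Z U\<^esub>"
proof -
 assume U: "Z.opn U"
 have L: "superring_hom complex_superring S0 (base S0)"
 using nil by (simp add: nilpotent_extension_def superalgebra_def)
 then have l: "base S0 \<in> ring_hom complex_superring S0" by (simp add: superring_hom_def)
 have b: "base (sec Z U) \<in> ring_hom S0 (sec Z U)"
 using Z.superalg[OF U] by (simp add: superalgebra_def superring_hom_def)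
 define c where "c = base S0 (1/2)"
 have c: "c \<in> carrier S0" using ring_hom_closed[OF l, of "1/2"] by (simp add: c_def complex_superring_def)
 have "c \<oplus>\<^bsub>S0\<^esub> c = base S0 (1/2 + 1/2)"
 using ring_hom_add[OF l, of "1/2" "1/2"] by (simp add: c_def complex_superring_def)
 also have "\<dots> = \<one>\<^bsub>S0\<^esub>" using ring_hom_one[OF l] by (simp add: complex_superring_def)
 finally have "base (sec Z U) c \<oplus>\<^bsub>sec Z U\<^esub> base (sec Z U) c = \<one>\<^bsub>sec Z U\<^esub>"
 using ring_hom_add[OF b c c] ring_hom_one[OF b] by simp
 then show ?thesis using ring_hom_closed[OF b c] by blast
qed

subsection \<open>Vertical vector fields, lifts and annihilators\<close>

lemma verticalD:
 assumes "v \<in> vertical S0 Z W sg U"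
 shows "v \<in> carrier (Z.T U)"
 and "W.opn V ==> pr V <= U ==> b \<in> W.Sc V ==> v (pr V) (com sg V b) = \<zero>\<^bsub>sec Z (pr V)\<^esub>"
proof -
 show "v \<in> carrier (Z.T U)" using assms by (simp add: vertical_def)
 assume V: "W.opn V" "pr V <= U" "b \<in> W.Sc V"
 have "U \<inter> pr V = pr V" using V by auto
 moreover have "v (U \<inter> pr V) (res Z (pr V) (U \<inter> pr V) (com sg V b)) = \<zero>\<^bsub>sec Z (U \<inter> pr V)\<^esub>"
 using assms V(1,3) unfolding vertical_def by blast
 ultimately show "v (pr V) (com sg V b) = \<zero>\<^bsub>sec Z (pr V)\<^esub>"
 using Z.res_id[OF pre_open[OF V(1)] com_closed[OF V(1,3)]] by simp
qed

lemma verticalI: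
 assumes U: "Z.opn U" and v: "v \<in> carrier (Z.T U)"
 and *: "!!V b. W.opn V ==> pr V <= U ==> b \<in> W.Sc V ==> v (pr V) (com sg V b) = \<zero>\<^bsub>sec Z (pr V)\<^esub>"
 shows "v \<in> vertical S0 Z W sg U"
proof -
 have "v (U \<inter> pr V) (res Z (pr V) (U \<inter> pr V) (com sg V b)) = \<zero>\<^bsub>sec Z (U \<inter> pr V)\<^esub>"
 if V: "W.opn V" "b \<in> W.Sc V" for V b
 proof -
 let ?V = "dn U \<inter> V"
 have o: "W.opn ?V" using dn_open[OF U] V by auto
 have e: "pr ?V = U \<inter> pr V" using pre_dn[OF U] by (simp add: pre_Int)
 have "res Z (pr V) (pr ?V) (com sg V b) = com sg ?V (res W V ?V b)"
 using com_res[OF V(1) o] V by auto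
 then show ?thesis using *[OF o, of "res W V ?V b"] W.res_closed[OF V(1) o _ V(2)] by (simp flip: e) (simp add: e)
 qed
 then show ?thesis using v unfolding vertical_def by blast
qed

lemma local_liftD:
 assumes "local_lift S0 Z W sg V v U v'" "W.opn V"
 shows "Z.opn U" "U <= pr V" "v' \<in> carrier (Z.T U)"
 and "W.opn V' ==> pr V' <= U ==> b \<in> W.Sc V' ==> v \<in> carrier (W.T V) ==>
 v' (pr V') (com sg V' b) = com sg V' (v V' b)"
proof -
 show U: "Z.opn U" "U <= pr V" "v' \<in> carrier (Z.T U)" using assms(1) by (simp_all add: local_lift_def)
 assume V': "W.opn V'" "pr V' <= U" "b \<in> W.Sc V'" and v: "v \<in> carrier (W.T V)"
 have s: "V' <= V" using pre_subset_iff[OF V'(1)] V'(2) U(2) by blast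
 have "U \<inter> pr V' = pr V'" using V' by auto
 moreover have "v' (U \<inter> pr V') (res Z (pr V') (U \<inter> pr V') (com sg V' b)) = res Z (pr V') (U \<inter> pr V') (com sg V' (v V' b))"
 using assms(1) V' s unfolding local_lift_def by blast
 ultimately show "v' (pr V') (com sg V' b) = com sg V' (v V' b)"
 using Z.res_id[OF pre_open[OF V'(1)] com_closed[OF V'(1,3)]]
 Z.res_id[OF pre_open[OF V'(1)] com_closed[OF V'(1) W.T_apply(1)[OF v V'(1) s V'(3)]]] by simp
qed

lemma local_liftI:
 assumes V: "W.opn V" and v: "v \<in> carrier (W.T V)" and U: "Z.opn U" "U <= pr V" "v' \<in> carrier (Z.T U)"
 and *: "!!V' b. W.opn V' ==> pr V' <= U ==> b \<in> W.Sc V' ==> v' (pr V') (com sg V' b) = com sg V' (v V' b)"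
 shows "local_lift S0 Z W sg V v U v'"
proof -
 have "v' (U \<inter> pr V') (res Z (pr V') (U \<inter> pr V') (com sg V' b)) = res Z (pr V') (U \<inter> pr V') (com sg V' (v V' b))"
 if V': "W.opn V'" "V' <= V" "b \<in> W.Sc V'" for V' b
 proof -
 let ?V = "dn U \<inter> V'"
 have o: "W.opn ?V" using dn_open[OF U(1)] V' by auto
 have e: "U \<inter> pr V' = pr ?V" using pre_dn[OF U(1)] by (simp add: pre_Int)
 have vb: "v V' b \<in> W.Sc V'" using W.T_apply(1)[OF v V'] .
 have "res Z (pr V') (pr ?V) (com sg V' b) = com sg ?V (res W V' ?V b)"
 using com_res[OF V'(1) o _ V'(3)] by auto
 moreover have "res Z (pr V') (pr ?V) (com sg V' (v V' b)) = com sg ?V (res W V' ?V (v V' b))"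
 using com_res[OF V'(1) o _ vb] by auto
 moreover have "v ?V (res W V' ?V b) = res W V' ?V (v V' b)"
 using W.T_res[OF v V'(1) o _ V'(2,3)] by auto
 moreover have "pr ?V <= U" using e by auto
 ultimately show ?thesis
 unfolding e using *[OF o, of "res W V' ?V b"] W.res_closed[OF V'(1) o _ V'(3)] by simp
 qed
 then show ?thesis using U unfolding local_lift_def by blast
qed

lemma T_eq_on_parts:
 assumes U: "Z.opn U" "v \<in> carrier (Z.T U)" and V: "W.opn V" "V <= V1" "W.opn V1" "pr V <= U"
 and u: "u \<in> carrier (W.T V1)" and b: "b \<in> gr (sec W V) j"
 and eq: "v (pr V) (com sg V b) = com sg V (u V b)"
 shows "Z.Tpart U i v (pr V) (com sg V b) = com sg V (W.Tpart V1 i u V b)"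
proof -
 interpret R: superring "sec Z (pr V)" using Z.sring pre_open V by blast
 interpret S: superring "sec W V" using W.sring V by blast
 have bc: "b \<in> W.Sc V" using b S.gr.g_closed by blast
 have p: "Z.Tpart U k v \<in> hom_vf S0 Z U k" "W.Tpart V1 k u \<in> hom_vf S0 W V1 k" for k
 using Z.Tpart_in[OF U] W.Tpart_in[OF V(3) u] .
 note a = Z.hom_vf_apply[OF p(1) pre_open[OF V(1)] V(4)] and c = W.hom_vf_apply[OF p(2) V(1,2)]
 have l: "Z.Tpart U k v (pr V) (com sg V b) \<in> gr (sec Z (pr V)) (k + j)"
 and r: "com sg V (W.Tpart V1 k u V b) \<in> gr (sec Z (pr V)) (k + j)" for k
 using a(3)[OF com_gr[OF V(1) b]] com_gr[OF V(1) c(3)[OF b]] .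
 have "Z.Tpart U 0 v (pr V) (com sg V b) \<oplus>\<^bsub>sec Z (pr V)\<^esub> Z.Tpart U 1 v (pr V) (com sg V b) =
 com sg V (W.Tpart V1 0 u V b) \<oplus>\<^bsub>sec Z (pr V)\<^esub> com sg V (W.Tpart V1 1 u V b)"
 using eq Z.Tpart_apply[OF U pre_open[OF V(1)] V(4) com_closed[OF V(1) bc]] W.Tpart_apply[OF V(3) u V(1,2) bc]
 com_add[OF V(1) c(1)[OF bc] c(1)[OF bc]] by simp
 then have "Z.Tpart U 0 v (pr V) (com sg V b) = com sg V (W.Tpart V1 0 u V b) &
 Z.Tpart U 1 v (pr V) (com sg V b) = com sg V (W.Tpart V1 1 u V b)"
 proof (rule R.gr.parts_unique[of _ j, rotated 4])
 show "Z.Tpart U 0 v (pr V) (com sg V b) \<in> gr (sec Z (pr V)) j" using l[of 0] unfolding add_0 .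
 show "com sg V (W.Tpart V1 0 u V b) \<in> gr (sec Z (pr V)) j" using r[of 0] unfolding add_0 .
 show "Z.Tpart U 1 v (pr V) (com sg V b) \<in> gr (sec Z (pr V)) (j + 1)" using l[of 1] unfolding add.commute[of j] .
 show "com sg V (W.Tpart V1 1 u V b) \<in> gr (sec Z (pr V)) (j + 1)" using r[of 1] unfolding add.commute[of j] .
 qed
 then show ?thesis using bit_cases[of i] by auto
qed

lemma local_lift_part:
 assumes V: "W.opn V" "v \<in> carrier (W.T V)" and l: "local_lift S0 Z W sg V v U v'"
 shows "local_lift S0 Z W sg V (W.Tpart V i v) U (Z.Tpart U i v')"
proof -
 note d = local_liftD[OF l V(1)]
 have p: "Z.Tpart U i v' \<in> hom_vf S0 Z U i" "W.Tpart V i v \<in> hom_vf S0 W V i"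
 using Z.Tpart_in d W.Tpart_in V by auto
 show ?thesis
 proof (rule local_liftI[OF V(1) W.hom_vf_in_T[OF p(2)] d(1,2) Z.hom_vf_in_T[OF p(1)]])
 fix V' b assume V': "W.opn V'" "pr V' <= U" and b: "b \<in> W.Sc V'"
 have s: "V' <= V" using pre_subset_iff[OF V'(1)] V'(2) d(2) by blast
 interpret R: superring "sec Z (pr V')" using Z.sring pre_open V' by blast
 interpret S: superring "sec W V'" using W.sring V' by blast
 note a = Z.hom_vf_apply[OF p(1) pre_open[OF V'(1)] V'(2)] and c = W.hom_vf_apply[OF p(2) V'(1) s]
 from b show "Z.Tpart U i v' (pr V') (com sg V' b) = com sg V' (W.Tpart V i v V' b)"
 proof (induction rule: S.gr.graded_induct)
 case (hom j b)
 then show ?case using T_eq_on_parts[OF d(1,3) V'(1) s V(1) V'(2) V(2) hom] d(4)[OF V' _ V(2)] S.gr.g_closed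
 by blast
 next
 case (add x y)
 then show ?case by (simp add: com_add[OF V'(1)] a(2) com_closed[OF V'(1)] c(1,2))
 qed
 qed
qed

lemma vertical_iff_lift_zero:
 assumes "Z.opn U"
 shows "v \<in> vertical S0 Z W sg U \<longleftrightarrow> local_lift S0 Z W sg (dn U) \<zero>\<^bsub>W.T (dn U)\<^esub> U v"
proof
 have V: "W.opn (dn U)" "\<zero>\<^bsub>W.T (dn U)\<^esub> \<in> carrier (W.T (dn U))"
 using dn_open[OF assms] abelian_group.axioms(1)[OF W.T_abelian_group] abelian_monoid.zero_closed by blast+
 have z: "com sg V (\<zero>\<^bsub>W.T (dn U)\<^esub> V b) = \<zero>\<^bsub>sec Z (pr V)\<^esub>" if "W.opn V" "pr V <= U" "b \<in> W.Sc V" for V b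
 proof -
 have "V <= dn U" using dn_pre[OF that(1)] that(2) by blast
 then show ?thesis using that com_zero by simp
 qed
 show "local_lift S0 Z W sg (dn U) \<zero>\<^bsub>W.T (dn U)\<^esub> U v" if "v \<in> vertical S0 Z W sg U"
 using verticalD[OF that] z pre_dn[OF assms] by (intro local_liftI[OF V assms]) auto
 show "v \<in> vertical S0 Z W sg U" if "local_lift S0 Z W sg (dn U) \<zero>\<^bsub>W.T (dn U)\<^esub> U v"
 using local_liftD[OF that V(1)] V(2) z by (intro verticalI[OF assms]) metis+
qed

lemma vertical_part: "Z.opn U ==> v \<in> vertical S0 Z W sg U ==> Z.Tpart U i v \<in> vertical S0 Z W sg U"
proof -
 assume U: "Z.opn U" and v: "v \<in> vertical S0 Z W sg U"
 interpret g: graded_group "W.T (dn U)" "hom_vf S0 W (dn U)" using W.T_graded dn_open U by blast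
 show ?thesis
 using local_lift_part[OF dn_open[OF U] g.zero_closed, of U v i] v U g.part_zero[of i]
 by (simp only: vertical_iff_lift_zero[OF U])
qed

lemma vertical_restrict:
 assumes "Z.opn U" "Z.opn U'" "U' <= U" "v \<in> vertical S0 Z W sg U"
 shows "vf_ext Z U' v \<in> vertical S0 Z W sg U'"
proof (rule verticalI[OF assms(2) Z.T_restrict[OF verticalD(1)[OF assms(4)] assms(3)]])
 fix V b assume V: "W.opn V" "pr V <= U'" "b \<in> W.Sc V"
 then show "vf_ext Z U' v (pr V) (com sg V b) = \<zero>\<^bsub>sec Z (pr V)\<^esub>"
 using verticalD(2)[OF assms(4) V(1) _ V(3)] assms(3) pre_open com_closed by auto
qed

lemma local_lift_restrict:
 assumes V: "W.opn V" "v \<in> carrier (W.T V)" and l: "local_lift S0 Z W sg V v U v'"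
 and V': "W.opn V'" "V' <= V" and U': "Z.opn U'" "U' <= U" "U' <= pr V'"
 shows "local_lift S0 Z W sg V' (vf_ext W V' v) U' (vf_ext Z U' v')"
proof (rule local_liftI[OF V'(1) W.T_restrict[OF V(2) V'(2)] U'(1,3)])
 note d = local_liftD[OF l V(1)]
 show "vf_ext Z U' v' \<in> carrier (Z.T U')" using Z.T_restrict d U' by blast
 fix V1 b assume 1: "W.opn V1" "pr V1 <= U'" "b \<in> W.Sc V1"
 then have "V1 <= V'" using pre_subset_iff U' by blast
 then show "vf_ext Z U' v' (pr V1) (com sg V1 b) = com sg V1 (vf_ext W V' v V1 b)"
 using d(4)[OF 1(1) _ 1(3) V(2)] 1 U' pre_open com_closed by auto
qed

end

text \<open>An open subset of the target over which the odd coordinates \<open>et\<close> exist.\<close>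

locale frame = osub S0 Z W sg
 for S0 :: "('l, complex) superalg" and Z :: "('z, 'a, 'l) superspace" and W :: "('w, 'b, 'l) superspace"
 and sg :: "('z, 'w, 'a, 'b) smor" +
 fixes V0 :: "'w set" and et :: "nat => 'a" and n :: nat
 assumes V0: "W.opn V0" and theta0: "i < n ==> et i \<in> gr (sec Z (pr V0)) 1"
 and coords: "W.opn V ==> V <= V0 ==> s \<in> Z.Sc (pr V) ==>
 \<exists>!c. c \<in> Pow {..<n} \<rightarrow>\<^sub>E carrier (sec W V) &
 s = (\<Oplus>\<^bsub>sec Z (pr V)\<^esub>I\<in>Pow {..<n}. com sg V (c I) \<otimes>\<^bsub>sec Z (pr V)\<^esub>
 odd_monom (sec Z (pr V)) (\<lambda>i. res Z (pr V0) (pr V) (et i)) I)"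

lemma (in osub) frame_exists:
 assumes "w \<in> topspace (space W)"
 shows "EX V0 et n. w \<in> V0 & frame S0 Z W sg V0 et n"
proof -
 obtain n V where V: "W.opn V" "w \<in> V" and p: "odd_projection (restrict_to Z (pr V)) (restrict_to W V) sg n"
 using sub assms unfolding purely_odd_submersion_def by meson
 have sec: "sec (restrict_to Z (pr V)) = sec Z" "sec (restrict_to W V) = sec W" "res (restrict_to Z (pr V)) = res Z"
 by (simp_all add: restrict_to_def)
 have top: "topspace (space (restrict_to Z (pr V))) = pr V"
 using openin_subset[OF pre_open[OF V(1)]] by (auto simp: restrict_to_def)
 have pr': "pre (restrict_to Z (pr V)) sg V' = pr V'" if "V' <= V" for V'
 unfolding pre_def[of "restrict_to Z (pr V)"] top using that by (auto simp: pre_def)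
 have op: "openin (space (restrict_to W V)) V'" if "W.opn V'" "V' <= V" for V'
 using that V by (simp add: restrict_to_def openin_open_subtopology)
 from p[unfolded odd_projection_def sec top, THEN conjunct2] obtain et where th: "\<forall>i<n. et i \<in> gr (sec Z (pr V)) 1"
 and c: "ALL V'. openin (space (restrict_to W V)) V' --> (\<forall>s\<in>carrier (sec Z (pre (restrict_to Z (pr V)) sg V')).
 \<exists>!c. c \<in> Pow {..<n} \<rightarrow>\<^sub>E carrier (sec W V') &
 s = (\<Oplus>\<^bsub>sec Z (pre (restrict_to Z (pr V)) sg V')\<^esub>I\<in>Pow {..<n}.
 com sg V' (c I) \<otimes>\<^bsub>sec Z (pre (restrict_to Z (pr V)) sg V')\<^esub>
 odd_monom (sec Z (pre (restrict_to Z (pr V)) sg V'))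
 (\<lambda>i. res Z (pr V) (pre (restrict_to Z (pr V)) sg V') (et i)) I))"
 by (elim exE conjE)
 have "frame S0 Z W sg V et n"
 proof unfold_locales
 fix V' s assume V': "W.opn V'" "V' <= V" "s \<in> Z.Sc (pr V')"
 show "\<exists>!c. c \<in> Pow {..<n} \<rightarrow>\<^sub>E carrier (sec W V') &
 s = (\<Oplus>\<^bsub>sec Z (pr V')\<^esub>I\<in>Pow {..<n}. com sg V' (c I) \<otimes>\<^bsub>sec Z (pr V')\<^esub>
 odd_monom (sec Z (pr V')) (\<lambda>i. res Z (pr V) (pr V') (et i)) I)"
 using c[THEN spec, THEN mp, OF op[OF V'(1,2)], unfolded pr'[OF V'(2)], THEN bspec, OF V'(3)] .
 qed (use V th in auto)
 then show ?thesis using V by blast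
qed

context frame
begin

abbreviation th :: "'w set => nat => 'a" where "th V i \<equiv> res Z (pr V0) (pr V) (et i)"

lemma ext: "W.opn V ==> V <= V0 ==> odd_ext (sec W V) (sec Z (pr V)) (com sg V) (th V) n"
proof -
 assume V: "W.opn V" "V <= V0"
 note o = pre_open[OF V(1)]
 interpret A: superring "sec W V" using W.sring V by blast
 interpret B: superring "sec Z (pr V)" using Z.sring o by blast
 show ?thesis
 proof unfold_locales
 show "\<exists>u\<in>carrier (sec Z (pr V)). u \<oplus>\<^bsub>sec Z (pr V)\<^esub> u = \<one>\<^bsub>sec Z (pr V)\<^esub>" using half[OF o] .
 show "superring_hom (sec W V) (sec Z (pr V)) (com sg V)" using com_shom V by blast
 show "th V i \<in> gr (sec Z (pr V)) 1" if "i < n" for i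
 using Z.res_gr[OF pre_open[OF V0] o pre_mono[OF V(2)] theta0[OF that]] .
 qed (rule coords[OF V])
qed

lemma th_res: "W.opn V ==> V <= V0 ==> W.opn V' ==> V' <= V ==> i < n ==>
 res Z (pr V) (pr V') (th V i) = th V' i"
proof -
 assume V: "W.opn V" "V <= V0" "W.opn V'" "V' <= V" "i < n"
 interpret B: superring "sec Z (pr V0)" using Z.sring pre_open V0 by blast
 show ?thesis using V pre_open V0 pre_mono B.gr.g_closed[OF theta0[OF V(5)]] by (intro Z.res_res) auto
qed

lemma vf_unique:
 assumes V: "W.opn V" "V <= V0" and v: "v \<in> hom_vf S0 Z (pr V) i" and w: "w \<in> hom_vf S0 Z (pr V) i"
 and com: "!!V' b. W.opn V' ==> V' <= V ==> b \<in> W.Sc V' ==> v (pr V') (com sg V' b) = w (pr V') (com sg V' b)"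
 and th: "!!j. j < n ==> v (pr V) (th V j) = w (pr V) (th V j)"
 shows "v = w"
proof (rule Z.vf_eqI[OF Z.hom_vf_ext[OF v] Z.hom_vf_ext[OF w]])
 fix U a assume U: "Z.opn U" "U <= pr V" "a \<in> Z.Sc U"
 obtain V' where V': "W.opn V'" "U = pr V'" using open_pre_cases[OF U(1)] by blast
 have s: "V' <= V" using pre_subset_iff V' U by blast
 interpret odd_ext "sec W V'" "sec Z (pr V')" "com sg V'" "th V'" n using ext V' s V by blast
 have U': "Z.opn (pr V')" "pr V' <= pr V" using U V' by auto
 note d = Z.hom_vf_apply[OF v U'] and e = Z.hom_vf_apply[OF w U']
 have t: "v (pr V') (th V' j) = w (pr V') (th V' j)" if "j < n" for j
 proof -
 interpret E: odd_ext "sec W V" "sec Z (pr V)" "com sg V" "th V" n using ext V by blast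
 show ?thesis
 using th[OF that] Z.hom_vf_res[OF v pre_open[OF V(1)] U'(1,2) order_refl E.theta_closed[OF that]]
 Z.hom_vf_res[OF w pre_open[OF V(1)] U'(1,2) order_refl E.theta_closed[OF that]]
 th_res[OF V V'(1) s that] by simp
 qed
 from U(3) show "v U a = w U a" unfolding V'(2)
 proof (induction rule: gen_induct)
 case (base b)
 then show ?case using com V' s by blast
 next
 case (mult x j)
 then show ?case using t theta_closed by (simp add: d(4) e(4))
 qed (simp add: d(2) e(2))
qed

lemma vf_extension:
 assumes V1: "W.opn V1" "V1 <= V0"
 and d: "!!V b. W.opn V ==> V <= V1 ==> b \<in> W.Sc V ==> d V b \<in> Z.Sc (pr V)"
 and d_add: "!!V a b. W.opn V ==> V <= V1 ==> a \<in> W.Sc V ==> b \<in> W.Sc V ==>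
 d V (a \<oplus>\<^bsub>sec W V\<^esub> b) = d V a \<oplus>\<^bsub>sec Z (pr V)\<^esub> d V b"
 and d_gr: "!!V j b. W.opn V ==> V <= V1 ==> b \<in> gr (sec W V) j ==> d V b \<in> gr (sec Z (pr V)) (i + j)"
 and d_mult: "!!V a b. W.opn V ==> V <= V1 ==> a \<in> W.Sc V ==> b \<in> W.Sc V ==>
 d V (a \<otimes>\<^bsub>sec W V\<^esub> b) = d V a \<otimes>\<^bsub>sec Z (pr V)\<^esub> com sg V b
 \<oplus>\<^bsub>sec Z (pr V)\<^esub> Z.tws (pr V) i (com sg V a) \<otimes>\<^bsub>sec Z (pr V)\<^esub> d V b"
 and d_res: "!!V V' b. W.opn V ==> V <= V1 ==> W.opn V' ==> V' <= V ==> b \<in> W.Sc V ==>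
 d V' (res W V V' b) = res Z (pr V) (pr V') (d V b)"
 and d_base: "!!V l. W.opn V ==> V <= V1 ==> l \<in> carrier S0 ==> d V (base (sec W V) l) = \<zero>\<^bsub>sec Z (pr V)\<^esub>"
 and beta: "!!j. j < n ==> \<beta> j \<in> gr (sec Z (pr V1)) (i + 1)"
 shows "\<exists>v\<in>hom_vf S0 Z (pr V1) i. (ALL V b. W.opn V --> V <= V1 --> b \<in> W.Sc V --> v (pr V) (com sg V b) = d V b) &
 (ALL V j. W.opn V --> V <= V1 --> j < n --> v (pr V) (th V j) = res Z (pr V1) (pr V) (\<beta> j))"
proof -
 define Q where "Q V D \<longleftrightarrow> (\<forall>x\<in>Z.Sc (pr V). D x \<in> Z.Sc (pr V)) &
 (\<forall>x\<in>Z.Sc (pr V). \<forall>y\<in>Z.Sc (pr V). D (x \<oplus>\<^bsub>sec Z (pr V)\<^esub> y) = D x \<oplus>\<^bsub>sec Z (pr V)\<^esub> D y) &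
 (ALL j. \<forall>x\<in>gr (sec Z (pr V)) j. D x \<in> gr (sec Z (pr V)) (i + j)) &
 (\<forall>x\<in>Z.Sc (pr V). \<forall>y\<in>Z.Sc (pr V). D (x \<otimes>\<^bsub>sec Z (pr V)\<^esub> y) =
 D x \<otimes>\<^bsub>sec Z (pr V)\<^esub> y \<oplus>\<^bsub>sec Z (pr V)\<^esub> Z.tws (pr V) i x \<otimes>\<^bsub>sec Z (pr V)\<^esub> D y) &
 (\<forall>a\<in>W.Sc V. D (com sg V a) = d V a) & (\<forall>j<n. D (th V j) = res Z (pr V1) (pr V) (\<beta> j))" for V D
 have ex: "EX D. Q V D" if V: "W.opn V" "V <= V1" for V
 proof -
 interpret odd_ext "sec W V" "sec Z (pr V)" "com sg V" "th V" n using ext V V1 by blast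
 have bt: "res Z (pr V1) (pr V) (\<beta> j) \<in> gr (sec Z (pr V)) (i + 1)" if "j < n" for j
 using Z.res_gr[OF pre_open[OF V1(1)] pre_open[OF V(1)] pre_mono[OF V(2)] beta[OF that]] .
 show ?thesis unfolding Q_def
 by (rule extend_derivation_total[of "d V" i "\<lambda>j. res Z (pr V1) (pr V) (\<beta> j)"];
 rule d[OF V] d_add[OF V] d_gr[OF V] d_mult[OF V] bt; assumption)
 qed
 define D where "D V = (SOME D. Q V D)" for V
 have D: "Q V (D V)" if "W.opn V" "V <= V1" for V
 unfolding D_def using ex[OF that] by (rule someI_ex)
 define v where "v = vf_ext Z (pr V1) (\<lambda>U. D (dn U))"
 have v: "v (pr V) a = D V a" if "W.opn V" "V <= V1" "a \<in> Z.Sc (pr V)" for V a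
 unfolding v_def using that pre_open pre_mono by (simp add: dn_pre)
 have "v \<in> hom_vf S0 Z (pr V1) i"
 proof (rule Z.hom_vfI)
 show "vf_ext Z (pr V1) v = v" by (simp add: v_def)
 fix U assume U: "Z.opn U" "U <= pr V1"
 obtain V where V: "W.opn V" "U = pr V" using open_pre_cases[OF U(1)] by blast
 have s: "V <= V1" using pre_subset_iff V U by blast
 interpret R: superring "sec Z (pr V)" using Z.sring U V by blast
 note q = D[OF V(1) s, unfolded Q_def]
 have b: "base (sec Z (pr V)) l = com sg V (base (sec W V) l)" "base (sec W V) l \<in> W.Sc V" if "l \<in> carrier S0" for l
 using com_base[OF V(1) that] W.base_closed[OF V(1) that] by auto
 show "derivation S0 (sec Z U) i (v U)"
 unfolding V(2)
 proof (rule Z.derivationI[OF pre_open[OF V(1)]])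
 fix a j assume a: "a \<in> gr (sec Z (pr V)) j"
 show "v (pr V) a \<in> gr (sec Z (pr V)) (i + j)"
 unfolding v[OF V(1) s R.gr.g_closed[OF a]] using q a by blast
 next
 fix l assume l: "l \<in> carrier S0"
 show "v (pr V) (base (sec Z (pr V)) l) = \<zero>\<^bsub>sec Z (pr V)\<^esub>"
 unfolding b(1)[OF l] v[OF V(1) s com_closed[OF V(1) b(2)[OF l]]] using q b(2)[OF l] d_base[OF V(1) s l] by auto
 qed (use q v[OF V(1) s] in auto)
 next
 fix U U' a assume U: "Z.opn U" "Z.opn U'" "U' <= U" "U <= pr V1" "a \<in> Z.Sc U"
 obtain V where V: "W.opn V" "U = pr V" using open_pre_cases[OF U(1)] by blast
 obtain V' where V': "W.opn V'" "U' = pr V'" using open_pre_cases[OF U(2)] by blast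
 have s: "V <= V1" "V' <= V" "V' <= V1" using pre_subset_iff V V' U by blast+
 have ss: "Z.opn (pr V)" "Z.opn (pr V')" "pr V' <= pr V" using U V V' by auto
 note q = D[OF V(1) s(1), unfolded Q_def] and q' = D[OF V'(1) s(3), unfolded Q_def]
 interpret odd_ext "sec W V" "sec Z (pr V)" "com sg V" "th V" n using ext V s V1 by blast
 interpret odd_ext': odd_ext "sec W V'" "sec Z (pr V')" "com sg V'" "th V'" n using ext V' s V1 by blast
 have q1: "!!x. x \<in> Z.Sc (pr V) ==> D V x \<in> Z.Sc (pr V)"
 "!!x y. x \<in> Z.Sc (pr V) ==> y \<in> Z.Sc (pr V) ==> D V (x \<oplus>\<^bsub>sec Z (pr V)\<^esub> y) = D V x \<oplus>\<^bsub>sec Z (pr V)\<^esub> D V y"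
 "!!x y. x \<in> Z.Sc (pr V) ==> y \<in> Z.Sc (pr V) ==> D V (x \<otimes>\<^bsub>sec Z (pr V)\<^esub> y) =
 D V x \<otimes>\<^bsub>sec Z (pr V)\<^esub> y \<oplus>\<^bsub>sec Z (pr V)\<^esub> Z.tws (pr V) i x \<otimes>\<^bsub>sec Z (pr V)\<^esub> D V y"
 "!!a. a \<in> W.Sc V ==> D V (com sg V a) = d V a" "!!j. j < n ==> D V (th V j) = res Z (pr V1) (pr V) (\<beta> j)"
 using q by blast+
 have q2: "!!x. x \<in> Z.Sc (pr V') ==> D V' x \<in> Z.Sc (pr V')"
 "!!x y. x \<in> Z.Sc (pr V') ==> y \<in> Z.Sc (pr V') ==> D V' (x \<oplus>\<^bsub>sec Z (pr V')\<^esub> y) = D V' x \<oplus>\<^bsub>sec Z (pr V')\<^esub> D V' y"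
 "!!x y. x \<in> Z.Sc (pr V') ==> y \<in> Z.Sc (pr V') ==> D V' (x \<otimes>\<^bsub>sec Z (pr V')\<^esub> y) =
 D V' x \<otimes>\<^bsub>sec Z (pr V')\<^esub> y \<oplus>\<^bsub>sec Z (pr V')\<^esub> Z.tws (pr V') i x \<otimes>\<^bsub>sec Z (pr V')\<^esub> D V' y"
 "!!a. a \<in> W.Sc V' ==> D V' (com sg V' a) = d V' a" "!!j. j < n ==> D V' (th V' j) = res Z (pr V1) (pr V') (\<beta> j)"
 using q' by blast+
 have rr: "!!x. x \<in> Z.Sc (pr V) ==> res Z (pr V) (pr V') x \<in> Z.Sc (pr V')" using Z.res_closed ss by blast
 have bc: "\<beta> j \<in> Z.Sc (pr V1)" if "j < n" for j
 proof -
 interpret R: superring "sec Z (pr V1)" using Z.sring pre_open V1 by blast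
 show ?thesis using R.gr.g_closed beta[OF that] by blast
 qed
 from U(5) have "D V' (res Z (pr V) (pr V') a) = res Z (pr V) (pr V') (D V a)" unfolding V(2)
 proof (induction rule: gen_induct)
 case (base b)
 have "D V' (res Z (pr V) (pr V') (com sg V b)) = D V' (com sg V' (res W V V' b))"
 using com_res[OF V(1) V'(1) s(2) base] by simp
 also have "\<dots> = d V' (res W V V' b)" using q2(4) W.res_closed[OF V(1) V'(1) s(2) base] by simp
 also have "\<dots> = res Z (pr V) (pr V') (d V b)" using d_res[OF V(1) s(1) V'(1) s(2) base] .
 finally show ?case using q1(4)[OF base] by simp
 next
 case (mult x j)
 have jn: "j < n" using mult by simp
 have t: "res Z (pr V) (pr V') (th V j) = th V' j"
 using th_res[OF V(1) subset_trans[OF s(1) V1(2)] V'(1) s(2) jn] .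
 have "res Z (pr V) (pr V') (D V (th V j)) = D V' (th V' j)"
 using q1(5) q2(5) jn Z.res_res[OF pre_open[OF V1(1)] ss(1,2,3) pre_mono[OF s(1)] bc[OF jn]] by simp
 moreover have "D V (th V j) \<in> Z.Sc (pr V)" using q1(1)[of "th V j"] theta_closed[OF jn] by simp
 ultimately show ?case
 using mult q1(1)[of x] rr[of x] theta_closed[of j] odd_ext'.theta_closed[of j] t
 by (simp add: q1(3) q2(3) Z.res_mult[OF ss] Z.res_add[OF ss] Z.res_tw[OF ss])
 next
 case (add x y)
 then show ?case by (simp add: q1(1,2) q2(2) rr Z.res_add[OF ss])
 qed
 then show "v U' (res Z U U' a) = res Z U U' (v U a)"
 using v V V' s U rr by simp
 qed
 moreover have "v (pr V) (com sg V b) = d V b" if "W.opn V" "V <= V1" "b \<in> W.Sc V" for V b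
 using D[OF that(1,2), unfolded Q_def] that v com_closed by simp
 moreover have "v (pr V) (th V j) = res Z (pr V1) (pr V) (\<beta> j)" if V: "W.opn V" "V <= V1" and j: "j < n" for V j
 proof -
 interpret odd_ext "sec W V" "sec Z (pr V)" "com sg V" "th V" n using ext V V1 by blast
 show ?thesis using D[OF V, unfolded Q_def] v[OF V theta_closed[OF j]] j by simp
 qed
 ultimately show ?thesis by blast
qed

end

lemma (in sspace) T_neg_apply:
 assumes "opn U" "v \<in> carrier (T U)" "opn V" "V <= U" "a \<in> Sc V"
 shows "(\<ominus>\<^bsub>T U\<^esub> v) V a = \<ominus>\<^bsub>sec Z V\<^esub> v V a"
proof -
 interpret g: abelian_group "T U" using T_abelian_group assms by blast
 interpret R: superring "sec Z V" using sring assms by blast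
 have n: "\<ominus>\<^bsub>T U\<^esub> v \<in> carrier (T U)" using assms by blast
 have "(v \<oplus>\<^bsub>T U\<^esub> \<ominus>\<^bsub>T U\<^esub> v) V a = \<zero>\<^bsub>T U\<^esub> V a" using g.r_neg[OF assms(2)] by (simp only:)
 then have "v V a \<oplus>\<^bsub>sec Z V\<^esub> (\<ominus>\<^bsub>T U\<^esub> v) V a = \<zero>\<^bsub>sec Z V\<^esub>"
 using assms vf_add_apply by simp
 then show ?thesis using R.neg_unique T_apply(1)[OF assms(2-5)] T_apply(1)[OF n assms(3-5)] by blast
qed

subsection \<open>Partial derivatives\<close>

context frame
begin

definition pd :: "nat => ('z, 'a) vf" where
 "pd j = (SOME v. v \<in> hom_vf S0 Z (pr V0) 1 &
 (ALL V b. W.opn V --> V <= V0 --> b \<in> W.Sc V --> v (pr V) (com sg V b) = \<zero>\<^bsub>sec Z (pr V)\<^esub>) &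
 (ALL V i. W.opn V --> V <= V0 --> i < n -->
 v (pr V) (th V i) = (if i = j then \<one>\<^bsub>sec Z (pr V)\<^esub> else \<zero>\<^bsub>sec Z (pr V)\<^esub>)))"

lemma pd_exists:
 "pd j \<in> hom_vf S0 Z (pr V0) 1 &
 (ALL V b. W.opn V --> V <= V0 --> b \<in> W.Sc V --> pd j (pr V) (com sg V b) = \<zero>\<^bsub>sec Z (pr V)\<^esub>) &
 (ALL V i. W.opn V --> V <= V0 --> i < n -->
 pd j (pr V) (th V i) = (if i = j then \<one>\<^bsub>sec Z (pr V)\<^esub> else \<zero>\<^bsub>sec Z (pr V)\<^esub>))"
proof -
 let ?b = "\<lambda>i. if i = j then \<one>\<^bsub>sec Z (pr V0)\<^esub> else \<zero>\<^bsub>sec Z (pr V0)\<^esub>"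
 have R: "superring (sec Z (pr V))" if "W.opn V" for V using Z.sring pre_open that by blast
 have "\<exists>v\<in>hom_vf S0 Z (pr V0) 1. (ALL V b. W.opn V --> V <= V0 --> b \<in> W.Sc V --> v (pr V) (com sg V b) = \<zero>\<^bsub>sec Z (pr V)\<^esub>) &
 (ALL V i. W.opn V --> V <= V0 --> i < n --> v (pr V) (th V i) = res Z (pr V0) (pr V) (?b i))"
 proof (rule vf_extension[OF V0 order_refl])
 fix i assume "i < n"
 interpret R: superring "sec Z (pr V0)" using R V0 .
 have "?b i \<in> gr (sec Z (pr V0)) 0" using R.one_even by auto
 then show "?b i \<in> gr (sec Z (pr V0)) (1 + 1)" unfolding bit_add_self .
 next
 fix V V' assume V: "W.opn V" "W.opn V'" "V' <= V"
 show "\<zero>\<^bsub>sec Z (pr V')\<^esub> = res Z (pr V) (pr V') \<zero>\<^bsub>sec Z (pr V)\<^esub>"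
 using Z.res_zero[OF pre_open[OF V(1)] pre_open[OF V(2)] pre_mono[OF V(3)]] by simp
 next
 fix V assume V: "W.opn V"
 interpret R: superring "sec Z (pr V)" using R V .
 show "\<zero>\<^bsub>sec Z (pr V)\<^esub> \<in> Z.Sc (pr V)" "\<zero>\<^bsub>sec Z (pr V)\<^esub> = \<zero>\<^bsub>sec Z (pr V)\<^esub> \<oplus>\<^bsub>sec Z (pr V)\<^esub> \<zero>\<^bsub>sec Z (pr V)\<^esub>"
 "\<zero>\<^bsub>sec Z (pr V)\<^esub> \<in> gr (sec Z (pr V)) i" "\<zero>\<^bsub>sec Z (pr V)\<^esub> = \<zero>\<^bsub>sec Z (pr V)\<^esub>" for i by simp_all
 fix a b assume "a \<in> W.Sc V" "b \<in> W.Sc V"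
 then show "\<zero>\<^bsub>sec Z (pr V)\<^esub> = \<zero>\<^bsub>sec Z (pr V)\<^esub> \<otimes>\<^bsub>sec Z (pr V)\<^esub> com sg V b \<oplus>\<^bsub>sec Z (pr V)\<^esub>
 Z.tws (pr V) 1 (com sg V a) \<otimes>\<^bsub>sec Z (pr V)\<^esub> \<zero>\<^bsub>sec Z (pr V)\<^esub>"
 using com_closed[OF V] by simp
 qed
 then obtain v where v: "v \<in> hom_vf S0 Z (pr V0) 1"
 "ALL V b. W.opn V --> V <= V0 --> b \<in> W.Sc V --> v (pr V) (com sg V b) = \<zero>\<^bsub>sec Z (pr V)\<^esub>"
 "!!V i. W.opn V ==> V <= V0 ==> i < n ==> v (pr V) (th V i) = res Z (pr V0) (pr V) (?b i)" by blast
 have "res Z (pr V0) (pr V) (?b i) = (if i = j then \<one>\<^bsub>sec Z (pr V)\<^esub> else \<zero>\<^bsub>sec Z (pr V)\<^esub>)"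
 if "W.opn V" "V <= V0" for V i
 using Z.res_one[OF pre_open[OF V0] pre_open[OF that(1)] pre_mono[OF that(2)]]
 Z.res_zero[OF pre_open[OF V0] pre_open[OF that(1)] pre_mono[OF that(2)]] by simp
 with v have "EX v. v \<in> hom_vf S0 Z (pr V0) 1 &
 (ALL V b. W.opn V --> V <= V0 --> b \<in> W.Sc V --> v (pr V) (com sg V b) = \<zero>\<^bsub>sec Z (pr V)\<^esub>) &
 (ALL V i. W.opn V --> V <= V0 --> i < n -->
 v (pr V) (th V i) = (if i = j then \<one>\<^bsub>sec Z (pr V)\<^esub> else \<zero>\<^bsub>sec Z (pr V)\<^esub>))"
 by (intro exI[of _ v] conjI) simp_all
 from someI_ex[OF this] show ?thesis unfolding pd_def .
qed

lemma pd_hom: "pd j \<in> hom_vf S0 Z (pr V0) 1"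
 using pd_exists by blast

lemma pd_com: "W.opn V ==> V <= V0 ==> b \<in> W.Sc V ==> pd j (pr V) (com sg V b) = \<zero>\<^bsub>sec Z (pr V)\<^esub>"
 using pd_exists by blast

lemma pd_th: "W.opn V ==> V <= V0 ==> i < n ==>
 pd j (pr V) (th V i) = (if i = j then \<one>\<^bsub>sec Z (pr V)\<^esub> else \<zero>\<^bsub>sec Z (pr V)\<^esub>)"
 using pd_exists[of j, THEN conjunct2, THEN conjunct2] by blast

lemma pd_anti:
 assumes V: "W.opn V" "V <= V0" and a: "a \<in> Z.Sc (pr V)"
 shows "pd i (pr V) (pd j (pr V) a) = \<ominus>\<^bsub>sec Z (pr V)\<^esub> pd j (pr V) (pd i (pr V) a)"
proof -
 interpret odd_ext "sec W V" "sec Z (pr V)" "com sg V" "th V" n using ext V by blast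
 let ?t = "Z.tws (pr V) 1"
 note d = Z.hom_vf_apply[OF pd_hom pre_open[OF V(1)] pre_mono[OF V(2)]]
 have tw: "?t (pd k (pr V) x) = \<ominus>\<^bsub>sec Z (pr V)\<^esub> pd k (pr V) (?t x)" if "x \<in> Z.Sc (pr V)" for k x
 using Z.hom_vf_tw[OF pd_hom pre_open[OF V(1)] pre_mono[OF V(2)] that, of 1] by (simp add: ksgn_def)
 from a show ?thesis
 proof (induction rule: gen_induct)
 case (base b)
 then show ?case using pd_com[OF V] d(6) by simp
 next
 case (mult x k)
 have tk: "th V k \<in> Z.Sc (pr V)" using mult theta_closed by blast
 have c: "pd i (pr V) x \<in> Z.Sc (pr V)" "pd j (pr V) x \<in> Z.Sc (pr V)" "?t x \<in> Z.Sc (pr V)"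
 "pd i (pr V) (?t x) \<in> Z.Sc (pr V)" "pd j (pr V) (?t x) \<in> Z.Sc (pr V)"
 "pd i (pr V) (pd j (pr V) x) \<in> Z.Sc (pr V)" "pd j (pr V) (pd i (pr V) x) \<in> Z.Sc (pr V)"
 "pd j (pr V) (pd i (pr V) x) \<otimes>\<^bsub>sec Z (pr V)\<^esub> th V k \<in> Z.Sc (pr V)"
 using mult d(1) tk by auto
 have 1: "pd l (pr V) (x \<otimes>\<^bsub>sec Z (pr V)\<^esub> th V k) = pd l (pr V) x \<otimes>\<^bsub>sec Z (pr V)\<^esub> th V k \<oplus>\<^bsub>sec Z (pr V)\<^esub>
 (if k = l then ?t x else \<zero>\<^bsub>sec Z (pr V)\<^esub>)" if "x \<in> Z.Sc (pr V)" for l x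
 using that tk mult pd_th[OF V, of k l] by (simp add: d(4))
 have 2: "pd l (pr V) (pd m (pr V) (x \<otimes>\<^bsub>sec Z (pr V)\<^esub> th V k)) =
 pd l (pr V) (pd m (pr V) x) \<otimes>\<^bsub>sec Z (pr V)\<^esub> th V k \<oplus>\<^bsub>sec Z (pr V)\<^esub>
 (if k = l then \<ominus>\<^bsub>sec Z (pr V)\<^esub> pd m (pr V) (?t x) else \<zero>\<^bsub>sec Z (pr V)\<^esub>) \<oplus>\<^bsub>sec Z (pr V)\<^esub>
 (if k = m then pd l (pr V) (?t x) else \<zero>\<^bsub>sec Z (pr V)\<^esub>)" for l m
 using mult(1) tk d(1)[of x m] by (auto simp: 1 d(2,6) tw d(1))
 have "pd i (pr V) (pd j (pr V) x) \<otimes>\<^bsub>sec Z (pr V)\<^esub> th V k =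
 \<ominus>\<^bsub>sec Z (pr V)\<^esub> (pd j (pr V) (pd i (pr V) x) \<otimes>\<^bsub>sec Z (pr V)\<^esub> th V k)"
 unfolding mult.IH using c tk by (simp add: B.l_minus)
 then show ?case unfolding 2 using c tk
 by (auto simp: B.l_minus B.minus_add B.minus_minus B.a_ac)
 next
 case (add x y)
 then show ?case using d(1) by (simp add: d(2) B.minus_add)
 qed
qed

lemma oring: "W.opn V ==> V <= V0 ==> odd_ring (sec Z (pr V)) (th V) (\<lambda>j. pd j (pr V)) n"
proof -
 assume V: "W.opn V" "V <= V0"
 interpret odd_ext "sec W V" "sec Z (pr V)" "com sg V" "th V" n using ext V by blast
 note d = Z.hom_vf_apply[OF pd_hom pre_open[OF V(1)] pre_mono[OF V(2)]]
 show ?thesis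
 by unfold_locales (rule theta_odd half d(1-4) pd_th[OF V] pd_anti[OF V]; assumption)+
qed

abbreviation pdd :: "'w set => nat => ('z, 'a) vf" where "pdd V j \<equiv> vf_ext Z (pr V) (pd j)"

lemma pdd_hom: "V <= V0 ==> pdd V j \<in> hom_vf S0 Z (pr V) 1"
 using Z.hom_vf_restrict[OF pd_hom pre_mono] .

lemma pdd_vertical: "W.opn V ==> V <= V0 ==> pdd V j \<in> vertical S0 Z W sg (pr V)"
proof (rule verticalI[OF pre_open Z.hom_vf_in_T[OF pdd_hom]])
 fix V' b assume V: "W.opn V" "V <= V0" "W.opn V'" "pr V' <= pr V" "b \<in> W.Sc V'"
 then have "V' <= V0" using pre_subset_iff by blast
 then show "pdd V j (pr V') (com sg V' b) = \<zero>\<^bsub>sec Z (pr V')\<^esub>"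
 using V pre_open com_closed pd_com by simp
qed

lemma pdd_bracket: "W.opn V ==> V <= V0 ==> vf_bracket Z (pr V) 1 1 (pdd V i) (pdd V j) = \<zero>\<^bsub>Z.T (pr V)\<^esub>"
proof (rule Z.vf_eqI)
 fix U a assume V: "W.opn V" "V <= V0" and U: "Z.opn U" "U <= pr V" "a \<in> Z.Sc U"
 obtain V' where V': "W.opn V'" "U = pr V'" using open_pre_cases[OF U(1)] by blast
 have s: "V' <= V0" using pre_subset_iff V V' U by blast
 interpret R: superring "sec Z U" using Z.sring U by blast
 have c: "pd k U a \<in> Z.Sc U" for k
 using Z.hom_vf_apply(1)[OF pd_hom pre_open[OF V'(1)] pre_mono[OF s]] U V' by simp
 have cc: "pd k U (pd l U a) \<in> Z.Sc U" for k l
 using Z.hom_vf_apply(1)[OF pd_hom pre_open[OF V'(1)] pre_mono[OF s]] c V' by simp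
 have "pd i U (pd j U a) = \<ominus>\<^bsub>sec Z U\<^esub> pd j U (pd i U a)"
 unfolding V'(2) by (rule pd_anti[OF V'(1) s U(3)[unfolded V'(2)]])
 then show "vf_bracket Z (pr V) 1 1 (pdd V i) (pdd V j) U a = \<zero>\<^bsub>Z.T (pr V)\<^esub> U a"
 using U c cc by (simp add: Z.bracket_apply ksgn_def a_minus_def R.minus_minus R.l_neg)
qed (simp_all add: vf_bracket_def)

subsection \<open>Lifts\<close>

lemma lift_exists:
 assumes V: "W.opn V" "V <= V0" and v: "v \<in> hom_vf S0 W V i"
 shows "\<exists>v'\<in>hom_vf S0 Z (pr V) i. local_lift S0 Z W sg V v (pr V) v'"
proof -
 have R: "superring (sec Z (pr V))" if "W.opn V" for V using Z.sring pre_open that by blast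
 have "\<exists>v'\<in>hom_vf S0 Z (pr V) i. (ALL V' b. W.opn V' --> V' <= V --> b \<in> W.Sc V' --> v' (pr V') (com sg V' b) = com sg V' (v V' b)) &
 (ALL V' j. W.opn V' --> V' <= V --> j < n --> v' (pr V') (th V' j) = res Z (pr V) (pr V') \<zero>\<^bsub>sec Z (pr V)\<^esub>)"
 proof (rule vf_extension[OF V])
 fix V' assume V': "W.opn V'" "V' <= V"
 note d = W.hom_vf_apply[OF v V']
 fix a b assume ab: "a \<in> W.Sc V'" "b \<in> W.Sc V'"
 interpret S: superring "sec W V'" using W.sring V' by blast
 show "com sg V' (v V' b) \<in> Z.Sc (pr V')" using d(1) com_closed V' ab by blast
 show "com sg V' (v V' (a \<oplus>\<^bsub>sec W V'\<^esub> b)) = com sg V' (v V' a) \<oplus>\<^bsub>sec Z (pr V')\<^esub> com sg V' (v V' b)"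
 using d(1) V' ab by (simp add: d(2) com_add)
 show "com sg V' (v V' (a \<otimes>\<^bsub>sec W V'\<^esub> b)) = com sg V' (v V' a) \<otimes>\<^bsub>sec Z (pr V')\<^esub> com sg V' b \<oplus>\<^bsub>sec Z (pr V')\<^esub>
 Z.tws (pr V') i (com sg V' a) \<otimes>\<^bsub>sec Z (pr V')\<^esub> com sg V' (v V' b)"
 using d(1) V' ab by (simp add: d(4) com_add com_mult com_tw)
 next
 fix V' j b assume V': "W.opn V'" "V' <= V" "b \<in> gr (sec W V') j"
 show "com sg V' (v V' b) \<in> gr (sec Z (pr V')) (i + j)"
 using com_gr[OF V'(1) W.hom_vf_apply(3)[OF v V']] .
 next
 fix V' V'' b assume V': "W.opn V'" "V' <= V" "W.opn V''" "V'' <= V'" "b \<in> W.Sc V'"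
 show "com sg V'' (v V'' (res W V' V'' b)) = res Z (pr V') (pr V'') (com sg V' (v V' b))"
 using W.hom_vf_res[OF v V'(1,3,4,2,5)] com_res[OF V'(1,3,4) W.hom_vf_apply(1)[OF v V'(1,2,5)]] by simp
 next
 fix V' l assume V': "W.opn V'" "V' <= V" "l \<in> carrier S0"
 then show "com sg V' (v V' (base (sec W V') l)) = \<zero>\<^bsub>sec Z (pr V')\<^esub>"
 using W.hom_vf_apply(5)[OF v V'] com_zero by simp
 next
 fix j assume "j < n"
 interpret R: superring "sec Z (pr V)" using R V by blast
 show "\<zero>\<^bsub>sec Z (pr V)\<^esub> \<in> gr (sec Z (pr V)) (i + 1)" by simp
 qed
 then obtain v' where v': "v' \<in> hom_vf S0 Z (pr V) i"
 "ALL V' b. W.opn V' --> V' <= V --> b \<in> W.Sc V' --> v' (pr V') (com sg V' b) = com sg V' (v V' b)" by blast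
 have "local_lift S0 Z W sg V v (pr V) v'"
 using v' pre_subset_iff
 by (intro local_liftI[OF V(1) W.hom_vf_in_T[OF v] pre_open[OF V(1)] order_refl Z.hom_vf_in_T[OF v'(1)]]) blast
 then show ?thesis using v' by blast
qed

end

context osub
begin

lemma lift_near:
 assumes V: "W.opn V" and z: "z \<in> pr V"
 shows "EX V'. W.opn V' & V' <= V & z \<in> pr V' &
 (ALL i. \<forall>v\<in>hom_vf S0 W V i. \<exists>v'\<in>hom_vf S0 Z (pr V') i. local_lift S0 Z W sg V v (pr V') v')"
proof -
 have "pt sg z \<in> topspace (space W)" using z V openin_subset by (fastforce simp: pre_def)
 then obtain V0 et n where f: "pt sg z \<in> V0" "frame S0 Z W sg V0 et n" using frame_exists by blast
 interpret frame S0 Z W sg V0 et n by (rule f)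
 let ?V = "V \<inter> V0"
 have o: "W.opn ?V" using V V0 by blast
 have "\<exists>v'\<in>hom_vf S0 Z (pr ?V) i. local_lift S0 Z W sg V v (pr ?V) v'" if v: "v \<in> hom_vf S0 W V i" for i v
 proof -
 have r: "vf_ext W ?V v \<in> hom_vf S0 W ?V i" using W.hom_vf_restrict[OF v] by blast
 obtain v' where v': "v' \<in> hom_vf S0 Z (pr ?V) i" "local_lift S0 Z W sg ?V (vf_ext W ?V v) (pr ?V) v'"
 using lift_exists[OF o _ r] by blast
 note d = local_liftD[OF v'(2) o]
 have "local_lift S0 Z W sg V v (pr ?V) v'"
 proof (rule local_liftI[OF V W.hom_vf_in_T[OF v] d(1) _ d(3)])
 show "pr ?V <= pr V" by (rule pre_mono) blast
 fix V' b assume V': "W.opn V'" "pr V' <= pr ?V" "b \<in> W.Sc V'"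
 have "V' <= ?V" using pre_subset_iff[OF V'(1,2)] .
 then show "v' (pr V') (com sg V' b) = com sg V' (v V' b)"
 using d(4)[OF V' W.hom_vf_in_T[OF r]] V' by simp
 qed
 then show ?thesis using v' by blast
 qed
 moreover have "z \<in> pr ?V" using z f by (auto simp: pre_def)
 ultimately show ?thesis using o by blast
qed

lemma local_lift_add:
 assumes V: "W.opn V" "v \<in> carrier (W.T V)" "w \<in> carrier (W.T V)"
 and l: "local_lift S0 Z W sg V v U v'" "local_lift S0 Z W sg V w U w'"
 shows "local_lift S0 Z W sg V (v \<oplus>\<^bsub>W.T V\<^esub> w) U (v' \<oplus>\<^bsub>Z.T U\<^esub> w')"
proof -
 note d = local_liftD[OF l(1) V(1)] and e = local_liftD[OF l(2) V(1)]
 show ?thesis unfolding W.tangent_simps Z.tangent_simps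
 proof (rule local_liftI[OF V(1) W.T_add_closed[OF V] d(1,2) Z.T_add_closed[OF d(1,3) e(3)]])
 fix V' b assume V': "W.opn V'" "pr V' <= U" "b \<in> W.Sc V'"
 have s: "V' <= V" using pre_subset_iff[OF V'(1)] V' d(2) by blast
 show "vf_add Z U v' w' (pr V') (com sg V' b) = com sg V' (vf_add W V v w V' b)"
 using V' s d(4)[OF V' V(2)] e(4)[OF V' V(3)] pre_open com_closed
 W.T_apply(1)[OF V(2) V'(1) s] W.T_apply(1)[OF V(3) V'(1) s]
 by (simp add: Z.vf_add_apply W.vf_add_apply com_add)
 qed
qed

lemma lift_near':
 assumes V: "W.opn V" and v: "v \<in> carrier (W.T V)" and z: "z \<in> pr V"
 shows "EX U v'. z \<in> U & local_lift S0 Z W sg V v U v'"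
proof -
 obtain V' where V': "W.opn V'" "z \<in> pr V'"
 "!!i v. v \<in> hom_vf S0 W V i ==> \<exists>v'\<in>hom_vf S0 Z (pr V') i. local_lift S0 Z W sg V v (pr V') v'"
 using lift_near[OF V z] by blast
 note p = W.Tpart_in[OF V v]
 obtain v0 v1 where l: "local_lift S0 Z W sg V (W.Tpart V 0 v) (pr V') v0" "local_lift S0 Z W sg V (W.Tpart V 1 v) (pr V') v1"
 using V'(3)[OF p[of 0]] V'(3)[OF p[of 1]] by blast
 have "W.Tpart V 0 v \<oplus>\<^bsub>W.T V\<^esub> W.Tpart V 1 v = v" using graded_group.part_sum01[OF W.T_graded[OF V] v] .
 then have "local_lift S0 Z W sg V v (pr V') (v0 \<oplus>\<^bsub>Z.T (pr V')\<^esub> v1)"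
 using local_lift_add[OF V W.hom_vf_in_T[OF p] W.hom_vf_in_T[OF p] l] by (simp only:)
 then show ?thesis using V' by blast
qed

lemma local_lift_smult:
 assumes V: "W.opn V" "v \<in> carrier (W.T V)" "b \<in> W.Sc V" and l: "local_lift S0 Z W sg V v U v'"
 shows "local_lift S0 Z W sg V (b \<odot>\<^bsub>W.T V\<^esub> v) U (res Z (pr V) U (com sg V b) \<odot>\<^bsub>Z.T U\<^esub> v')"
proof -
 note d = local_liftD[OF l V(1)]
 have c: "res Z (pr V) U (com sg V b) \<in> Z.Sc U" using Z.res_closed[OF pre_open d(1,2)] com_closed V by blast
 show ?thesis
 proof (rule local_liftI[OF V(1) W.T_smult_closed[OF V(1,3,2)] d(1,2) Z.T_smult_closed[OF d(1) c d(3)]])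
 fix V' x assume V': "W.opn V'" "pr V' <= U" "x \<in> W.Sc V'"
 have s: "V' <= V" using pre_subset_iff[OF V'(1)] V' d(2) by blast
 have "res Z U (pr V') (res Z (pr V) U (com sg V b)) = com sg V' (res W V V' b)"
 using Z.res_res[OF pre_open[OF V(1)] d(1) pre_open[OF V'(1)] V'(2) d(2) com_closed[OF V(1,3)]]
 com_res[OF V(1) V'(1) s V(3)] by simp
 then show "(res Z (pr V) U (com sg V b) \<odot>\<^bsub>Z.T U\<^esub> v') (pr V') (com sg V' x) = com sg V' ((b \<odot>\<^bsub>W.T V\<^esub> v) V' x)"
 using V' s d(4)[OF V' V(2)] pre_open com_closed W.res_closed[OF V(1) V'(1) s V(3)]
 W.T_apply(1)[OF V(2) V'(1) s] by (simp add: com_mult)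
 qed
qed

lemma local_lift_bracket:
 assumes V: "W.opn V" and v: "v \<in> hom_vf S0 W V i" "w \<in> hom_vf S0 W V j"
 and v': "v' \<in> hom_vf S0 Z U i" "w' \<in> hom_vf S0 Z U j"
 and l: "local_lift S0 Z W sg V v U v'" "local_lift S0 Z W sg V w U w'"
 shows "local_lift S0 Z W sg V (vf_bracket W V i j v w) U (vf_bracket Z U i j v' w')"
proof -
 note d = local_liftD[OF l(1) V] and e = local_liftD[OF l(2) V]
 note vT = W.hom_vf_in_T[OF v(1)] and wT = W.hom_vf_in_T[OF v(2)]
 show ?thesis
 proof (rule local_liftI[OF V W.hom_vf_in_T[OF W.bracket_hom_vf[OF v]] d(1,2) Z.hom_vf_in_T[OF Z.bracket_hom_vf[OF v']]])
 fix V' b assume V': "W.opn V'" "pr V' <= U" and b: "b \<in> W.Sc V'"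
 have s: "V' <= V" using pre_subset_iff[OF V'(1)] V' d(2) by blast
 interpret S: superring "sec W V'" using W.sring V' by blast
 have c: "v V' b \<in> W.Sc V'" "w V' b \<in> W.Sc V'" "v V' (w V' b) \<in> W.Sc V'" "w V' (v V' b) \<in> W.Sc V'"
 using W.T_apply(1)[OF vT V'(1) s] W.T_apply(1)[OF wT V'(1) s] b by auto
 have neg: "com sg V' (\<ominus>\<^bsub>sec W V'\<^esub> x) = \<ominus>\<^bsub>sec Z (pr V')\<^esub> com sg V' x" if "x \<in> W.Sc V'" for x
 using superring_hom_part(2)[OF W.sring Z.sring com_shom that] pre_open V' by blast
 show "vf_bracket Z U i j v' w' (pr V') (com sg V' b) = com sg V' (vf_bracket W V i j v w V' b)"
 using V' s b c d(4)[OF V' b vT] d(4)[OF V' c(2) vT] e(4)[OF V' b wT] e(4)[OF V' c(1) wT] pre_open com_closed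
 by (simp add: Z.bracket_apply W.bracket_apply a_minus_def com_add com_ksgn neg)
 qed
qed

lemma lift_difference_vertical:
 assumes V: "W.opn V" "v \<in> carrier (W.T V)"
 and l: "local_lift S0 Z W sg V v U v'" "local_lift S0 Z W sg V v U v''"
 shows "v' \<ominus>\<^bsub>Z.T U\<^esub> v'' \<in> vertical S0 Z W sg U"
proof -
 note d = local_liftD[OF l(1) V(1)] and e = local_liftD[OF l(2) V(1)]
 interpret g: abelian_group "Z.T U" using Z.T_abelian_group d by blast
 show ?thesis
 proof (rule verticalI[OF d(1) g.minus_closed[OF d(3) e(3)]])
 fix V' b assume V': "W.opn V'" "pr V' <= U" "b \<in> W.Sc V'"
 interpret R: superring "sec Z (pr V')" using Z.sring pre_open V' by blast
 have c: "com sg V' b \<in> Z.Sc (pr V')" using com_closed V' by blast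
 have "(v' \<ominus>\<^bsub>Z.T U\<^esub> v'') (pr V') (com sg V' b) = v' (pr V') (com sg V' b) \<oplus>\<^bsub>sec Z (pr V')\<^esub> (\<ominus>\<^bsub>Z.T U\<^esub> v'') (pr V') (com sg V' b)"
 using V' c pre_open Z.vf_add_apply by (simp add: a_minus_def)
 also have "\<dots> = v'' (pr V') (com sg V' b) \<oplus>\<^bsub>sec Z (pr V')\<^esub> \<ominus>\<^bsub>sec Z (pr V')\<^esub> v'' (pr V') (com sg V' b)"
 using Z.T_neg_apply[OF d(1) e(3) pre_open[OF V'(1)] V'(2) c] d(4)[OF V' V(2)] e(4)[OF V' V(2)] by simp
 also have "\<dots> = \<zero>\<^bsub>sec Z (pr V')\<^esub>" using Z.T_apply(1)[OF e(3) pre_open[OF V'(1)] V'(2) c] by (rule R.r_neg)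
 finally show "(v' \<ominus>\<^bsub>Z.T U\<^esub> v'') (pr V') (com sg V' b) = \<zero>\<^bsub>sec Z (pr V')\<^esub>" .
 qed
qed

lemma vertical_bracket_lift:
 assumes U: "Z.opn U" and V: "W.opn V" and v: "v \<in> hom_vf S0 W V j" and v': "v' \<in> hom_vf S0 Z U j"
 and l: "local_lift S0 Z W sg V v U v'" and u: "u \<in> hom_vf S0 Z U i" "u \<in> vertical S0 Z W sg U"
 shows "vf_bracket Z U i j u v' \<in> vertical S0 Z W sg U"
proof (rule verticalI[OF U Z.hom_vf_in_T[OF Z.bracket_hom_vf[OF u(1) v']]])
 fix V' b assume V': "W.opn V'" "pr V' <= U" and b: "b \<in> W.Sc V'"
 interpret R: superring "sec Z (pr V')" using Z.sring pre_open V' by blast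
 note d = local_liftD[OF l V]
 have s: "V' <= V" using pre_subset_iff[OF V'(1)] V' d(2) by blast
 have c: "v V' b \<in> W.Sc V'" using W.hom_vf_apply(1)[OF v V'(1) s b] .
 show "vf_bracket Z U i j u v' (pr V') (com sg V' b) = \<zero>\<^bsub>sec Z (pr V')\<^esub>"
 using V' b c pre_open com_closed verticalD(2)[OF u(2) V' b] verticalD(2)[OF u(2) V' c] d(4)[OF V' b W.hom_vf_in_T[OF v]]
 Z.hom_vf_apply(6)[OF v' pre_open[OF V'(1)] V'(2)]
 by (simp add: Z.bracket_apply ksgn_def a_minus_def)
qed

end

section \<open>The functor\<close>

lemma (in dmodl) gr_local:
 assumes U: "opn U" and m: "m \<in> Mc U"
 and loc: "!!x. x \<in> U ==> EX V. opn V & x \<in> V & V <= U & mres F U V m \<in> mgr (msec F V) i"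
 shows "m \<in> mgr (msec F U) i"
proof -
 interpret U: supmod "sec Z U" "msec F U" using smod U .
 have "mpart (msec F U) i m = m"
 proof (rule sheaf_eqI[OF msheaf U])
 fix x assume "x \<in> U"
 then obtain V where V: "opn V" "x \<in> V" "V <= U" "mres F U V m \<in> mgr (msec F V) i" using loc by blast
 interpret V: supmod "sec Z V" "msec F V" using smod V by blast
 have "mres F U V (mpart (msec F U) i m) = mres F U V m"
 using mres_part[OF U V(1,3) m, of i] V.M.part_of[OF V(4), of i] by (simp add: mpart_eq_hpart)
 then show "EX V. opn V & x \<in> V & V <= U & mres F U V (mpart (msec F U) i m) = mres F U V m" using V by blast
 qed (use m in \<open>auto simp: mpart_eq_hpart\<close>)
 then show ?thesis using U.M.part_in[OF m, of i] by (simp add: mpart_eq_hpart)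
qed

locale osubm = osub S0 Z W sg + F: dmodl S0 Z F
 for S0 :: "('l, complex) superalg" and Z :: "('z, 'a, 'l) superspace" and W :: "('w, 'b, 'l) superspace"
 and sg :: "('z, 'w, 'a, 'b) smor" and F :: "('z, 'a, 'm) dmod"
begin

abbreviation A :: "'z set => 'm set" where "A U \<equiv> ann_vertical S0 Z W sg F U"
abbreviation dp :: "('w, 'b, 'm) dmod" where "dp \<equiv> dplus S0 Z W sg F"

lemma ann_sec: "m \<in> A U ==> m \<in> F.Mc U"
 by (simp add: ann_vertical_def)

lemma annD: "m \<in> A U ==> Z.opn V ==> V <= U ==> v \<in> vertical S0 Z W sg V ==>
 conn F V v (mres F U V m) = \<zero>\<^bsub>msec F V\<^esub>"
 by (simp add: ann_vertical_def)

lemma annI: "m \<in> F.Mc U ==> (!!V v. Z.opn V ==> V <= U ==> v \<in> vertical S0 Z W sg V ==>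
 conn F V v (mres F U V m) = \<zero>\<^bsub>msec F V\<^esub>) ==> m \<in> A U"
 by (simp add: ann_vertical_def)

lemma ann_conn: "Z.opn U ==> m \<in> A U ==> v \<in> vertical S0 Z W sg U ==> conn F U v m = \<zero>\<^bsub>msec F U\<^esub>"
 using annD[of m U U v] F.mres_id[of U m] ann_sec by simp

lemma ann_res: "Z.opn U ==> Z.opn V ==> V <= U ==> m \<in> A U ==> mres F U V m \<in> A V"
proof (rule annI)
 assume U: "Z.opn U" "Z.opn V" "V <= U" and m: "m \<in> A U"
 show "mres F U V m \<in> F.Mc V" using F.mres_closed[OF U ann_sec[OF m]] .
 fix V' v assume V': "Z.opn V'" "V' <= V" "v \<in> vertical S0 Z W sg V'"
 then show "conn F V' v (mres F V V' (mres F U V m)) = \<zero>\<^bsub>msec F V'\<^esub>"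
 using F.mres_mres[OF U(1,2) V'(1,2) U(3) ann_sec[OF m]] annD[OF m V'(1) _ V'(3)] U by auto
qed

lemma ann_local:
 assumes U: "Z.opn U" and m: "m \<in> F.Mc U"
 and loc: "!!x. x \<in> U ==> EX V. Z.opn V & x \<in> V & V <= U & mres F U V m \<in> A V"
 shows "m \<in> A U"
proof (rule annI[OF m])
 fix V v assume V: "Z.opn V" "V <= U" and v: "v \<in> vertical S0 Z W sg V"
 note vT = verticalD(1)[OF v]
 have mV: "mres F U V m \<in> F.Mc V" using F.mres_closed[OF U V m] .
 interpret V: supmod "sec Z V" "msec F V" using F.smod V by blast
 show "conn F V v (mres F U V m) = \<zero>\<^bsub>msec F V\<^esub>"
 proof (rule sheaf_eqI[OF F.msheaf V(1) F.conn_closed[OF V(1) vT mV] V.M.zero_closed])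
 fix x assume x: "x \<in> V"
 then obtain V1 where V1: "Z.opn V1" "x \<in> V1" "V1 <= U" "mres F U V1 m \<in> A V1" using loc V by blast
 let ?V = "V1 \<inter> V"
 have o: "Z.opn ?V" "?V <= V" "?V <= V1" using V V1 by auto
 have r: "mres F V ?V (mres F U V m) = mres F V1 ?V (mres F U V1 m)"
 using F.mres_mres[OF U V(1) o(1,2) V(2) m] F.mres_mres[OF U V1(1) o(1,3) V1(3) m] by simp
 have "mres F V ?V (conn F V v (mres F U V m)) = conn F ?V (vf_ext Z ?V v) (mres F V ?V (mres F U V m))"
 using F.conn_res[OF V(1) o(1,2) vT mV] .
 also have "\<dots> = \<zero>\<^bsub>msec F ?V\<^esub>"
 unfolding r using annD[OF V1(4) o(1,3) vertical_restrict[OF V(1) o(1,2) v]] .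
 also have "\<dots> = mres F V ?V \<zero>\<^bsub>msec F V\<^esub>" using F.mres_zero[OF V(1) o(1,2)] by simp
 finally show "EX V'. Z.opn V' & x \<in> V' & V' <= V &
 mres F V V' (conn F V v (mres F U V m)) = mres F V V' \<zero>\<^bsub>msec F V\<^esub>"
 using o x V1 by blast
 qed
qed

lemma ann_zero: "Z.opn U ==> \<zero>\<^bsub>msec F U\<^esub> \<in> A U"
proof (rule annI)
 assume U: "Z.opn U"
 interpret U: supmod "sec Z U" "msec F U" using F.smod U by blast
 show "\<zero>\<^bsub>msec F U\<^esub> \<in> F.Mc U" by simp
 fix V v assume V: "Z.opn V" "V <= U" "v \<in> vertical S0 Z W sg V"
 then show "conn F V v (mres F U V \<zero>\<^bsub>msec F U\<^esub>) = \<zero>\<^bsub>msec F V\<^esub>"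
 using F.mres_zero[OF U V(1,2)] F.conn_zero[OF V(1) verticalD(1)[OF V(3)]] by simp
qed

lemma ann_add:
 assumes U: "Z.opn U" and m: "m \<in> A U" "m' \<in> A U"
 shows "m \<oplus>\<^bsub>msec F U\<^esub> m' \<in> A U"
proof (rule annI)
 interpret U: supmod "sec Z U" "msec F U" using F.smod U by blast
 show "m \<oplus>\<^bsub>msec F U\<^esub> m' \<in> F.Mc U" using m ann_sec by simp
 fix V v assume V: "Z.opn V" "V <= U" "v \<in> vertical S0 Z W sg V"
 interpret V: supmod "sec Z V" "msec F V" using F.smod V by blast
 show "conn F V v (mres F U V (m \<oplus>\<^bsub>msec F U\<^esub> m')) = \<zero>\<^bsub>msec F V\<^esub>"
 using F.mres_add[OF U V(1,2) ann_sec[OF m(1)] ann_sec[OF m(2)]]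
 F.conn_add[OF V(1) verticalD(1)[OF V(3)] F.mres_closed[OF U V(1,2) ann_sec[OF m(1)]] F.mres_closed[OF U V(1,2) ann_sec[OF m(2)]]]
 annD[OF m(1) V] annD[OF m(2) V] by simp
qed

lemma ann_smult:
 assumes V: "W.opn V" and b: "b \<in> W.Sc V" and m: "m \<in> A (pr V)"
 shows "com sg V b \<odot>\<^bsub>msec F (pr V)\<^esub> m \<in> A (pr V)"
proof (rule annI)
 note U = pre_open[OF V]
 interpret U: supmod "sec Z (pr V)" "msec F (pr V)" using F.smod U by blast
 have c: "com sg V b \<in> Z.Sc (pr V)" using com_closed V b by blast
 show "com sg V b \<odot>\<^bsub>msec F (pr V)\<^esub> m \<in> F.Mc (pr V)" using c m ann_sec by simp
 fix U1 v assume U1: "Z.opn U1" "U1 <= pr V" and v: "v \<in> vertical S0 Z W sg U1"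
 obtain V1 where V1: "W.opn V1" "U1 = pr V1" using open_pre_cases[OF U1(1)] by blast
 have s: "V1 <= V" using pre_subset_iff V1 U1 by blast
 interpret V: supmod "sec Z U1" "msec F U1" using F.smod U1 by blast
 let ?m = "mres F (pr V) U1 m" and ?b = "res Z (pr V) U1 (com sg V b)"
 have mm: "?m \<in> F.Mc U1" and bb: "?b \<in> Z.Sc U1"
 using F.mres_closed[OF U U1 ann_sec[OF m]] Z.res_closed[OF U U1 c] by auto
 have be: "?b = com sg V1 (res W V V1 b)" using com_res[OF V V1(1) s b] V1 by simp
 have br: "res W V V1 b \<in> W.Sc V1" using W.res_closed[OF V V1(1) s b] .
 have vT: "v \<in> carrier (Z.T U1)" using verticalD v by blast
 have 0: "conn F U1 (Z.Tpart U1 i v) (?b \<odot>\<^bsub>msec F U1\<^esub> ?m) = \<zero>\<^bsub>msec F U1\<^esub>" for i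
 proof -
 have pv: "Z.Tpart U1 i v \<in> vertical S0 Z W sg U1" using vertical_part[OF U1(1) v] .
 have "Z.Tpart U1 i v U1 ?b = \<zero>\<^bsub>sec Z U1\<^esub>"
 unfolding be using verticalD(2)[OF pv V1(1) _ br] V1 by simp
 moreover have "conn F U1 (Z.Tpart U1 i v) ?m = \<zero>\<^bsub>msec F U1\<^esub>" using annD[OF m U1 pv] .
 ultimately show ?thesis using F.conn_leibniz[OF U1(1) Z.Tpart_in[OF U1(1) vT] bb mm] mm bb by simp
 qed
 have "conn F U1 v (?b \<odot>\<^bsub>msec F U1\<^esub> ?m) = \<zero>\<^bsub>msec F U1\<^esub>"
 using F.conn_parts[OF U1(1) vT V.smult_closed[OF bb mm]] 0 by simp
 then show "conn F U1 v (mres F (pr V) U1 (com sg V b \<odot>\<^bsub>msec F (pr V)\<^esub> m)) = \<zero>\<^bsub>msec F U1\<^esub>"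
 using F.mres_smult[OF U U1 c ann_sec[OF m]] by simp
qed

lemma ann_neg:
 assumes U: "Z.opn U" and m: "m \<in> A U"
 shows "\<ominus>\<^bsub>msec F U\<^esub> m \<in> A U"
proof (rule annI)
 interpret U: supmod "sec Z U" "msec F U" using F.smod U by blast
 show n: "\<ominus>\<^bsub>msec F U\<^esub> m \<in> F.Mc U" using ann_sec m by simp
 fix V v assume V: "Z.opn V" "V <= U" "v \<in> vertical S0 Z W sg V"
 interpret V: supmod "sec Z V" "msec F V" using F.smod V by blast
 note vT = verticalD(1)[OF V(3)]
 have "\<zero>\<^bsub>msec F V\<^esub> = conn F V v (mres F U V m \<oplus>\<^bsub>msec F V\<^esub> mres F U V (\<ominus>\<^bsub>msec F U\<^esub> m))"
 using F.mres_add[OF U V(1,2) ann_sec[OF m] n] U.M.r_neg[OF ann_sec[OF m]] F.mres_zero[OF U V(1,2)]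
 F.conn_zero[OF V(1) vT] by simp
 also have "\<dots> = \<zero>\<^bsub>msec F V\<^esub> \<oplus>\<^bsub>msec F V\<^esub> conn F V v (mres F U V (\<ominus>\<^bsub>msec F U\<^esub> m))"
 using F.conn_add[OF V(1) vT F.mres_closed[OF U V(1,2) ann_sec[OF m]] F.mres_closed[OF U V(1,2) n]] annD[OF m V] by simp
 finally show "conn F V v (mres F U V (\<ominus>\<^bsub>msec F U\<^esub> m)) = \<zero>\<^bsub>msec F V\<^esub>"
 using F.conn_closed[OF V(1) vT F.mres_closed[OF U V(1,2) n]] by simp
qed

lemma ann_part:
 assumes U: "Z.opn U" and m: "m \<in> A U"
 shows "mpart (msec F U) k m \<in> A U"
proof (rule annI)
 interpret U: supmod "sec Z U" "msec F U" using F.smod U by blast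
 note mU = ann_sec[OF m]
 show "mpart (msec F U) k m \<in> F.Mc U" using mU by (simp add: mpart_eq_hpart)
 fix V v assume V: "Z.opn V" "V <= U" and v: "v \<in> vertical S0 Z W sg V"
 interpret V: supmod "sec Z V" "msec F V" using F.smod V by blast
 let ?m = "mres F U V m"
 have mV: "?m \<in> F.Mc V" using F.mres_closed[OF U V mU] .
 have vT: "v \<in> carrier (Z.T V)" using verticalD v by blast
 have 0: "conn F V (Z.Tpart V i v) (V.M.prt k ?m) = \<zero>\<^bsub>msec F V\<^esub>" for i
 proof -
 note pi = Z.Tpart_in[OF V(1) vT, of i]
 let ?c = "\<lambda>k. conn F V (Z.Tpart V i v) (V.M.prt k ?m)"
 have g: "?c l \<in> mgr (msec F V) (i + l)" for l using F.conn_gr[OF V(1) pi V.M.part_in[OF mV]] .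
 have "?c k \<oplus>\<^bsub>msec F V\<^esub> ?c (k + 1) = conn F V (Z.Tpart V i v) ?m"
 using F.conn_add[OF V(1) Z.hom_vf_in_T[OF pi] V.M.part_closed[OF mV] V.M.part_closed[OF mV], of k "k + 1"]
 V.M.part_sum[OF mV, of k] by (simp only:)
 also have "\<dots> = \<zero>\<^bsub>msec F V\<^esub> \<oplus>\<^bsub>msec F V\<^esub> \<zero>\<^bsub>msec F V\<^esub>"
 using annD[OF m V vertical_part[OF V(1) v]] by simp
 finally show ?thesis
 using V.M.parts_unique[OF g[of k] _ V.M.g_zero V.M.g_zero, of "?c (k + 1)"] g[of "k + 1"]
 by (simp only: add.assoc)
 qed
 have "conn F V v (V.M.prt k ?m) = \<zero>\<^bsub>msec F V\<^esub>"
 using F.conn_parts[OF V(1) vT V.M.part_closed[OF mV, of k]] 0 by simp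
 then show "conn F V v (mres F U V (mpart (msec F U) k m)) = \<zero>\<^bsub>msec F V\<^esub>"
 using F.mres_part[OF U V mU, of k] by (simp add: mpart_eq_hpart)
qed

subsection \<open>The action of vector fields\<close>

lemma conn_lift_ann0:
 assumes V: "W.opn V" "v \<in> carrier (W.T V)" and l: "local_lift S0 Z W sg V v U v'" and m: "m \<in> A U"
 and u: "u \<in> vertical S0 Z W sg U"
 shows "conn F U u (conn F U v' m) = \<zero>\<^bsub>msec F U\<^esub>"
proof -
 note d = local_liftD[OF l V(1)]
 note U = d(1) and mU = ann_sec[OF m]
 interpret U: supmod "sec Z U" "msec F U" using F.smod U by blast
 have uT: "u \<in> carrier (Z.T U)" using verticalD u by blast
 have 0: "conn F U (Z.Tpart U i u) (conn F U (Z.Tpart U j v') m) = \<zero>\<^bsub>msec F U\<^esub>" for i j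
 proof -
 note p = Z.Tpart_in[OF U uT, of i] Z.Tpart_in[OF U d(3), of j] W.Tpart_in[OF V, of j]
 have pu: "Z.Tpart U i u \<in> vertical S0 Z W sg U" using vertical_part[OF U u] .
 have b: "vf_bracket Z U i j (Z.Tpart U i u) (Z.Tpart U j v') \<in> vertical S0 Z W sg U"
 using vertical_bracket_lift[OF U V(1) p(3) p(2) local_lift_part[OF V l] p(1) pu] .
 let ?x = "conn F U (Z.Tpart U i u) (conn F U (Z.Tpart U j v') m)"
 have "\<zero>\<^bsub>msec F U\<^esub> = ?x \<ominus>\<^bsub>msec F U\<^esub> ksgn (msec F U) i j (conn F U (Z.Tpart U j v') (conn F U (Z.Tpart U i u) m))"
 using F.conn_bracket[OF U p(1,2) mU] ann_conn[OF U m b] by simp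
 also have "\<dots> = ?x"
 using ann_conn[OF U m pu] F.conn_zero[OF U Z.hom_vf_in_T[OF p(2)]]
 F.conn_closed[OF U Z.hom_vf_in_T[OF p(1)] F.conn_closed[OF U Z.hom_vf_in_T[OF p(2)] mU]]
 by (simp add: ksgn_def a_minus_def)
 finally show ?thesis by simp
 qed
 have c: "conn F U (Z.Tpart U j v') m \<in> F.Mc U" for j
 using F.conn_closed[OF U Z.hom_vf_in_T[OF Z.Tpart_in[OF U d(3)]] mU] .
 have 1: "conn F U u (conn F U (Z.Tpart U j v') m) = \<zero>\<^bsub>msec F U\<^esub>" for j
 using F.conn_parts[OF U uT c] 0 by simp
 show ?thesis
 using F.conn_parts[OF U d(3) mU] F.conn_add[OF U uT c c, of 0 1] 1 by simp
qed

lemma conn_lift_ann: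
 assumes V: "W.opn V" "v \<in> carrier (W.T V)" and l: "local_lift S0 Z W sg V v U v'" and m: "m \<in> A U"
 shows "conn F U v' m \<in> A U"
proof -
 note d = local_liftD[OF l V(1)]
 show ?thesis
 proof (rule annI[OF F.conn_closed[OF d(1,3) ann_sec[OF m]]])
 fix U' u assume U': "Z.opn U'" "U' <= U" and u: "u \<in> vertical S0 Z W sg U'"
 have "local_lift S0 Z W sg V (vf_ext W V v) U' (vf_ext Z U' v')"
 using local_lift_restrict[OF V l V(1) order_refl U'] U' d(2) by blast
 then have "conn F U' u (conn F U' (vf_ext Z U' v') (mres F U U' m)) = \<zero>\<^bsub>msec F U'\<^esub>"
 using conn_lift_ann0[OF V(1) _ _ ann_res[OF d(1) U' m] u] W.T_ext[OF V(2)] V(2) by metis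
 then show "conn F U' u (mres F U U' (conn F U v' m)) = \<zero>\<^bsub>msec F U'\<^esub>"
 using F.conn_res[OF d(1) U' d(3) ann_sec[OF m]] by simp
 qed
qed

lemma conn_lift_unique:
 assumes V: "W.opn V" "v \<in> carrier (W.T V)" and m: "m \<in> A U"
 and l: "local_lift S0 Z W sg V v U v'" "local_lift S0 Z W sg V v U v''"
 shows "conn F U v' m = conn F U v'' m"
proof -
 note d = local_liftD[OF l(1) V(1)] and e = local_liftD[OF l(2) V(1)]
 interpret g: abelian_group "Z.T U" using Z.T_abelian_group d by blast
 interpret U: supmod "sec Z U" "msec F U" using F.smod d by blast
 have e3: "v'' \<in> carrier (Z.T U)" using e by blast
 have vd: "v' \<ominus>\<^bsub>Z.T U\<^esub> v'' \<in> vertical S0 Z W sg U" using lift_difference_vertical[OF V l] .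
 have "v' = (v' \<ominus>\<^bsub>Z.T U\<^esub> v'') \<oplus>\<^bsub>Z.T U\<^esub> v''" using d(3) e3 by algebra
 then have "conn F U v' m = conn F U (v' \<ominus>\<^bsub>Z.T U\<^esub> v'') m \<oplus>\<^bsub>msec F U\<^esub> conn F U v'' m"
 using F.conn_vadd[OF d(1) verticalD(1)[OF vd] e3 ann_sec[OF m]] by metis
 then show ?thesis using ann_conn[OF d(1) m vd] F.conn_closed[OF d(1) e3 ann_sec[OF m]] by simp
qed

lemma lift_all:
 assumes V: "W.opn V" and z: "z \<in> pr V"
 obtains V' where "W.opn V'" "V' <= V" "z \<in> pr V'"
 "!!i v. v \<in> hom_vf S0 W V i ==> \<exists>v'\<in>hom_vf S0 Z (pr V') i. local_lift S0 Z W sg V v (pr V') v'"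
 "!!v. v \<in> carrier (W.T V) ==> EX v'. local_lift S0 Z W sg V v (pr V') v'"
proof -
 obtain V' where V': "W.opn V'" "V' <= V" "z \<in> pr V'"
 "!!i v. v \<in> hom_vf S0 W V i ==> \<exists>v'\<in>hom_vf S0 Z (pr V') i. local_lift S0 Z W sg V v (pr V') v'"
 using lift_near[OF V z] by blast
 have "EX v'. local_lift S0 Z W sg V v (pr V') v'" if v: "v \<in> carrier (W.T V)" for v
 proof -
 note p = W.Tpart_in[OF V v]
 obtain v0 v1 where l: "local_lift S0 Z W sg V (W.Tpart V 0 v) (pr V') v0" "local_lift S0 Z W sg V (W.Tpart V 1 v) (pr V') v1"
 using V'(4)[OF p[of 0]] V'(4)[OF p[of 1]] by blast
 have "W.Tpart V 0 v \<oplus>\<^bsub>W.T V\<^esub> W.Tpart V 1 v = v" using graded_group.part_sum01[OF W.T_graded[OF V] v] .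
 then have "local_lift S0 Z W sg V v (pr V') (v0 \<oplus>\<^bsub>Z.T (pr V')\<^esub> v1)"
 using local_lift_add[OF V W.hom_vf_in_T[OF p] W.hom_vf_in_T[OF p] l] by (simp only:)
 then show ?thesis by blast
 qed
 then show thesis using that V' by blast
qed

lemma dp_simps [simp]:
 "carrier (msec dp V) = A (pr V)" "\<zero>\<^bsub>msec dp V\<^esub> = \<zero>\<^bsub>msec F (pr V)\<^esub>" "add (msec dp V) = add (msec F (pr V))"
 "smult (msec dp V) = (\<lambda>b m. com sg V b \<odot>\<^bsub>msec F (pr V)\<^esub> m)"
 "mgr (msec dp V) = (\<lambda>i. mgr (msec F (pr V)) i \<inter> A (pr V))"
 "mres dp V V' = mres F (pr V) (pr V')"
 by (simp_all add: dplus_def Let_def)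

lemma dconn_ex1:
 assumes V: "W.opn V" "v \<in> carrier (W.T V)" and m: "m \<in> A (pr V)"
 shows "\<exists>!n. n \<in> A (pr V) & (ALL U v'. local_lift S0 Z W sg V v U v' -->
 conn F U v' (mres F (pr V) U m) = mres F (pr V) U n)"
proof -
 note U = pre_open[OF V(1)] and mU = ann_sec[OF m]
 let ?Q = "\<lambda>U s. EX v'. local_lift S0 Z W sg V v U v' & s = conn F U v' (mres F (pr V) U m)"
 have r: "mres F (pr V) U1 m \<in> A U1" if "Z.opn U1" "U1 <= pr V" for U1
 using ann_res[OF U that m] .
 have rr: "mres F U1 U2 (conn F U1 v' (mres F (pr V) U1 m)) = conn F U2 (vf_ext Z U2 v') (mres F (pr V) U2 m)
 & local_lift S0 Z W sg V v U2 (vf_ext Z U2 v')"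
 if l: "local_lift S0 Z W sg V v U1 v'" and o: "Z.opn U2" "U2 <= U1" for U1 U2 v'
 proof -
 note d = local_liftD[OF l V(1)]
 have "local_lift S0 Z W sg V (vf_ext W V v) U2 (vf_ext Z U2 v')"
 using local_lift_restrict[OF V l V(1) order_refl o] o d(2) by blast
 then show ?thesis
 using F.conn_res[OF d(1) o d(3) ann_sec[OF r[OF d(1,2)]]] F.mres_mres[OF U d(1) o d(2) mU] W.T_ext[OF V(2)] by simp
 qed
 have "\<exists>s\<in>F.Mc (pr V). ALL U t. Z.opn U --> U <= pr V --> t \<in> F.Mc U --> ?Q U t --> mres F (pr V) U s = t"
 proof (rule sheaf_glue[OF F.msheaf U])
 fix z assume z: "z \<in> pr V"
 obtain U1 v' where l: "z \<in> U1" "local_lift S0 Z W sg V v U1 v'" using lift_near'[OF V z] by blast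
 note d = local_liftD[OF l(2) V(1)]
 show "EX U1 s. Z.opn U1 & z \<in> U1 & U1 <= pr V & s \<in> F.Mc U1 & ?Q U1 s"
 using l d F.conn_closed[OF d(1,3) ann_sec[OF r[OF d(1,2)]]] by blast
 next
 fix U1 s U2 t assume "Z.opn U1" "Z.opn U2" "?Q U1 s" "?Q U2 t"
 then obtain v1 v2 where l: "local_lift S0 Z W sg V v U1 v1" "s = conn F U1 v1 (mres F (pr V) U1 m)"
 "local_lift S0 Z W sg V v U2 v2" "t = conn F U2 v2 (mres F (pr V) U2 m)" by blast
 have o: "Z.opn (U1 \<inter> U2)" "U1 \<inter> U2 <= U1" "U1 \<inter> U2 <= U2" using \<open>Z.opn U1\<close> \<open>Z.opn U2\<close> by auto
 have s: "U1 \<inter> U2 <= pr V" using local_liftD(2)[OF l(1) V(1)] by blast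
 show "mres F U1 (U1 \<inter> U2) s = mres F U2 (U1 \<inter> U2) t"
 unfolding l(2,4) using rr[OF l(1) o(1,2)] rr[OF l(3) o(1,3)] conn_lift_unique[OF V r[OF o(1) s]] by metis
 qed
 then obtain n where n: "n \<in> F.Mc (pr V)"
 "!!U t. Z.opn U ==> U <= pr V ==> t \<in> F.Mc U ==> ?Q U t ==> mres F (pr V) U n = t" by blast
 have nl: "conn F U1 v' (mres F (pr V) U1 m) = mres F (pr V) U1 n" if l: "local_lift S0 Z W sg V v U1 v'" for U1 v'
 proof -
 note d = local_liftD[OF l V(1)]
 show ?thesis using n(2)[OF d(1,2) F.conn_closed[OF d(1,3) ann_sec[OF r[OF d(1,2)]]]] l by metis
 qed
 have nA: "n \<in> A (pr V)"
 proof (rule ann_local[OF U n(1)])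
 fix z assume z: "z \<in> pr V"
 obtain U1 v' where l: "z \<in> U1" "local_lift S0 Z W sg V v U1 v'" using lift_near'[OF V z] by blast
 note d = local_liftD[OF l(2) V(1)]
 show "EX V1. Z.opn V1 & z \<in> V1 & V1 <= pr V & mres F (pr V) V1 n \<in> A V1"
 using l d conn_lift_ann[OF V l(2) r[OF d(1,2)]] nl[OF l(2)] by metis
 qed
 show ?thesis
 proof (rule ex1I[of _ n])
 show "n \<in> A (pr V) & (ALL U v'. local_lift S0 Z W sg V v U v' -->
 conn F U v' (mres F (pr V) U m) = mres F (pr V) U n)" using nA nl by blast
 fix n' assume n': "n' \<in> A (pr V) & (ALL U v'. local_lift S0 Z W sg V v U v' -->
 conn F U v' (mres F (pr V) U m) = mres F (pr V) U n')"
 show "n' = n"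
 proof (rule sheaf_eqI[OF F.msheaf U ann_sec n(1)])
 fix z assume z: "z \<in> pr V"
 obtain U1 v' where l: "z \<in> U1" "local_lift S0 Z W sg V v U1 v'" using lift_near'[OF V z] by blast
 show "EX V1. Z.opn V1 & z \<in> V1 & V1 <= pr V & mres F (pr V) V1 n' = mres F (pr V) V1 n"
 using l local_liftD[OF l(2) V(1)] n' nl[OF l(2)] by metis
 qed (use n' in blast)
 qed
qed

lemma dconn_def: "conn dp V v m = (THE n. n \<in> A (pr V) & (ALL U v'. local_lift S0 Z W sg V v U v' -->
 conn F U v' (mres F (pr V) U m) = mres F (pr V) U n))"
 by (simp add: dplus_def)

lemma dconn:
 assumes V: "W.opn V" "v \<in> carrier (W.T V)" and m: "m \<in> A (pr V)"
 shows "conn dp V v m \<in> A (pr V)"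
 and "local_lift S0 Z W sg V v U v' ==> mres F (pr V) U (conn dp V v m) = conn F U v' (mres F (pr V) U m)"
 using theI'[OF dconn_ex1[OF assms], folded dconn_def] by auto

lemma dconn_eqI:
 assumes V: "W.opn V" "v \<in> carrier (W.T V)" and m: "m \<in> A (pr V)" and n: "n \<in> F.Mc (pr V)"
 and loc: "!!z. z \<in> pr V ==> EX U v'. z \<in> U & local_lift S0 Z W sg V v U v' &
 mres F (pr V) U n = conn F U v' (mres F (pr V) U m)"
 shows "conn dp V v m = n"
proof (rule sheaf_eqI[OF F.msheaf pre_open[OF V(1)] ann_sec[OF dconn(1)[OF V m]] n])
 fix z assume "z \<in> pr V"
 then obtain U v' where l: "z \<in> U" "local_lift S0 Z W sg V v U v'"
 "mres F (pr V) U n = conn F U v' (mres F (pr V) U m)" using loc by blast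
 show "EX U. Z.opn U & z \<in> U & U <= pr V & mres F (pr V) U (conn dp V v m) = mres F (pr V) U n"
 using l local_liftD[OF l(2) V(1)] dconn(2)[OF V m l(2)] by metis
qed

end

lemma (in sspace) dmoduleI:
 assumes "omodule Z F"
 and "!!U v m. opn U ==> v \<in> carrier (T U) ==> m \<in> carrier (msec F U) ==> conn F U v m \<in> carrier (msec F U)"
 and "!!U v m n. opn U ==> v \<in> carrier (T U) ==> m \<in> carrier (msec F U) ==> n \<in> carrier (msec F U) ==>
 conn F U v (m \<oplus>\<^bsub>msec F U\<^esub> n) = conn F U v m \<oplus>\<^bsub>msec F U\<^esub> conn F U v n"
 and "!!U v w m. opn U ==> v \<in> carrier (T U) ==> w \<in> carrier (T U) ==> m \<in> carrier (msec F U) ==>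
 conn F U (v \<oplus>\<^bsub>T U\<^esub> w) m = conn F U v m \<oplus>\<^bsub>msec F U\<^esub> conn F U w m"
 and "!!U a v m. opn U ==> a \<in> Sc U ==> v \<in> carrier (T U) ==> m \<in> carrier (msec F U) ==>
 conn F U (a \<odot>\<^bsub>T U\<^esub> v) m = a \<odot>\<^bsub>msec F U\<^esub> conn F U v m"
 and "!!U i j v m. opn U ==> v \<in> mgr (T U) i ==> m \<in> mgr (msec F U) j ==> conn F U v m \<in> mgr (msec F U) (i + j)"
 and "!!U i j v a m. opn U ==> v \<in> mgr (T U) i ==> a \<in> gr (sec Z U) j ==> m \<in> carrier (msec F U) ==>
 conn F U v (a \<odot>\<^bsub>msec F U\<^esub> m) =
 v U a \<odot>\<^bsub>msec F U\<^esub> m \<oplus>\<^bsub>msec F U\<^esub> ksgn (msec F U) i j (a \<odot>\<^bsub>msec F U\<^esub> conn F U v m)"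
 and "!!U i j v w m. opn U ==> v \<in> mgr (T U) i ==> w \<in> mgr (T U) j ==> m \<in> carrier (msec F U) ==>
 conn F U (vf_bracket Z U i j v w) m = conn F U v (conn F U w m) \<ominus>\<^bsub>msec F U\<^esub>
 ksgn (msec F U) i j (conn F U w (conn F U v m))"
 and "!!U V v m. opn U ==> opn V ==> V <= U ==> v \<in> carrier (T U) ==> m \<in> carrier (msec F U) ==>
 mres F U V (conn F U v m) = conn F V (mres (tangent S0 Z) U V v) (mres F U V m)"
 shows "dmodule S0 Z F"
 unfolding dmodule_def Let_def
 by (intro conjI allI impI ballI; (elim conjE)?; rule assms; assumption)

context osubm
begin

lemma dp_abelian: "W.opn V ==> abelian_group (msec dp V)"
proof -
 assume V: "W.opn V"
 note U = pre_open[OF V]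
 interpret U: supmod "sec Z (pr V)" "msec F (pr V)" using F.smod U .
 show ?thesis
 proof (rule abelian_groupI; unfold dp_simps)
 fix x assume x: "x \<in> A (pr V)"
 then show "\<exists>y\<in>A (pr V). y \<oplus>\<^bsub>msec F (pr V)\<^esub> x = \<zero>\<^bsub>msec F (pr V)\<^esub>"
 using ann_neg[OF U x] U.M.l_neg[OF ann_sec[OF x]] by blast
 qed (use ann_add[OF U] ann_zero[OF U] ann_sec in \<open>auto simp: U.M.a_ac\<close>)
qed

lemma dp_neg: "W.opn V ==> m \<in> A (pr V) ==> \<ominus>\<^bsub>msec dp V\<^esub> m = \<ominus>\<^bsub>msec F (pr V)\<^esub> m"
proof -
 assume V: "W.opn V" and m: "m \<in> A (pr V)"
 interpret D: abelian_group "msec dp V" using dp_abelian V .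
 interpret U: supmod "sec Z (pr V)" "msec F (pr V)" using F.smod pre_open V by blast
 show ?thesis
 using m ann_neg[OF pre_open[OF V] m] U.M.l_neg[OF ann_sec[OF m]] by (intro D.minus_equality) simp_all
qed

lemma dp_ksgn: "W.opn V ==> m \<in> A (pr V) ==> ksgn (msec dp V) i j m = ksgn (msec F (pr V)) i j m"
 by (simp add: ksgn_def dp_neg)

lemma ann_ksgn: "Z.opn U ==> m \<in> A U ==> ksgn (msec F U) i j m \<in> A U"
 by (simp add: ksgn_def ann_neg)

lemma dp_minus: "W.opn V ==> n \<in> A (pr V) ==> m \<ominus>\<^bsub>msec dp V\<^esub> n = m \<ominus>\<^bsub>msec F (pr V)\<^esub> n"
 by (simp add: a_minus_def dp_neg)

lemma mres_ksgn: "Z.opn U ==> Z.opn V ==> V <= U ==> m \<in> F.Mc U ==>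
 mres F U V (ksgn (msec F U) i j m) = ksgn (msec F V) i j (mres F U V m)"
 by (simp add: ksgn_def F.mres_neg)

lemma dp_graded: "W.opn V ==> graded_group (msec dp V) (mgr (msec dp V))"
proof (rule graded_groupI[OF dp_abelian])
 assume V: "W.opn V"
 note U = pre_open[OF V]
 interpret D: abelian_group "msec dp V" using dp_abelian V .
 interpret U: supmod "sec Z (pr V)" "msec F (pr V)" using F.smod U .
 fix i
 show "subgroup (mgr (msec dp V) i) (add_monoid (msec dp V))"
 proof (rule D.add.subgroupI)
 show "mgr (msec dp V) i ~= {}" using ann_zero[OF U] U.M.g_zero[of i] by (auto simp del: U.M.g_zero)
 qed (use U.M.g_neg U.M.g_add ann_add[OF U] ann_neg[OF U] dp_neg[OF V] in auto)
 fix x assume "x \<in> carrier (msec dp V)"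
 then have x: "x \<in> A (pr V)" by simp
 show "EX a b. a \<in> mgr (msec dp V) 0 & b \<in> mgr (msec dp V) 1 & x = a \<oplus>\<^bsub>msec dp V\<^esub> b"
 using ann_part[OF U x] U.M.part_in[OF ann_sec[OF x]] U.M.part_sum01[OF ann_sec[OF x]]
 by (intro exI[of _ "U.M.prt 0 x"] exI[of _ "U.M.prt 1 x"]) (simp add: mpart_eq_hpart)
next
 fix V x assume V: "W.opn V" and x: "x \<in> mgr (msec dp V) 0" "x \<in> mgr (msec dp V) 1"
 interpret U: supmod "sec Z (pr V)" "msec F (pr V)" using F.smod pre_open V by blast
 show "x = \<zero>\<^bsub>msec dp V\<^esub>" using U.M.g_disjoint[of x 0] x by simp
qed

lemma dp_part: "W.opn V ==> m \<in> A (pr V) ==> mpart (msec dp V) i m = mpart (msec F (pr V)) i m"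
proof -
 assume V: "W.opn V" and m: "m \<in> A (pr V)"
 note U = pre_open[OF V]
 interpret D: graded_group "msec dp V" "mgr (msec dp V)" using dp_graded V .
 interpret U: supmod "sec Z (pr V)" "msec F (pr V)" using F.smod U .
 note p = ann_part[OF U m, unfolded mpart_eq_hpart] U.M.part_in[OF ann_sec[OF m]]
 show ?thesis unfolding mpart_eq_hpart
 proof (rule D.part_eqI)
 show "U.M.prt i m \<in> mgr (msec dp V) i" "U.M.prt (i + 1) m \<in> mgr (msec dp V) (i + 1)"
 unfolding dp_simps using p by blast+
 show "m = U.M.prt i m \<oplus>\<^bsub>msec dp V\<^esub> U.M.prt (i + 1) m"
 unfolding dp_simps using U.M.part_sum[OF ann_sec[OF m]] by (rule sym)
 qed
qed

lemma dp_supermodule: "W.opn V ==> supermodule (sec W V) (msec dp V)"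
proof -
 assume V: "W.opn V"
 note U = pre_open[OF V]
 interpret U: supmod "sec Z (pr V)" "msec F (pr V)" using F.smod U .
 have g: "is_grading (msec dp V) (mgr (msec dp V))" using graded_group.grading[OF dp_graded[OF V]] .
 have "com sg V a \<odot>\<^bsub>msec F (pr V)\<^esub> m \<in> mgr (msec F (pr V)) (i + j) \<inter> A (pr V)"
 if "a \<in> gr (sec W V) i" "m \<in> mgr (msec F (pr V)) j \<inter> A (pr V)" for i j a m
 proof -
 interpret R: superring "sec W V" using W.sring V .
 show ?thesis
 using U.smult_gr[OF com_gr[OF V that(1)]] that(2) ann_smult[OF V R.gr.g_closed[OF that(1)]] by blast
 qed
 then have 1: "ALL i j. \<forall>a\<in>gr (sec W V) i. \<forall>m\<in>mgr (msec dp V) j. a \<odot>\<^bsub>msec dp V\<^esub> m \<in> mgr (msec dp V) (i + j)"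
 unfolding dp_simps by blast
 show ?thesis
 unfolding supermodule_def
 proof (intro conjI)
 show "\<forall>a\<in>W.Sc V. \<forall>m\<in>carrier (msec dp V). a \<odot>\<^bsub>msec dp V\<^esub> m \<in> carrier (msec dp V)"
 using ann_smult[OF V] by simp
 qed (use dp_abelian[OF V] g 1 ann_sec in \<open>auto simp del: dp_simps(5) simp: com_add[OF V] com_mult[OF V] com_one[OF V]
 com_closed[OF V] U.smult_l_distr U.smult_assoc U.smult_r_distr\<close>)
qed

lemma dp_sheaf: "set_sheaf (space W) (\<lambda>V. carrier (msec dp V)) (mres dp)"
 unfolding set_sheaf_def
proof (intro conjI allI impI ballI; (elim conjE)?; unfold dp_simps)
 fix U V s assume "W.opn U" "W.opn V" "V <= U" "s \<in> A (pr U)"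
 then show "mres F (pr U) (pr V) s \<in> A (pr V)" using ann_res pre_open pre_mono by metis
next
 fix U s assume "W.opn U" "s \<in> A (pr U)"
 then show "mres F (pr U) (pr U) s = s" using F.mres_id pre_open ann_sec by metis
next
 fix U V V' s assume "W.opn U" "W.opn V" "W.opn V'" "V' <= V" "V <= U" "s \<in> A (pr U)"
 then show "mres F (pr V) (pr V') (mres F (pr U) (pr V) s) = mres F (pr U) (pr V') s"
 using F.mres_mres pre_open pre_mono ann_sec by metis
next
 fix \<U> s t assume o: "\<forall>V\<in>\<U>. W.opn V" and s: "s \<in> A (pr (\<Union>\<U>))" and t: "t \<in> A (pr (\<Union>\<U>))"
 and e: "\<forall>V\<in>\<U>. mres F (pr (\<Union>\<U>)) (pr V) s = mres F (pr (\<Union>\<U>)) (pr V) t"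
 have oU: "W.opn (\<Union>\<U>)" using o by blast
 show "s = t"
 proof (rule sheaf_eqI[OF F.msheaf pre_open[OF oU] ann_sec[OF s] ann_sec[OF t]])
 fix x assume "x \<in> pr (\<Union>\<U>)"
 then obtain V where V: "V \<in> \<U>" "x \<in> pr V" by (auto simp: pre_def)
 then show "EX U. Z.opn U & x \<in> U & U <= pr (\<Union>\<U>) & mres F (pr (\<Union>\<U>)) U s = mres F (pr (\<Union>\<U>)) U t"
 using o e pre_open pre_mono[of V "\<Union>\<U>"] by blast
 qed
next
 fix \<U> f assume f: "\<forall>V\<in>\<U>. W.opn V & f V \<in> A (pr V)"
 and c: "\<forall>V\<in>\<U>. \<forall>V'\<in>\<U>. mres F (pr V) (pr (V \<inter> V')) (f V) = mres F (pr V') (pr (V \<inter> V')) (f V')"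
 have oU: "W.opn (\<Union>\<U>)" using f by blast
 have "\<exists>s\<in>F.Mc (pr (\<Union>\<U>)). ALL U t. Z.opn U --> U <= pr (\<Union>\<U>) --> t \<in> F.Mc U -->
 (dn U \<in> \<U> & t = f (dn U)) --> mres F (pr (\<Union>\<U>)) U s = t"
 proof (rule sheaf_glue[OF F.msheaf pre_open[OF oU]])
 fix x assume "x \<in> pr (\<Union>\<U>)"
 then obtain V where V: "V \<in> \<U>" "x \<in> pr V" by (auto simp: pre_def)
 then show "EX U s. Z.opn U & x \<in> U & U <= pr (\<Union>\<U>) & s \<in> F.Mc U & dn U \<in> \<U> & s = f (dn U)"
 using f pre_open dn_pre ann_sec pre_mono[of V "\<Union>\<U>"] by (intro exI[of _ "pr V"]) auto
 next
 fix U s U' s' assume h: "Z.opn U" "dn U \<in> \<U> & s = f (dn U)" "Z.opn U'" "dn U' \<in> \<U> & s' = f (dn U')"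
 have "mres F (pr (dn U)) (pr (dn U \<inter> dn U')) (f (dn U)) = mres F (pr (dn U')) (pr (dn U \<inter> dn U')) (f (dn U'))"
 using c h by blast
 then show "mres F U (U \<inter> U') s = mres F U' (U \<inter> U') s'"
 using h by (simp add: pre_Int pre_dn)
 qed
 then obtain s where s: "s \<in> F.Mc (pr (\<Union>\<U>))" "!!U t. Z.opn U ==> U <= pr (\<Union>\<U>) ==> t \<in> F.Mc U ==>
 dn U \<in> \<U> & t = f (dn U) ==> mres F (pr (\<Union>\<U>)) U s = t" by blast
 have sV: "mres F (pr (\<Union>\<U>)) (pr V) s = f V" if V: "V \<in> \<U>" for V
 proof -
 have fV: "W.opn V" "f V \<in> A (pr V)" using f V by blast+
 have "V <= \<Union>\<U>" using V by blast
 from s(2)[OF pre_open[OF fV(1)] pre_mono[OF this] ann_sec[OF fV(2)]] show ?thesis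
 using dn_pre[OF fV(1)] V by simp
 qed
 have "s \<in> A (pr (\<Union>\<U>))"
 proof (rule ann_local[OF pre_open[OF oU] s(1)])
 fix x assume "x \<in> pr (\<Union>\<U>)"
 then obtain V where V: "V \<in> \<U>" "x \<in> pr V" by (auto simp: pre_def)
 have fV: "W.opn V" "f V \<in> A (pr V)" using f V by blast+
 have "V <= \<Union>\<U>" using V by blast
 then show "EX V. Z.opn V & x \<in> V & V <= pr (\<Union>\<U>) & mres F (pr (\<Union>\<U>)) V s \<in> A V"
 using V fV pre_open[OF fV(1)] sV[OF V(1)] pre_mono[of V "\<Union>\<U>"] by (intro exI[of _ "pr V"]) simp
 qed
 then show "\<exists>s\<in>A (pr (\<Union>\<U>)). \<forall>V\<in>\<U>. mres F (pr (\<Union>\<U>)) (pr V) s = f V" using sV by blast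
qed

lemma dp_omodule: "omodule W dp"
 unfolding omodule_def
proof (intro conjI allI impI)
 fix V assume "W.opn V"
 then show "supermodule (sec W V) (msec dp V)" by (rule dp_supermodule)
next
 fix V V' assume "W.opn V & W.opn V' & V' <= V"
 then have V: "W.opn V" "W.opn V'" "V' <= V" by auto
 note m = F.mresD[OF pre_open[OF V(1)] pre_open[OF V(2)] pre_mono[OF V(3)]]
 show "\<forall>m\<in>carrier (msec dp V). \<forall>n\<in>carrier (msec dp V).
 mres dp V V' (m \<oplus>\<^bsub>msec dp V\<^esub> n) = mres dp V V' m \<oplus>\<^bsub>msec dp V'\<^esub> mres dp V V' n"
 using m(1) ann_sec by simp
 show "\<forall>a\<in>W.Sc V. \<forall>m\<in>carrier (msec dp V). mres dp V V' (a \<odot>\<^bsub>msec dp V\<^esub> m) = res W V V' a \<odot>\<^bsub>msec dp V'\<^esub> mres dp V V' m"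
 using m(2) ann_sec com_closed[OF V(1)] com_res[OF V] by simp
 show "mres dp V V' ` mgr (msec dp V) i <= mgr (msec dp V') i" for i
 using m(3) ann_res[OF pre_open[OF V(1)] pre_open[OF V(2)] pre_mono[OF V(3)]] by auto
qed (rule dp_sheaf)

lemma lift_apply_com:
 assumes V: "W.opn V" "v \<in> carrier (W.T V)" and l: "local_lift S0 Z W sg V v U v'" and b: "b \<in> W.Sc V"
 shows "v' U (res Z (pr V) U (com sg V b)) = res Z (pr V) U (com sg V (v V b))"
proof -
 have "U \<inter> pr V = U" using local_liftD(2)[OF l V(1)] by blast
 then show ?thesis using l V(1) b unfolding local_lift_def by (metis order_refl)
qed

theorem dplus_dmodule: "dmodule S0 W dp"
proof (rule W.dmoduleI[OF dp_omodule])
 fix V assume V: "W.opn V"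
 note U = pre_open[OF V]
 interpret U: supmod "sec Z (pr V)" "msec F (pr V)" using F.smod U .
 have sm: "mres F (pr V) (pr V') m \<in> A (pr V')" "mres F (pr V) (pr V') m \<in> F.Mc (pr V')" if "m \<in> A (pr V)" "W.opn V'" "V' <= V" for m V'
 using ann_res[OF U pre_open[OF that(2)] pre_mono[OF that(3)] that(1)] ann_sec by blast+
 fix v m assume v: "v \<in> carrier (W.T V)" and "m \<in> carrier (msec dp V)"
 then have m: "m \<in> A (pr V)" by simp
 note c = dconn[OF V v m]
 show "conn dp V v m \<in> carrier (msec dp V)" using c(1) by simp
 show "conn dp V v (m \<oplus>\<^bsub>msec dp V\<^esub> n) = conn dp V v m \<oplus>\<^bsub>msec dp V\<^esub> conn dp V v n"
 if "n \<in> carrier (msec dp V)" for n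
 unfolding dp_simps
 proof (rule dconn_eqI[OF V v])
 have n: "n \<in> A (pr V)" using that by simp
 note e = dconn[OF V v n]
 show "m \<oplus>\<^bsub>msec F (pr V)\<^esub> n \<in> A (pr V)" using ann_add U m n by blast
 show "conn dp V v m \<oplus>\<^bsub>msec F (pr V)\<^esub> conn dp V v n \<in> F.Mc (pr V)" using c(1) e(1) ann_sec by simp
 fix z assume "z \<in> pr V"
 then obtain V' v' where V': "W.opn V'" "V' <= V" "z \<in> pr V'" and l: "local_lift S0 Z W sg V v (pr V') v'"
 using lift_all[OF V] v by metis
 note d = local_liftD[OF l V]
 have "mres F (pr V) (pr V') (conn dp V v m \<oplus>\<^bsub>msec F (pr V)\<^esub> conn dp V v n) =
 conn F (pr V') v' (mres F (pr V) (pr V') (m \<oplus>\<^bsub>msec F (pr V)\<^esub> n))"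
 using F.mres_add[OF U d(1,2) ann_sec[OF c(1)] ann_sec[OF e(1)]] F.mres_add[OF U d(1,2) ann_sec[OF m] ann_sec[OF n]]
 c(2)[OF l] e(2)[OF l] F.conn_add[OF d(1,3) sm(2)[OF m V'(1,2)] sm(2)[OF n V'(1,2)]] by simp
 then show "EX U v'. z \<in> U & local_lift S0 Z W sg V v U v' &
 mres F (pr V) U (conn dp V v m \<oplus>\<^bsub>msec F (pr V)\<^esub> conn dp V v n) = conn F U v' (mres F (pr V) U (m \<oplus>\<^bsub>msec F (pr V)\<^esub> n))"
 using V' l by blast
 qed
 show "conn dp V (v \<oplus>\<^bsub>W.T V\<^esub> w) m = conn dp V v m \<oplus>\<^bsub>msec dp V\<^esub> conn dp V w m" if w: "w \<in> carrier (W.T V)" for w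
 unfolding dp_simps
 proof (rule dconn_eqI[OF V _ m])
 note e = dconn[OF V w m]
 show "v \<oplus>\<^bsub>W.T V\<^esub> w \<in> carrier (W.T V)" using W.T_add_closed[OF V v w] by simp
 show "conn dp V v m \<oplus>\<^bsub>msec F (pr V)\<^esub> conn dp V w m \<in> F.Mc (pr V)" using c(1) e(1) ann_sec by simp
 fix z assume "z \<in> pr V"
 then obtain V' v' w' where V': "W.opn V'" "V' <= V" "z \<in> pr V'" and l: "local_lift S0 Z W sg V v (pr V') v'"
 "local_lift S0 Z W sg V w (pr V') w'"
 using lift_all[OF V] v w by metis
 note d = local_liftD[OF l(1) V] and d' = local_liftD[OF l(2) V]
 have "mres F (pr V) (pr V') (conn dp V v m \<oplus>\<^bsub>msec F (pr V)\<^esub> conn dp V w m) =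
 conn F (pr V') (v' \<oplus>\<^bsub>Z.T (pr V')\<^esub> w') (mres F (pr V) (pr V') m)"
 using F.mres_add[OF U d(1,2) ann_sec[OF c(1)] ann_sec[OF e(1)]]
 c(2)[OF l(1)] e(2)[OF l(2)] F.conn_vadd[OF d(1,3) d'(3) sm(2)[OF m V'(1,2)]] by simp
 then show "EX U v'. z \<in> U & local_lift S0 Z W sg V (v \<oplus>\<^bsub>W.T V\<^esub> w) U v' &
 mres F (pr V) U (conn dp V v m \<oplus>\<^bsub>msec F (pr V)\<^esub> conn dp V w m) = conn F U v' (mres F (pr V) U m)"
 using V' local_lift_add[OF V v w l] by blast
 qed
 show "mres dp V V' (conn dp V v m) = conn dp V' (mres (tangent S0 W) V V' v) (mres dp V V' m)"
 if V': "W.opn V'" "V' <= V" for V'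
 unfolding dp_simps W.tangent_simps
 proof (rule dconn_eqI[OF V'(1) W.T_restrict[OF v V'(2)] sm(1)[OF m V'] sm(2)[OF c(1) V'], symmetric])
 fix z assume "z \<in> pr V'"
 then obtain V1 where V1: "W.opn V1" "V1 <= V'" "z \<in> pr V1"
 and la: "!!v. v \<in> carrier (W.T V') ==> EX v'. local_lift S0 Z W sg V' v (pr V1) v'"
 using lift_all[OF V'(1)] by metis
 obtain V2 v' where V2: "W.opn V2" "V2 <= V" "z \<in> pr V2" and l: "local_lift S0 Z W sg V v (pr V2) v'"
 using lift_all[OF V, of z] v \<open>z \<in> pr V'\<close> pre_mono[OF V'(2)] by (metis subsetD)
 let ?V = "V1 \<inter> V2"
 have o: "W.opn ?V" "?V <= V2" "?V <= V'" using V1 V2 by auto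
 note U2 = pre_open[OF o(1)] pre_mono[OF o(2)] pre_mono[OF o(3)]
 have l': "local_lift S0 Z W sg V' (vf_ext W V' v) (pr ?V) (vf_ext Z (pr ?V) v')"
 using local_lift_restrict[OF V v l V' U2] .
 note d = local_liftD[OF l V]
 have "mres F (pr V') (pr ?V) (mres F (pr V) (pr V') (conn dp V v m)) = mres F (pr V) (pr ?V) (conn dp V v m)"
 using F.mres_mres[OF U pre_open[OF V'(1)] U2(1,3) pre_mono[OF V'(2)] ann_sec[OF c(1)]] .
 also have "\<dots> = mres F (pr V2) (pr ?V) (mres F (pr V) (pr V2) (conn dp V v m))"
 using F.mres_mres[OF U d(1) U2(1,2) d(2) ann_sec[OF c(1)]] by simp
 also have "\<dots> = conn F (pr ?V) (vf_ext Z (pr ?V) v') (mres F (pr V2) (pr ?V) (mres F (pr V) (pr V2) m))"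
 unfolding c(2)[OF l] using F.conn_res[OF d(1) U2(1,2) d(3) sm(2)[OF m V2(1,2)]] .
 also have "mres F (pr V2) (pr ?V) (mres F (pr V) (pr V2) m) = mres F (pr V') (pr ?V) (mres F (pr V) (pr V') m)"
 using F.mres_mres[OF U d(1) U2(1,2) d(2) ann_sec[OF m]]
 F.mres_mres[OF U pre_open[OF V'(1)] U2(1,3) pre_mono[OF V'(2)] ann_sec[OF m]] by simp
 finally show "EX U v'. z \<in> U & local_lift S0 Z W sg V' (vf_ext W V' v) U v' &
 mres F (pr V') U (mres F (pr V) (pr V') (conn dp V v m)) = conn F U v' (mres F (pr V') U (mres F (pr V) (pr V') m))"
 using l' V1 V2 by (metis IntI pre_Int)
 qed
next
 fix V a v m assume V: "W.opn V" and a: "a \<in> W.Sc V" and v: "v \<in> carrier (W.T V)" and "m \<in> carrier (msec dp V)"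
 then have m: "m \<in> A (pr V)" by simp
 note U = pre_open[OF V] and c = dconn[OF V v m]
 interpret U: supmod "sec Z (pr V)" "msec F (pr V)" using F.smod U .
 show "conn dp V (a \<odot>\<^bsub>W.T V\<^esub> v) m = a \<odot>\<^bsub>msec dp V\<^esub> conn dp V v m"
 unfolding dp_simps
 proof (rule dconn_eqI[OF V W.T_smult_closed[OF V a v] m])
 show "com sg V a \<odot>\<^bsub>msec F (pr V)\<^esub> conn dp V v m \<in> F.Mc (pr V)" using c(1) ann_sec com_closed[OF V a] by simp
 fix z assume "z \<in> pr V"
 then obtain V' v' where V': "W.opn V'" "V' <= V" "z \<in> pr V'" and l: "local_lift S0 Z W sg V v (pr V') v'"
 using lift_all[OF V] v by metis
 note d = local_liftD[OF l V]
 have "mres F (pr V) (pr V') (com sg V a \<odot>\<^bsub>msec F (pr V)\<^esub> conn dp V v m) =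
 conn F (pr V') (res Z (pr V) (pr V') (com sg V a) \<odot>\<^bsub>Z.T (pr V')\<^esub> v') (mres F (pr V) (pr V') m)"
 using F.mres_smult[OF U d(1,2) com_closed[OF V a] ann_sec[OF c(1)]] c(2)[OF l]
 F.conn_smult[OF d(1) Z.res_closed[OF U d(1,2) com_closed[OF V a]] d(3) F.mres_closed[OF U d(1,2) ann_sec[OF m]]] by simp
 then show "EX U v'. z \<in> U & local_lift S0 Z W sg V (a \<odot>\<^bsub>W.T V\<^esub> v) U v' &
 mres F (pr V) U (com sg V a \<odot>\<^bsub>msec F (pr V)\<^esub> conn dp V v m) = conn F U v' (mres F (pr V) U m)"
 using V' local_lift_smult[OF V v a l] by blast
 qed
next
 fix V i j v m assume V: "W.opn V" and "v \<in> mgr (W.T V) i" "m \<in> mgr (msec dp V) j"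
 then have v: "v \<in> hom_vf S0 W V i" and m: "m \<in> A (pr V)" "m \<in> mgr (msec F (pr V)) j" by auto
 note U = pre_open[OF V] and vT = W.hom_vf_in_T[OF v]
 note c = dconn[OF V vT m(1)]
 have "conn dp V v m \<in> mgr (msec F (pr V)) (i + j)"
 proof (rule F.gr_local[OF U ann_sec[OF c(1)]])
 fix z assume "z \<in> pr V"
 then obtain V' v' where V': "W.opn V'" "V' <= V" "z \<in> pr V'" and l: "v' \<in> hom_vf S0 Z (pr V') i" "local_lift S0 Z W sg V v (pr V') v'"
 using lift_all[OF V] v by metis
 note d = local_liftD[OF l(2) V]
 have "mres F (pr V) (pr V') (conn dp V v m) \<in> mgr (msec F (pr V')) (i + j)"
 unfolding c(2)[OF l(2)] using F.conn_gr[OF d(1) l(1) F.mres_gr[OF U d(1,2) m(2)]] .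
 then show "EX V'. Z.opn V' & z \<in> V' & V' <= pr V & mres F (pr V) V' (conn dp V v m) \<in> mgr (msec F V') (i + j)"
 using d V' by blast
 qed
 then show "conn dp V v m \<in> mgr (msec dp V) (i + j)" unfolding dp_simps using c(1) by blast
next
 fix V i j v a m assume V: "W.opn V" and "v \<in> mgr (W.T V) i" and a: "a \<in> gr (sec W V) j" and "m \<in> carrier (msec dp V)"
 then have v: "v \<in> hom_vf S0 W V i" and m: "m \<in> A (pr V)" by auto
 interpret R: superring "sec W V" using W.sring V .
 note U = pre_open[OF V] and vT = W.hom_vf_in_T[OF v] and aS = R.gr.g_closed[OF a]
 interpret U: supmod "sec Z (pr V)" "msec F (pr V)" using F.smod U .
 note c = dconn[OF V vT m]
 have va: "v V a \<in> W.Sc V" using W.T_apply(1)[OF vT V order_refl aS] .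
 let ?x = "com sg V (v V a) \<odot>\<^bsub>msec F (pr V)\<^esub> m" and ?y = "com sg V a \<odot>\<^bsub>msec F (pr V)\<^esub> conn dp V v m"
 have xy: "?x \<in> A (pr V)" "?y \<in> A (pr V)" using ann_smult[OF V va m] ann_smult[OF V aS c(1)] .
 have "conn dp V v (com sg V a \<odot>\<^bsub>msec F (pr V)\<^esub> m) = ?x \<oplus>\<^bsub>msec F (pr V)\<^esub> ksgn (msec F (pr V)) i j ?y"
 proof (rule dconn_eqI[OF V vT ann_smult[OF V aS m]])
 show "?x \<oplus>\<^bsub>msec F (pr V)\<^esub> ksgn (msec F (pr V)) i j ?y \<in> F.Mc (pr V)" using xy ann_sec by simp
 fix z assume "z \<in> pr V"
 then obtain V' v' where V': "W.opn V'" "V' <= V" "z \<in> pr V'" and l: "v' \<in> hom_vf S0 Z (pr V') i" "local_lift S0 Z W sg V v (pr V') v'"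
 using lift_all[OF V] v by metis
 note d = local_liftD[OF l(2) V]
 have ksM: "ksgn (msec F (pr V)) i j ?y \<in> F.Mc (pr V)" using xy ann_sec by simp
 let ?r = "mres F (pr V) (pr V')" and ?a = "res Z (pr V) (pr V') (com sg V a)"
 have "?r (?x \<oplus>\<^bsub>msec F (pr V)\<^esub> ksgn (msec F (pr V)) i j ?y) =
 res Z (pr V) (pr V') (com sg V (v V a)) \<odot>\<^bsub>msec F (pr V')\<^esub> ?r m \<oplus>\<^bsub>msec F (pr V')\<^esub>
 ksgn (msec F (pr V')) i j (?a \<odot>\<^bsub>msec F (pr V')\<^esub> conn F (pr V') v' (?r m))"
 using F.mres_add[OF U d(1,2) ann_sec[OF xy(1)] ksM] mres_ksgn[OF U d(1,2) ann_sec[OF xy(2)]]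
 F.mres_smult[OF U d(1,2) com_closed[OF V va] ann_sec[OF m]]
 F.mres_smult[OF U d(1,2) com_closed[OF V aS] ann_sec[OF c(1)]] c(2)[OF l(2)] by simp
 also have "\<dots> = conn F (pr V') v' (?a \<odot>\<^bsub>msec F (pr V')\<^esub> ?r m)"
 using F.conn_leibniz0[OF d(1) l(1) Z.res_gr[OF U d(1,2) com_gr[OF V a]] F.mres_closed[OF U d(1,2) ann_sec[OF m]]]
 lift_apply_com[OF V vT l(2) aS] by simp
 also have "?a \<odot>\<^bsub>msec F (pr V')\<^esub> ?r m = ?r (com sg V a \<odot>\<^bsub>msec F (pr V)\<^esub> m)"
 using F.mres_smult[OF U d(1,2) com_closed[OF V aS] ann_sec[OF m]] by simp
 finally show "EX U v'. z \<in> U & local_lift S0 Z W sg V v U v' &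
 mres F (pr V) U (?x \<oplus>\<^bsub>msec F (pr V)\<^esub> ksgn (msec F (pr V)) i j ?y) = conn F U v' (mres F (pr V) U (com sg V a \<odot>\<^bsub>msec F (pr V)\<^esub> m))"
 using V' l(2) by blast
 qed
 then show "conn dp V v (a \<odot>\<^bsub>msec dp V\<^esub> m) = v V a \<odot>\<^bsub>msec dp V\<^esub> m \<oplus>\<^bsub>msec dp V\<^esub>
 ksgn (msec dp V) i j (a \<odot>\<^bsub>msec dp V\<^esub> conn dp V v m)"
 using dp_ksgn[OF V xy(2)] by simp
next
 fix V i j v w m assume V: "W.opn V" and "v \<in> mgr (W.T V) i" "w \<in> mgr (W.T V) j" and "m \<in> carrier (msec dp V)"
 then have v: "v \<in> hom_vf S0 W V i" and w: "w \<in> hom_vf S0 W V j" and m: "m \<in> A (pr V)" by auto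
 note U = pre_open[OF V] and vT = W.hom_vf_in_T[OF v] and wT = W.hom_vf_in_T[OF w]
 interpret U: supmod "sec Z (pr V)" "msec F (pr V)" using F.smod U .
 note c = dconn[OF V vT m] and e = dconn[OF V wT m]
 note cw = dconn[OF V vT e(1)] and ev = dconn[OF V wT c(1)]
 let ?y = "conn dp V w (conn dp V v m)"
 have k: "ksgn (msec F (pr V)) i j ?y \<in> A (pr V)" using ann_ksgn[OF U ev(1)] .
 have "conn dp V (vf_bracket W V i j v w) m = conn dp V v (conn dp V w m) \<ominus>\<^bsub>msec F (pr V)\<^esub> ksgn (msec F (pr V)) i j ?y"
 proof (rule dconn_eqI[OF V W.hom_vf_in_T[OF W.bracket_hom_vf[OF v w]] m])
 show "conn dp V v (conn dp V w m) \<ominus>\<^bsub>msec F (pr V)\<^esub> ksgn (msec F (pr V)) i j ?y \<in> F.Mc (pr V)"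
 using cw(1) k ann_sec by simp
 fix z assume "z \<in> pr V"
 then obtain V' v' w' where V': "W.opn V'" "V' <= V" "z \<in> pr V'"
 and l: "v' \<in> hom_vf S0 Z (pr V') i" "local_lift S0 Z W sg V v (pr V') v'"
 "w' \<in> hom_vf S0 Z (pr V') j" "local_lift S0 Z W sg V w (pr V') w'"
 using lift_all[OF V] v w by metis
 note d = local_liftD[OF l(2) V] and d' = local_liftD[OF l(4) V]
 let ?r = "mres F (pr V) (pr V')"
 have rm: "?r m \<in> F.Mc (pr V')" using F.mres_closed[OF U d(1,2) ann_sec[OF m]] .
 have "?r (conn dp V v (conn dp V w m) \<ominus>\<^bsub>msec F (pr V)\<^esub> ksgn (msec F (pr V)) i j ?y) =
 conn F (pr V') v' (conn F (pr V') w' (?r m)) \<ominus>\<^bsub>msec F (pr V')\<^esub> ksgn (msec F (pr V')) i j (conn F (pr V') w' (conn F (pr V') v' (?r m)))"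
 using F.mres_add[OF U d(1,2) ann_sec[OF cw(1)] ann_sec[OF ann_neg[OF U k]]] F.mres_neg[OF U d(1,2) ann_sec[OF k]]
 mres_ksgn[OF U d(1,2) ann_sec[OF ev(1)]] cw(2)[OF l(2)] ev(2)[OF l(4)] c(2)[OF l(2)] e(2)[OF l(4)]
 by (simp add: a_minus_def)
 also have "\<dots> = conn F (pr V') (vf_bracket Z (pr V') i j v' w') (?r m)"
 using F.conn_bracket[OF d(1) l(1,3) rm] by simp
 finally show "EX U v'. z \<in> U & local_lift S0 Z W sg V (vf_bracket W V i j v w) U v' &
 mres F (pr V) U (conn dp V v (conn dp V w m) \<ominus>\<^bsub>msec F (pr V)\<^esub> ksgn (msec F (pr V)) i j ?y) = conn F U v' (mres F (pr V) U m)"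
 using V' local_lift_bracket[OF V v w l(1,3,2,4)] by blast
 qed
 then show "conn dp V (vf_bracket W V i j v w) m = conn dp V v (conn dp V w m) \<ominus>\<^bsub>msec dp V\<^esub>
 ksgn (msec dp V) i j (conn dp V w (conn dp V v m))"
 using dp_ksgn[OF V ev(1)] dp_minus[OF V k] by simp
qed

end

section \<open>Exactness\<close>

lemma dmod_morD:
 assumes "dmod_mor S0 Z F G f" "openin (space Z) U"
 shows "m \<in> carrier (msec F U) ==> f U m \<in> carrier (msec G U)"
 and "m \<in> carrier (msec F U) ==> n \<in> carrier (msec F U) ==>
 f U (m \<oplus>\<^bsub>msec F U\<^esub> n) = f U m \<oplus>\<^bsub>msec G U\<^esub> f U n"
 and "a \<in> carrier (sec Z U) ==> m \<in> carrier (msec F U) ==> f U (a \<odot>\<^bsub>msec F U\<^esub> m) = a \<odot>\<^bsub>msec G U\<^esub> f U m"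
 and "m \<in> mgr (msec F U) i ==> f U m \<in> mgr (msec G U) i"
 and "openin (space Z) V ==> V <= U ==> m \<in> carrier (msec F U) ==> f V (mres F U V m) = mres G U V (f U m)"
 and "v \<in> carrier (msec (tangent S0 Z) U) ==> m \<in> carrier (msec F U) ==> f U (conn F U v m) = conn G U v (f U m)"
proof -
 note o = assms(1)[unfolded dmod_mor_def, THEN conjunct1, unfolded omod_mor_def]
 note a = o[THEN conjunct1, THEN spec, THEN mp, OF assms(2)]
 show "m \<in> carrier (msec F U) ==> f U m \<in> carrier (msec G U)" using a[THEN conjunct1] by blast
 show "m \<in> carrier (msec F U) ==> n \<in> carrier (msec F U) ==>
 f U (m \<oplus>\<^bsub>msec F U\<^esub> n) = f U m \<oplus>\<^bsub>msec G U\<^esub> f U n" using a[THEN conjunct2, THEN conjunct1] by blast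
 show "a \<in> carrier (sec Z U) ==> m \<in> carrier (msec F U) ==> f U (a \<odot>\<^bsub>msec F U\<^esub> m) = a \<odot>\<^bsub>msec G U\<^esub> f U m"
 using a[THEN conjunct2, THEN conjunct2, THEN conjunct1] by blast
 show "m \<in> mgr (msec F U) i ==> f U m \<in> mgr (msec G U) i"
 using a[THEN conjunct2, THEN conjunct2, THEN conjunct2, THEN spec, of i] by blast
 show "openin (space Z) V ==> V <= U ==> m \<in> carrier (msec F U) ==> f V (mres F U V m) = mres G U V (f U m)"
 using o[THEN conjunct2, THEN spec, THEN spec, THEN mp, of U V] assms(2) by blast
 show "v \<in> carrier (msec (tangent S0 Z) U) ==> m \<in> carrier (msec F U) ==> f U (conn F U v m) = conn G U v (f U m)"
 using assms(1)[unfolded dmod_mor_def, THEN conjunct2] assms(2) by blast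
qed

context osub
begin

lemma osubm: "dmodule S0 Z F ==> osubm S0 Z W sg F"
 by unfold_locales

lemma dplus_mor:
 assumes F: "dmodule S0 Z F" and G: "dmodule S0 Z G" and f: "dmod_mor S0 Z F G f"
 shows "dmod_mor S0 W (dplus S0 Z W sg F) (dplus S0 Z W sg G) (dplus_mor Z sg f)"
proof -
 interpret F: osubm S0 Z W sg F using osubm F .
 interpret G: osubm S0 Z W sg G using osubm G .
 note d = dmod_morD[OF f]
 have f0: "f U \<zero>\<^bsub>msec F U\<^esub> = \<zero>\<^bsub>msec G U\<^esub>" if U: "Z.opn U" for U
 proof -
 interpret MF: supmod "sec Z U" "msec F U" using F.F.smod U .
 interpret MG: supmod "sec Z U" "msec G U" using G.F.smod U .
 show ?thesis using d(2)[OF U MF.M.zero_closed MF.M.zero_closed] d(1)[OF U MF.M.zero_closed]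
 by (intro MG.M.idem_zero) simp_all
 qed
 have fA: "f U m \<in> G.A U" if U: "Z.opn U" and m: "m \<in> F.A U" for U m
 proof (rule G.annI[OF d(1)[OF U F.ann_sec[OF m]]])
 fix V v assume V: "Z.opn V" "V <= U" "v \<in> vertical S0 Z W sg V"
 show "conn G V v (mres G U V (f U m)) = \<zero>\<^bsub>msec G V\<^esub>"
 using d(5)[OF U V(1,2) F.ann_sec[OF m]] d(6)[OF V(1) verticalD(1)[OF V(3)] F.F.mres_closed[OF U V(1,2) F.ann_sec[OF m]]]
 F.annD[OF m V] f0[OF V(1)] by simp
 qed
 show ?thesis
 unfolding dmod_mor_def omod_mor_def dplus_mor_def
 proof (intro conjI allI impI ballI; (elim conjE)?)
 fix V v m assume V: "W.opn V" and v: "v \<in> carrier (W.T V)" and "m \<in> carrier (msec F.dp V)"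
 then have m: "m \<in> F.A (pr V)" by simp
 note U = pre_open[OF V]
 note fm = fA[OF U m] and c = F.dconn[OF V v m]
 show "f (pr V) (conn F.dp V v m) = conn G.dp V v (f (pr V) m)"
 proof (rule G.dconn_eqI[OF V v fm d(1)[OF U F.ann_sec[OF c(1)]], symmetric])
 fix z assume z: "z \<in> pr V"
 obtain U1 v' where l: "z \<in> U1" "local_lift S0 Z W sg V v U1 v'" using lift_near'[OF V v z] by blast
 note e = local_liftD[OF l(2) V]
 have "mres G (pr V) U1 (f (pr V) (conn F.dp V v m)) = conn G U1 v' (mres G (pr V) U1 (f (pr V) m))"
 using d(5)[OF U e(1,2) F.ann_sec[OF c(1)]] d(5)[OF U e(1,2) F.ann_sec[OF m]] c(2)[OF l(2)]
 d(6)[OF e(1,3) F.F.mres_closed[OF U e(1,2) F.ann_sec[OF m]]] by simp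
 then show "EX U v'. z \<in> U & local_lift S0 Z W sg V v U v' &
 mres G (pr V) U (f (pr V) (conn F.dp V v m)) = conn G U v' (mres G (pr V) U (f (pr V) m))" using l by blast
 qed
 qed (use fA d pre_open pre_mono F.ann_sec com_closed in \<open>auto\<close>)
qed

end

context frame
begin

lemma odd_module_of:
 assumes "dmodule S0 Z F" and V: "W.opn V" "V <= V0"
 shows "odd_module (sec Z (pr V)) (msec F (pr V)) (th V) (\<lambda>j. pd j (pr V)) n (\<lambda>j. conn F (pr V) (pdd V j))"
proof -
 interpret F: osubm S0 Z W sg F using osubm assms(1) .
 note U = pre_open[OF V(1)]
 interpret odd_ring "sec Z (pr V)" "th V" "\<lambda>j. pd j (pr V)" n using oring V .
 interpret supmod "sec Z (pr V)" "msec F (pr V)" using F.F.smod U .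
 note p = pdd_hom[OF V(2)]
 show ?thesis
 proof unfold_locales
 fix j m assume j: "j < n" and m: "m \<in> carrier (msec F (pr V))"
 show c: "conn F (pr V) (pdd V j) m \<in> carrier (msec F (pr V))" using F.F.conn_closed[OF U Z.hom_vf_in_T[OF p] m] .
 show "conn F (pr V) (pdd V j) (m \<oplus>\<^bsub>msec F (pr V)\<^esub> m') =
 conn F (pr V) (pdd V j) m \<oplus>\<^bsub>msec F (pr V)\<^esub> conn F (pr V) (pdd V j) m'" if "m' \<in> carrier (msec F (pr V))" for m'
 using F.F.conn_add[OF U Z.hom_vf_in_T[OF p] m that] .
 fix i assume i: "i < n"
 have ci: "conn F (pr V) (pdd V i) m \<in> carrier (msec F (pr V))" using F.F.conn_closed[OF U Z.hom_vf_in_T[OF p] m] .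
 have cc: "conn F (pr V) (pdd V i) (conn F (pr V) (pdd V j) m) \<in> carrier (msec F (pr V))"
 "conn F (pr V) (pdd V j) (conn F (pr V) (pdd V i) m) \<in> carrier (msec F (pr V))"
 using F.F.conn_closed[OF U Z.hom_vf_in_T[OF p] c] F.F.conn_closed[OF U Z.hom_vf_in_T[OF p] ci] .
 have "conn F (pr V) (pdd V j) (conn F (pr V) (pdd V i) m) \<oplus>\<^bsub>msec F (pr V)\<^esub>
 conn F (pr V) (pdd V i) (conn F (pr V) (pdd V j) m) = \<zero>\<^bsub>msec F (pr V)\<^esub>"
 using F.F.conn_bracket[OF U p[of j] p[of i] m] pdd_bracket[OF V, of j i] F.F.conn_vzero[OF U m] cc
 by (simp add: ksgn_def a_minus_def M.minus_minus)
 then show "conn F (pr V) (pdd V i) (conn F (pr V) (pdd V j) m) =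
 \<ominus>\<^bsub>msec F (pr V)\<^esub> conn F (pr V) (pdd V j) (conn F (pr V) (pdd V i) m)"
 using cc by (intro M.neg_unique)
 next
 fix j a m assume "j < n" and a: "a \<in> carrier (sec Z (pr V))" and m: "m \<in> carrier (msec F (pr V))"
 show "conn F (pr V) (pdd V j) (a \<odot>\<^bsub>msec F (pr V)\<^esub> m) =
 pd j (pr V) a \<odot>\<^bsub>msec F (pr V)\<^esub> m \<oplus>\<^bsub>msec F (pr V)\<^esub> gr.tw 1 a \<odot>\<^bsub>msec F (pr V)\<^esub> conn F (pr V) (pdd V j) m"
 using F.F.conn_leibniz[OF U p a m] U a by simp
 next
 fix j m p' assume "j < n" "m \<in> mgr (msec F (pr V)) p'"
 then show "conn F (pr V) (pdd V j) m \<in> mgr (msec F (pr V)) (1 + p')" using F.F.conn_gr[OF U p] by blast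
 qed
qed

abbreviation proj :: "('z, 'a, 'm) dmod => 'w set => 'm => 'm" where
 "proj F V \<equiv> oddproj (msec F (pr V)) (th V) (\<lambda>j. conn F (pr V) (pdd V j)) n"

text \<open>A vertical vector field is a combination of the partial derivatives; these are subtracted one
 by one.\<close>

lemma vertical_kills:
 assumes F: "dmodule S0 Z F" and V: "W.opn V" "V <= V0" and m: "m \<in> carrier (msec F (pr V))"
 and km: "!!j. j < n ==> conn F (pr V) (pdd V j) m = \<zero>\<^bsub>msec F (pr V)\<^esub>"
 and v: "v \<in> hom_vf S0 Z (pr V) i" "v \<in> vertical S0 Z W sg (pr V)"
 shows "conn F (pr V) v m = \<zero>\<^bsub>msec F (pr V)\<^esub>"
proof -
 interpret F: osubm S0 Z W sg F using osubm F .
 note U = pre_open[OF V(1)]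
 interpret M: supmod "sec Z (pr V)" "msec F (pr V)" using F.F.smod U .
 interpret odd_ring "sec Z (pr V)" "th V" "\<lambda>j. pd j (pr V)" n using oring V .
 interpret g: graded_group "Z.T (pr V)" "hom_vf S0 Z (pr V)" using Z.T_graded U .
 have "k <= n ==> v \<in> hom_vf S0 Z (pr V) i ==> v \<in> vertical S0 Z W sg (pr V) ==>
 (!!j. k <= j ==> j < n ==> v (pr V) (th V j) = \<zero>\<^bsub>sec Z (pr V)\<^esub>) ==>
 conn F (pr V) v m = \<zero>\<^bsub>msec F (pr V)\<^esub>" for k v
 proof (induction k arbitrary: v)
 case 0
 have "v = \<zero>\<^bsub>Z.T (pr V)\<^esub>"
 proof (rule vf_unique[OF V 0(2)])
 show "\<zero>\<^bsub>Z.T (pr V)\<^esub> \<in> hom_vf S0 Z (pr V) i" by (rule g.g_zero)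
 fix V' b assume V': "W.opn V'" "V' <= V" "b \<in> W.Sc V'"
 show "v (pr V') (com sg V' b) = \<zero>\<^bsub>Z.T (pr V)\<^esub> (pr V') (com sg V' b)"
 using verticalD(2)[OF 0(3) V'(1) pre_mono[OF V'(2)] V'(3)] pre_open[OF V'(1)] pre_mono[OF V'(2)]
 com_closed[OF V'(1,3)] by simp
 next
 fix j assume j: "j < n"
 then show "v (pr V) (th V j) = \<zero>\<^bsub>Z.T (pr V)\<^esub> (pr V) (th V j)"
 using 0(4)[of j] U M.gr.g_closed[OF theta_odd[OF j]] by simp
 qed
 then show ?case using F.F.conn_vzero[OF U m] by simp
 next
 case (Suc k)
 have kn: "k < n" using Suc.prems by simp
 note tk = M.gr.g_closed[OF theta_odd[OF kn]]
 let ?c = "v (pr V) (th V k)"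
 let ?w = "?c \<odot>\<^bsub>Z.T (pr V)\<^esub> pdd V k"
 note vT = Z.hom_vf_in_T[OF Suc.prems(2)] and p = pdd_hom[OF V(2)]
 have cg: "?c \<in> gr (sec Z (pr V)) (i + 1)"
 using Z.hom_vf_apply(3)[OF Suc.prems(2) U order_refl theta_odd[OF kn]] .
 have cc: "?c \<in> carrier (sec Z (pr V))" using M.gr.g_closed[OF cg] .
 have wg: "?w \<in> hom_vf S0 Z (pr V) i"
 using Z.hom_vf_smult[OF U cg p[of k]] unfolding bit_add_self .
 have wT: "?w \<in> carrier (Z.T (pr V))" using Z.hom_vf_in_T[OF wg] .
 have ug: "v \<ominus>\<^bsub>Z.T (pr V)\<^esub> ?w \<in> hom_vf S0 Z (pr V) i" using g.g_minus[OF Suc.prems(2) wg] .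
 have ua: "(v \<ominus>\<^bsub>Z.T (pr V)\<^esub> ?w) U' a = v U' a \<oplus>\<^bsub>sec Z U'\<^esub> \<ominus>\<^bsub>sec Z U'\<^esub> ?w U' a"
 if "Z.opn U'" "U' <= pr V" "a \<in> Z.Sc U'" for U' a
 using Z.T_neg_apply[OF U wT that] that by (simp only: a_minus_def Z.tangent_simps Z.vf_add_apply)
 have wa: "?w U' a = res Z (pr V) U' ?c \<otimes>\<^bsub>sec Z U'\<^esub> pd k U' a" if "Z.opn U'" "U' <= pr V" "a \<in> Z.Sc U'" for U' a
 using that by simp
 have "conn F (pr V) (v \<ominus>\<^bsub>Z.T (pr V)\<^esub> ?w) m = \<zero>\<^bsub>msec F (pr V)\<^esub>"
 proof (rule Suc.IH[OF _ ug])
 show "v \<ominus>\<^bsub>Z.T (pr V)\<^esub> ?w \<in> vertical S0 Z W sg (pr V)"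
 proof (rule verticalI[OF U Z.hom_vf_in_T[OF ug]])
 fix V' b assume V': "W.opn V'" "pr V' <= pr V" "b \<in> W.Sc V'"
 interpret R': superring "sec Z (pr V')" using Z.sring pre_open V' by blast
 have "V' <= V0" using pre_subset_iff[OF V'(1,2)] V by blast
 then show "(v \<ominus>\<^bsub>Z.T (pr V)\<^esub> ?w) (pr V') (com sg V' b) = \<zero>\<^bsub>sec Z (pr V')\<^esub>"
 unfolding ua[OF pre_open[OF V'(1)] V'(2) com_closed[OF V'(1,3)]] wa[OF pre_open[OF V'(1)] V'(2) com_closed[OF V'(1,3)]]
 using verticalD(2)[OF Suc.prems(3) V'] pd_com[OF V'(1) _ V'(3)] Z.res_closed[OF U pre_open[OF V'(1)] V'(2) cc] by simp
 qed
 fix j assume j: "k <= j" "j < n"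
 note tj = M.gr.g_closed[OF theta_odd[OF j(2)]]
 have "res Z (pr V) (pr V) ?c = ?c" using Z.res_id U cc by blast
 then show "(v \<ominus>\<^bsub>Z.T (pr V)\<^esub> ?w) (pr V) (th V j) = \<zero>\<^bsub>sec Z (pr V)\<^esub>"
 unfolding ua[OF U order_refl tj] wa[OF U order_refl tj]
 using pd_th[OF V j(2), of k] cc Suc.prems(4)[of j] j M.r_neg[OF cc] by (cases "j = k") simp_all
 qed (use kn in simp)
 moreover have "conn F (pr V) ?w m = \<zero>\<^bsub>msec F (pr V)\<^esub>"
 using F.F.conn_smult[OF U cc Z.hom_vf_in_T[OF p] m] km[OF kn] cc by simp
 moreover have "v = (v \<ominus>\<^bsub>Z.T (pr V)\<^esub> ?w) \<oplus>\<^bsub>Z.T (pr V)\<^esub> ?w" using vT wT by algebra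
 ultimately show ?case
 using F.F.conn_vadd[OF U Z.hom_vf_in_T[OF ug] wT m] by (metis M.M.zero_closed M.M.r_zero)
 qed
 from this[of n v] v show ?thesis by simp
qed

lemma ann_frame:
 assumes F: "dmodule S0 Z F" and V: "W.opn V" "V <= V0" and m: "m \<in> carrier (msec F (pr V))"
 and km: "!!j. j < n ==> conn F (pr V) (pdd V j) m = \<zero>\<^bsub>msec F (pr V)\<^esub>"
 shows "m \<in> ann_vertical S0 Z W sg F (pr V)"
proof -
 interpret F: osubm S0 Z W sg F using osubm F .
 note U = pre_open[OF V(1)]
 show ?thesis
 proof (rule F.annI[OF m])
 fix U1 v assume U1: "Z.opn U1" "U1 <= pr V" and v: "v \<in> vertical S0 Z W sg U1"
 obtain V1 where V1: "W.opn V1" "U1 = pr V1" using open_pre_cases[OF U1(1)] by blast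
 have s: "V1 <= V" "V1 <= V0" using pre_subset_iff[OF V1(1)] U1 V1 V by blast+
 let ?m = "mres F (pr V) (pr V1) m"
 note U1' = pre_open[OF V1(1)] pre_mono[OF s(1)]
 have mm: "?m \<in> F.F.Mc (pr V1)" using F.F.mres_closed[OF U U1' m] .
 interpret M: supmod "sec Z (pr V1)" "msec F (pr V1)" using F.F.smod U1' by blast
 have k: "conn F (pr V1) (pdd V1 j) ?m = \<zero>\<^bsub>msec F (pr V1)\<^esub>" if "j < n" for j
 using F.F.conn_res[OF U U1' Z.hom_vf_in_T[OF pdd_hom[OF V(2)]] m, of j] km[OF that] F.F.mres_zero[OF U U1'] U1' by simp
 have v': "v \<in> vertical S0 Z W sg (pr V1)" using v V1 by simp
 have 0: "conn F (pr V1) (Z.Tpart (pr V1) i v) ?m = \<zero>\<^bsub>msec F (pr V1)\<^esub>" for i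
 using vertical_kills[OF F V1(1) s(2) mm k Z.Tpart_in[OF U1'(1) verticalD(1)[OF v']] vertical_part[OF U1'(1) v']] .
 have "conn F (pr V1) v ?m = \<zero>\<^bsub>msec F (pr V1)\<^esub>"
 using F.F.conn_parts[OF U1'(1) verticalD(1)[OF v'] mm] 0 by simp
 then show "conn F U1 v (mres F (pr V) U1 m) = \<zero>\<^bsub>msec F U1\<^esub>" using V1 by simp
 qed
qed

lemma proj_ann:
 assumes F: "dmodule S0 Z F" and V: "W.opn V" "V <= V0" and m: "m \<in> carrier (msec F (pr V))"
 shows "proj F V m \<in> ann_vertical S0 Z W sg F (pr V)"
proof -
 interpret odd_module "sec Z (pr V)" "msec F (pr V)" "th V" "\<lambda>j. pd j (pr V)" n "\<lambda>j. conn F (pr V) (pdd V j)"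
 using odd_module_of[OF F V] .
 show ?thesis using ann_frame[OF F V P_closed[OF order_refl m]] E_P[OF _ order_refl m] by blast
qed

lemma proj_fix:
 assumes F: "dmodule S0 Z F" and V: "W.opn V" "V <= V0" and m: "m \<in> ann_vertical S0 Z W sg F (pr V)"
 shows "proj F V m = m"
proof -
 interpret F: osubm S0 Z W sg F using osubm F .
 interpret odd_module "sec Z (pr V)" "msec F (pr V)" "th V" "\<lambda>j. pd j (pr V)" n "\<lambda>j. conn F (pr V) (pdd V j)"
 using odd_module_of[OF F V] .
 show ?thesis
 using P_fix[OF order_refl F.ann_sec[OF m]] F.ann_conn[OF pre_open[OF V(1)] m pdd_vertical[OF V]] by blast
qed

end

context osub
begin

lemma pt_surj: "W.opn V ==> x \<in> V ==> \<exists>z\<in>pr V. pt sg z = x"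
proof -
 assume V: "W.opn V" and "x \<in> V"
 then have "x \<in> dn (pr V)" using dn_pre[OF V] by simp
 then show ?thesis by (elim imageE) blast
qed

theorem dplus_exact:
 assumes F: "dmodule S0 Z F" and G: "dmodule S0 Z G" and H: "dmodule S0 Z H"
 and f: "dmod_mor S0 Z F G f" and g: "dmod_mor S0 Z G H g" and ex: "short_exact Z F G H f g"
 shows "short_exact W (dplus S0 Z W sg F) (dplus S0 Z W sg G) (dplus S0 Z W sg H) (dplus_mor Z sg f) (dplus_mor Z sg g)"
proof -
 interpret F: osubm S0 Z W sg F using osubm F .
 interpret G: osubm S0 Z W sg G using osubm G .
 interpret H: osubm S0 Z W sg H using osubm H .
 note df = dmod_morD[OF f] and dg = dmod_morD[OF g]
 note e = ex[unfolded short_exact_def, THEN spec, THEN mp]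
 have inj: "inj_on (f U) (F.F.Mc U)" if "Z.opn U" for U
 using e[THEN conjunct1, OF that] .
 have mid: "g U s = \<zero>\<^bsub>msec H U\<^esub> \<longleftrightarrow>
 (\<forall>x\<in>U. EX V. Z.opn V & x \<in> V & V <= U & (\<exists>t\<in>F.F.Mc V. f V t = mres G U V s))"
 if "Z.opn U" "s \<in> G.F.Mc U" for U s
 using e[THEN conjunct2, THEN conjunct1, THEN bspec, OF that] .
 have sur: "EX V. Z.opn V & x \<in> V & V <= U & (\<exists>t\<in>G.F.Mc V. g V t = mres H U V s)"
 if "Z.opn U" "s \<in> H.F.Mc U" "x \<in> U" for U s x
 using e[THEN conjunct2, THEN conjunct2, THEN bspec, THEN bspec, OF that] .
 have f0: "f U \<zero>\<^bsub>msec F U\<^esub> = \<zero>\<^bsub>msec G U\<^esub>" if U: "Z.opn U" for U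
 proof -
 interpret MF: supmod "sec Z U" "msec F U" using F.F.smod U .
 interpret MG: supmod "sec Z U" "msec G U" using G.F.smod U .
 show ?thesis using df(2)[OF U MF.M.zero_closed MF.M.zero_closed] df(1)[OF U MF.M.zero_closed]
 by (intro MG.M.idem_zero) simp_all
 qed
 have bk: "t \<in> F.A U" if U: "Z.opn U" and t: "t \<in> F.F.Mc U" and ft: "f U t \<in> G.A U" for U t
 proof (rule F.annI[OF t])
 fix V v assume V: "Z.opn V" "V <= U" "v \<in> vertical S0 Z W sg V"
 interpret MF: supmod "sec Z V" "msec F V" using F.F.smod V by blast
 note tV = F.F.mres_closed[OF U V(1,2) t]
 have "f V (conn F V v (mres F U V t)) = conn G V v (mres G U V (f U t))"
 using df(6)[OF V(1) verticalD(1)[OF V(3)] tV] df(5)[OF U V(1,2) t] by simp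
 also have "\<dots> = f V \<zero>\<^bsub>msec F V\<^esub>" using G.annD[OF ft V] f0[OF V(1)] by simp
 finally show "conn F V v (mres F U V t) = \<zero>\<^bsub>msec F V\<^esub>"
 using inj_onD[OF inj[OF V(1)]] F.F.conn_closed[OF V(1) verticalD(1)[OF V(3)] tV] MF.M.zero_closed by blast
 qed
 show ?thesis
 unfolding short_exact_def dplus_mor_def
 proof (intro allI impI conjI ballI)
 fix V assume V: "W.opn V"
 note U = pre_open[OF V]
 show "inj_on (f (pr V)) (carrier (msec F.dp V))"
 using inj[OF U] F.ann_sec by (intro inj_on_subset[OF inj[OF U]]) auto
 fix s assume "s \<in> carrier (msec G.dp V)"
 then have s: "s \<in> G.A (pr V)" by simp
 show "g (pr V) s = \<zero>\<^bsub>msec H.dp V\<^esub> \<longleftrightarrow> (\<forall>x\<in>V. EX V'. W.opn V' & x \<in> V' & V' <= V &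
 (\<exists>t\<in>carrier (msec F.dp V'). f (pr V') t = mres G.dp V V' s))"
 unfolding F.dp_simps G.dp_simps H.dp_simps mid[OF U G.ann_sec[OF s]]
 proof (rule iffI; rule ballI)
 fix x assume x: "x \<in> V" and
 a: "\<forall>x\<in>pr V. EX U. Z.opn U & x \<in> U & U <= pr V & (\<exists>t\<in>F.F.Mc U. f U t = mres G (pr V) U s)"
 obtain z where z: "z \<in> pr V" "pt sg z = x" using pt_surj[OF V x] by (elim bexE)
 then obtain U1 t where t: "Z.opn U1" "z \<in> U1" "U1 <= pr V" "t \<in> F.F.Mc U1" "f U1 t = mres G (pr V) U1 s"
 using a by blast
 obtain V1 where V1: "W.opn V1" "U1 = pr V1" using open_pre_cases[OF t(1)] by blast
 have "t \<in> F.A U1" using bk[OF t(1,4)] G.ann_res[OF U t(1,3) s] t(5) by simp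
 moreover have "x \<in> V1" "V1 <= V" using z t V1 pre_subset_iff[OF V1(1)] by (auto simp: pre_def)
 ultimately show "EX V'. W.opn V' & x \<in> V' & V' <= V & (\<exists>t\<in>F.A (pr V'). f (pr V') t = mres G (pr V) (pr V') s)"
 using t(5) V1 by blast
 next
 fix z assume z: "z \<in> pr V" and
 a: "\<forall>x\<in>V. EX V'. W.opn V' & x \<in> V' & V' <= V & (\<exists>t\<in>F.A (pr V'). f (pr V') t = mres G (pr V) (pr V') s)"
 then obtain V' t where t: "W.opn V'" "pt sg z \<in> V'" "V' <= V" "t \<in> F.A (pr V')" "f (pr V') t = mres G (pr V) (pr V') s"
 by (auto simp: pre_def)
 have "z \<in> pr V'" using t z by (simp add: pre_def)
 then show "EX U. Z.opn U & z \<in> U & U <= pr V & (\<exists>t\<in>F.F.Mc U. f U t = mres G (pr V) U s)"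
 using pre_open[OF t(1)] pre_mono[OF t(3)] F.ann_sec[OF t(4)] t(5) by blast
 qed
 next
 fix V s x assume V: "W.opn V" and "s \<in> carrier (msec H.dp V)" and x: "x \<in> V"
 then have s: "s \<in> H.A (pr V)" by simp
 note U = pre_open[OF V]
 obtain z where z: "z \<in> pr V" "pt sg z = x" using pt_surj[OF V x] by (elim bexE)
 obtain U1 t where t: "Z.opn U1" "z \<in> U1" "U1 <= pr V" "t \<in> G.F.Mc U1" "g U1 t = mres H (pr V) U1 s"
 using sur[OF U H.ann_sec[OF s] z(1)] by blast
 obtain V1 where V1: "W.opn V1" "U1 = pr V1" using open_pre_cases[OF t(1)] by blast
 have "x \<in> topspace (space W)" using x V openin_subset by blast
 then obtain V0 et n where fr: "x \<in> V0" "frame S0 Z W sg V0 et n" using frame_exists by blast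
 interpret frame S0 Z W sg V0 et n by (rule fr)
 let ?V = "V1 \<inter> V0"
 have o: "W.opn ?V" "?V <= V0" "?V <= V1" using V1 V0 by auto
 note Uo = pre_open[OF o(1)] and s1 = pre_mono[OF o(3)]
 have s2: "pr ?V <= pr V" using s1 t(3) V1(2) by blast
 have s3: "?V <= V" using pre_subset_iff[OF o(1) s2] .
 let ?t = "mres G (pr V1) (pr ?V) t"
 have tc: "?t \<in> G.F.Mc (pr ?V)" using G.F.mres_closed[OF pre_open[OF V1(1)] Uo s1] t(4) V1(2) by blast
 note MG = odd_module_of[OF G o(1,2)] and MH = odd_module_of[OF H o(1,2)]
 have "g (pr ?V) (proj G ?V ?t) = proj H ?V (g (pr ?V) ?t)"
 using dg(6)[OF Uo Z.hom_vf_in_T[OF pdd_hom[OF o(2)]]]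
 by (intro oddproj_natural[OF MG MH dg(1)[OF Uo] dg(2)[OF Uo] dg(3)[OF Uo] _ tc order_refl]) auto
 also have "g (pr ?V) ?t = mres H (pr V) (pr ?V) s"
 using dg(5)[OF pre_open[OF V1(1)] Uo s1] t(4,5) V1(2) H.F.mres_mres[OF U t(1) Uo _ t(3) H.ann_sec[OF s]] s1 by simp
 also have "proj H ?V \<dots> = \<dots>" using proj_fix[OF H o(1,2) H.ann_res[OF U Uo s2 s]] .
 finally have "g (pr ?V) (proj G ?V ?t) = mres H (pr V) (pr ?V) s" .
 moreover have "x \<in> ?V" using z t V1 fr by (auto simp: pre_def)
 ultimately show "EX V'. W.opn V' & x \<in> V' & V' <= V & (\<exists>t\<in>carrier (msec G.dp V'). g (pr V') t = mres H.dp V V' s)"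
 unfolding G.dp_simps H.dp_simps using proj_ann[OF G o(1,2) tc] o(1) s3 by blast
 qed
qed

end

section \<open>Local freeness\<close>

context sspace
begin

abbreviation free :: "nat => nat => 'z set => ('a, nat => 'a) supermod" where
 "free p q U \<equiv> msec (free_omod Z p q) U"

lemma free_simps [simp]:
 "carrier (free p q U) = {..<p + q} \<rightarrow>\<^sub>E Sc U"
 "\<zero>\<^bsub>free p q U\<^esub> = (\<lambda>k\<in>{..<p + q}. \<zero>\<^bsub>sec Z U\<^esub>)"
 "add (free p q U) = (\<lambda>c d. \<lambda>k\<in>{..<p + q}. c k \<oplus>\<^bsub>sec Z U\<^esub> d k)"
 "smult (free p q U) = (\<lambda>a c. \<lambda>k\<in>{..<p + q}. a \<otimes>\<^bsub>sec Z U\<^esub> c k)"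
 "mgr (free p q U) = (\<lambda>i. \<Pi>\<^sub>E k\<in>{..<p + q}. gr (sec Z U) (if k < p then i else i + 1))"
 "mres (free_omod Z p q) U V c = (\<lambda>k\<in>{..<p + q}. res Z U V (c k))"
 by (simp_all add: free_omod_def Let_def)

lemma free_supmod: "opn U ==> supmod (sec Z U) (free p q U)"
proof -
 assume U: "opn U"
 interpret R: superring "sec Z U" using sring U .
 let ?K = "{..<p + q}"
 have ext: "(\<lambda>k\<in>?K. c k) = c" if "c \<in> ?K \<rightarrow>\<^sub>E Sc U" for c using that by (simp add: PiE_restrict)
 have ag: "abelian_group (free p q U)"
 proof (rule abelian_groupI; unfold free_simps)
 fix x y z assume x: "x \<in> ?K \<rightarrow>\<^sub>E Sc U"
 have xk: "k \<in> ?K ==> x k \<in> Sc U" for k using x by auto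
 show "(\<lambda>k\<in>?K. (\<lambda>k\<in>?K. \<zero>\<^bsub>sec Z U\<^esub>) k \<oplus>\<^bsub>sec Z U\<^esub> x k) = x"
 using xk by (subst ext[OF x, symmetric], intro restrict_ext) simp
 show "\<exists>y\<in>?K \<rightarrow>\<^sub>E Sc U. (\<lambda>k\<in>?K. y k \<oplus>\<^bsub>sec Z U\<^esub> x k) = (\<lambda>k\<in>?K. \<zero>\<^bsub>sec Z U\<^esub>)"
 using xk by (intro bexI[of _ "\<lambda>k\<in>?K. \<ominus>\<^bsub>sec Z U\<^esub> x k"] restrict_ext) (auto simp: R.l_neg)
 assume y: "y \<in> ?K \<rightarrow>\<^sub>E Sc U"
 have yk: "k \<in> ?K ==> y k \<in> Sc U" for k using y by auto
 show "(\<lambda>k\<in>?K. x k \<oplus>\<^bsub>sec Z U\<^esub> y k) \<in> ?K \<rightarrow>\<^sub>E Sc U" using xk yk by auto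
 show "(\<lambda>k\<in>?K. x k \<oplus>\<^bsub>sec Z U\<^esub> y k) = (\<lambda>k\<in>?K. y k \<oplus>\<^bsub>sec Z U\<^esub> x k)"
 using xk yk by (intro restrict_ext) (simp add: R.a_comm)
 assume z: "z \<in> ?K \<rightarrow>\<^sub>E Sc U"
 have zk: "k \<in> ?K ==> z k \<in> Sc U" for k using z by auto
 show "(\<lambda>k\<in>?K. (\<lambda>k\<in>?K. x k \<oplus>\<^bsub>sec Z U\<^esub> y k) k \<oplus>\<^bsub>sec Z U\<^esub> z k) =
 (\<lambda>k\<in>?K. x k \<oplus>\<^bsub>sec Z U\<^esub> (\<lambda>k\<in>?K. y k \<oplus>\<^bsub>sec Z U\<^esub> z k) k)"
 using xk yk zk by (intro restrict_ext) (simp add: R.a_assoc)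
 qed auto
 interpret G: abelian_group "free p q U" using ag .
 have neg: "\<ominus>\<^bsub>free p q U\<^esub> x = (\<lambda>k\<in>?K. \<ominus>\<^bsub>sec Z U\<^esub> x k)" if x: "x \<in> ?K \<rightarrow>\<^sub>E Sc U" for x
 proof (rule G.minus_equality)
 have xk: "k \<in> ?K ==> x k \<in> Sc U" for k using x by auto
 then show "(\<lambda>k\<in>?K. \<ominus>\<^bsub>sec Z U\<^esub> x k) \<oplus>\<^bsub>free p q U\<^esub> x = \<zero>\<^bsub>free p q U\<^esub>"
 unfolding free_simps by (intro restrict_ext) (simp add: R.l_neg)
 qed (use x in auto)
 have gsub: "x k \<in> Sc U" if "x \<in> mgr (free p q U) i" "k \<in> ?K" for x k i
 using that R.gr.g_closed by auto
 have "graded_group (free p q U) (mgr (free p q U))"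
 proof (rule graded_groupI[OF ag])
 fix i
 show "subgroup (mgr (free p q U) i) (add_monoid (free p q U))"
 proof (rule G.add.subgroupI)
 show "mgr (free p q U) i <= carrier (free p q U)" using R.gr.g_closed by (auto simp: PiE_iff)
 have "(\<lambda>k\<in>?K. \<zero>\<^bsub>sec Z U\<^esub>) \<in> mgr (free p q U) i" by auto
 then show "mgr (free p q U) i ~= {}" by blast
 fix a assume a: "a \<in> mgr (free p q U) i"
 have ac: "a \<in> ?K \<rightarrow>\<^sub>E Sc U" using a gsub[OF a] by (auto simp: PiE_iff)
 show "\<ominus>\<^bsub>free p q U\<^esub> a \<in> mgr (free p q U) i"
 unfolding neg[OF ac] free_simps using a R.gr.g_neg by (auto simp: PiE_iff)
 fix b assume "b \<in> mgr (free p q U) i"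
 then show "a \<oplus>\<^bsub>free p q U\<^esub> b \<in> mgr (free p q U) i" using a R.gr.g_add by (auto simp: PiE_iff)
 qed
 next
 fix x assume "x \<in> carrier (free p q U)"
 then have x: "x \<in> ?K \<rightarrow>\<^sub>E Sc U" by simp
 let ?a = "\<lambda>i. \<lambda>k\<in>?K. R.gr.prt (if k < p then i else i + 1) (x k)"
 have m: "?a i \<in> mgr (free p q U) i" for i using x R.gr.part_in by (auto simp del: of_bool_eq)
 have "x = ?a 0 \<oplus>\<^bsub>free p q U\<^esub> ?a (0 + 1)"
 proof -
 have "(if k < p then R.gr.prt 0 (x k) else R.gr.prt (0 + 1) (x k)) \<oplus>\<^bsub>sec Z U\<^esub>
 (if k < p then R.gr.prt (0 + 1) (x k) else R.gr.prt (0 + 1 + 1) (x k)) = x k" if "k \<in> ?K" for k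
 using R.gr.part_sum[of "x k" 0] R.gr.part_sum[of "x k" "0 + 1"] x that by auto
 then show ?thesis unfolding free_simps
 by (subst ext[OF x, symmetric], intro restrict_ext) (simp add: if_distrib[of "\<lambda>i. R.gr.prt i _"])
 qed
 then show "EX a b. a \<in> mgr (free p q U) 0 & b \<in> mgr (free p q U) 1 & x = a \<oplus>\<^bsub>free p q U\<^esub> b"
 using m[of 0] m[of 1] unfolding add_0 by blast
 next
 fix x assume x: "x \<in> mgr (free p q U) 0" "x \<in> mgr (free p q U) 1"
 have "x k = \<zero>\<^bsub>sec Z U\<^esub>" if k: "k \<in> ?K" for k
 proof -
 have m: "x k \<in> gr (sec Z U) (if k < p then 0 else 0 + 1)" "x k \<in> gr (sec Z U) (if k < p then 1 else 1 + 1)"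
 using PiE_mem[OF x(1)[unfolded free_simps] k] PiE_mem[OF x(2)[unfolded free_simps] k] .
 show ?thesis
 proof (cases "k < p")
 case True
 then show ?thesis using m R.gr.g_disjoint[of "x k" 0] by simp
 next
 case False
 then show ?thesis using m R.gr.g_disjoint[of "x k" 0] by simp
 qed
 qed
 then have "(\<lambda>k\<in>?K. x k) = (\<lambda>k\<in>?K. \<zero>\<^bsub>sec Z U\<^esub>)" by (intro restrict_ext)
 moreover have "(\<lambda>k\<in>?K. x k) = x" using x(1)[unfolded free_simps] by (rule PiE_restrict)
 ultimately show "x = \<zero>\<^bsub>free p q U\<^esub>" unfolding free_simps by simp
 qed
 then have gr: "is_grading (free p q U) (mgr (free p q U))" by (rule graded_group.grading)
 have smg: "a \<otimes>\<^bsub>sec Z U\<^esub> x k \<in> gr (sec Z U) (if k < p then i + j else i + j + 1)"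
 if "a \<in> gr (sec Z U) i" "x \<in> mgr (free p q U) j" "k \<in> ?K" for a x k i j
 proof -
 have "x k \<in> gr (sec Z U) (if k < p then j else j + 1)" using PiE_mem[OF that(2)[unfolded free_simps] that(3)] .
 then show ?thesis using R.mult_gr[OF that(1), of "x k"] by (cases "k < p") (simp_all only: if_True if_False add.assoc)
 qed
 have smgr: "ALL i j. \<forall>a\<in>gr (sec Z U) i. \<forall>m\<in>mgr (free p q U) j. a \<odot>\<^bsub>free p q U\<^esub> m \<in> mgr (free p q U) (i + j)"
 proof (intro allI ballI)
 fix i j a m assume am: "a \<in> gr (sec Z U) i" "m \<in> mgr (free p q U) j"
 show "a \<odot>\<^bsub>free p q U\<^esub> m \<in> mgr (free p q U) (i + j)"
 unfolding free_simps by (rule restrict_PiE_iff[THEN iffD2], rule ballI, rule smg[OF am])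
 qed
 show ?thesis
 proof (rule supmodI[OF R.supercomm], unfold supermodule_def, intro conjI ballI)
 show "abelian_group (free p q U)" using ag .
 fix a m assume a: "a \<in> Sc U" and "m \<in> carrier (free p q U)"
 then have m: "m \<in> ?K \<rightarrow>\<^sub>E Sc U" by simp
 then have mk: "k \<in> ?K ==> m k \<in> Sc U" for k by auto
 show "a \<odot>\<^bsub>free p q U\<^esub> m \<in> carrier (free p q U)" using a mk by auto
 { fix n assume "n \<in> carrier (free p q U)"
 then have nk: "k \<in> ?K ==> n k \<in> Sc U" for k by auto
 show "a \<odot>\<^bsub>free p q U\<^esub> (m \<oplus>\<^bsub>free p q U\<^esub> n) = a \<odot>\<^bsub>free p q U\<^esub> m \<oplus>\<^bsub>free p q U\<^esub> a \<odot>\<^bsub>free p q U\<^esub> n"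
 unfolding free_simps using a mk nk by (intro restrict_ext) (simp add: R.r_distr) }
 { fix b assume b: "b \<in> Sc U"
 show "(a \<oplus>\<^bsub>sec Z U\<^esub> b) \<odot>\<^bsub>free p q U\<^esub> m = a \<odot>\<^bsub>free p q U\<^esub> m \<oplus>\<^bsub>free p q U\<^esub> b \<odot>\<^bsub>free p q U\<^esub> m"
 unfolding free_simps using a b mk by (intro restrict_ext) (simp add: R.l_distr)
 show "(a \<otimes>\<^bsub>sec Z U\<^esub> b) \<odot>\<^bsub>free p q U\<^esub> m = a \<odot>\<^bsub>free p q U\<^esub> (b \<odot>\<^bsub>free p q U\<^esub> m)"
 unfolding free_simps using a b mk by (intro restrict_ext) (simp add: R.m_assoc) }
 next
 fix m assume "m \<in> carrier (free p q U)"
 then have m: "m \<in> ?K \<rightarrow>\<^sub>E Sc U" by simp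
 have "(\<lambda>k\<in>?K. \<one>\<^bsub>sec Z U\<^esub> \<otimes>\<^bsub>sec Z U\<^esub> m k) = (\<lambda>k\<in>?K. m k)"
 by (intro restrict_ext) (rule R.l_one[OF PiE_mem[OF m]])
 then show "\<one>\<^bsub>sec Z U\<^esub> \<odot>\<^bsub>free p q U\<^esub> m = m" unfolding free_simps ext[OF m] .
 qed (rule gr smgr)+
qed

lemma free_neg:
 assumes "opn U" "x \<in> {..<p + q} \<rightarrow>\<^sub>E Sc U"
 shows "\<ominus>\<^bsub>free p q U\<^esub> x = (\<lambda>k\<in>{..<p + q}. \<ominus>\<^bsub>sec Z U\<^esub> x k)"
proof -
 interpret supmod "sec Z U" "free p q U" using free_supmod assms by blast
 show ?thesis
 proof (rule M.minus_equality)
 have "k \<in> {..<p + q} ==> x k \<in> Sc U" for k using assms by auto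
 then show "(\<lambda>k\<in>{..<p + q}. \<ominus>\<^bsub>sec Z U\<^esub> x k) \<oplus>\<^bsub>free p q U\<^esub> x = \<zero>\<^bsub>free p q U\<^esub>"
 unfolding free_simps by (intro restrict_ext) (simp add: l_neg)
 qed (use assms in auto)
qed

end

context frame
begin

abbreviation freeE :: "nat => nat => 'w set => nat => (nat => 'a) => nat => 'a" where
 "freeE p q V j c \<equiv> \<lambda>k\<in>{..<p + q}. pd j (pr V) (c k)"
abbreviation projR :: "'w set => 'a => 'a" where
 "projR V \<equiv> oddproj (regmod (sec Z (pr V))) (th V) (\<lambda>j. pd j (pr V)) n"

lemma free_odd_module:
 assumes V: "W.opn V" "V <= V0"
 shows "odd_module (sec Z (pr V)) (Z.free p q (pr V)) (th V) (\<lambda>j. pd j (pr V)) n (freeE p q V)"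
proof -
 note U = pre_open[OF V(1)]
 interpret R: odd_ring "sec Z (pr V)" "th V" "\<lambda>j. pd j (pr V)" n using oring V .
 interpret supmod "sec Z (pr V)" "Z.free p q (pr V)" using Z.free_supmod U .
 note neg = Z.free_neg[OF U]
 show ?thesis
 proof unfold_locales
 fix j m assume j: "j < n" and "m \<in> carrier (Z.free p q (pr V))"
 then have mk: "k \<in> {..<p + q} ==> m k \<in> Z.Sc (pr V)" for k by auto
 show "freeE p q V j m \<in> carrier (Z.free p q (pr V))" using R.D_closed[OF j] mk by auto
 { fix m' assume "m' \<in> carrier (Z.free p q (pr V))"
 then have mk': "k \<in> {..<p + q} ==> m' k \<in> Z.Sc (pr V)" for k by auto
 show "freeE p q V j (m \<oplus>\<^bsub>Z.free p q (pr V)\<^esub> m') = freeE p q V j m \<oplus>\<^bsub>Z.free p q (pr V)\<^esub> freeE p q V j m'"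
 unfolding Z.free_simps using mk mk' by (intro restrict_ext) (simp add: R.D_add[OF j]) }
 { fix i assume i: "i < n"
 have f: "freeE p q V i m \<in> {..<p + q} \<rightarrow>\<^sub>E Z.Sc (pr V)" for i using mk Z.hom_vf_apply(1)[OF pd_hom U pre_mono[OF V(2)]] by auto
 have f2: "freeE p q V j (freeE p q V i m) \<in> {..<p + q} \<rightarrow>\<^sub>E Z.Sc (pr V)" using mk R.D_closed[OF j] R.D_closed[OF i] by auto
 show "freeE p q V i (freeE p q V j m) = \<ominus>\<^bsub>Z.free p q (pr V)\<^esub> freeE p q V j (freeE p q V i m)"
 unfolding neg[OF f2]
 proof (intro restrict_ext)
 fix k assume k: "k \<in> {..<p + q}"
 show "pd i (pr V) (freeE p q V j m k) = \<ominus>\<^bsub>sec Z (pr V)\<^esub> freeE p q V j (freeE p q V i m) k"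
 unfolding restrict_apply'[OF k] by (rule R.D_anti[OF i j mk[OF k]])
 qed }
 { fix a assume "a \<in> Z.Sc (pr V)"
 then show "freeE p q V j (a \<odot>\<^bsub>Z.free p q (pr V)\<^esub> m) = pd j (pr V) a \<odot>\<^bsub>Z.free p q (pr V)\<^esub> m
 \<oplus>\<^bsub>Z.free p q (pr V)\<^esub> R.gr.tw 1 a \<odot>\<^bsub>Z.free p q (pr V)\<^esub> freeE p q V j m"
 unfolding Z.free_simps using mk by (intro restrict_ext) (simp add: R.D_mult[OF j]) }
 next
 fix j m i assume j: "j < n" and m: "m \<in> mgr (Z.free p q (pr V)) i"
 have "pd j (pr V) (m k) \<in> gr (sec Z (pr V)) (if k < p then 1 + i else 1 + i + 1)" if "k \<in> {..<p + q}" for k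
 proof -
 have "m k \<in> gr (sec Z (pr V)) (if k < p then i else i + 1)" using PiE_mem[OF m[unfolded Z.free_simps] that] .
 then show ?thesis using R.D_odd[OF j, of "m k"] by (cases "k < p") (simp_all only: if_True if_False add.assoc)
 qed
 then show "freeE p q V j m \<in> mgr (Z.free p q (pr V)) (1 + i)"
 unfolding Z.free_simps by (intro restrict_PiE_iff[THEN iffD2] ballI)
 qed
qed

lemma free_proj:
 assumes V: "W.opn V" "V <= V0" and c: "c \<in> {..<p + q} \<rightarrow>\<^sub>E Z.Sc (pr V)"
 shows "oddproj (Z.free p q (pr V)) (th V) (freeE p q V) n c = (\<lambda>k\<in>{..<p + q}. projR V (c k))"
proof -
 note U = pre_open[OF V(1)]
 interpret odd_module "sec Z (pr V)" "Z.free p q (pr V)" "th V" "\<lambda>j. pd j (pr V)" n "freeE p q V"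
 using free_odd_module V .
 have "m <= n ==> P m c = (\<lambda>k\<in>{..<p + q}. PR m (c k))" for m
 proof (induction m)
 case 0
 then show ?case using c by (simp add: PiE_restrict)
 next
 case (Suc m)
 have m: "m < n" "m <= n" using Suc.prems by auto
 have ck: "PR m (c k) \<in> Z.Sc (pr V)" if "k \<in> {..<p + q}" for k using PR_closed[OF m(2)] c that by auto
 have w: "th V m \<odot>\<^bsub>Z.free p q (pr V)\<^esub> freeE p q V m (P m c) =
 (\<lambda>k\<in>{..<p + q}. th V m \<otimes>\<^bsub>sec Z (pr V)\<^esub> pd m (pr V) (PR m (c k)))"
 unfolding Suc.IH[OF m(2)] Z.free_simps by (intro restrict_ext) simp
 have wc: "(\<lambda>k\<in>{..<p + q}. th V m \<otimes>\<^bsub>sec Z (pr V)\<^esub> pd m (pr V) (PR m (c k))) \<in> {..<p + q} \<rightarrow>\<^sub>E Z.Sc (pr V)"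
 using ck D_closed[OF m(1)] theta_closed[OF m(1)] by auto
 have "P (Suc m) c = P m c \<oplus>\<^bsub>Z.free p q (pr V)\<^esub> (\<lambda>k\<in>{..<p + q}. \<ominus>\<^bsub>sec Z (pr V)\<^esub>
 (\<lambda>k\<in>{..<p + q}. th V m \<otimes>\<^bsub>sec Z (pr V)\<^esub> pd m (pr V) (PR m (c k))) k)"
 unfolding oddproj.simps a_minus_def w Z.free_neg[OF U wc] ..
 also have "\<dots> = (\<lambda>k\<in>{..<p + q}. PR (Suc m) (c k))"
 unfolding Suc.IH[OF m(2)] Z.free_simps by (intro restrict_ext) (simp add: a_minus_def)
 finally show ?case .
 qed
 then show ?thesis by simp
qed

lemma projR_image:
 assumes V: "W.opn V" "V <= V0" and a: "a \<in> Z.Sc (pr V)"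
 shows "\<exists>b\<in>W.Sc V. projR V a = com sg V b"
proof -
 interpret S: superring "sec W V" using W.sring V by blast
 interpret B: odd_ext "sec W V" "sec Z (pr V)" "com sg V" "th V" n using ext V by blast
 interpret odd_module "sec Z (pr V)" "regmod (sec Z (pr V))" "th V" "\<lambda>j. pd j (pr V)" n "\<lambda>j. pd j (pr V)"
 using odd_ring.regmod_odd_module[OF oring[OF V]] .
 from a show ?thesis
 proof (induction rule: B.gen_induct)
 case (base b)
 then show ?case using P_fix[OF order_refl, of "com sg V b"] pd_com[OF V] com_closed[OF V(1)] by auto
 next
 case (mult x j)
 have jn: "j < n" using mult by simp
 have "projR V (x \<otimes>\<^bsub>sec Z (pr V)\<^esub> th V j) = projR V x \<otimes>\<^bsub>sec Z (pr V)\<^esub> projR V (th V j)"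
 using P_smult[OF order_refl, of x "th V j"] mult theta_closed[OF jn] by simp
 also have "\<dots> = com sg V \<zero>\<^bsub>sec W V\<^esub>"
 using PR_theta[OF order_refl jn] jn P_closed[OF order_refl, of x] mult com_zero[OF V(1)] by simp
 finally show ?case by blast
 next
 case (add x y)
 then show ?case using P_add[OF order_refl, of x y] com_add[OF V(1)] by (metis S.a_closed regmod_simps(1,3))
 qed
qed

definition aug :: "'w set => 'a => 'b" where
 "aug V a = (SOME b. b \<in> W.Sc V & com sg V b = projR V a)"

lemma aug: "W.opn V ==> V <= V0 ==> a \<in> Z.Sc (pr V) ==> aug V a \<in> W.Sc V & com sg V (aug V a) = projR V a"
 unfolding aug_def by (rule someI_ex) (use projR_image in metis)

lemma com_inj: "W.opn V ==> V <= V0 ==> a \<in> W.Sc V ==> b \<in> W.Sc V ==> com sg V a = com sg V b ==> a = b"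
 using odd_ext.inj_h[OF ext] by (auto dest: inj_onD)

lemma projR_com: "W.opn V ==> V <= V0 ==> b \<in> W.Sc V ==> projR V (com sg V b) = com sg V b"
proof -
 assume V: "W.opn V" "V <= V0" and b: "b \<in> W.Sc V"
 interpret odd_module "sec Z (pr V)" "regmod (sec Z (pr V))" "th V" "\<lambda>j. pd j (pr V)" n "\<lambda>j. pd j (pr V)"
 using odd_ring.regmod_odd_module[OF oring[OF V]] .
 show ?thesis using P_fix[OF order_refl, of "com sg V b"] pd_com[OF V b] com_closed[OF V(1) b] by simp
qed

lemma aug_gr: "W.opn V ==> V <= V0 ==> a \<in> gr (sec Z (pr V)) i ==> aug V a \<in> gr (sec W V) i"
proof -
 assume V: "W.opn V" "V <= V0" and a: "a \<in> gr (sec Z (pr V)) i"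
 interpret B: odd_ext "sec W V" "sec Z (pr V)" "com sg V" "th V" n using ext V by blast
 interpret odd_module "sec Z (pr V)" "regmod (sec Z (pr V))" "th V" "\<lambda>j. pd j (pr V)" n "\<lambda>j. pd j (pr V)"
 using odd_ring.regmod_odd_module[OF oring[OF V]] .
 have "projR V a \<in> gr (sec Z (pr V)) i" using P_gr[OF order_refl, of a i] a by simp
 then show ?thesis using aug[OF V B.B.gr.g_closed[OF a]] B.h_gr_iff[of "aug V a" i] by simp
qed

lemma projR_res:
 assumes V: "W.opn V" "V <= V0" and V': "W.opn V'" "V' <= V" and a: "a \<in> Z.Sc (pr V)"
 shows "projR V' (res Z (pr V) (pr V') a) = res Z (pr V) (pr V') (projR V a)"
proof -
 note U = pre_open[OF V(1)] pre_open[OF V'(1)] pre_mono[OF V'(2)]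
 have s: "V' <= V0" using V V' by auto
 interpret M: odd_module "sec Z (pr V)" "regmod (sec Z (pr V))" "th V" "\<lambda>j. pd j (pr V)" n "\<lambda>j. pd j (pr V)"
 using odd_ring.regmod_odd_module[OF oring[OF V]] .
 have "m <= n ==> oddproj (regmod (sec Z (pr V'))) (th V') (\<lambda>j. pd j (pr V')) m (res Z (pr V) (pr V') a) =
 res Z (pr V) (pr V') (M.P m a)" for m
 proof (induction m)
 case (Suc m)
 let ?x = "M.P m a"
 have x: "?x \<in> Z.Sc (pr V)" "pd m (pr V) ?x \<in> Z.Sc (pr V)" "th V m \<in> Z.Sc (pr V)"
 "th V m \<otimes>\<^bsub>sec Z (pr V)\<^esub> pd m (pr V) ?x \<in> Z.Sc (pr V)"
 using Suc.prems M.P_closed[of m a] a M.D_closed M.theta_closed by auto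
 have "th V' m = res Z (pr V) (pr V') (th V m)" using th_res[OF V V'] Suc.prems by simp
 moreover have "pd m (pr V') (res Z (pr V) (pr V') ?x) = res Z (pr V) (pr V') (pd m (pr V) ?x)"
 using Z.hom_vf_res[OF pd_hom U pre_mono[OF V(2)] x(1)] .
 ultimately show ?case using Suc x U
 by (simp add: a_minus_def Z.res_add[OF U] Z.res_mult[OF U] Z.res_neg[OF U])
 qed simp
 then show ?thesis by simp
qed

lemma free_over_frame:
 assumes F: "dmodule S0 Z F" and U: "Z.opn U" "V <= V0" "W.opn V" "pr V <= U"
 and f: "omod_iso (restrict_to Z U) F (free_omod (restrict_to Z U) p q) f"
 shows "\<exists>\<psi>. omod_iso (restrict_to W V) (dplus S0 Z W sg F) (free_omod (restrict_to W V) p q) \<psi>"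
proof -
 interpret F: osubm S0 Z W sg F using osubm F .
 let ?K = "{..<p + q}"
 have fo: "free_omod (restrict_to Z U) p q = free_omod Z p q" "free_omod (restrict_to W V) p q = free_omod W p q"
 by (simp_all add: free_omod_def restrict_to_def)
 have opU: "openin (space (restrict_to Z U)) (pr V')" "W.opn V'" "V' <= V" "V' <= V0"
 if "openin (space (restrict_to W V)) V'" for V'
 proof -
 have V': "W.opn V'" "V' <= V"
 using that U(3) by (auto simp: restrict_to_def openin_open_subtopology)
 then show "W.opn V'" "V' <= V" "V' <= V0" using U(2) by auto
 show "openin (space (restrict_to Z U)) (pr V')"
 using pre_open[OF V'(1)] pre_mono[OF V'(2)] U by (auto simp: restrict_to_def openin_open_subtopology)
 qed
 have rs: "sec (restrict_to Z U) = sec Z" "res (restrict_to Z U) = res Z" "sec (restrict_to W V) = sec W"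
 "res (restrict_to W V) = res W" by (simp_all add: restrict_to_def)
 note iso = f[unfolded omod_iso_def omod_mor_def fo rs]
 define \<psi> where "\<psi> V' m = (\<lambda>k\<in>?K. aug V' (f (pr V') m k))" for V' m
 define \<rho> where "\<rho> V' c = proj F V' (inv_into (F.F.Mc (pr V')) (f (pr V')) (\<lambda>k\<in>?K. com sg V' (c k)))" for V' c
 have main: "(\<forall>m\<in>F.A (pr V'). \<psi> V' m \<in> ?K \<rightarrow>\<^sub>E W.Sc V') &
 (\<forall>m\<in>F.A (pr V'). \<forall>m'\<in>F.A (pr V'). \<psi> V' (m \<oplus>\<^bsub>msec F (pr V')\<^esub> m') = \<psi> V' m \<oplus>\<^bsub>W.free p q V'\<^esub> \<psi> V' m') &
 (\<forall>b\<in>W.Sc V'. \<forall>m\<in>F.A (pr V'). \<psi> V' (com sg V' b \<odot>\<^bsub>msec F (pr V')\<^esub> m) = b \<odot>\<^bsub>W.free p q V'\<^esub> \<psi> V' m) &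
 (ALL i. \<forall>m\<in>mgr (msec F (pr V')) i \<inter> F.A (pr V'). \<psi> V' m \<in> mgr (W.free p q V') i) &
 (\<forall>m\<in>F.A (pr V'). \<rho> V' (\<psi> V' m) = m) &
 (\<forall>c\<in>?K \<rightarrow>\<^sub>E W.Sc V'. \<rho> V' c \<in> F.A (pr V') & \<psi> V' (\<rho> V' c) = c) &
 (ALL i. \<forall>c\<in>mgr (W.free p q V') i. \<rho> V' c \<in> mgr (msec F (pr V')) i) &
 (\<forall>m\<in>F.A (pr V'). \<forall>k\<in>?K. com sg V' (\<psi> V' m k) = projR V' (f (pr V') m k))"
 if oV: "openin (space (restrict_to W V)) V'" for V'
 proof -
 note V' = opU(2,4)[OF oV] and o = pre_open[OF opU(2)[OF oV]]
 note i0 = iso[THEN conjunct1, THEN conjunct1, THEN spec, THEN mp, OF opU(1)[OF oV]]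
 note i1 = iso[THEN conjunct2, THEN spec, THEN mp, OF opU(1)[OF oV]]
 interpret MF: odd_module "sec Z (pr V')" "msec F (pr V')" "th V'" "\<lambda>j. pd j (pr V')" n "\<lambda>j. conn F (pr V') (pdd V' j)"
 using odd_module_of[OF F V'] .
 interpret FF: odd_module "sec Z (pr V')" "Z.free p q (pr V')" "th V'" "\<lambda>j. pd j (pr V')" n "freeE p q V'"
 using free_odd_module V' .
 interpret FW: supmod "sec W V'" "W.free p q V'" using W.free_supmod V' by blast
 interpret RR: odd_module "sec Z (pr V')" "regmod (sec Z (pr V'))" "th V'" "\<lambda>j. pd j (pr V')" n "\<lambda>j. pd j (pr V')"
 using odd_ring.regmod_odd_module[OF oring[OF V']] .
 let ?f = "f (pr V')" and ?M = "msec F (pr V')"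
 let ?g = "inv_into (F.F.Mc (pr V')) ?f"
 have f1: "!!m. m \<in> carrier ?M ==> ?f m \<in> ?K \<rightarrow>\<^sub>E Z.Sc (pr V')" using i0[THEN conjunct1] by simp
 have f2: "!!m m'. m \<in> carrier ?M ==> m' \<in> carrier ?M ==> ?f (m \<oplus>\<^bsub>?M\<^esub> m') = ?f m \<oplus>\<^bsub>Z.free p q (pr V')\<^esub> ?f m'"
 using i0[THEN conjunct2, THEN conjunct1] by blast
 have f3: "!!a m. a \<in> Z.Sc (pr V') ==> m \<in> carrier ?M ==> ?f (a \<odot>\<^bsub>?M\<^esub> m) = a \<odot>\<^bsub>Z.free p q (pr V')\<^esub> ?f m"
 using i0[THEN conjunct2, THEN conjunct2, THEN conjunct1] by blast
 have bij: "bij_betw ?f (carrier ?M) (?K \<rightarrow>\<^sub>E Z.Sc (pr V'))" using i1[THEN conjunct1] by simp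
 have fgr: "?f ` mgr ?M i = mgr (Z.free p q (pr V')) i" for i using i1[THEN conjunct2] by blast
 have fg: "!!c. c \<in> ?K \<rightarrow>\<^sub>E Z.Sc (pr V') ==> ?f (?g c) = c" "!!c. c \<in> ?K \<rightarrow>\<^sub>E Z.Sc (pr V') ==> ?g c \<in> carrier ?M"
 "!!m. m \<in> carrier ?M ==> ?g (?f m) = m"
 using bij_betw_inv_into_right[OF bij] bij_betwE[OF bij_betw_inv_into[OF bij]] bij_betw_inv_into_left[OF bij] by blast+
 have g_lin: "!!c d. c \<in> ?K \<rightarrow>\<^sub>E Z.Sc (pr V') ==> d \<in> ?K \<rightarrow>\<^sub>E Z.Sc (pr V') ==>
 ?g (c \<oplus>\<^bsub>Z.free p q (pr V')\<^esub> d) = ?g c \<oplus>\<^bsub>?M\<^esub> ?g d"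
 and g_smult: "!!a c. a \<in> Z.Sc (pr V') ==> c \<in> ?K \<rightarrow>\<^sub>E Z.Sc (pr V') ==>
 ?g (a \<odot>\<^bsub>Z.free p q (pr V')\<^esub> c) = a \<odot>\<^bsub>?M\<^esub> ?g c"
 proof -
 fix c d assume c: "c \<in> ?K \<rightarrow>\<^sub>E Z.Sc (pr V')" and d: "d \<in> ?K \<rightarrow>\<^sub>E Z.Sc (pr V')"
 have "?f (?g c \<oplus>\<^bsub>?M\<^esub> ?g d) = c \<oplus>\<^bsub>Z.free p q (pr V')\<^esub> d" using f2[OF fg(2)[OF c] fg(2)[OF d]] fg(1) c d by simp
 then show "?g (c \<oplus>\<^bsub>Z.free p q (pr V')\<^esub> d) = ?g c \<oplus>\<^bsub>?M\<^esub> ?g d"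
 using fg(3)[OF MF.M.a_closed[OF fg(2)[OF c] fg(2)[OF d]]] by metis
 next
 fix a c assume a: "a \<in> Z.Sc (pr V')" and c: "c \<in> ?K \<rightarrow>\<^sub>E Z.Sc (pr V')"
 have "?f (a \<odot>\<^bsub>?M\<^esub> ?g c) = a \<odot>\<^bsub>Z.free p q (pr V')\<^esub> c" using f3[OF a fg(2)[OF c]] fg(1)[OF c] by simp
 then show "?g (a \<odot>\<^bsub>Z.free p q (pr V')\<^esub> c) = a \<odot>\<^bsub>?M\<^esub> ?g c"
 using fg(3)[OF MF.smult_closed[OF a fg(2)[OF c]]] by metis
 qed
 have fk: "?f m k \<in> Z.Sc (pr V')" if "m \<in> carrier ?M" "k \<in> ?K" for m k using f1[OF that(1)] that(2) by auto
 have comc: "(\<lambda>k\<in>?K. com sg V' (c k)) \<in> ?K \<rightarrow>\<^sub>E Z.Sc (pr V')" if "c \<in> ?K \<rightarrow>\<^sub>E W.Sc V'" for c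
 using that com_closed V' by auto
 have psi: "\<psi> V' m \<in> ?K \<rightarrow>\<^sub>E W.Sc V'" "k \<in> ?K ==> com sg V' (\<psi> V' m k) = projR V' (?f m k)"
 if "m \<in> carrier ?M" for m k
 using aug[OF V'] fk[OF that] by (auto simp: \<psi>_def)
 have cpsi: "(\<lambda>k\<in>?K. com sg V' (\<psi> V' m k)) = FF.P n (?f m)" if "m \<in> carrier ?M" for m
 unfolding free_proj[OF V' f1[OF that]] by (rule restrict_ext) (rule psi(2)[OF that])
 have ceq: "c = d" if "c \<in> ?K \<rightarrow>\<^sub>E W.Sc V'" "d \<in> ?K \<rightarrow>\<^sub>E W.Sc V'" "!!k. k \<in> ?K ==> com sg V' (c k) = com sg V' (d k)" for c d
 proof (rule PiE_ext[OF that(1,2)])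
 fix k assume "k \<in> ?K"
 then show "c k = d k" using com_inj[OF V'] that PiE_mem by metis
 qed
 have 1: "\<rho> V' (\<psi> V' m) = m" if m: "m \<in> F.A (pr V')" for m
 proof -
 note mc = F.ann_sec[OF m]
 have "\<rho> V' (\<psi> V' m) = proj F V' (?g (FF.P n (?f m)))" unfolding \<rho>_def cpsi[OF mc] ..
 also have "\<dots> = proj F V' (?g (?f m))"
 proof (rule oddproj_linear[OF free_odd_module[OF V', of p q] odd_module_of[OF F V']])
 qed (use f1[OF mc] fg(2) g_lin g_smult in \<open>simp_all only: Z.free_simps(1) order_refl\<close>)
 finally show ?thesis using fg(3)[OF mc] proj_fix[OF F V' m] by simp
 qed
 have chi: "\<rho> V' c \<in> F.A (pr V')" if "c \<in> ?K \<rightarrow>\<^sub>E W.Sc V'" for c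
 unfolding \<rho>_def using proj_ann[OF F V' fg(2)[OF comc[OF that]]] .
 have 2: "\<psi> V' (\<rho> V' c) = c" if c: "c \<in> ?K \<rightarrow>\<^sub>E W.Sc V'" for c
 proof (rule ceq[OF psi(1)[OF F.ann_sec[OF chi[OF c]]] c])
 fix k assume k: "k \<in> ?K"
 let ?c = "\<lambda>k\<in>?K. com sg V' (c k)"
 have "FF.P n (?f (\<rho> V' c)) = FF.P n (?f (?g ?c))"
 unfolding \<rho>_def
 proof (rule oddproj_linear[OF odd_module_of[OF F V'] free_odd_module[OF V', of p q]])
 qed (use fg(2)[OF comc[OF c]] f1 f2 f3 in \<open>simp_all only: Z.free_simps(1) order_refl\<close>)
 then have "(\<lambda>k\<in>?K. com sg V' (\<psi> V' (\<rho> V' c) k)) = (\<lambda>k\<in>?K. projR V' (?c k))"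
 unfolding cpsi[OF F.ann_sec[OF chi[OF c]]] fg(1)[OF comc[OF c]] free_proj[OF V' comc[OF c]] .
 from fun_cong[OF this, of k] show "com sg V' (\<psi> V' (\<rho> V' c) k) = com sg V' (c k)"
 using k c projR_com[OF V', of "c k"] by auto
 qed
 have 3: "\<psi> V' (m \<oplus>\<^bsub>?M\<^esub> m') = \<psi> V' m \<oplus>\<^bsub>W.free p q V'\<^esub> \<psi> V' m'" if m: "m \<in> F.A (pr V')" "m' \<in> F.A (pr V')" for m m'
 proof (rule ceq)
 note mc = F.ann_sec[OF m(1)] F.ann_sec[OF m(2)]
 show "\<psi> V' (m \<oplus>\<^bsub>?M\<^esub> m') \<in> ?K \<rightarrow>\<^sub>E W.Sc V'" using psi(1) mc by simp
 show "\<psi> V' m \<oplus>\<^bsub>W.free p q V'\<^esub> \<psi> V' m' \<in> ?K \<rightarrow>\<^sub>E W.Sc V'" using FW.M.a_closed psi(1) mc by (simp only: W.free_simps)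
 fix k assume k: "k \<in> ?K"
 then show "com sg V' (\<psi> V' (m \<oplus>\<^bsub>?M\<^esub> m') k) = com sg V' ((\<psi> V' m \<oplus>\<^bsub>W.free p q V'\<^esub> \<psi> V' m') k)"
 using mc psi f2[OF mc] fk RR.P_add[OF order_refl, of "?f m k" "?f m' k"] com_add[OF V'(1) PiE_mem[OF psi(1)[OF mc(1)] k] PiE_mem[OF psi(1)[OF mc(2)] k]]
 by simp
 qed
 have 4: "\<psi> V' (com sg V' b \<odot>\<^bsub>?M\<^esub> m) = b \<odot>\<^bsub>W.free p q V'\<^esub> \<psi> V' m" if b: "b \<in> W.Sc V'" and m: "m \<in> F.A (pr V')" for b m
 proof (rule ceq)
 note mc = F.ann_sec[OF m] and cb = com_closed[OF V'(1) b]
 show "\<psi> V' (com sg V' b \<odot>\<^bsub>?M\<^esub> m) \<in> ?K \<rightarrow>\<^sub>E W.Sc V'" using psi(1) mc cb by simp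
 show "b \<odot>\<^bsub>W.free p q V'\<^esub> \<psi> V' m \<in> ?K \<rightarrow>\<^sub>E W.Sc V'" using FW.smult_closed[OF b] psi(1) mc by (simp only: W.free_simps)
 fix k assume k: "k \<in> ?K"
 then show "com sg V' (\<psi> V' (com sg V' b \<odot>\<^bsub>?M\<^esub> m) k) = com sg V' ((b \<odot>\<^bsub>W.free p q V'\<^esub> \<psi> V' m) k)"
 using mc psi f3[OF cb mc] fk cb RR.P_smult[OF order_refl cb, of "?f m k"] projR_com[OF V' b]
 com_mult[OF V'(1) b PiE_mem[OF psi(1)[OF mc] k]] by simp
 qed
 have 5: "\<psi> V' m \<in> mgr (W.free p q V') i" if m: "m \<in> mgr ?M i \<inter> F.A (pr V')" for m i
 proof -
 have fm: "?f m \<in> mgr (Z.free p q (pr V')) i" using fgr m by blast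
 have "?f m k \<in> gr (sec Z (pr V')) (if k < p then i else i + 1)" if "k \<in> ?K" for k
 using PiE_mem[OF fm[unfolded Z.free_simps] that] .
 then have a: "aug V' (?f m k) \<in> gr (sec W V') (if k < p then i else i + 1)" if "k \<in> ?K" for k
 using aug_gr[OF V'] that by blast
 show ?thesis unfolding \<psi>_def W.free_simps by (rule restrict_PiE_iff[THEN iffD2], rule ballI, rule a)
 qed
 have 6: "\<rho> V' c \<in> mgr ?M i" if c: "c \<in> mgr (W.free p q V') i" for c i
 proof -
 let ?c = "\<lambda>k\<in>?K. com sg V' (c k)"
 have "c k \<in> gr (sec W V') (if k < p then i else i + 1)" if "k \<in> ?K" for k
 using PiE_mem[OF c[unfolded W.free_simps] that] .
 then have a: "com sg V' (c k) \<in> gr (sec Z (pr V')) (if k < p then i else i + 1)" if "k \<in> ?K" for k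
 using com_gr[OF V'(1)] that by blast
 have "?c \<in> mgr (Z.free p q (pr V')) i" unfolding Z.free_simps by (rule restrict_PiE_iff[THEN iffD2], rule ballI, rule a)
 then obtain m where m: "m \<in> mgr ?M i" "?c = ?f m" using fgr by blast
 have "?g ?c = m" unfolding m(2) using fg(3) MF.M.g_closed[OF m(1)] by blast
 then show ?thesis unfolding \<rho>_def using MF.P_gr[OF order_refl m(1)] by simp
 qed
 show ?thesis
 by (intro conjI allI ballI; rule psi(1)[OF F.ann_sec] psi(2)[OF F.ann_sec] 1 2 3 4 5 6 chi; assumption)
 qed
 have "omod_iso (restrict_to W V) F.dp (free_omod W p q) \<psi>"
 unfolding omod_iso_def omod_mor_def rs
 proof (intro conjI allI impI)
 fix V' assume oV: "openin (space (restrict_to W V)) V'"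
 note m1 = main[OF oV, THEN conjunct1]
 note m = main[OF oV, THEN conjunct2]
 note m2 = m[THEN conjunct1] and m3 = m[THEN conjunct2, THEN conjunct1]
 note m = m[THEN conjunct2, THEN conjunct2]
 note m4 = m[THEN conjunct1] and m5 = m[THEN conjunct2, THEN conjunct1]
 note m = m[THEN conjunct2, THEN conjunct2]
 note m6 = m[THEN conjunct1] and m7 = m[THEN conjunct2, THEN conjunct1]
 show "\<forall>m\<in>carrier (msec F.dp V'). \<psi> V' m \<in> carrier (W.free p q V')"
 unfolding F.dp_simps W.free_simps by (rule m1)
 show "\<forall>m\<in>carrier (msec F.dp V'). \<forall>n\<in>carrier (msec F.dp V'). \<psi> V' (m \<oplus>\<^bsub>msec F.dp V'\<^esub> n) = \<psi> V' m \<oplus>\<^bsub>W.free p q V'\<^esub> \<psi> V' n"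
 unfolding F.dp_simps by (rule m2)
 show "\<forall>a\<in>W.Sc V'. \<forall>m\<in>carrier (msec F.dp V'). \<psi> V' (a \<odot>\<^bsub>msec F.dp V'\<^esub> m) = a \<odot>\<^bsub>W.free p q V'\<^esub> \<psi> V' m"
 unfolding F.dp_simps by (rule m3)
 show sub: "\<psi> V' ` mgr (msec F.dp V') i <= mgr (W.free p q V') i" for i
 unfolding F.dp_simps using m4 by blast
 show "bij_betw (\<psi> V') (carrier (msec F.dp V')) (carrier (W.free p q V'))"
 unfolding F.dp_simps W.free_simps(1)
 proof (rule bij_betw_byWitness[where f' = "\<rho> V'"])
 show "\<psi> V' ` F.A (pr V') <= ?K \<rightarrow>\<^sub>E W.Sc V'" using m1 by blast
 show "\<rho> V' ` (?K \<rightarrow>\<^sub>E W.Sc V') <= F.A (pr V')" using m6 by blast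
 show "\<forall>c\<in>?K \<rightarrow>\<^sub>E W.Sc V'. \<psi> V' (\<rho> V' c) = c" using m6 by blast
 qed (rule m5)
 fix i
 have "c \<in> \<psi> V' ` mgr (msec F.dp V') i" if c: "c \<in> mgr (W.free p q V') i" for c
 proof -
 interpret FW: supmod "sec W V'" "W.free p q V'" using W.free_supmod opU(2)[OF oV] by blast
 have cc: "c \<in> ?K \<rightarrow>\<^sub>E W.Sc V'" using FW.M.g_closed[OF c] unfolding W.free_simps(1) .
 have "\<rho> V' c \<in> mgr (msec F.dp V') i"
 unfolding F.dp_simps using m6[THEN bspec, OF cc] m7[THEN spec, THEN bspec, OF c] by blast
 moreover have "c = \<psi> V' (\<rho> V' c)" using m6[THEN bspec, OF cc] by simp
 ultimately show ?thesis by (rule rev_image_eqI)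
 qed
 then show "\<psi> V' ` mgr (msec F.dp V') i = mgr (W.free p q V') i" using sub[of i] by blast
 next
 fix V1 V2 assume "openin (space (restrict_to W V)) V1 & openin (space (restrict_to W V)) V2 & V2 <= V1"
 then have oV: "openin (space (restrict_to W V)) V1" "openin (space (restrict_to W V)) V2" "V2 <= V1" by auto
 note V1 = opU(2,4)[OF oV(1)] and V2 = opU(2,4)[OF oV(2)]
 note o = pre_open[OF V1(1)] pre_open[OF V2(1)] pre_mono[OF oV(3)]
 show "\<forall>m\<in>carrier (msec F.dp V1). \<psi> V2 (mres F.dp V1 V2 m) = mres (free_omod W p q) V1 V2 (\<psi> V1 m)"
 unfolding F.dp_simps
 proof
 fix m assume m: "m \<in> F.A (pr V1)"
 let ?r = "mres F (pr V1) (pr V2) m"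
 have rA: "?r \<in> F.A (pr V2)" using F.ann_res[OF o m] .
 have fr: "f (pr V2) ?r = mres (free_omod Z p q) (pr V1) (pr V2) (f (pr V1) m)"
 using iso[THEN conjunct1, THEN conjunct2, THEN spec, THEN spec, THEN mp, of "pr V1" "pr V2"] opU(1)[OF oV(1)] opU(1)[OF oV(2)] o(3)
 F.ann_sec[OF m] by blast
 have p1: "\<psi> V1 m \<in> ?K \<rightarrow>\<^sub>E W.Sc V1" "\<psi> V2 ?r \<in> ?K \<rightarrow>\<^sub>E W.Sc V2"
 using main[OF oV(1), THEN conjunct1] main[OF oV(2), THEN conjunct1] m rA by blast+
 show "\<psi> V2 ?r = mres (free_omod W p q) V1 V2 (\<psi> V1 m)"
 unfolding W.free_simps
 proof (rule PiE_ext[OF p1(2)])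
 show "(\<lambda>k\<in>?K. res W V1 V2 (\<psi> V1 m k)) \<in> ?K \<rightarrow>\<^sub>E W.Sc V2"
 using p1(1) W.res_closed[OF V1(1) V2(1) oV(3)] by auto
 fix k assume k: "k \<in> ?K"
 note pk = PiE_mem[OF p1(1) k]
 have fk: "f (pr V1) m k \<in> Z.Sc (pr V1)"
 using iso[THEN conjunct1, THEN conjunct1, THEN spec, THEN mp, OF opU(1)[OF oV(1)], THEN conjunct1] F.ann_sec[OF m] k
 unfolding Z.free_simps(1) by (blast intro: PiE_mem)
 note last = main[THEN conjunct2, THEN conjunct2, THEN conjunct2, THEN conjunct2, THEN conjunct2,
 THEN conjunct2, THEN conjunct2, THEN bspec, THEN bspec]
 note a = last[OF oV(1) m k] last[OF oV(2) rA k]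
 have "com sg V2 (\<psi> V2 ?r k) = com sg V2 (res W V1 V2 (\<psi> V1 m k))"
 using a com_res[OF V1(1) V2(1) oV(3) pk] projR_res[OF V1 V2(1) oV(3) fk] fr k by simp
 then have "\<psi> V2 ?r k = res W V1 V2 (\<psi> V1 m k)"
 using com_inj[OF V2 PiE_mem[OF p1(2) k] W.res_closed[OF V1(1) V2(1) oV(3) pk]] by simp
 then show "\<psi> V2 ?r k = (\<lambda>k\<in>?K. res W V1 V2 (\<psi> V1 m k)) k" using k by simp
 qed
 qed
 qed
 then show ?thesis unfolding fo by blast
qed

end

theorem (in osub) dplus_free_near:
 assumes F: "dmodule S0 Z F" and z: "z \<in> topspace (space Z)" and fr: "free_near Z F z p q"
 shows "free_near W (dplus S0 Z W sg F) (pt sg z) p q"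
proof -
 obtain U f where U: "Z.opn U" "z \<in> U" and f: "omod_iso (restrict_to Z U) F (free_omod (restrict_to Z U) p q) f"
 using fr unfolding free_near_def by blast
 have "pt sg z \<in> topspace (space W)" using z surj_pt by blast
 then obtain V0 et n where fr0: "pt sg z \<in> V0" "frame S0 Z W sg V0 et n" using frame_exists by blast
 interpret frame S0 Z W sg V0 et n by (rule fr0)
 let ?V = "dn U \<inter> V0"
 have o: "W.opn ?V" "?V <= V0" using dn_open[OF U(1)] V0 by auto
 have s: "pr ?V <= U" using pre_dn[OF U(1)] pre_mono[of ?V "dn U"] by auto
 show ?thesis unfolding free_near_def using free_over_frame[OF F U(1) o(2,1) s f] o(1) U(2) fr0(1) by blast
qed

section \<open>Tensor products of supermodules\<close>

lemma rel_neg: "x \<in> tensor_rel R M N ==> - x \<in> tensor_rel R M N"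
 using tensor_rel.diff[OF tensor_rel.zero] by simp

lemma rel_add: "x \<in> tensor_rel R M N ==> y \<in> tensor_rel R M N ==> x + y \<in> tensor_rel R M N"
 using tensor_rel.diff[OF _ rel_neg] by fastforce

text \<open>Equality in the tensor product of the elements represented by two formal combinations.\<close>

definition teq ::
 "('a, 'r) superring_scheme => ('a, 'm, 's) supermod_scheme => ('a, 'n, 't) supermod_scheme =>
 ('m \<times> 'n \<Rightarrow>\<^sub>0 int) => ('m \<times> 'n \<Rightarrow>\<^sub>0 int) => bool" where
 "teq R M N c d \<longleftrightarrow> c - d \<in> tensor_rel R M N"

lemma teq_refl [simp]: "teq R M N c c"
 by (simp add: teq_def tensor_rel.zero)

lemma teq_sym: "teq R M N c d ==> teq R M N d c"
 using rel_neg by (fastforce simp: teq_def)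

lemma teq_trans [trans]: "teq R M N c d ==> teq R M N d e ==> teq R M N c e"
 using rel_add[of "c - d" R M N "d - e"] by (simp add: teq_def)

lemma teq_add: "teq R M N c d ==> teq R M N c' d' ==> teq R M N (c + c') (d + d')"
 using rel_add[of "c - d" R M N "c' - d'"] by (simp add: teq_def algebra_simps)

lemma teq_diff: "teq R M N c d ==> teq R M N c' d' ==> teq R M N (c - c') (d - d')"
 using tensor_rel.diff[of "c - d" R M N "c' - d'"] by (simp add: teq_def algebra_simps)

lemma tensor_frags_closed:
 "0 \<in> tensor_frags M N" "c \<in> tensor_frags M N ==> d \<in> tensor_frags M N ==> c + d \<in> tensor_frags M N"
 "c \<in> tensor_frags M N ==> d \<in> tensor_frags M N ==> c - d \<in> tensor_frags M N"
 "m \<in> carrier M ==> n \<in> carrier N ==> frag_of (m, n) \<in> tensor_frags M N"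
 "c \<in> tensor_frags M N ==> frag_cmul k c \<in> tensor_frags M N"
 using Poly_Mapping.keys_add[of c d] keys_diff[of c d] keys_cmul[of k c]
 by (auto simp: tensor_frags_def)

lemma tensor_frags_induct [consumes 1, case_names zero one diff]:
 assumes "c \<in> tensor_frags M N" "Q 0" "!!m n. m \<in> carrier M ==> n \<in> carrier N ==> Q (frag_of (m, n))"
 "!!c d. Q c ==> Q d ==> Q (c - d)"
 shows "Q c"
 by (rule frag_induction[of c "carrier M \<times> carrier N"]) (use assms in \<open>auto simp: tensor_frags_def\<close>)

lemma frag_extend_frags:
 assumes "c \<in> tensor_frags M N" "!!m n. m \<in> carrier M ==> n \<in> carrier N ==> f (m, n) \<in> tensor_frags M' N'"
 shows "frag_extend f c \<in> tensor_frags M' N'"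
 using assms(1) by (induction rule: tensor_frags_induct)
 (simp_all add: assms(2) frag_extend_diff tensor_frags_closed)

lemma frag_extend_rel:
 assumes "x \<in> tensor_rel R M N"
 and "!!m m' n. m \<in> carrier M ==> m' \<in> carrier M ==> n \<in> carrier N ==>
 teq R' M' N' (f (m \<oplus>\<^bsub>M\<^esub> m', n)) (f (m, n) + f (m', n))"
 and "!!m n n'. m \<in> carrier M ==> n \<in> carrier N ==> n' \<in> carrier N ==>
 teq R' M' N' (f (m, n \<oplus>\<^bsub>N\<^esub> n')) (f (m, n) + f (m, n'))"
 and "!!a i j m n. a \<in> gr R i ==> m \<in> mgr M j ==> n \<in> carrier N ==>
 teq R' M' N' (f (ksgn M i j (a \<odot>\<^bsub>M\<^esub> m), n)) (f (m, a \<odot>\<^bsub>N\<^esub> n))"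
 shows "frag_extend f x \<in> tensor_rel R' M' N'"
 using assms(1)
proof induction
 case zero
 then show ?case by (simp add: tensor_rel.zero)
next
 case (diff x y)
 then show ?case by (simp add: frag_extend_diff tensor_rel.diff)
next
 case (add_left m m' n)
 then show ?case using assms(2)[of m m' n] by (simp add: frag_extend_diff frag_extend_add teq_def diff_diff_eq)
next
 case (add_right m n n')
 then show ?case using assms(3)[of m n n'] by (simp add: frag_extend_diff frag_extend_add teq_def diff_diff_eq)
next
 case (balanced a i m j n)
 then show ?case using assms(4)[of a i m j n] by (simp add: frag_extend_diff teq_def)
qed

lemma class_self: "c \<in> tensor_frags M N ==> c \<in> tensor_class R M N c"
 by (simp add: tensor_class_def tensor_rel.zero)

lemma class_eqI: "teq R M N c d ==> tensor_class R M N c = tensor_class R M N d"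
proof -
 assume t: "teq R M N c d"
 have "x - c \<in> tensor_rel R M N \<longleftrightarrow> x - d \<in> tensor_rel R M N" for x
 using teq_trans[of R M N x c d] teq_trans[of R M N x d c] t teq_sym[OF t] unfolding teq_def by blast
 then show ?thesis by (simp add: tensor_class_def)
qed

lemma class_eq_iff: "c \<in> tensor_frags M N ==> tensor_class R M N c = tensor_class R M N d \<longleftrightarrow> teq R M N c d"
proof
 assume c: "c \<in> tensor_frags M N" and e: "tensor_class R M N c = tensor_class R M N d"
 have "c \<in> tensor_class R M N d" using class_self[OF c, of R] unfolding e .
 then show "teq R M N c d" by (simp add: tensor_class_def teq_def)
qed (rule class_eqI)

lemma class_op:
 assumes "c \<in> tensor_frags M N" "!!x. x \<in> tensor_rel R M N ==> f x \<in> tensor_rel R' M' N'"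
 "!!x y. f (x - y) = f x - f y"
 shows "(\<Union>c'\<in>tensor_class R M N c. tensor_class R' M' N' (f c')) = tensor_class R' M' N' (f c)"
proof -
 have "tensor_class R' M' N' (f c') = tensor_class R' M' N' (f c)" if "c' \<in> tensor_class R M N c" for c'
 using that assms(2)[of "c' - c"] by (intro class_eqI) (auto simp: tensor_class_def teq_def assms(3))
 then show ?thesis using class_self[OF assms(1), of R] by blast
qed

locale tens = M: supmod R M + N: supmod R N
 for R :: "('a, 'r) superring_scheme" and M :: "('a, 'm, 's) supermod_scheme" and N :: "('a, 'n, 't) supermod_scheme"
begin

abbreviation tq (infix \<open>\<doteq>\<close> 50) where "tq \<equiv> teq R M N"

lemma te_add_l: "m \<in> carrier M ==> m' \<in> carrier M ==> n \<in> carrier N ==>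
 frag_of (m \<oplus>\<^bsub>M\<^esub> m', n) \<doteq> frag_of (m, n) + frag_of (m', n)"
 using tensor_rel.add_left[of m M m' n N R] by (simp add: teq_def diff_diff_eq)

lemma te_add_r: "m \<in> carrier M ==> n \<in> carrier N ==> n' \<in> carrier N ==>
 frag_of (m, n \<oplus>\<^bsub>N\<^esub> n') \<doteq> frag_of (m, n) + frag_of (m, n')"
 using tensor_rel.add_right[of m M n N n' R] by (simp add: teq_def diff_diff_eq)

lemma te_zero_l: "n \<in> carrier N ==> frag_of (\<zero>\<^bsub>M\<^esub>, n) \<doteq> 0"
 using te_add_l[of "\<zero>\<^bsub>M\<^esub>" "\<zero>\<^bsub>M\<^esub>" n] rel_neg by (fastforce simp: teq_def)

lemma te_zero_r: "m \<in> carrier M ==> frag_of (m, \<zero>\<^bsub>N\<^esub>) \<doteq> 0"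
 using te_add_r[of m "\<zero>\<^bsub>N\<^esub>" "\<zero>\<^bsub>N\<^esub>"] rel_neg by (fastforce simp: teq_def)

lemma te_neg_l: "m \<in> carrier M ==> n \<in> carrier N ==> frag_of (\<ominus>\<^bsub>M\<^esub> m, n) \<doteq> - frag_of (m, n)"
proof -
 assume c: "m \<in> carrier M" "n \<in> carrier N"
 then have "frag_of (m, n) + frag_of (\<ominus>\<^bsub>M\<^esub> m, n) \<doteq> frag_of (\<zero>\<^bsub>M\<^esub>, n)"
 using teq_sym[OF te_add_l[of m "\<ominus>\<^bsub>M\<^esub> m" n]] by (simp add: M.M.r_neg)
 then have "frag_of (m, n) + frag_of (\<ominus>\<^bsub>M\<^esub> m, n) \<doteq> 0" by (rule teq_trans) (use c te_zero_l in blast)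
 then show ?thesis by (simp add: teq_def add.commute)
qed

lemma te_neg_r: "m \<in> carrier M ==> n \<in> carrier N ==> frag_of (m, \<ominus>\<^bsub>N\<^esub> n) \<doteq> - frag_of (m, n)"
proof -
 assume c: "m \<in> carrier M" "n \<in> carrier N"
 then have "frag_of (m, n) + frag_of (m, \<ominus>\<^bsub>N\<^esub> n) \<doteq> frag_of (m, \<zero>\<^bsub>N\<^esub>)"
 using teq_sym[OF te_add_r[of m n "\<ominus>\<^bsub>N\<^esub> n"]] by (simp add: N.M.r_neg)
 then have "frag_of (m, n) + frag_of (m, \<ominus>\<^bsub>N\<^esub> n) \<doteq> 0" by (rule teq_trans) (use c te_zero_r in blast)
 then show ?thesis by (simp add: teq_def add.commute)
qed

text \<open>The relation $ma \otimes n = m \otimes an$ with the sign expressed by the parity involution, for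
 inhomogeneous \<open>m\<close>.\<close>

lemma te_bal:
 assumes a: "a \<in> gr R i" and m: "m \<in> carrier M" and n: "n \<in> carrier N"
 shows "frag_of (m, a \<odot>\<^bsub>N\<^esub> n) \<doteq> frag_of (a \<odot>\<^bsub>M\<^esub> M.M.tw i m, n)"
proof -
 have ac: "a \<in> carrier R" using M.gr.g_closed[OF a] .
 from m show ?thesis
 proof (induction rule: M.M.graded_induct)
 case (hom j m)
 have "m \<in> carrier M" using M.M.g_closed[OF hom] .
 then have "a \<odot>\<^bsub>M\<^esub> M.M.tw i m = ksgn M i j (a \<odot>\<^bsub>M\<^esub> m)"
 using ac by (simp add: M.M.tw_of[OF hom] ksgn_def M.smult_r_minus)
 then show ?case using rel_neg[OF tensor_rel.balanced[OF a hom n]] by (simp add: teq_def)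
 next
 case (add x y)
 have an: "a \<odot>\<^bsub>N\<^esub> n \<in> carrier N" using ac n by simp
 have t: "a \<odot>\<^bsub>M\<^esub> M.M.tw i x \<in> carrier M" "a \<odot>\<^bsub>M\<^esub> M.M.tw i y \<in> carrier M" using ac add by auto
 have "frag_of (x \<oplus>\<^bsub>M\<^esub> y, a \<odot>\<^bsub>N\<^esub> n) \<doteq> frag_of (x, a \<odot>\<^bsub>N\<^esub> n) + frag_of (y, a \<odot>\<^bsub>N\<^esub> n)"
 using te_add_l add an by blast
 also have "\<dots> \<doteq> frag_of (a \<odot>\<^bsub>M\<^esub> M.M.tw i x, n) + frag_of (a \<odot>\<^bsub>M\<^esub> M.M.tw i y, n)"
 using teq_add add by blast
 also have "\<dots> \<doteq> frag_of (a \<odot>\<^bsub>M\<^esub> M.M.tw i x \<oplus>\<^bsub>M\<^esub> a \<odot>\<^bsub>M\<^esub> M.M.tw i y, n)"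
 using teq_sym[OF te_add_l[OF t n]] .
 finally show ?case using add ac by (simp add: M.M.tw_add M.smult_r_distr)
 qed
qed

lemma ksgn_smult: "a \<in> gr R i ==> m \<in> mgr M j ==> ksgn M i j (a \<odot>\<^bsub>M\<^esub> m) = a \<odot>\<^bsub>M\<^esub> M.M.tw i m"
 using M.gr.g_closed M.M.g_closed by (simp add: M.M.tw_of ksgn_def M.smult_r_minus)

lemma smult_rel:
 assumes b: "b \<in> carrier R" and x: "x \<in> tensor_rel R M N"
 shows "frag_extend (\<lambda>(m, n). frag_of (b \<odot>\<^bsub>M\<^esub> m, n)) x \<in> tensor_rel R M N"
proof (rule frag_extend_rel[OF x])
 fix m m' n assume "m \<in> carrier M" "m' \<in> carrier M" "n \<in> carrier N"
 then show "(case (m \<oplus>\<^bsub>M\<^esub> m', n) of (m, n) => frag_of (b \<odot>\<^bsub>M\<^esub> m, n)) \<doteq>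
 (case (m, n) of (m, n) => frag_of (b \<odot>\<^bsub>M\<^esub> m, n)) + (case (m', n) of (m, n) => frag_of (b \<odot>\<^bsub>M\<^esub> m, n))"
 using te_add_l[of "b \<odot>\<^bsub>M\<^esub> m" "b \<odot>\<^bsub>M\<^esub> m'" n] b by (simp add: M.smult_r_distr)
next
 fix m n n' assume "m \<in> carrier M" "n \<in> carrier N" "n' \<in> carrier N"
 then show "(case (m, n \<oplus>\<^bsub>N\<^esub> n') of (m, n) => frag_of (b \<odot>\<^bsub>M\<^esub> m, n)) \<doteq>
 (case (m, n) of (m, n) => frag_of (b \<odot>\<^bsub>M\<^esub> m, n)) + (case (m, n') of (m, n) => frag_of (b \<odot>\<^bsub>M\<^esub> m, n))"
 using te_add_r b by simp
next
 fix a i j m n assume a: "a \<in> gr R i" and m: "m \<in> mgr M j" and n: "n \<in> carrier N"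
 have c: "a \<in> carrier R" "m \<in> carrier M" using M.gr.g_closed[OF a] M.M.g_closed[OF m] .
 have "b \<odot>\<^bsub>M\<^esub> (a \<odot>\<^bsub>M\<^esub> M.M.tw i m) = a \<odot>\<^bsub>M\<^esub> M.M.tw i (b \<odot>\<^bsub>M\<^esub> m)"
 using b c M.supercommute_tw[OF a, of "M.gr.tw i b"] by (simp add: M.tw_smult flip: M.smult_assoc)
 then show "(case (ksgn M i j (a \<odot>\<^bsub>M\<^esub> m), n) of (m, n) => frag_of (b \<odot>\<^bsub>M\<^esub> m, n)) \<doteq>
 (case (m, a \<odot>\<^bsub>N\<^esub> n) of (m, n) => frag_of (b \<odot>\<^bsub>M\<^esub> m, n))"
 using teq_sym[OF te_bal[OF a _ n, of "b \<odot>\<^bsub>M\<^esub> m"]] b c by (simp add: ksgn_smult[OF a m])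
qed

end

section \<open>The presheaf of tensor products\<close>

lemma (in dmodl) conn_tw:
 assumes U: "opn U" and v: "v \<in> hom_vf S0 Z U i" and m: "m \<in> Mc U"
 shows "ptwist (msec F U) (mgr (msec F U)) k (conn F U v m) =
 ksgn (msec F U) k i (conn F U v (ptwist (msec F U) (mgr (msec F U)) k m))"
proof -
 interpret supmod "sec Z U" "msec F U" using smod U .
 note vT = hom_vf_in_T[OF v] and c = conn_closed[OF U hom_vf_in_T[OF v]]
 have neg: "conn F U v (\<ominus>\<^bsub>msec F U\<^esub> x) = \<ominus>\<^bsub>msec F U\<^esub> conn F U v x" if "x \<in> Mc U" for x
 using that c conn_zero[OF U vT] by (intro M.neg_unique) (simp_all flip: conn_add[OF U vT] add: M.r_neg)
 from m show ?thesis
 proof (induction rule: M.graded_induct)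
 case (hom j m)
 have "m \<in> Mc U" using M.g_closed[OF hom] .
 then show ?case using c M.tw_of[OF hom, of k] M.tw_of[OF conn_gr[OF U v hom], of k]
 bit_cases[of k] bit_cases[of i] bit_cases[of j] by (auto simp: ksgn_def neg)
 next
 case (add x y)
 then show ?case using c by (simp add: conn_add[OF U vT] M.tw_add) (simp add: ksgn_def M.minus_add)
 qed
qed

locale tpre = sspace S0 Z + F: dmodl S0 Z F + G: dmodl S0 Z G
 for S0 :: "('l, complex) superalg" and Z :: "('z, 'a, 'l) superspace"
 and F :: "('z, 'a, 'm) dmod" and G :: "('z, 'a, 'n) dmod"
begin

abbreviation fr where "fr U \<equiv> tensor_frags (msec F U) (msec G U)"
abbreviation te where "te U \<equiv> teq (sec Z U) (msec F U) (msec G U)"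
abbreviation cl where "cl U \<equiv> tensor_class (sec Z U) (msec F U) (msec G U)"
abbreviation rel where "rel U \<equiv> tensor_rel (sec Z U) (msec F U) (msec G U)"
abbreviation rs :: "'z set => 'z set => ('m \<times> 'n \<Rightarrow>\<^sub>0 int) => ('m \<times> 'n \<Rightarrow>\<^sub>0 int)" where
 "rs U V \<equiv> frag_extend (\<lambda>(m, n). frag_of (mres F U V m, mres G U V n))"
abbreviation sm :: "'z set => 'a => ('m \<times> 'n \<Rightarrow>\<^sub>0 int) => ('m \<times> 'n \<Rightarrow>\<^sub>0 int)" where
 "sm U b \<equiv> frag_extend (\<lambda>(m, n). frag_of (b \<odot>\<^bsub>msec F U\<^esub> m, n))"
abbreviation cn where "cn U \<equiv> tensor_conn_frag S0 Z F G U"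
abbreviation P where "P \<equiv> tensor_presheaf S0 Z F G"
abbreviation gfr where "gfr U i \<equiv> {c. Poly_Mapping.keys c <= (\<Union>j. mgr (msec F U) j \<times> mgr (msec G U) (i + j))}"

lemma tens: "opn U ==> tens (sec Z U) (msec F U) (msec G U)"
 using F.smod G.smod by (simp add: tens_def)

lemma cn_diff: "cn U v (c - d) = cn U v c - cn U v d"
 by (simp add: tensor_conn_frag_def frag_extend_diff)

lemma cn_of: "cn U v (frag_of (m, n)) = frag_of (conn F U v m, n) +
 (\<Sum>i\<in>{0, 1}. \<Sum>j\<in>{0, 1}. frag_cmul (if i = 1 & j = 1 then -1 else 1)
 (frag_of (mpart (msec F U) j m, conn G U (Tpart U i v) n)))"
 by (simp add: tensor_conn_frag_def mpart_eq_hpart[of "T U"])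

text \<open>The Leibniz rule for inhomogeneous arguments, in terms of the homogeneous parts of the vector
 field.\<close>

lemma cn_teq:
 assumes U: "opn U" and v: "v \<in> carrier (T U)" and m: "m \<in> F.Mc U" and n: "n \<in> G.Mc U"
 shows "te U (cn U v (frag_of (m, n)))
 ((frag_of (conn F U (Tpart U 0 v) m, n) + frag_of (m, conn G U (Tpart U 0 v) n)) +
 (frag_of (conn F U (Tpart U 1 v) m, n) +
 frag_of (ptwist (msec F U) (mgr (msec F U)) 1 m, conn G U (Tpart U 1 v) n)))"
proof -
 interpret tens "sec Z U" "msec F U" "msec G U" using tens U .
 note p = hom_vf_in_T[OF Tpart_in[OF U v]]
 let ?x = "M.M.prt 0 m" and ?y = "M.M.prt 1 m" and ?a = "conn G U (Tpart U 0 v) n" and ?b = "conn G U (Tpart U 1 v) n"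
 have c: "?x \<in> F.Mc U" "?y \<in> F.Mc U" "?a \<in> G.Mc U" "?b \<in> G.Mc U" "\<ominus>\<^bsub>msec F U\<^esub> ?y \<in> F.Mc U"
 using m n G.conn_closed[OF U p] by auto
 have 1: "te U (frag_of (conn F U v m, n)) (frag_of (conn F U (Tpart U 0 v) m, n) + frag_of (conn F U (Tpart U 1 v) m, n))"
 unfolding F.conn_parts[OF U v m] using te_add_l F.conn_closed[OF U p m] n by blast
 have 2: "te U (frag_of (?x, ?a) + frag_of (?y, ?a)) (frag_of (m, ?a))"
 using teq_sym[OF te_add_l[OF c(1,2,3)]] M.M.part_sum01[OF m] by simp
 have "te U (frag_of (?x, ?b) + frag_of (\<ominus>\<^bsub>msec F U\<^esub> ?y, ?b)) (frag_of (M.M.tw 1 m, ?b))"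
 using teq_sym[OF te_add_l[OF c(1,5,4)]] by (simp add: ptwist_def a_minus_def)
 then have 3: "te U (frag_of (?x, ?b) + - frag_of (?y, ?b)) (frag_of (M.M.tw 1 m, ?b))"
 using teq_trans[OF teq_add[OF teq_refl teq_sym[OF te_neg_l[OF c(2,4)]]]] by blast
 have E: "cn U v (frag_of (m, n)) = frag_of (conn F U v m, n) +
 ((frag_of (?x, ?a) + frag_of (?y, ?a)) + (frag_of (?x, ?b) + - frag_of (?y, ?b)))"
 by (simp add: cn_of mpart_eq_hpart)
 show ?thesis
 using teq_add[OF 1 teq_add[OF 2 3]] unfolding E by (simp only: add.assoc add.left_commute add.commute)
qed

lemma cn_hom:
 assumes U: "opn U" and v: "v \<in> hom_vf S0 Z U i" and m: "m \<in> F.Mc U" and n: "n \<in> G.Mc U"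
 shows "te U (cn U v (frag_of (m, n)))
 (frag_of (conn F U v m, n) + frag_of (ptwist (msec F U) (mgr (msec F U)) i m, conn G U v n))"
proof -
 interpret tens "sec Z U" "msec F U" "msec G U" using tens U .
 interpret g: graded_group "T U" "hom_vf S0 Z U" using T_graded U .
 have p: "Tpart U k v = (if k = i then v else \<zero>\<^bsub>T U\<^esub>)" for k using g.part_of[OF v] .
 have z: "te U (frag_of (conn F U \<zero>\<^bsub>T U\<^esub> m, n) + frag_of (x, conn G U \<zero>\<^bsub>T U\<^esub> n)) 0" if "x \<in> F.Mc U" for x
 unfolding F.conn_vzero[OF U m] G.conn_vzero[OF U n]
 using teq_add[OF te_zero_l[OF n] te_zero_r[OF that]] by simp
 consider "i = 0" | "i = 1" using bit_cases by auto
 then show ?thesis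
 proof cases
 case 1
 have p': "Tpart U 0 v = v" "Tpart U 1 v = \<zero>\<^bsub>T U\<^esub>" using p 1 by auto
 show ?thesis
 using teq_trans[OF cn_teq[OF U hom_vf_in_T[OF v] m n] teq_add[OF teq_refl z[OF M.M.tw_closed[OF m, of 1], folded p'(2)]]]
 unfolding p'(1) 1 by simp
 next
 case 2
 have p': "Tpart U 0 v = \<zero>\<^bsub>T U\<^esub>" "Tpart U 1 v = v" using p 2 by auto
 show ?thesis
 using teq_trans[OF cn_teq[OF U hom_vf_in_T[OF v] m n] teq_add[OF z[OF m, folded p'(1)] teq_refl]]
 unfolding p'(2) 2 by simp
 qed
qed

lemma leibniz_rel:
 assumes U: "opn U" and v: "v \<in> hom_vf S0 Z U i" and x: "x \<in> rel U"
 shows "frag_extend (\<lambda>(m, n). frag_of (conn F U v m, n) +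
 frag_of (ptwist (msec F U) (mgr (msec F U)) i m, conn G U v n)) x \<in> rel U"
proof -
 interpret tens "sec Z U" "msec F U" "msec G U" using tens U .
 note vT = hom_vf_in_T[OF v]
 note c = F.conn_closed[OF U vT] G.conn_closed[OF U vT] and s = F.conn_add[OF U vT] G.conn_add[OF U vT]
 note d = hom_vf_apply[OF v U order_refl]
 show ?thesis
 proof (rule frag_extend_rel[OF x]; unfold prod.case)
 fix m m' n assume m: "m \<in> F.Mc U" "m' \<in> F.Mc U" and n: "n \<in> G.Mc U"
 have "te U (frag_of (conn F U v (m \<oplus>\<^bsub>msec F U\<^esub> m'), n) + frag_of (M.M.tw i (m \<oplus>\<^bsub>msec F U\<^esub> m'), conn G U v n))
 ((frag_of (conn F U v m, n) + frag_of (conn F U v m', n)) +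
 (frag_of (M.M.tw i m, conn G U v n) + frag_of (M.M.tw i m', conn G U v n)))"
 unfolding s(1)[OF m] M.M.tw_add[OF m]
 by (rule teq_add[OF te_add_l[OF c(1)[OF m(1)] c(1)[OF m(2)] n]
 te_add_l[OF M.M.tw_closed[OF m(1)] M.M.tw_closed[OF m(2)] c(2)[OF n]]])
 then show "te U (frag_of (conn F U v (m \<oplus>\<^bsub>msec F U\<^esub> m'), n) + frag_of (M.M.tw i (m \<oplus>\<^bsub>msec F U\<^esub> m'), conn G U v n))
 (frag_of (conn F U v m, n) + frag_of (M.M.tw i m, conn G U v n) +
 (frag_of (conn F U v m', n) + frag_of (M.M.tw i m', conn G U v n)))"
 by (simp only: add.assoc add.left_commute add.commute)
 next
 fix m n n' assume m: "m \<in> F.Mc U" and n: "n \<in> G.Mc U" "n' \<in> G.Mc U"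
 have "te U (frag_of (conn F U v m, n \<oplus>\<^bsub>msec G U\<^esub> n') + frag_of (M.M.tw i m, conn G U v (n \<oplus>\<^bsub>msec G U\<^esub> n')))
 ((frag_of (conn F U v m, n) + frag_of (conn F U v m, n')) +
 (frag_of (M.M.tw i m, conn G U v n) + frag_of (M.M.tw i m, conn G U v n')))"
 unfolding s(2)[OF n]
 by (rule teq_add[OF te_add_r[OF c(1)[OF m] n] te_add_r[OF M.M.tw_closed[OF m] c(2)[OF n(1)] c(2)[OF n(2)]]])
 then show "te U (frag_of (conn F U v m, n \<oplus>\<^bsub>msec G U\<^esub> n') + frag_of (M.M.tw i m, conn G U v (n \<oplus>\<^bsub>msec G U\<^esub> n')))
 (frag_of (conn F U v m, n) + frag_of (M.M.tw i m, conn G U v n) +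
 (frag_of (conn F U v m, n') + frag_of (M.M.tw i m, conn G U v n')))"
 by (simp only: add.assoc add.left_commute add.commute)
 next
 fix a k j m n assume a: "a \<in> gr (sec Z U) k" and mj: "m \<in> mgr (msec F U) j" and n: "n \<in> G.Mc U"
 have ac: "a \<in> Sc U" and m: "m \<in> F.Mc U" using M.gr.g_closed[OF a] M.M.g_closed[OF mj] .
 let ?t = "M.M.tw" and ?a = "M.gr.tw i a" and ?m = "M.M.tw k m" and ?vn = "conn G U v n"
 have ag: "?a \<in> gr (sec Z U) k" using M.gr.tw_in[OF a] .
 have cc: "v U a \<in> Sc U" "?a \<in> Sc U" "?m \<in> F.Mc U" "conn F U v ?m \<in> F.Mc U" "?vn \<in> G.Mc U" "?t i m \<in> F.Mc U"
 "conn F U v m \<in> F.Mc U" "?t i ?m \<in> F.Mc U"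
 "v U a \<odot>\<^bsub>msec F U\<^esub> ?m \<in> F.Mc U" "?a \<odot>\<^bsub>msec F U\<^esub> conn F U v ?m \<in> F.Mc U"
 "v U a \<odot>\<^bsub>msec G U\<^esub> n \<in> G.Mc U" "?a \<odot>\<^bsub>msec G U\<^esub> ?vn \<in> G.Mc U"
 using ac m n c d(1) by auto
 have tt: "?t (i + k) (?t i m) = ?m" "?t k (?t i m) = ?t i ?m"
 using m bit_cases[of i] bit_cases[of k] by auto
 have sg: "a \<odot>\<^bsub>msec F U\<^esub> ?t k (conn F U v m) = ?a \<odot>\<^bsub>msec F U\<^esub> conn F U v ?m"
 using F.conn_tw[OF U v m, of k] cc ac by (auto simp: M.gr.tw_of[OF a] ksgn_def M.smult_r_minus M.smult_l_minus)
 have "te U (frag_of (conn F U v m, a \<odot>\<^bsub>msec G U\<^esub> n) + frag_of (?t i m, conn G U v (a \<odot>\<^bsub>msec G U\<^esub> n)))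
 (frag_of (a \<odot>\<^bsub>msec F U\<^esub> ?t k (conn F U v m), n) +
 (frag_of (?t i m, v U a \<odot>\<^bsub>msec G U\<^esub> n) + frag_of (?t i m, ?a \<odot>\<^bsub>msec G U\<^esub> ?vn)))"
 unfolding G.conn_leibniz[OF U v ac n] by (rule teq_add[OF te_bal[OF a cc(7) n] te_add_r[OF cc(6,11,12)]])
 also have "te U \<dots> (frag_of (a \<odot>\<^bsub>msec F U\<^esub> ?t k (conn F U v m), n) +
 (frag_of (v U a \<odot>\<^bsub>msec F U\<^esub> ?t (i + k) (?t i m), n) + frag_of (?a \<odot>\<^bsub>msec F U\<^esub> ?t k (?t i m), ?vn)))"
 by (rule teq_add[OF teq_refl teq_add[OF te_bal[OF d(3)[OF a] cc(6) n] te_bal[OF ag cc(6,5)]]])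
 finally have 1: "te U (frag_of (conn F U v m, a \<odot>\<^bsub>msec G U\<^esub> n) + frag_of (?t i m, conn G U v (a \<odot>\<^bsub>msec G U\<^esub> n)))
 (frag_of (?a \<odot>\<^bsub>msec F U\<^esub> conn F U v ?m, n) +
 (frag_of (v U a \<odot>\<^bsub>msec F U\<^esub> ?m, n) + frag_of (?a \<odot>\<^bsub>msec F U\<^esub> ?t i ?m, ?vn)))"
 unfolding sg tt .
 have 2: "te U (frag_of (conn F U v (a \<odot>\<^bsub>msec F U\<^esub> ?m), n) + frag_of (?t i (a \<odot>\<^bsub>msec F U\<^esub> ?m), ?vn))
 ((frag_of (v U a \<odot>\<^bsub>msec F U\<^esub> ?m, n) + frag_of (?a \<odot>\<^bsub>msec F U\<^esub> conn F U v ?m, n)) + frag_of (?a \<odot>\<^bsub>msec F U\<^esub> ?t i ?m, ?vn))"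
 unfolding F.conn_leibniz[OF U v ac cc(3)] M.tw_smult[OF ac cc(3)] by (rule teq_add[OF te_add_l[OF cc(9,10) n] teq_refl])
 show "te U (frag_of (conn F U v (ksgn (msec F U) k j (a \<odot>\<^bsub>msec F U\<^esub> m)), n) +
 frag_of (?t i (ksgn (msec F U) k j (a \<odot>\<^bsub>msec F U\<^esub> m)), ?vn))
 (frag_of (conn F U v m, a \<odot>\<^bsub>msec G U\<^esub> n) + frag_of (?t i m, conn G U v (a \<odot>\<^bsub>msec G U\<^esub> n)))"
 unfolding ksgn_smult[OF a mj] by (rule teq_trans[OF _ teq_sym[OF 1]]) (use 2 in \<open>simp only: add.assoc add.left_commute add.commute\<close>)
 qed
qed

lemma cn_rel:
 assumes U: "opn U" and v: "v \<in> carrier (T U)" and x: "x \<in> rel U" "x \<in> fr U"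
 shows "cn U v x \<in> rel U"
proof -
 let ?e = "\<lambda>i. frag_extend (\<lambda>(m, n). frag_of (conn F U (Tpart U i v) m, n) +
 frag_of (ptwist (msec F U) (mgr (msec F U)) i m, conn G U (Tpart U i v) n))"
 interpret tens "sec Z U" "msec F U" "msec G U" using tens U .
 from x(2) have "te U (cn U v x) (?e 0 x + ?e 1 x)"
 proof (induction rule: tensor_frags_induct)
 case (one m n)
 then show ?case using cn_teq[OF U v one] by simp
 next
 case (diff c d)
 show ?case using teq_diff[OF diff] unfolding cn_diff frag_extend_diff add_diff_add .
 qed (simp add: tensor_conn_frag_def)
 moreover have "?e 0 x + ?e 1 x \<in> rel U"
 using leibniz_rel[OF U Tpart_in[OF U v] x(1)] by (intro rel_add)
 ultimately show ?thesis using rel_add[of "cn U v x - (?e 0 x + ?e 1 x)" _ _ _ "?e 0 x + ?e 1 x"] by (simp add: teq_def)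
qed

lemma rs_rel:
 assumes U: "opn U" "opn V" "V <= U" and x: "x \<in> rel U"
 shows "rs U V x \<in> rel V"
proof -
 interpret U: tens "sec Z U" "msec F U" "msec G U" using tens U by blast
 interpret V: tens "sec Z V" "msec F V" "msec G V" using tens U by blast
 note c = F.mres_closed[OF U] G.mres_closed[OF U]
 show ?thesis
 proof (rule frag_extend_rel[OF x]; unfold prod.case)
 fix a i j m n assume a: "a \<in> gr (sec Z U) i" and m: "m \<in> mgr (msec F U) j" and n: "n \<in> G.Mc U"
 have ac: "a \<in> Sc U" and mc: "m \<in> F.Mc U" using U.M.gr.g_closed[OF a] U.M.M.g_closed[OF m] .
 have "mres F U V (ksgn (msec F U) i j (a \<odot>\<^bsub>msec F U\<^esub> m)) = ksgn (msec F V) i j (res Z U V a \<odot>\<^bsub>msec F V\<^esub> mres F U V m)"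
 using U ac mc by (simp add: ksgn_def F.mres_neg F.mres_smult)
 then show "te V (frag_of (mres F U V (ksgn (msec F U) i j (a \<odot>\<^bsub>msec F U\<^esub> m)), mres G U V n))
 (frag_of (mres F U V m, mres G U V (a \<odot>\<^bsub>msec G U\<^esub> n)))"
 using tensor_rel.balanced[OF res_gr[OF U a] F.mres_gr[OF U m] c(2)[OF n]] G.mres_smult[OF U ac n] by (simp add: teq_def)
 qed (use c V.te_add_l V.te_add_r F.mres_add[OF U] G.mres_add[OF U] in simp_all)
qed

lemma fr_closed:
 assumes U: "opn U" and c: "c \<in> fr U"
 shows "b \<in> Sc U ==> sm U b c \<in> fr U" "v \<in> carrier (T U) ==> cn U v c \<in> fr U"
 "opn V ==> V <= U ==> rs U V c \<in> fr V"
proof -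
 interpret U: tens "sec Z U" "msec F U" "msec G U" using tens U by blast
 show "sm U b c \<in> fr U" if "b \<in> Sc U"
 using that by (intro frag_extend_frags[OF c]) (auto simp: tensor_frags_closed)
 show "rs U V c \<in> fr V" if "opn V" "V <= U"
 using that U F.mres_closed G.mres_closed by (intro frag_extend_frags[OF c]) (auto simp: tensor_frags_closed)
 assume v: "v \<in> carrier (T U)"
 from c show "cn U v c \<in> fr U"
 proof (induction rule: tensor_frags_induct)
 case (one m n)
 have "conn G U (Tpart U i v) n \<in> G.Mc U" for i using G.conn_closed[OF U hom_vf_in_T[OF Tpart_in[OF U v]] one(2)] .
 then show ?case unfolding cn_of mpart_eq_hpart using one F.conn_closed[OF U v one(1)]
 by (auto intro!: tensor_frags_closed simp: sum.insert)
 qed (simp_all add: cn_diff tensor_frags_closed, simp add: tensor_conn_frag_def tensor_frags_closed)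
qed

lemma rs_rs: "opn U ==> opn V ==> opn V' ==> V' <= V ==> V <= U ==> c \<in> fr U ==> rs V V' (rs U V c) = rs U V' c"
proof (rotate_tac -1, induction rule: tensor_frags_induct)
 case (one m n)
 then show ?case using F.mres_mres[of U V V' m] G.mres_mres[of U V V' n] by simp
qed (simp_all add: frag_extend_diff)

lemma rs_id: "opn U ==> c \<in> fr U ==> rs U U c = c"
proof (rotate_tac -1, induction rule: tensor_frags_induct)
 case (one m n)
 then show ?case using F.mres_id G.mres_id by simp
qed (simp_all add: frag_extend_diff)

lemma rs_sm: "opn U ==> opn V ==> V <= U ==> b \<in> Sc U ==> c \<in> fr U ==> rs U V (sm U b c) = sm V (res Z U V b) (rs U V c)"
proof (rotate_tac -1, induction rule: tensor_frags_induct)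
 case (one m n)
 then show ?case using F.mres_smult by simp
qed (simp_all add: frag_extend_diff)

lemma rs_cn:
 assumes U: "opn U" "opn V" "V <= U" and v: "v \<in> carrier (T U)" and c: "c \<in> fr U"
 shows "rs U V (cn U v c) = cn V (vf_ext Z V v) (rs U V c)"
 using c
proof (induction rule: tensor_frags_induct)
 case (one m n)
 have "mres G U V (conn G U (Tpart U i v) n) = conn G V (Tpart V i (vf_ext Z V v)) (mres G U V n)" for i
 using G.conn_res[OF U(1,2,3) hom_vf_in_T[OF Tpart_in[OF U(1) v]] one(2)] Tpart_restrict[OF U v] by simp
 then show ?case
 using F.conn_res[OF U v one(1)] F.mres_part[OF U one(1)]
 by (simp add: cn_of frag_extend_add frag_extend_cmul frag_extend_minus frag_extend_diff)
qed (simp_all add: cn_diff frag_extend_diff, simp add: tensor_conn_frag_def)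

lemma P_simps:
 "carrier (msec P U) = cl U ` fr U" "\<zero>\<^bsub>msec P U\<^esub> = cl U 0" "mgr (msec P U) i = cl U ` gfr U i"
 by (simp_all add: tensor_presheaf_def tensor_supermod_def)

lemma P_add: "c \<in> fr U ==> d \<in> fr U ==> cl U c \<oplus>\<^bsub>msec P U\<^esub> cl U d = cl U (c + d)"
proof -
 assume c: "c \<in> fr U" and d: "d \<in> fr U"
 have "cl U (c' + d') = cl U (c + d)" if "c' \<in> cl U c" "d' \<in> cl U d" for c' d'
 using that by (intro class_eqI teq_add) (auto simp: tensor_class_def teq_def)
 then show ?thesis using class_self[OF c] class_self[OF d]
 by (simp add: tensor_presheaf_def tensor_supermod_def) blast
qed

lemma P_smult: "opn U ==> b \<in> Sc U ==> c \<in> fr U ==> b \<odot>\<^bsub>msec P U\<^esub> cl U c = cl U (sm U b c)"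
 using class_op[of c "msec F U" "msec G U" "sec Z U" "sm U b", OF _ tens.smult_rel[OF tens]]
 by (simp add: tensor_presheaf_def tensor_supermod_def frag_extend_diff)

lemma P_res: "opn U ==> opn V ==> V <= U ==> c \<in> fr U ==> mres P U V (cl U c) = cl V (rs U V c)"
 using class_op[of c "msec F U" "msec G U" "sec Z U" "rs U V", OF _ rs_rel]
 by (simp add: tensor_presheaf_def frag_extend_diff)

lemma P_conn:
 assumes "opn U" "v \<in> carrier (T U)" "c \<in> fr U"
 shows "conn P U v (cl U c) = cl U (cn U v c)"
proof -
 have "cl U (cn U v c') = cl U (cn U v c)" if "c' \<in> cl U c" for c'
 proof (rule class_eqI)
 have "c' - c \<in> rel U" "c' - c \<in> fr U" using that assms by (auto simp: tensor_class_def tensor_frags_closed)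
 then show "te U (cn U v c') (cn U v c)" using cn_rel[OF assms(1,2)] by (simp add: teq_def flip: cn_diff)
 qed
 then show ?thesis using class_self[OF assms(3)] by (simp add: tensor_presheaf_def) blast
qed

end

section \<open>Sections of the tensor product sheaf\<close>

lemma ex_image1: "(EX a. (EX c. A c & a = h c) & t = g a) \<longleftrightarrow> (EX c. A c & t = g (h c))"
 by blast

lemma ex_image2: "(EX a b. (EX c. A c & a = h c) & (EX d. B d & b = h d) & t = g a b) \<longleftrightarrow>
 (EX c d. A c & B d & t = g (h c) (h d))"
 by blast

lemma ex_dup: "(EX c. A c & Q c) \<longleftrightarrow> (EX c d. A c & A d & Q c)"
 by blast

lemma ex_congr1: "(!!c. A c ==> g c = h c) ==> (EX c. A c & t = g c) \<longleftrightarrow> (EX c. A c & t = h c)"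
 by auto

lemma ex_congr2:
 assumes "!!c d. A c ==> B d ==> g c d = h c d"
 shows "(EX c d. A c & B d & t = g c d) \<longleftrightarrow> (EX c d. A c & B d & t = h c d)"
proof -
 have "(A c & B d & t = g c d) = (A c & B d & t = h c d)" for c d using assms[of c d] by auto
 then show ?thesis by simp
qed

context tpre
begin

abbreviation gm where "gm x V c \<equiv> germ (space Z) P x V (cl V c)"
abbreviation TD where "TD \<equiv> tensor_dmod S0 Z F G"
abbreviation gv where "gv s V c \<equiv> c \<in> fr V & (\<forall>y\<in>V. s y = gm y V c)"

lemma te_rs: "opn U ==> opn V ==> V <= U ==> te U c d ==> te V (rs U V c) (rs U V d)"
 using rs_rel[of U V "c - d"] by (simp add: teq_def frag_extend_diff)

lemma gm_sub:
 assumes V: "opn V" "c \<in> fr V" and V': "opn V'" "c' \<in> fr V'"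
 and W: "opn W" "x \<in> W" "W <= V" "W <= V'" "te W (rs V W c) (rs V' W c')"
 shows "gm x V c <= gm x V' c'"
proof
 fix p assume "p \<in> gm x V c"
 then obtain A t W2 where p: "p = (A, t)" "opn A" "x \<in> A" "t \<in> carrier (msec P A)" "opn W2" "x \<in> W2"
 "W2 <= V \<inter> A" "mres P V W2 (cl V c) = mres P A W2 t"
 unfolding germ_def by blast
 obtain a where a: "a \<in> fr A" "t = cl A a" using p(4) unfolding P_simps by blast
 let ?W = "W \<inter> W2"
 have s: "W2 <= V" "W2 <= A" "?W <= W" "?W <= W2" "?W <= V'" "?W <= A" using W p(7) by auto
 have o: "opn ?W" using openin_Int[OF W(1) p(5)] .
 have "cl W2 (rs V W2 c) = cl W2 (rs A W2 a)"
 using p(8) P_res[OF V(1) p(5) s(1) V(2)] P_res[OF p(2,5) s(2) a(1)] a(2) by simp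
 then have t2: "te W2 (rs V W2 c) (rs A W2 a)"
 using class_eq_iff[OF fr_closed(3)[OF V p(5) s(1)]] by blast
 have 1: "te ?W (rs V ?W c) (rs A ?W a)"
 using te_rs[OF p(5) o s(4) t2] rs_rs[OF V(1) p(5) o s(4,1) V(2)] rs_rs[OF p(2,5) o s(4,2) a(1)] by simp
 have 2: "te ?W (rs V ?W c) (rs V' ?W c')"
 using te_rs[OF W(1) o s(3) W(5)] rs_rs[OF V(1) W(1) o s(3) W(3) V(2)] rs_rs[OF V'(1) W(1) o s(3) W(4) V'(2)] by simp
 have "te ?W (rs V' ?W c') (rs A ?W a)" using teq_trans[OF teq_sym[OF 2] 1] .
 then have "mres P V' ?W (cl V' c') = mres P A ?W t"
 unfolding a(2) P_res[OF V'(1) o s(5) V'(2)] P_res[OF p(2) o s(6) a(1)] by (rule class_eqI)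
 moreover have "x \<in> ?W" "?W <= V' \<inter> A" using W(2) p(6) s by auto
 ultimately show "p \<in> gm x V' c'" unfolding germ_def p(1) mem_Collect_eq prod.case using p(2,3,4) o by blast
qed

text \<open>Two formal combinations have the same germ iff their images in the tensor product agree near the
 point.\<close>

lemma gm_iff:
 assumes V: "opn V" "x \<in> V" "c \<in> fr V" and V': "opn V'" "x \<in> V'" "c' \<in> fr V'"
 shows "gm x V c = gm x V' c' \<longleftrightarrow>
 (EX W. opn W & x \<in> W & W <= V & W <= V' & te W (rs V W c) (rs V' W c'))"
proof
 assume e: "gm x V c = gm x V' c'"
 have "(V', cl V' c') \<in> gm x V' c'" using V' unfolding germ_def mem_Collect_eq prod.case P_simps by blast
 then have "(V', cl V' c') \<in> gm x V c" unfolding e .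
 then obtain W where W: "opn W" "x \<in> W" "W <= V \<inter> V'" "mres P V W (cl V c) = mres P V' W (cl V' c')"
 unfolding germ_def by blast
 have s: "W <= V" "W <= V'" using W by auto
 have "te W (rs V W c) (rs V' W c')"
 using W(4) unfolding P_res[OF V(1) W(1) s(1) V(3)] P_res[OF V'(1) W(1) s(2) V'(3)]
 class_eq_iff[OF fr_closed(3)[OF V(1,3) W(1) s(1)]] .
 then show "EX W. opn W & x \<in> W & W <= V & W <= V' & te W (rs V W c) (rs V' W c')" using W s by blast
next
 assume "EX W. opn W & x \<in> W & W <= V & W <= V' & te W (rs V W c) (rs V' W c')"
 then obtain W where W: "opn W" "x \<in> W" "W <= V" "W <= V'" "te W (rs V W c) (rs V' W c')" by blast
 show "gm x V c = gm x V' c'"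
 using gm_sub[OF V(1,3) V'(1,3) W] gm_sub[OF V'(1,3) V(1,3) W(1,2,4,3) teq_sym[OF W(5)]] by (rule equalityI)
qed

lemma gv_res: "opn V ==> opn W ==> W <= V ==> gv s V c ==> gv s W (rs V W c)"
proof (elim conjE, intro conjI ballI)
 assume V: "opn V" "opn W" "W <= V" and c: "c \<in> fr V" "\<forall>y\<in>V. s y = gm y V c"
 show r: "rs V W c \<in> fr W" using fr_closed(3)[OF V(1) c(1) V(2,3)] .
 fix y assume y: "y \<in> W"
 have "gm y V c = gm y W (rs V W c)"
 unfolding gm_iff[OF V(1) subsetD[OF V(3) y] c(1) V(2) y r] using V y rs_id[OF V(2) r]
 by (intro exI[of _ W]) simp
 then show "s y = gm y W (rs V W c)" using c(2) V(3) y by auto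
qed

lemma gv_te: "gv s V c ==> d \<in> fr V ==> te V c d ==> gv s V d"
proof -
 assume g: "gv s V c" and d: "d \<in> fr V" and t: "te V c d"
 show ?thesis using g d unfolding class_eqI[OF t] by blast
qed

lemma rep: "represents (space Z) P V t s \<longleftrightarrow> (EX c. gv s V c & t = cl V c)"
proof
 assume "represents (space Z) P V t s"
 then obtain c where "c \<in> fr V" "t = cl V c" "\<forall>y\<in>V. s y = germ (space Z) P y V t"
 unfolding represents_def P_simps by blast
 then show "EX c. gv s V c & t = cl V c" by (intro exI[of _ c]) simp
next
 assume "EX c. gv s V c & t = cl V c"
 then obtain c where "gv s V c" "t = cl V c" by blast
 then show "represents (space Z) P V t s" unfolding represents_def P_simps by simp
qed

lemma TD_carrier: "s \<in> carrier (msec TD U) \<longleftrightarrow> s \<in> extensional U &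
 (\<forall>x\<in>U. EX V c. opn V & x \<in> V & V <= U & gv s V c)"
 unfolding tensor_dmod_def sheafification_def Let_def rep by (simp; blast)

lemma gfr_fr: "opn U ==> c \<in> gfr U i ==> c \<in> fr U"
proof -
 assume U: "opn U" and c: "c \<in> gfr U i"
 interpret tens "sec Z U" "msec F U" "msec G U" using tens U .
 have "mgr (msec F U) j \<times> mgr (msec G U) (i + j) <= F.Mc U \<times> G.Mc U" for j
 using M.M.g_closed N.M.g_closed by blast
 then show ?thesis using c unfolding tensor_frags_def mem_Collect_eq by blast
qed

lemma TD_mgr: "s \<in> mgr (msec TD U) i \<longleftrightarrow> s \<in> extensional U &
 (\<forall>x\<in>U. EX V c. opn V & x \<in> V & V <= U & c \<in> gfr V i & gv s V c)"
proof -
 have R: "(EX t. represents (space Z) P V t s & t \<in> mgr (msec P V) i) \<longleftrightarrow> (EX c. c \<in> gfr V i & gv s V c)" if V: "opn V" for V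
 proof
 assume "EX t. represents (space Z) P V t s & t \<in> mgr (msec P V) i"
 then obtain c where c: "c \<in> gfr V i" "represents (space Z) P V (cl V c) s" unfolding P_simps by blast
 then have "gv s V c" using gfr_fr[OF V c(1)] unfolding represents_def by blast
 then show "EX c. c \<in> gfr V i & gv s V c" using c by blast
 next
 assume "EX c. c \<in> gfr V i & gv s V c"
 then show "EX t. represents (space Z) P V t s & t \<in> mgr (msec P V) i" unfolding P_simps rep by blast
 qed
 show ?thesis unfolding tensor_dmod_def sheafification_def Let_def by (simp add: R cong: conj_cong)
qed

lemma germwise_gm:
 assumes "opn V" "x \<in> V" "V <= U" "Q V (cl V c)"
 and "!!V' t. opn V' ==> x \<in> V' ==> V' <= U ==> Q V' t ==> germ (space Z) P x V' t = gm x V c"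
 shows "germwise (space Z) P U Q x = gm x V c"
proof -
 have "x \<in> U" using assms by auto
 then have "germwise (space Z) P U Q x =
 (THE g. EX V t. opn V & x \<in> V & V <= U & Q V t & g = germ (space Z) P x V t)"
 by (simp add: germwise_def)
 also have "\<dots> = gm x V c" proof (rule the_equality)
 show "EX V' t. opn V' & x \<in> V' & V' <= U & Q V' t & gm x V c = germ (space Z) P x V' t"
 using assms(1-4) by (intro exI[of _ V] exI[of _ "cl V c"] conjI refl)
 fix g assume "EX V t. opn V & x \<in> V & V <= U & Q V t & g = germ (space Z) P x V t"
 then obtain V' t where h: "opn V'" "x \<in> V'" "V' <= U" "Q V' t" "g = germ (space Z) P x V' t"
 by (elim exE conjE) (rule that)
 show "g = gm x V c" using assms(5)[OF h(1-4)] unfolding h(5) .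
 qed
 finally show ?thesis .
qed

lemma germwise_op:
 assumes f: "!!V W c d. opn V ==> opn W ==> W <= V ==> V <= U ==> c \<in> fr V ==> d \<in> fr V ==>
 rs V W (f V c d) = f W (rs V W c) (rs V W d)"
 and fc: "!!V c d. opn V ==> V <= U ==> c \<in> fr V ==> d \<in> fr V ==> f V c d \<in> fr V"
 and ft: "!!V c d c' d'. opn V ==> V <= U ==> c \<in> fr V ==> d \<in> fr V ==> c' \<in> fr V ==> d' \<in> fr V ==>
 te V c c' ==> te V d d' ==> te V (f V c d) (f V c' d')"
 and Q: "!!V t. opn V ==> V <= U ==> Q V t \<longleftrightarrow> (EX c d. gv s V c & gv s' V d & t = cl V (f V c d))"
 and V: "opn V" "V <= U" and c: "gv s V c" "gv s' V d"
 shows "gv (germwise (space Z) P U Q) V (f V c d)"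
proof (intro conjI ballI)
 note cc = c(1)[THEN conjunct1] c(2)[THEN conjunct1]
 show fV: "f V c d \<in> fr V" using fc[OF V cc] .
 fix x assume x: "x \<in> V"
 show "germwise (space Z) P U Q x = gm x V (f V c d)"
 proof (rule germwise_gm[OF V(1) x V(2)])
 show "Q V (cl V (f V c d))"
 by (rule iffD2[OF Q[OF V]]) (rule exI[of _ c], rule exI[of _ d], rule conjI[OF c(1) conjI[OF c(2) refl]])
 fix V' t assume V': "opn V'" "x \<in> V'" "V' <= U" and q: "Q V' t"
 obtain c' d' where cd: "gv s V' c' & gv s' V' d' & t = cl V' (f V' c' d')"
 using iffD1[OF Q[OF V'(1,3)] q] by (elim exE) (rule that)
 note c' = cd[THEN conjunct1] cd[THEN conjunct2, THEN conjunct1] and t = cd[THEN conjunct2, THEN conjunct2]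
 note cc' = c'(1)[THEN conjunct1] c'(2)[THEN conjunct1]
 have g: "gm x V' c' = gm x V c" "gm x V' d' = gm x V d" using trans[OF sym[OF c'(1)[THEN conjunct2, rule_format, OF V'(2)]] c(1)[THEN conjunct2, rule_format, OF x]]
 trans[OF sym[OF c'(2)[THEN conjunct2, rule_format, OF V'(2)]] c(2)[THEN conjunct2, rule_format, OF x]] .
 obtain W1 where W1: "opn W1" "x \<in> W1" "W1 <= V'" "W1 <= V" "te W1 (rs V' W1 c') (rs V W1 c)"
 using iffD1[OF gm_iff[OF V'(1,2) cc'(1) V(1) x cc(1)] g(1)] by (elim exE conjE) (rule that)
 obtain W2 where W2: "opn W2" "x \<in> W2" "W2 <= V'" "W2 <= V" "te W2 (rs V' W2 d') (rs V W2 d)"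
 using iffD1[OF gm_iff[OF V'(1,2) cc'(2) V(1) x cc(2)] g(2)] by (elim exE conjE) (rule that)
 let ?W = "W1 \<inter> W2"
 have s: "?W <= W1" "?W <= W2" "?W <= V'" "?W <= V" "?W <= U" using W1 V'(3) by auto
 have o: "opn ?W" using openin_Int[OF W1(1) W2(1)] .
 have 1: "te ?W (rs V' ?W c') (rs V ?W c)"
 using te_rs[OF W1(1) o s(1) W1(5)] rs_rs[OF V'(1) W1(1) o s(1) W1(3) cc'(1)] rs_rs[OF V(1) W1(1) o s(1) W1(4) cc(1)] by simp
 have 2: "te ?W (rs V' ?W d') (rs V ?W d)"
 using te_rs[OF W2(1) o s(2) W2(5)] rs_rs[OF V'(1) W2(1) o s(2) W2(3) cc'(2)] rs_rs[OF V(1) W2(1) o s(2) W2(4) cc(2)] by simp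
 note r = fr_closed(3)[OF V'(1) _ o s(3)] fr_closed(3)[OF V(1) _ o s(4)]
 have "te ?W (rs V' ?W (f V' c' d')) (rs V ?W (f V c d))"
 unfolding f[OF V'(1) o s(3) V'(3) cc'] f[OF V(1) o s(4) V(2) cc]
 by (rule ft[OF o s(5) r(1)[OF cc'(1)] r(1)[OF cc'(2)] r(2)[OF cc(1)] r(2)[OF cc(2)] 1 2])
 from this show "germ (space Z) P x V' t = gm x V (f V c d)"
 unfolding t gm_iff[OF V'(1,2) fc[OF V'(1,3) cc'] V(1) x fV]
 by (intro exI[of _ ?W] conjI o s(3,4) IntI W1(2) W2(2))
 qed
qed

lemma TD_ops:
 "\<zero>\<^bsub>msec TD U\<^esub> = germwise (space Z) P U (\<lambda>V t. t = \<zero>\<^bsub>msec P V\<^esub>)"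
 "s \<oplus>\<^bsub>msec TD U\<^esub> s' = germwise (space Z) P U (\<lambda>V t. EX a b. represents (space Z) P V a s &
 represents (space Z) P V b s' & t = a \<oplus>\<^bsub>msec P V\<^esub> b)"
 "b \<odot>\<^bsub>msec TD U\<^esub> s = germwise (space Z) P U (\<lambda>V t. EX a. represents (space Z) P V a s & t = res Z U V b \<odot>\<^bsub>msec P V\<^esub> a)"
 "conn TD U v s = germwise (space Z) P U (\<lambda>V t. EX a. represents (space Z) P V a s & t = conn P V (vf_ext Z V v) a)"
 "mres TD U V s = restrict s V"
 by (simp_all add: tensor_dmod_def sheafification_def Let_def)

lemma TD_ext:
 "\<zero>\<^bsub>msec TD U\<^esub> \<in> extensional U" "s \<oplus>\<^bsub>msec TD U\<^esub> s' \<in> extensional U" "b \<odot>\<^bsub>msec TD U\<^esub> s \<in> extensional U"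
 "conn TD U v s \<in> extensional U" "mres TD U V s \<in> extensional V"
 unfolding TD_ops germwise_def by simp_all

lemma gv_zero: "opn V ==> V <= U ==> gv \<zero>\<^bsub>msec TD U\<^esub> V 0"
proof (intro conjI ballI)
 assume V: "opn V" "V <= U"
 show z: "0 \<in> fr V" by (rule tensor_frags_closed)
 fix x assume x: "x \<in> V"
 show "\<zero>\<^bsub>msec TD U\<^esub> x = gm x V 0" unfolding TD_ops
 proof (rule germwise_gm[OF V(1) x V(2)])
 fix V' t assume V': "opn V'" "x \<in> V'" "V' <= U" "t = \<zero>\<^bsub>msec P V'\<^esub>"
 have "opn (V \<inter> V')" using openin_Int[OF V(1) V'(1)] .
 then show "germ (space Z) P x V' t = gm x V 0"
 unfolding V'(4) P_simps gm_iff[OF V'(1,2) tensor_frags_closed(1) V(1) x z] using x V'(2)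
 by (intro exI[of _ "V \<inter> V'"]) auto
 qed (simp add: P_simps)
qed

lemma gv_add:
 assumes "opn V" "V <= U" "gv s V c" "gv s' V d"
 shows "gv (s \<oplus>\<^bsub>msec TD U\<^esub> s') V (c + d)"
 unfolding TD_ops
proof (rule germwise_op[where f = "\<lambda>V c d. c + d", OF _ _ _ _ assms])
 fix V t
 show "(EX a b. represents (space Z) P V a s & represents (space Z) P V b s' & t = a \<oplus>\<^bsub>msec P V\<^esub> b) \<longleftrightarrow>
 (EX c d. gv s V c & gv s' V d & t = cl V (c + d))"
 unfolding rep ex_image2 by (rule ex_congr2, rule P_add) (elim conjE, assumption)+
qed (rule frag_extend_add, erule (1) tensor_frags_closed(2), erule (1) teq_add)

lemma gv_smult:
 assumes V: "opn U" "opn V" "V <= U" "gv s V c" and b: "b \<in> Sc U"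
 shows "gv (b \<odot>\<^bsub>msec TD U\<^esub> s) V (sm V (res Z U V b) c)"
 unfolding TD_ops
proof (rule germwise_op[where f = "\<lambda>V c d. sm V (res Z U V b) c" and s' = s, OF _ _ _ _ V(2,3,4,4)])
 have r: "res Z U V b \<in> Sc V" if "opn V" "V <= U" for V using res_closed[OF V(1) that b] .
 fix V assume o: "opn V" "V <= U"
 note r = r[OF o]
 show "(EX a. represents (space Z) P V a s & t = res Z U V b \<odot>\<^bsub>msec P V\<^esub> a) \<longleftrightarrow>
 (EX c d. gv s V c & gv s V d & t = cl V (sm V (res Z U V b) c))" for t
 unfolding rep ex_image1 by (rule trans[OF _ ex_dup], rule ex_congr1, rule P_smult[OF o(1) r], elim conjE)
 show "sm V (res Z U V b) c \<in> fr V" if "c \<in> fr V" for c using fr_closed(1)[OF o(1) that r] .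
 show "te V (sm V (res Z U V b) c) (sm V (res Z U V b) c')" if "te V c c'" for c c'
 using that tens.smult_rel[OF tens[OF o(1)] r, of "c - c'"] by (simp add: teq_def frag_extend_diff)
 fix W c assume W: "opn W" "W <= V" and c: "c \<in> fr V"
 show "rs V W (sm V (res Z U V b) c) = sm W (res Z U W b) (rs V W c)"
 unfolding rs_sm[OF o(1) W r c] res_res[OF V(1) o(1) W(1) W(2) o(2) b] ..
qed

lemma cn_te:
 assumes "opn V" "v \<in> carrier (T V)" "c \<in> fr V" "c' \<in> fr V" "te V c c'"
 shows "te V (cn V v c) (cn V v c')"
 using cn_rel[OF assms(1,2), of "c - c'"] tensor_frags_closed(3)[OF assms(3,4)] assms(5) by (simp add: teq_def cn_diff)

lemma gv_conn:
 assumes V: "opn V" "V <= U" "gv s V c" and v: "v \<in> carrier (T U)"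
 shows "gv (conn TD U v s) V (cn V (vf_ext Z V v) c)"
 unfolding TD_ops
proof (rule germwise_op[where f = "\<lambda>V c d. cn V (vf_ext Z V v) c" and s' = s, OF _ _ _ _ V(1,2,3,3)])
 fix V assume o: "opn V" "V <= U"
 note r = T_restrict[OF v o(2)]
 show "(EX a. represents (space Z) P V a s & t = conn P V (vf_ext Z V v) a) \<longleftrightarrow>
 (EX c d. gv s V c & gv s V d & t = cl V (cn V (vf_ext Z V v) c))" for t
 unfolding rep ex_image1 by (rule trans[OF _ ex_dup], rule ex_congr1, rule P_conn[OF o(1) r], elim conjE)
 show "cn V (vf_ext Z V v) c \<in> fr V" if "c \<in> fr V" for c using fr_closed(2)[OF o(1) that r] .
 show "te V (cn V (vf_ext Z V v) c) (cn V (vf_ext Z V v) c')" if "c \<in> fr V" "c' \<in> fr V" "te V c c'" for c c'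
 using cn_te[OF o(1) r that] .
 fix W c assume W: "opn W" "W <= V" and c: "c \<in> fr V"
 show "rs V W (cn V (vf_ext Z V v) c) = cn W (vf_ext Z W v) (rs V W c)"
 unfolding rs_cn[OF o(1) W r c] vf_ext_vf_ext[OF W(2)] ..
qed

lemma gv_restrict: "gv s V c ==> V <= U ==> gv (restrict s U) V c"
proof (intro conjI ballI)
 assume g: "gv s V c" and V: "V <= U"
 show "c \<in> fr V" by (rule g[THEN conjunct1])
 fix y assume y: "y \<in> V"
 show "restrict s U y = gm y V c"
 using g[THEN conjunct2, rule_format, OF y] unfolding restrict_apply'[OF subsetD[OF V y]] .
qed

lemma TD_eqI:
 assumes "s \<in> extensional U" "t \<in> extensional U" "!!x. x \<in> U ==> EX V c. x \<in> V & gv s V c & gv t V c"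
 shows "s = t"
proof (rule extensionalityI[OF assms(1,2)])
 fix x assume "x \<in> U"
 from assms(3)[OF this] obtain V c where x: "x \<in> V" and c: "gv s V c" "gv t V c" by meson
 show "s x = t x" using trans[OF c(1)[THEN conjunct2, rule_format, OF x] sym[OF c(2)[THEN conjunct2, rule_format, OF x]]] .
qed

lemma gfr_rs: "opn U ==> opn V ==> V <= U ==> c \<in> gfr U i ==> rs U V c \<in> gfr V i"
proof -
 assume U: "opn U" "opn V" "V <= U" and c: "c \<in> gfr U i"
 have "Poly_Mapping.keys (case p of (m, n) => frag_of (mres F U V m, mres G U V n)) <=
 (\<Union>j. mgr (msec F V) j \<times> mgr (msec G V) (i + j))" if p: "p \<in> Poly_Mapping.keys c" for p
 proof -
 obtain j where "p \<in> mgr (msec F U) j \<times> mgr (msec G U) (i + j)" using p c by blast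
 then show ?thesis using F.mres_gr[OF U] G.mres_gr[OF U] by (cases p) (auto intro!: exI[of _ j])
 qed
 then show ?thesis unfolding mem_Collect_eq by (rule subset_trans[OF keys_frag_extend UN_least])
qed

end

lemma (in tens) te_minus_l: "m \<in> carrier M ==> m' \<in> carrier M ==> n \<in> carrier N ==>
 tq (frag_of (m \<ominus>\<^bsub>M\<^esub> m', n)) (frag_of (m, n) - frag_of (m', n))"
 using teq_trans[OF te_add_l[of m "\<ominus>\<^bsub>M\<^esub> m'" n] teq_add[OF teq_refl te_neg_l[of m' n]]] by (simp add: a_minus_def)

lemma (in tens) te_minus_r: "m \<in> carrier M ==> n \<in> carrier N ==> n' \<in> carrier N ==>
 tq (frag_of (m, n \<ominus>\<^bsub>N\<^esub> n')) (frag_of (m, n) - frag_of (m, n'))"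
 using teq_trans[OF te_add_r[of m n "\<ominus>\<^bsub>N\<^esub> n'"] teq_add[OF teq_refl te_neg_r[of m n']]] by (simp add: a_minus_def)

section \<open>Tensor products of annihilated sections\<close>

locale otens = osub S0 Z W sg + F: osubm S0 Z W sg F + G: osubm S0 Z W sg G
 for S0 :: "('l, complex) superalg" and Z :: "('z, 'a, 'l) superspace" and W :: "('w, 'b, 'l) superspace"
 and sg :: "('z, 'w, 'a, 'b) smor" and F :: "('z, 'a, 'm) dmod" and G :: "('z, 'a, 'n) dmod"

sublocale otens \<subseteq> Zt: tpre S0 Z F G
 by unfold_locales

sublocale otens \<subseteq> Wt: tpre S0 W "dplus S0 Z W sg F" "dplus S0 Z W sg G"
 by (intro tpre.intro dmodl.intro dmodl_axioms.intro W.sspace_axioms F.dplus_dmodule G.dplus_dmodule)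

context otens
begin

lemma fr_sub: "c \<in> Wt.fr V ==> c \<in> Zt.fr (pr V)"
 using F.ann_sec G.ann_sec unfolding tensor_frags_def mem_Collect_eq F.dp_simps G.dp_simps by blast

lemma gfr_sub: "c \<in> Wt.gfr V i ==> c \<in> Zt.gfr (pr V) i"
 unfolding mem_Collect_eq F.dp_simps G.dp_simps by blast

lemma rel_sub: "W.opn V ==> x \<in> Wt.rel V ==> x \<in> Zt.rel (pr V)"
proof -
 assume V: "W.opn V" and x: "x \<in> Wt.rel V"
 from x show ?thesis
 proof induction
 case zero
 then show ?case by (rule tensor_rel.zero)
 next
 case (diff x y)
 then show ?case by (intro tensor_rel.diff)
 next
 case (add_left m m' n)
 then show ?case
 using tensor_rel.add_left[of m "msec F (pr V)" m' n "msec G (pr V)" "sec Z (pr V)"] F.ann_sec G.ann_sec by simp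
 next
 case (add_right m n n')
 then show ?case
 using tensor_rel.add_right[of m "msec F (pr V)" n "msec G (pr V)" n' "sec Z (pr V)"] F.ann_sec G.ann_sec by simp
 next
 case (balanced a i m j n)
 interpret S: superring "sec W V" using W.sring V .
 have m: "m \<in> mgr (msec F (pr V)) j" "m \<in> F.A (pr V)" and n: "n \<in> G.A (pr V)" using balanced by simp_all
 show ?case
 using tensor_rel.balanced[OF com_gr[OF V balanced(1)] m(1) G.ann_sec[OF n]]
 F.dp_ksgn[OF V F.ann_smult[OF V S.gr.g_closed[OF balanced(1)] m(2)]] by simp
 qed
qed

lemma te_sub: "W.opn V ==> Wt.te V c d ==> Zt.te (pr V) c d"
 unfolding teq_def by (rule rel_sub)

lemma rs_dp: "Wt.rs V V' = Zt.rs (pr V) (pr V')"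
 by (simp only: F.dp_simps G.dp_simps)

lemma sm_dp: "Wt.sm V b = Zt.sm (pr V) (com sg V b)"
 by (simp only: F.dp_simps G.dp_simps)

lemma lift_cn:
 assumes V: "W.opn V" "v \<in> carrier (W.T V)" and l: "local_lift S0 Z W sg V v U v'" and c: "c \<in> Wt.fr V"
 shows "Zt.rs (pr V) U (Wt.cn V v c) = Zt.cn U v' (Zt.rs (pr V) U c)"
 using c
proof (induction rule: tensor_frags_induct)
 case (one m n)
 then have m: "m \<in> F.A (pr V)" and n: "n \<in> G.A (pr V)" by simp_all
 note d = local_liftD[OF l V(1)]
 have 1: "mres F (pr V) U (conn F.dp V v m) = conn F U v' (mres F (pr V) U m)" using F.dconn(2)[OF V m l] .
 have 2: "mres G (pr V) U (conn G.dp V (W.Tpart V i v) n) = conn G U (Z.Tpart U i v') (mres G (pr V) U n)" for i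
 using G.dconn(2)[OF V(1) W.hom_vf_in_T[OF W.Tpart_in[OF V]] n local_lift_part[OF V l]] .
 have 3: "mres F (pr V) U (mpart (msec F.dp V) j m) = mpart (msec F U) j (mres F (pr V) U m)" for j
 unfolding F.dp_part[OF V(1) m] using F.F.mres_part[OF pre_open[OF V(1)] d(1,2) F.ann_sec[OF m]] .
 show ?case
 by (simp add: Wt.cn_of Zt.cn_of 1 2 3 frag_extend_add frag_extend_cmul frag_extend_minus frag_extend_diff)
qed (simp_all add: Wt.cn_diff Zt.cn_diff frag_extend_diff, simp add: tensor_conn_frag_def)

lemma vert_cn:
 assumes V: "W.opn V" and U: "Z.opn U" "U <= pr V" and v: "v \<in> vertical S0 Z W sg U" and c: "c \<in> Wt.fr V"
 shows "Zt.te U (Zt.cn U v (Zt.rs (pr V) U c)) 0"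
 using c
proof (induction rule: tensor_frags_induct)
 case zero
 then show ?case by (simp add: tensor_conn_frag_def)
next
 case (diff c d)
 then show ?case using teq_diff[OF diff] by (simp add: frag_extend_diff Zt.cn_diff)
next
 case (one m n)
 interpret tens "sec Z U" "msec F U" "msec G U" using Zt.tens[OF U(1)] .
 have m: "mres F (pr V) U m \<in> F.A U" and n: "mres G (pr V) U n \<in> G.A U"
 using one F.ann_res[OF pre_open[OF V] U] G.ann_res[OF pre_open[OF V] U] by simp_all
 note mc = F.ann_sec[OF m] and nc = G.ann_sec[OF n]
 have z: "conn F U (Z.Tpart U i v) (mres F (pr V) U m) = \<zero>\<^bsub>msec F U\<^esub>"
 "conn G U (Z.Tpart U i v) (mres G (pr V) U n) = \<zero>\<^bsub>msec G U\<^esub>" for i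
 using F.ann_conn[OF U(1) m vertical_part[OF U(1) v]] G.ann_conn[OF U(1) n vertical_part[OF U(1) v]] .
 have t: "ptwist (msec F U) (mgr (msec F U)) 1 (mres F (pr V) U m) \<in> F.F.Mc U"
 using mc by (rule M.M.tw_closed)
 show ?case
 using teq_trans[OF Zt.cn_teq[OF U(1) verticalD(1)[OF v] mc nc, unfolded z]
 teq_add[OF teq_add[OF te_zero_l[OF nc] te_zero_r[OF mc]] teq_add[OF te_zero_l[OF nc] te_zero_r[OF t]]]] by simp
qed

end

locale otframe = frame S0 Z W sg V0 et n + otens S0 Z W sg F G
 for S0 :: "('l, complex) superalg" and Z :: "('z, 'a, 'l) superspace" and W :: "('w, 'b, 'l) superspace"
 and sg :: "('z, 'w, 'a, 'b) smor" and V0 :: "'w set" and et :: "nat => 'a" and n :: nat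
 and F :: "('z, 'a, 'm) dmod" and G :: "('z, 'a, 'n) dmod"
begin

text \<open>The projections onto annihilated sections carry the relations of the tensor product over
 $\mathcal O_Z$ to those over $\mathcal O_W$, because they are semilinear over the augmentation
 $\mathcal O_Z \to \mathcal O_W$, $\theta_i \mapsto 0$.\<close>

lemma te_frame:
 assumes V: "W.opn V" "V <= V0" and c: "c \<in> Wt.fr V" "d \<in> Wt.fr V" and t: "Zt.te (pr V) c d"
 shows "Wt.te V c d"
proof -
 note mF = F.F.dmodule and mG = G.F.dmodule
 interpret MF: odd_module "sec Z (pr V)" "msec F (pr V)" "th V" "\<lambda>j. pd j (pr V)" n "\<lambda>j. conn F (pr V) (pdd V j)"
 using odd_module_of[OF mF V] .
 interpret MG: odd_module "sec Z (pr V)" "msec G (pr V)" "th V" "\<lambda>j. pd j (pr V)" n "\<lambda>j. conn G (pr V) (pdd V j)"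
 using odd_module_of[OF mG V] .
 interpret MW: tens "sec W V" "msec F.dp V" "msec G.dp V" using Wt.tens[OF V(1)] .
 let ?p = "proj F V" and ?q = "proj G V"
 let ?r = "frag_extend (\<lambda>(x, y). frag_of (?p x, ?q y))"
 note a = proj_ann[OF mF V] proj_ann[OF mG V]
 have rc: "?r c = c" if "c \<in> Wt.fr V" for c
 using that
 proof (induction rule: tensor_frags_induct)
 case (one x y)
 then show ?case using proj_fix[OF mF V, of x] proj_fix[OF mG V, of y] by simp
 qed (simp_all add: frag_extend_diff)
 have z: "?p \<zero>\<^bsub>msec F (pr V)\<^esub> = \<zero>\<^bsub>msec F (pr V)\<^esub>" by (rule MF.P_fix) simp_all
 have neg: "?p (ksgn (msec F (pr V)) i j x) = ksgn (msec F (pr V)) i j (?p x)" if x: "x \<in> F.F.Mc (pr V)" for i j x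
 proof -
 have "?p (\<ominus>\<^bsub>msec F (pr V)\<^esub> x) = \<ominus>\<^bsub>msec F (pr V)\<^esub> ?p x"
 proof (rule MF.M.neg_unique)
 show "?p x \<oplus>\<^bsub>msec F (pr V)\<^esub> ?p (\<ominus>\<^bsub>msec F (pr V)\<^esub> x) = \<zero>\<^bsub>msec F (pr V)\<^esub>"
 using MF.P_add[OF order_refl x MF.M.a_inv_closed[OF x]] z MF.M.r_neg[OF x] by simp
 qed (use x MF.P_closed[OF order_refl] in simp_all)
 then show ?thesis by (simp add: ksgn_def)
 qed
 have rel: "?r r \<in> Wt.rel V" if r: "r \<in> Zt.rel (pr V)" for r
 proof (rule frag_extend_rel[OF r]; unfold prod.case)
 fix x x' y assume x: "x \<in> F.F.Mc (pr V)" "x' \<in> F.F.Mc (pr V)" and y: "y \<in> G.F.Mc (pr V)"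
 show "Wt.te V (frag_of (?p (x \<oplus>\<^bsub>msec F (pr V)\<^esub> x'), ?q y)) (frag_of (?p x, ?q y) + frag_of (?p x', ?q y))"
 unfolding MF.P_add[OF order_refl x]
 using MW.te_add_l[unfolded F.dp_simps G.dp_simps, OF a(1)[OF x(1)] a(1)[OF x(2)] a(2)[OF y]] .
 next
 fix x y y' assume x: "x \<in> F.F.Mc (pr V)" and y: "y \<in> G.F.Mc (pr V)" "y' \<in> G.F.Mc (pr V)"
 show "Wt.te V (frag_of (?p x, ?q (y \<oplus>\<^bsub>msec G (pr V)\<^esub> y'))) (frag_of (?p x, ?q y) + frag_of (?p x, ?q y'))"
 unfolding MG.P_add[OF order_refl y]
 using MW.te_add_r[unfolded F.dp_simps G.dp_simps, OF a(1)[OF x] a(2)[OF y(1)] a(2)[OF y(2)]] .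
 next
 fix b i j x y assume b: "b \<in> gr (sec Z (pr V)) i" and x: "x \<in> mgr (msec F (pr V)) j" and y: "y \<in> G.F.Mc (pr V)"
 have bc: "b \<in> Z.Sc (pr V)" and xc: "x \<in> F.F.Mc (pr V)" using MF.gr.g_closed[OF b] MF.M.g_closed[OF x] .
 note au = aug[OF V bc, THEN conjunct1] aug[OF V bc, THEN conjunct2]
 have 1: "?p (ksgn (msec F (pr V)) i j (b \<odot>\<^bsub>msec F (pr V)\<^esub> x)) = ksgn (msec F.dp V) i j (aug V b \<odot>\<^bsub>msec F.dp V\<^esub> ?p x)"
 unfolding neg[OF MF.smult_closed[OF bc xc]] MF.P_smult[OF order_refl bc xc] F.dp_simps
 F.dp_ksgn[OF V(1) F.ann_smult[OF V(1) au(1) a(1)[OF xc]], unfolded au(2)] au(2) ..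
 have 2: "?q (b \<odot>\<^bsub>msec G (pr V)\<^esub> y) = aug V b \<odot>\<^bsub>msec G.dp V\<^esub> ?q y"
 unfolding MG.P_smult[OF order_refl bc y] G.dp_simps au(2) ..
 have 3: "?p x \<in> mgr (msec F.dp V) j" "?q y \<in> carrier (msec G.dp V)"
 unfolding F.dp_simps G.dp_simps using MF.P_gr[OF order_refl x] a(1)[OF xc] a(2)[OF y] by simp_all
 show "Wt.te V (frag_of (?p (ksgn (msec F (pr V)) i j (b \<odot>\<^bsub>msec F (pr V)\<^esub> x)), ?q y))
 (frag_of (?p x, ?q (b \<odot>\<^bsub>msec G (pr V)\<^esub> y)))"
 unfolding 1 2 teq_def by (rule tensor_rel.balanced[OF aug_gr[OF V b] 3])
 qed
 have "?r (c - d) \<in> Wt.rel V" using rel t unfolding teq_def .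
 then show ?thesis unfolding teq_def frag_extend_diff rc[OF c(1)] rc[OF c(2)] .
qed

text \<open>Conversely, an element of the tensor product that is killed by all partial derivatives is the
 image of itself under the projections, up to the relations: modulo the relations, replacing both
 factors by their projections along $\theta_k$ subtracts $\theta_k \nabla_{\partial_k}$, since the
 term with two factors $\theta_k$ vanishes.\<close>

lemma surj_frame:
 assumes V: "W.opn V" "V <= V0" and c: "c \<in> Zt.fr (pr V)"
 and kill: "!!j. j < n ==> Zt.cn (pr V) (pdd V j) c \<in> Zt.rel (pr V)"
 shows "\<exists>d\<in>Wt.fr V. Zt.te (pr V) c d & (ALL i. c \<in> Zt.gfr (pr V) i --> d \<in> Wt.gfr V i)"
proof -
 note mF = F.F.dmodule and mG = G.F.dmodule and o = pre_open[OF V(1)]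
 interpret MF: odd_module "sec Z (pr V)" "msec F (pr V)" "th V" "\<lambda>j. pd j (pr V)" n "\<lambda>j. conn F (pr V) (pdd V j)"
 using odd_module_of[OF mF V] .
 interpret MG: odd_module "sec Z (pr V)" "msec G (pr V)" "th V" "\<lambda>j. pd j (pr V)" n "\<lambda>j. conn G (pr V) (pdd V j)"
 using odd_module_of[OF mG V] .
 interpret T: tens "sec Z (pr V)" "msec F (pr V)" "msec G (pr V)" using Zt.tens[OF o] .
 let ?E = "\<lambda>k. conn F (pr V) (pdd V k)" and ?G = "\<lambda>k. conn G (pr V) (pdd V k)"
 let ?e = "\<lambda>k. frag_extend (\<lambda>(x, y). frag_of (MF.P k x, MG.P k y))"
 let ?q = "\<lambda>k. frag_extend (\<lambda>(x, y). frag_of (x \<ominus>\<^bsub>msec F (pr V)\<^esub> th V k \<odot>\<^bsub>msec F (pr V)\<^esub> ?E k x,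
 y \<ominus>\<^bsub>msec G (pr V)\<^esub> th V k \<odot>\<^bsub>msec G (pr V)\<^esub> ?G k y))"
 let ?s = "\<lambda>k b. Zt.sm (pr V) (th V k) (Zt.cn (pr V) (pdd V k) b)"
 have step: "Zt.te (pr V) (?q k b) (b - ?s k b)" if k: "k < n" and b: "b \<in> Zt.fr (pr V)" for k b
 using b
 proof (induction rule: tensor_frags_induct)
 case zero
 then show ?case by (simp add: tensor_conn_frag_def)
 next
 case (diff c d)
 have e: "(c - ?s k c) - (d - ?s k d) = (c - d) - (?s k c - ?s k d)" by (simp add: algebra_simps)
 show ?case using teq_diff[OF diff] unfolding e frag_extend_diff Zt.cn_diff .
 next
 case (one x y)
 let ?B = "th V k \<odot>\<^bsub>msec F (pr V)\<^esub> ?E k x" and ?D = "th V k \<odot>\<^bsub>msec G (pr V)\<^esub> ?G k y"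
 note th = MF.theta_odd[OF k] and thc = MF.gr.g_closed[OF MF.theta_odd[OF k]]
 note Ec = MF.E_closed[OF k one(1)] and Gc = MG.E_closed[OF k one(2)]
 note Bc = MF.smult_closed[OF thc Ec] and Dc = MG.smult_closed[OF thc Gc]
 have 1: "Zt.te (pr V) (frag_of (x \<ominus>\<^bsub>msec F (pr V)\<^esub> ?B, y \<ominus>\<^bsub>msec G (pr V)\<^esub> ?D))
 ((frag_of (x, y) - frag_of (x, ?D)) - (frag_of (?B, y) - frag_of (?B, ?D)))"
 by (rule teq_trans[OF T.te_minus_l[OF one(1) Bc] teq_diff[OF T.te_minus_r[OF one Dc] T.te_minus_r[OF Bc one(2) Dc]]])
 (use one(2) Dc in simp)
 have tB: "MF.M.tw 1 ?B = \<ominus>\<^bsub>msec F (pr V)\<^esub> (th V k \<odot>\<^bsub>msec F (pr V)\<^esub> MF.M.tw 1 (?E k x))"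
 unfolding MF.tw_smult[OF thc Ec] MF.tw_theta[OF k] using thc Ec by (simp add: MF.smult_l_minus)
 have zB: "th V k \<odot>\<^bsub>msec F (pr V)\<^esub> MF.M.tw 1 ?B = \<zero>\<^bsub>msec F (pr V)\<^esub>"
 unfolding tB using thc MF.M.tw_closed[OF Ec] MF.theta_theta[OF k MF.M.tw_closed[OF Ec]] by (simp add: MF.smult_r_minus)
 have 2: "Zt.te (pr V) (frag_of (?B, ?D)) 0"
 using teq_trans[OF T.te_bal[OF th Bc Gc, unfolded zB] T.te_zero_l[OF Gc]] .
 have "?s k (frag_of (x, y)) - Zt.sm (pr V) (th V k) (frag_of (?E k x, y) + frag_of (MF.M.tw 1 x, ?G k y)) \<in> Zt.rel (pr V)"
 using T.smult_rel[OF thc Zt.cn_hom[OF o pdd_hom[OF V(2)] one, unfolded teq_def]] unfolding frag_extend_diff .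
 then have "Zt.te (pr V) (?s k (frag_of (x, y))) (frag_of (?B, y) + frag_of (th V k \<odot>\<^bsub>msec F (pr V)\<^esub> MF.M.tw 1 x, ?G k y))"
 by (simp add: frag_extend_add teq_def)
 then have 3: "Zt.te (pr V) (?s k (frag_of (x, y))) (frag_of (?B, y) + frag_of (x, ?D))"
 by (rule teq_trans[OF _ teq_add[OF teq_refl teq_sym[OF T.te_bal[OF th one(1) Gc]]]])
 have e: "(frag_of (x, y) - frag_of (x, ?D)) - (frag_of (?B, y) - 0) = frag_of (x, y) - (frag_of (?B, y) + frag_of (x, ?D))"
 by (simp add: algebra_simps)
 have "Zt.te (pr V) (frag_of (x \<ominus>\<^bsub>msec F (pr V)\<^esub> ?B, y \<ominus>\<^bsub>msec G (pr V)\<^esub> ?D)) (frag_of (x, y) - ?s k (frag_of (x, y)))"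
 using teq_trans[OF teq_trans[OF 1 teq_diff[OF teq_refl teq_diff[OF teq_refl 2]], unfolded e] teq_diff[OF teq_refl teq_sym[OF 3]]] .
 then show ?case by simp
 qed
 have e: "?e k c \<in> Zt.fr (pr V)" if "k <= n" for k
 using MF.P_closed[OF that] MG.P_closed[OF that] by (intro frag_extend_frags[OF c]) (simp add: tensor_frags_closed)
 have main: "k <= n ==> Zt.te (pr V) c (?e k c)" for k
 proof (induction k)
 case 0
 have "frag_extend frag_of c = c" using c by (induction rule: tensor_frags_induct) (simp_all add: frag_extend_diff)
 then show ?case by simp
 next
 case (Suc k)
 then have k: "k < n" "k <= n" and IH: "Zt.te (pr V) c (?e k c)" by simp_all
 have E: "?e (Suc k) c = ?q k (?e k c)"
 using c by (induction rule: tensor_frags_induct) (simp_all add: frag_extend_diff)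
 have "Zt.cn (pr V) (pdd V k) (?e k c) - Zt.cn (pr V) (pdd V k) c \<in> Zt.rel (pr V)"
 using Zt.cn_te[OF o Z.hom_vf_in_T[OF pdd_hom[OF V(2)]] e[OF k(2)] c teq_sym[OF IH]] unfolding teq_def .
 from rel_add[OF this kill[OF k(1)]] have "Zt.cn (pr V) (pdd V k) (?e k c) \<in> Zt.rel (pr V)" by simp
 then have "?s k (?e k c) \<in> Zt.rel (pr V)"
 by (rule T.smult_rel[OF MF.gr.g_closed[OF MF.theta_odd[OF k(1)]]])
 from tensor_rel.diff[OF step[OF k(1) e[OF k(2)], unfolded teq_def] this]
 have "Zt.te (pr V) (?q k (?e k c)) (?e k c)" by (simp add: teq_def)
 then show ?case unfolding E by (rule teq_trans[OF IH teq_sym])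
 qed
 have d: "?e n c \<in> Wt.fr V"
 using proj_ann[OF mF V] proj_ann[OF mG V] by (intro frag_extend_frags[OF c]) (simp add: tensor_frags_closed)
 have g: "?e n c \<in> Wt.gfr V i" if c: "c \<in> Zt.gfr (pr V) i" for i
 proof -
 have "Poly_Mapping.keys (case p of (x, y) => frag_of (MF.P n x, MG.P n y)) <=
 (\<Union>j. mgr (msec F.dp V) j \<times> mgr (msec G.dp V) (i + j))" if k: "p \<in> Poly_Mapping.keys c" for p
 proof -
 obtain j x y where p: "p = (x, y)" "x \<in> mgr (msec F (pr V)) j" "y \<in> mgr (msec G (pr V)) (i + j)" using k c by (cases p) blast
 have "MF.P n x \<in> mgr (msec F.dp V) j" "MG.P n y \<in> mgr (msec G.dp V) (i + j)"
 using MF.P_gr[OF order_refl p(2)] MG.P_gr[OF order_refl p(3)]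
 proj_ann[OF mF V MF.M.g_closed[OF p(2)]] proj_ann[OF mG V MG.M.g_closed[OF p(3)]] by simp_all
 then show ?thesis unfolding p(1) prod.case keys_frag_of by blast
 qed
 then show ?thesis unfolding mem_Collect_eq by (rule subset_trans[OF keys_frag_extend UN_least])
 qed
 show ?thesis using d main[OF order_refl] g by blast
qed

end

section \<open>Compatibility with tensor products\<close>

context otens
begin

text \<open>Whether two formal combinations of annihilated sections agree in the tensor product can be
 tested on \<open>Z\<close> as well as on \<open>W\<close>: relations over \<open>W\<close> are relations over \<open>Z\<close>, and in coordinates the
 projections lead back.\<close>

lemma gm_eq:
 assumes V: "W.opn V" "x \<in> pr V" "c \<in> Wt.fr V" and V': "W.opn V'" "x \<in> pr V'" "d \<in> Wt.fr V'"
 shows "Zt.gm x (pr V) c = Zt.gm x (pr V') d \<longleftrightarrow> Wt.gm (pt sg x) V c = Wt.gm (pt sg x) V' d"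
proof -
 have x: "pt sg x \<in> V" "pt sg x \<in> V'" and xt: "x \<in> topspace (space Z)" using V(2) V'(2) by (simp_all add: pre_def)
 note iZ = Zt.gm_iff[OF pre_open[OF V(1)] V(2) fr_sub[OF V(3)] pre_open[OF V'(1)] V'(2) fr_sub[OF V'(3)]]
 note iW = Wt.gm_iff[OF V(1) x(1) V(3) V'(1) x(2) V'(3)]
 show ?thesis
 unfolding iZ iW
 proof
 assume "EX U. W.opn U & pt sg x \<in> U & U <= V & U <= V' & Wt.te U (Wt.rs V U c) (Wt.rs V' U d)"
 then obtain U where U: "W.opn U" "pt sg x \<in> U" "U <= V" "U <= V'" "Wt.te U (Wt.rs V U c) (Wt.rs V' U d)"
 by (elim exE conjE) (rule that)
 have "x \<in> pr U" using U(2) xt by (simp add: pre_def)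
 then show "EX U. Z.opn U & x \<in> U & U <= pr V & U <= pr V' & Zt.te U (Zt.rs (pr V) U c) (Zt.rs (pr V') U d)"
 using te_sub[OF U(1,5)] unfolding rs_dp
 by (intro exI[of _ "pr U"] conjI pre_open[OF U(1)] pre_mono[OF U(3)] pre_mono[OF U(4)])
 next
 assume "EX U. Z.opn U & x \<in> U & U <= pr V & U <= pr V' & Zt.te U (Zt.rs (pr V) U c) (Zt.rs (pr V') U d)"
 then obtain U where U: "Z.opn U" "x \<in> U" "U <= pr V" "U <= pr V'" "Zt.te U (Zt.rs (pr V) U c) (Zt.rs (pr V') U d)"
 by (elim exE conjE) (rule that)
 have "pt sg x \<in> topspace (space W)" using openin_subset[OF V(1)] x(1) by blast
 then obtain V0 et n where f: "pt sg x \<in> V0" "frame S0 Z W sg V0 et n" using frame_exists by blast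
 interpret fr: frame S0 Z W sg V0 et n by (rule f(2))
 interpret otf: otframe S0 Z W sg V0 et n F G by unfold_locales
 let ?U = "dn U \<inter> V0"
 have o: "W.opn ?U" using openin_Int[OF dn_open[OF U(1)] fr.V0] .
 have pU: "pr ?U <= U" using pre_dn[OF U(1)] pre_mono[of ?U "dn U"] by simp
 have s: "?U <= V" "?U <= V'"
 using pre_subset_iff[OF o subset_trans[OF pU U(3)]] pre_subset_iff[OF o subset_trans[OF pU U(4)]] .
 note oo = pre_open[OF V(1)] pre_open[OF V'(1)] pre_open[OF o]
 have "Zt.te (pr ?U) (Zt.rs (pr V) (pr ?U) c) (Zt.rs (pr V') (pr ?U) d)"
 using Zt.te_rs[OF U(1) oo(3) pU U(5)]
 unfolding Zt.rs_rs[OF oo(1) U(1) oo(3) pU U(3) fr_sub[OF V(3)]] Zt.rs_rs[OF oo(2) U(1) oo(3) pU U(4) fr_sub[OF V'(3)]] .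
 then have "Zt.te (pr ?U) (Wt.rs V ?U c) (Wt.rs V' ?U d)" unfolding rs_dp .
 then have "Wt.te ?U (Wt.rs V ?U c) (Wt.rs V' ?U d)"
 by (rule otf.te_frame[OF o Int_lower2 Wt.fr_closed(3)[OF V(1,3) o s(1)] Wt.fr_closed(3)[OF V'(1,3) o s(2)]])
 moreover have "pt sg x \<in> ?U" using U(2) f(1) by blast
 ultimately show "EX U. W.opn U & pt sg x \<in> U & U <= V & U <= V' & Wt.te U (Wt.rs V U c) (Wt.rs V' U d)"
 by (intro exI[of _ ?U] conjI o s)
 qed
qed

text \<open>The comparison map sends the germ of a formal combination of annihilated sections to the germ of
 the same combination over \<open>Z\<close>; this is well-defined and injective by the preceding lemma.\<close>

definition phi where
 "phi V s = (\<lambda>x\<in>pr V. THE g. EX V' c. W.opn V' & pt sg x \<in> V' & c \<in> Wt.fr V' &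
 s (pt sg x) = Wt.gm (pt sg x) V' c & g = Zt.gm x (pr V') c)"

lemma phi_ext: "phi V s \<in> extensional (pr V)"
 unfolding phi_def by simp

lemma phi_at:
 assumes V: "W.opn V'" "V' <= V" and x: "x \<in> pr V'" and c: "c \<in> Wt.fr V'" "s (pt sg x) = Wt.gm (pt sg x) V' c"
 shows "phi V s x = Zt.gm x (pr V') c"
proof -
 have xV: "x \<in> pr V" using subsetD[OF pre_mono[OF V(2)] x] .
 have px: "pt sg x \<in> V'" and xt: "x \<in> topspace (space Z)" using x by (simp_all add: pre_def)
 show ?thesis
 unfolding phi_def restrict_apply'[OF xV]
 proof (rule the_equality)
 show "EX V'' d. W.opn V'' & pt sg x \<in> V'' & d \<in> Wt.fr V'' &
 s (pt sg x) = Wt.gm (pt sg x) V'' d & Zt.gm x (pr V') c = Zt.gm x (pr V'') d"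
 by (intro exI[of _ V'] exI[of _ c] conjI V(1) px c refl)
 fix g assume "EX V'' d. W.opn V'' & pt sg x \<in> V'' & d \<in> Wt.fr V'' &
 s (pt sg x) = Wt.gm (pt sg x) V'' d & g = Zt.gm x (pr V'') d"
 then obtain V'' d where d: "W.opn V''" "pt sg x \<in> V''" "d \<in> Wt.fr V''"
 "s (pt sg x) = Wt.gm (pt sg x) V'' d" "g = Zt.gm x (pr V'') d"
 by (elim exE conjE) (rule that)
 have "x \<in> pr V''" using d(2) xt by (simp add: pre_def)
 from gm_eq[OF d(1) this d(3) V(1) x c(1)] show "g = Zt.gm x (pr V') c"
 unfolding d(5) using trans[OF sym[OF d(4)] c(2)] by (rule iffD2)
 qed
qed

lemma phi_gv: "W.opn V' ==> V' <= V ==> Wt.gv s V' c ==> Zt.gv (phi V s) (pr V') c"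
proof (intro conjI ballI)
 assume V: "W.opn V'" "V' <= V" and c: "Wt.gv s V' c"
 note cc = c[THEN conjunct1]
 show "c \<in> Zt.fr (pr V')" using fr_sub[OF cc] .
 fix x assume x: "x \<in> pr V'"
 have "pt sg x \<in> V'" using x by (simp add: pre_def)
 from phi_at[where s = s, OF V x cc c[THEN conjunct2, rule_format, OF this]] show "phi V s x = Zt.gm x (pr V') c" .
qed

lemma sec_near:
 assumes V: "W.opn V" and s: "s \<in> carrier (msec Wt.TD V)" and x: "x \<in> pr V"
 obtains V' c where "W.opn V'" "V' <= V" "x \<in> pr V'" "Wt.gv s V' c"
proof -
 have px: "pt sg x \<in> V" and xt: "x \<in> topspace (space Z)" using x by (simp_all add: pre_def)
 obtain V' c where c: "W.opn V'" "pt sg x \<in> V'" "V' <= V" "Wt.gv s V' c"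
 using bspec[OF conjunct2[OF iffD1[OF Wt.TD_carrier s]] px] by (elim exE conjE) (rule that; (intro conjI)?)
 show thesis by (rule that[OF c(1,3) _ c(4)]) (use c(2) xt in \<open>simp add: pre_def\<close>)
qed

lemma phi_reflect:
 assumes V: "W.opn V" and s: "s \<in> carrier (msec Wt.TD V)" and V': "W.opn V'" "V' <= V"
 and d: "d \<in> Wt.fr V'" "Zt.gv (phi V s) (pr V') d"
 shows "Wt.gv s V' d"
proof (intro conjI ballI)
 show "d \<in> Wt.fr V'" by (rule d(1))
 fix w assume "w \<in> V'"
 then obtain x where x: "x \<in> pr V'" "pt sg x = w" using pt_surj[OF V'(1)] by blast
 obtain V'' c where c: "W.opn V''" "V'' <= V" "x \<in> pr V''" "Wt.gv s V'' c"
 using sec_near[OF V s subsetD[OF pre_mono[OF V'(2)] x(1)]] .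
 have px: "pt sg x \<in> V''" using c(3) by (simp add: pre_def)
 have "Zt.gm x (pr V'') c = Zt.gm x (pr V') d"
 using trans[OF sym[OF phi_gv[OF c(1,2,4), THEN conjunct2, rule_format, OF c(3)]] d(2)[THEN conjunct2, rule_format, OF x(1)]] .
 then have "Wt.gm (pt sg x) V'' c = Wt.gm (pt sg x) V' d"
 unfolding gm_eq[OF c(1,3) c(4)[THEN conjunct1] V'(1) x(1) d(1)] .
 from trans[OF c(4)[THEN conjunct2, rule_format, OF px] this] show "s w = Wt.gm w V' d" unfolding x(2) .
qed

lemma phi_ann:
 assumes V: "W.opn V" and s: "s \<in> carrier (msec Wt.TD V)"
 shows "phi V s \<in> ann_vertical S0 Z W sg Zt.TD (pr V)"
 unfolding ann_vertical_def mem_Collect_eq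
proof (intro conjI allI impI ballI; (elim conjE)?)
 show "phi V s \<in> carrier (msec Zt.TD (pr V))"
 unfolding Zt.TD_carrier
 proof (intro conjI ballI phi_ext)
 fix x assume x: "x \<in> pr V"
 obtain V' c where c: "W.opn V'" "V' <= V" "x \<in> pr V'" "Wt.gv s V' c" using sec_near[OF V s x] .
 show "EX U c. Z.opn U & x \<in> U & U <= pr V & Zt.gv (phi V s) U c"
 by (rule exI[of _ "pr V'"], rule exI[of _ c])
 (rule conjI[OF pre_open[OF c(1)] conjI[OF c(3) conjI[OF pre_mono[OF c(2)] phi_gv[OF c(1,2,4)]]]])
 qed
 fix U v assume U: "Z.opn U" "U <= pr V" and v: "v \<in> vertical S0 Z W sg U"
 note vT = verticalD(1)[OF v]
 show "conn Zt.TD U v (mres Zt.TD (pr V) U (phi V s)) = \<zero>\<^bsub>msec Zt.TD U\<^esub>"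
 proof (rule Zt.TD_eqI[OF Zt.TD_ext(4) Zt.TD_ext(1)])
 fix x assume x: "x \<in> U"
 obtain V' c where c: "W.opn V'" "V' <= V" "x \<in> pr V'" "Wt.gv s V' c" using sec_near[OF V s subsetD[OF U(2) x]] .
 let ?U = "U \<inter> pr V'"
 have o: "Z.opn ?U" using openin_Int[OF U(1) pre_open[OF c(1)]] .
 note g = Zt.gv_restrict[OF Zt.gv_res[OF pre_open[OF c(1)] o Int_lower2 phi_gv[OF c(1,2,4)]] Int_lower1]
 note k = Zt.gv_conn[OF o Int_lower1 g vT]
 have "Zt.gv (conn Zt.TD U v (restrict (phi V s) U)) ?U 0"
 using Zt.gv_te[OF k tensor_frags_closed(1) vert_cn[OF c(1) o Int_lower2 vertical_restrict[OF U(1) o Int_lower1 v] c(4)[THEN conjunct1]]] .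
 then show "EX U' c. x \<in> U' & Zt.gv (conn Zt.TD U v (mres Zt.TD (pr V) U (phi V s))) U' c & Zt.gv \<zero>\<^bsub>msec Zt.TD U\<^esub> U' c"
 unfolding Zt.TD_ops(5)
 by (intro exI[of _ ?U] exI[of _ 0] conjI[OF IntI[OF x c(3)]] conjI[OF _ Zt.gv_zero[OF o Int_lower1]])
 qed
qed

text \<open>A section of the tensor product that is killed by the vertical vector fields is locally the
 image of a section over \<open>W\<close>: for the finitely many partial derivatives of a coordinate system, the
 vanishing of the derivatives holds for a formal combination on a common neighbourhood.\<close>

lemma ann_near:
 assumes V: "W.opn V" and S: "S \<in> ann_vertical S0 Z W sg Zt.TD (pr V)"
 and U: "Z.opn U" "x \<in> U" "U <= pr V" and c: "Zt.gv S U c"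
 shows "EX V' d. W.opn V' & x \<in> pr V' & V' <= V & d \<in> Wt.fr V' & Zt.gv S (pr V') d &
 (ALL i. c \<in> Zt.gfr U i --> d \<in> Wt.gfr V' i)"
proof -
 have xt: "x \<in> topspace (space Z)" using openin_subset[OF U(1)] U(2) by blast
 have "pt sg x \<in> topspace (space W)" using openin_subset[OF dn_open[OF U(1)]] U(2) by blast
 then obtain V0 et n where f: "pt sg x \<in> V0" "frame S0 Z W sg V0 et n" using frame_exists by blast
 interpret fr: frame S0 Z W sg V0 et n by (rule f(2))
 interpret otf: otframe S0 Z W sg V0 et n F G by unfold_locales
 let ?V = "dn U \<inter> V0"
 have o: "W.opn ?V" using openin_Int[OF dn_open[OF U(1)] fr.V0] .
 note oZ = pre_open[OF o] and sV = Int_lower2[of "dn U" V0]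
 have pU: "pr ?V <= U" using pre_dn[OF U(1)] pre_mono[of ?V "dn U"] by simp
 have xV: "x \<in> pr ?V" using U(2) f(1) xt by (simp add: pre_def)
 let ?c = "Zt.rs U (pr ?V) c"
 note c1 = Zt.gv_res[OF U(1) oZ pU c]
 note c1f = c1[THEN conjunct1]
 have "EX N. Z.opn N & x \<in> N & N <= pr ?V & Zt.te N (Zt.rs (pr ?V) N (Zt.cn (pr ?V) (fr.pdd ?V j) ?c)) 0" for j
 proof -
 note p = Z.hom_vf_in_T[OF fr.pdd_hom[OF sV]]
 have z: "conn Zt.TD (pr ?V) (fr.pdd ?V j) (mres Zt.TD (pr V) (pr ?V) S) = \<zero>\<^bsub>msec Zt.TD (pr ?V)\<^esub>"
 using S subset_trans[OF pU U(3)] oZ fr.pdd_vertical[OF o sV] unfolding ann_vertical_def by blast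
 have k: "Zt.gv (conn Zt.TD (pr ?V) (fr.pdd ?V j) (restrict S (pr ?V))) (pr ?V) (Zt.cn (pr ?V) (fr.pdd ?V j) ?c)"
 using Zt.gv_conn[OF oZ order_refl Zt.gv_restrict[OF c1 order_refl] p] unfolding Z.T_ext[OF p] .
 have "Zt.gm x (pr ?V) (Zt.cn (pr ?V) (fr.pdd ?V j) ?c) = Zt.gm x (pr ?V) 0"
 using k[THEN conjunct2, rule_format, OF xV] Zt.gv_zero[OF oZ order_refl, THEN conjunct2, rule_format, OF xV]
 unfolding z[unfolded Zt.TD_ops(5)] by (rule trans[OF sym])
 from iffD1[OF Zt.gm_iff[OF oZ xV k[THEN conjunct1] oZ xV tensor_frags_closed(1)] this]
 obtain N where N: "Z.opn N" "x \<in> N" "N <= pr ?V" "N <= pr ?V"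
 "Zt.te N (Zt.rs (pr ?V) N (Zt.cn (pr ?V) (fr.pdd ?V j) ?c)) (Zt.rs (pr ?V) N 0)" by (elim exE conjE) (rule that)
 have "Zt.rs (pr ?V) N 0 = 0" by simp
 then show ?thesis using N by (intro exI[of _ N]) simp
 qed
 then obtain N where N: "!!j. Z.opn (N j) & x \<in> N j & N j <= pr ?V &
 Zt.te (N j) (Zt.rs (pr ?V) (N j) (Zt.cn (pr ?V) (fr.pdd ?V j) ?c)) 0" by metis
 let ?N = "pr ?V \<inter> (\<Inter>j\<in>{..<n}. N j)"
 have oN: "Z.opn ?N"
 proof (cases n)
 case 0
 then show ?thesis using oZ by simp
 next
 case (Suc m)
 then have "Z.opn (\<Inter>j\<in>{..<n}. N j)" using N by (intro openin_INT2) auto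
 then show ?thesis using oZ by blast
 qed
 let ?V' = "dn ?N"
 have o': "W.opn ?V'" using dn_open[OF oN] .
 have pN: "pr ?V' = ?N" using pre_dn[OF oN] .
 have s': "pr ?V' <= pr ?V" unfolding pN by (rule Int_lower1)
 have sj: "pr ?V' <= N j" if "j < n" for j unfolding pN using that by blast
 have s0: "?V' <= V0" using subset_trans[OF pre_subset_iff[OF o' s'] sV] .
 have sV': "?V' <= V" using pre_subset_iff[OF o' subset_trans[OF s' subset_trans[OF pU U(3)]]] .
 have xN: "x \<in> pr ?V'" unfolding pN using xV N by blast
 note oZ' = pre_open[OF o']
 let ?d = "Zt.rs (pr ?V) (pr ?V') ?c"
 note c2 = Zt.gv_res[OF oZ oZ' s' c1]
 have kill: "Zt.cn (pr ?V') (fr.pdd ?V' j) ?d \<in> Zt.rel (pr ?V')" if j: "j < n" for j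
 proof -
 note p = Z.hom_vf_in_T[OF fr.pdd_hom[OF sV]]
 note Nj = N[of j, THEN conjunct1] N[of j, THEN conjunct2, THEN conjunct2, THEN conjunct1]
 N[of j, THEN conjunct2, THEN conjunct2, THEN conjunct2]
 have z0: "Zt.rs (N j) (pr ?V') 0 = 0" by simp
 have "Zt.te (pr ?V') (Zt.rs (pr ?V) (pr ?V') (Zt.cn (pr ?V) (fr.pdd ?V j) ?c)) 0"
 using Zt.te_rs[OF Nj(1) oZ' sj[OF j] Nj(3)]
 unfolding Zt.rs_rs[OF oZ Nj(1) oZ' sj[OF j] Nj(2) Zt.fr_closed(2)[OF oZ c1f p]] z0 .
 then show ?thesis
 unfolding Zt.rs_cn[OF oZ oZ' s' p c1f] Z.vf_ext_vf_ext[OF s'] teq_def diff_0_right .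
 qed
 have ex: "\<exists>d\<in>Wt.fr ?V'. Zt.te (pr ?V') ?d d & (ALL i. ?d \<in> Zt.gfr (pr ?V') i --> d \<in> Wt.gfr ?V' i)"
 by (rule otf.surj_frame[OF o' s0 c2[THEN conjunct1] kill])
 from ex obtain d where d: "d \<in> Wt.fr ?V'" "Zt.te (pr ?V') ?d d" "ALL i. ?d \<in> Zt.gfr (pr ?V') i --> d \<in> Wt.gfr ?V' i"
 by (elim bexE conjE) (rule that)
 have g: "ALL i. c \<in> Zt.gfr U i --> d \<in> Wt.gfr ?V' i"
 using d(3) Zt.gfr_rs[OF oZ oZ' s' Zt.gfr_rs[OF U(1) oZ pU]] by (intro allI impI) (rule mp, erule spec, assumption)
 show ?thesis
 by (rule exI[of _ ?V'], rule exI[of _ d])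
 (rule conjI[OF o' conjI[OF xN conjI[OF sV' conjI[OF d(1) conjI[OF Zt.gv_te[OF c2 fr_sub[OF d(1)] d(2)] g]]]]])
qed

lemma phi_surj:
 assumes V: "W.opn V" and S: "S \<in> ann_vertical S0 Z W sg Zt.TD (pr V)"
 shows "\<exists>s\<in>carrier (msec Wt.TD V). phi V s = S"
proof -
 have Sc: "S \<in> carrier (msec Zt.TD (pr V))" using S by (simp add: ann_vertical_def)
 note Sc = iffD1[OF Zt.TD_carrier Sc]
 define Q where "Q w N D \<longleftrightarrow> W.opn N & w \<in> N & N <= V & D \<in> Wt.fr N & Zt.gv S (pr N) D" for w N D
 have ex: "EX N D. Q w N D" if w: "w \<in> V" for w
 proof -
 obtain x where x: "x \<in> pr V" "pt sg x = w" using pt_surj[OF V w] by blast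
 obtain U c where c: "Z.opn U" "x \<in> U" "U <= pr V" "Zt.gv S U c"
 using bspec[OF conjunct2[OF Sc] x(1)] by (elim exE conjE) (rule that; (intro conjI)?)
 obtain V' d where d: "W.opn V'" "x \<in> pr V'" "V' <= V" "d \<in> Wt.fr V'" "Zt.gv S (pr V') d"
 using ann_near[OF V S c] by meson
 have w': "w \<in> V'" using d(2) x(2) by (simp add: pre_def)
 have "Q w V' d" unfolding Q_def by (rule conjI[OF d(1) conjI[OF w' conjI[OF d(3) conjI[OF d(4,5)]]]])
 then show ?thesis by (intro exI)
 qed
 define N where "N w = (SOME X. EX D. Q w X D)" for w
 define D where "D w = (SOME X. Q w (N w) X)" for w
 have NQ: "Q w (N w) (D w)" if w: "w \<in> V" for w
 proof -
 have "EX D. Q w (N w) D" unfolding N_def by (rule someI_ex[OF ex[OF w]])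
 then show ?thesis unfolding D_def by (rule someI_ex)
 qed
 note N = NQ[unfolded Q_def]
 define s where "s = (\<lambda>w\<in>V. Wt.gm w ((N w)) ((D w)))"
 note n1 = N[THEN conjunct1] and n2 = N[THEN conjunct2, THEN conjunct1] and n3 = N[THEN conjunct2, THEN conjunct2, THEN conjunct1]
 and n4 = N[THEN conjunct2, THEN conjunct2, THEN conjunct2, THEN conjunct1]
 and n5 = N[THEN conjunct2, THEN conjunct2, THEN conjunct2, THEN conjunct2]
 have gs: "Wt.gv s ((N w)) ((D w))" if w: "w \<in> V" for w
 proof (intro conjI ballI)
 show "(D w) \<in> Wt.fr ((N w))" by (rule n4[OF w])
 fix w' assume w': "w' \<in> (N w)"
 then obtain y where y: "y \<in> pr ((N w))" "pt sg y = w'" using pt_surj[OF n1[OF w]] by blast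
 note v = subsetD[OF n3[OF w] w']
 have y': "y \<in> pr ((N w'))" using y n2[OF v] by (simp add: pre_def)
 have "Zt.gm y (pr ((N w'))) ((D w')) = Zt.gm y (pr ((N w))) ((D w))"
 using trans[OF sym[OF n5[OF v, THEN conjunct2, rule_format, OF y']] n5[OF w, THEN conjunct2, rule_format, OF y(1)]] .
 then have "Wt.gm (pt sg y) ((N w')) ((D w')) = Wt.gm (pt sg y) ((N w)) ((D w))"
 unfolding gm_eq[OF n1[OF v] y' n4[OF v] n1[OF w] y(1) n4[OF w]] .
 then show "s w' = Wt.gm w' ((N w)) ((D w))" unfolding s_def restrict_apply'[OF v] y(2) .
 qed
 have sc: "s \<in> carrier (msec Wt.TD V)"
 unfolding Wt.TD_carrier
 proof (rule conjI, unfold s_def, rule restrict_extensional, fold s_def, rule ballI)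
 fix w assume w: "w \<in> V"
 show "EX V' c. W.opn V' & w \<in> V' & V' <= V & Wt.gv s V' c"
 by (rule exI[of _ "(N w)"], rule exI[of _ "(D w)"])
 (rule conjI[OF n1[OF w] conjI[OF n2[OF w] conjI[OF n3[OF w] gs[OF w]]]])
 qed
 have "phi V s = S"
 proof (rule Zt.TD_eqI[OF phi_ext conjunct1[OF Sc]])
 fix x assume x: "x \<in> pr V"
 have w: "pt sg x \<in> V" using x by (simp add: pre_def)
 have "x \<in> pr ((N (pt sg x)))" using x n2[OF w] by (simp add: pre_def)
 then show "EX U c. x \<in> U & Zt.gv (phi V s) U c & Zt.gv S U c"
 by (rule_tac exI[of _ "pr ((N (pt sg x)))"], rule_tac exI[of _ "(D (pt sg x))"])
 (rule conjI[OF _ conjI[OF phi_gv[OF n1[OF w] n3[OF w] gs[OF w]] n5[OF w]]])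
 qed
 then show ?thesis using sc by blast
qed

abbreviation dT where "dT \<equiv> dplus S0 Z W sg Zt.TD"

lemma dT_simps:
 "carrier (msec dT V) = ann_vertical S0 Z W sg Zt.TD (pr V)" "add (msec dT V) = add (msec Zt.TD (pr V))"
 "smult (msec dT V) b = smult (msec Zt.TD (pr V)) (com sg V b)"
 "mgr (msec dT V) i = mgr (msec Zt.TD (pr V)) i \<inter> ann_vertical S0 Z W sg Zt.TD (pr V)"
 "mres dT V V' = mres Zt.TD (pr V) (pr V')"
 by (simp_all add: dplus_def Let_def)

lemma phi_mgr:
 assumes V: "W.opn V" and s: "s \<in> carrier (msec Wt.TD V)"
 shows "s \<in> mgr (msec Wt.TD V) i \<longleftrightarrow> phi V s \<in> mgr (msec Zt.TD (pr V)) i"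
proof
 assume "s \<in> mgr (msec Wt.TD V) i"
 note m = conjunct2[OF iffD1[OF Wt.TD_mgr this]]
 show "phi V s \<in> mgr (msec Zt.TD (pr V)) i"
 unfolding Zt.TD_mgr
 proof (intro conjI ballI phi_ext)
 fix x assume x: "x \<in> pr V"
 have w: "pt sg x \<in> V" using x by (simp add: pre_def)
 obtain V' c where c: "W.opn V'" "pt sg x \<in> V'" "V' <= V" "c \<in> Wt.gfr V' i" "Wt.gv s V' c"
 using bspec[OF m w] by (elim exE conjE) (rule that; (intro conjI)?)
 have x': "x \<in> pr V'" using x c(2) by (simp add: pre_def)
 show "EX U c. Z.opn U & x \<in> U & U <= pr V & c \<in> Zt.gfr U i & Zt.gv (phi V s) U c"
 by (rule exI[of _ "pr V'"], rule exI[of _ c])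
 (rule conjI[OF pre_open[OF c(1)] conjI[OF x' conjI[OF pre_mono[OF c(3)] conjI[OF gfr_sub[OF c(4)] phi_gv[OF c(1,3,5)]]]]])
 qed
next
 assume "phi V s \<in> mgr (msec Zt.TD (pr V)) i"
 note m = conjunct2[OF iffD1[OF Zt.TD_mgr this]]
 show "s \<in> mgr (msec Wt.TD V) i"
 unfolding Wt.TD_mgr
 proof (intro conjI[OF conjunct1[OF iffD1[OF Wt.TD_carrier s]]] ballI)
 fix w assume w: "w \<in> V"
 obtain x where x: "x \<in> pr V" "pt sg x = w" using pt_surj[OF V w] by blast
 obtain U c where c: "Z.opn U" "x \<in> U" "U <= pr V" "c \<in> Zt.gfr U i" "Zt.gv (phi V s) U c"
 using bspec[OF m x(1)] by (elim exE conjE) (rule that; (intro conjI)?)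
 obtain V' d where d: "W.opn V'" "x \<in> pr V'" "V' <= V" "d \<in> Wt.fr V'" "Zt.gv (phi V s) (pr V') d"
 "ALL i. c \<in> Zt.gfr U i --> d \<in> Wt.gfr V' i"
 using ann_near[OF V phi_ann[OF V s] c(1,2,3,5)] by (elim exE conjE) (rule that; (intro conjI)?; assumption)
 have w': "w \<in> V'" using d(2) x(2) by (simp add: pre_def)
 show "EX V' c. W.opn V' & w \<in> V' & V' <= V & c \<in> Wt.gfr V' i & Wt.gv s V' c"
 by (rule exI[of _ V'], rule exI[of _ d])
 (rule conjI[OF d(1) conjI[OF w' conjI[OF d(3) conjI[OF d(6)[THEN spec, THEN mp, OF c(4)] phi_reflect[OF V s d(1,3,4,5)]]]]])
 qed
qed

lemma phi_inj: "W.opn V ==> inj_on (phi V) (carrier (msec Wt.TD V))"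
proof (rule inj_onI)
 fix s t assume V: "W.opn V" and s: "s \<in> carrier (msec Wt.TD V)" "t \<in> carrier (msec Wt.TD V)" and e: "phi V s = phi V t"
 show "s = t"
 proof (rule Wt.TD_eqI[OF conjunct1[OF iffD1[OF Wt.TD_carrier s(1)]] conjunct1[OF iffD1[OF Wt.TD_carrier s(2)]]])
 fix w assume w: "w \<in> V"
 obtain x where x: "x \<in> pr V" "pt sg x = w" using pt_surj[OF V w] by blast
 obtain V' c where c: "W.opn V'" "V' <= V" "x \<in> pr V'" "Wt.gv s V' c" using sec_near[OF V s(1) x(1)] .
 have w': "w \<in> V'" using c(3) x(2) by (simp add: pre_def)
 show "EX V c. w \<in> V & Wt.gv s V c & Wt.gv t V c"
 by (rule exI[of _ V'], rule exI[of _ c])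
 (rule conjI[OF w' conjI[OF c(4) phi_reflect[OF V s(2) c(1,2) c(4)[THEN conjunct1] phi_gv[OF c(1,2,4), unfolded e]]]])
 qed
qed

lemma TD_conn_closed:
 assumes V: "W.opn V" and s: "s \<in> carrier (msec Wt.TD V)" and v: "v \<in> carrier (W.T V)"
 shows "conn Wt.TD V v s \<in> carrier (msec Wt.TD V)"
 unfolding Wt.TD_carrier
proof (intro conjI[OF Wt.TD_ext(4)] ballI)
 fix w assume "w \<in> V"
 from bspec[OF conjunct2[OF iffD1[OF Wt.TD_carrier s]] this]
 obtain V' c where c: "W.opn V'" "w \<in> V'" "V' <= V" "Wt.gv s V' c" by (elim exE conjE) (rule that; (intro conjI)?)
 show "EX V' c. W.opn V' & w \<in> V' & V' <= V & Wt.gv (conn Wt.TD V v s) V' c"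
 by (rule exI[of _ V'], rule exI) (rule conjI[OF c(1) conjI[OF c(2) conjI[OF c(3) Wt.gv_conn[OF c(1,3,4) v]]]])
qed

lemma phi_conn:
 assumes V: "W.opn V" and s: "s \<in> carrier (msec Wt.TD V)" and v: "v \<in> carrier (W.T V)"
 shows "conn dT V v (phi V s) = phi V (conn Wt.TD V v s)"
proof -
 let ?n = "phi V (conn Wt.TD V v s)"
 have l: "conn Zt.TD U v' (mres Zt.TD (pr V) U (phi V s)) = mres Zt.TD (pr V) U ?n" if l: "local_lift S0 Z W sg V v U v'" for U v'
 proof (rule Zt.TD_eqI[OF Zt.TD_ext(4,5)])
 note d = local_liftD[OF l V]
 fix x assume x: "x \<in> U"
 obtain V' c where c: "W.opn V'" "V' <= V" "x \<in> pr V'" "Wt.gv s V' c" using sec_near[OF V s subsetD[OF d(2) x]] .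
 note cc = c(4)[THEN conjunct1] and vV = W.T_restrict[OF v c(2)]
 let ?U = "U \<inter> pr V'"
 have o: "Z.opn ?U" using openin_Int[OF d(1) pre_open[OF c(1)]] .
 note g = Zt.gv_restrict[OF Zt.gv_res[OF pre_open[OF c(1)] o Int_lower2 phi_gv[OF c(1,2,4)]] Int_lower1]
 note k = Zt.gv_conn[OF o Int_lower1 g d(3)]
 note h = Zt.gv_restrict[OF Zt.gv_res[OF pre_open[OF c(1)] o Int_lower2 phi_gv[OF c(1,2) Wt.gv_conn[OF c(1,2,4) v]]] Int_lower1]
 note e = lift_cn[OF c(1) vV local_lift_restrict[OF V v l c(1,2) o Int_lower1 Int_lower2] cc]
 show "EX U' c. x \<in> U' & Zt.gv (conn Zt.TD U v' (mres Zt.TD (pr V) U (phi V s))) U' c &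
 Zt.gv (mres Zt.TD (pr V) U ?n) U' c"
 unfolding Zt.TD_ops(5)
 by (rule exI[of _ ?U], rule exI) (rule conjI[OF IntI[OF x c(3)] conjI[OF k h[unfolded e]]])
 qed
 note a = phi_ann[OF V TD_conn_closed[OF V s v]]
 have "conn dT V v (phi V s) = (THE n. n \<in> ann_vertical S0 Z W sg Zt.TD (pr V) &
 (ALL U v'. local_lift S0 Z W sg V v U v' -->
 conn Zt.TD U v' (mres Zt.TD (pr V) U (phi V s)) = mres Zt.TD (pr V) U n))" by (simp add: dplus_def)
 also have "\<dots> = ?n"
 proof (rule the_equality)
 show "?n \<in> ann_vertical S0 Z W sg Zt.TD (pr V) & (ALL U v'. local_lift S0 Z W sg V v U v' -->
 conn Zt.TD U v' (mres Zt.TD (pr V) U (phi V s)) = mres Zt.TD (pr V) U ?n)"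
 by (intro conjI a allI impI l)
 fix n assume n: "n \<in> ann_vertical S0 Z W sg Zt.TD (pr V) & (ALL U v'. local_lift S0 Z W sg V v U v' -->
 conn Zt.TD U v' (mres Zt.TD (pr V) U (phi V s)) = mres Zt.TD (pr V) U n)"
 have "n \<in> carrier (msec Zt.TD (pr V))" using n[THEN conjunct1] by (simp add: ann_vertical_def)
 note ne = conjunct1[OF iffD1[OF Zt.TD_carrier this]]
 show "n = ?n"
 proof (rule extensionalityI[OF ne phi_ext])
 fix x assume x: "x \<in> pr V"
 obtain U v' where U: "x \<in> U" "local_lift S0 Z W sg V v U v'" using lift_near'[OF V v x] by blast
 have "restrict n U = restrict ?n U"
 using trans[OF sym[OF n[THEN conjunct2, rule_format, OF U(2)]] l[OF U(2)]] unfolding Zt.TD_ops(5) .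
 from fun_cong[OF this, of x] show "n x = ?n x" using U(1) by simp
 qed
 qed
 finally show ?thesis .
qed

theorem dplus_tensor:
 "\<exists>\<phi>. dmod_iso S0 W Wt.TD dT \<phi> &
 (ALL V. W.opn V --> (\<forall>m\<in>carrier (msec F.dp V). \<forall>n\<in>carrier (msec G.dp V).
 \<phi> V (pure_tensor S0 W F.dp G.dp V m n) = pure_tensor S0 Z F G (pr V) m n))"
proof (intro exI[of _ phi] conjI allI impI ballI)
 fix V m n assume V: "W.opn V" and m: "m \<in> carrier (msec F.dp V)" and n: "n \<in> carrier (msec G.dp V)"
 have f: "frag_of (m, n) \<in> Wt.fr V" using tensor_frags_closed(4)[OF m n] .
 show "phi V (pure_tensor S0 W F.dp G.dp V m n) = pure_tensor S0 Z F G (pr V) m n"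
 proof (rule extensionalityI[OF phi_ext])
 show "pure_tensor S0 Z F G (pr V) m n \<in> extensional (pr V)" by (simp add: pure_tensor_def)
 fix x assume x: "x \<in> pr V"
 have w: "pt sg x \<in> V" using x by (simp add: pre_def)
 have "pure_tensor S0 W F.dp G.dp V m n (pt sg x) = Wt.gm (pt sg x) V (frag_of (m, n))"
 unfolding pure_tensor_def restrict_apply'[OF w] ..
 from phi_at[where s = "pure_tensor S0 W F.dp G.dp V m n", OF V order_refl x f this]
 show "phi V (pure_tensor S0 W F.dp G.dp V m n) x = pure_tensor S0 Z F G (pr V) m n x"
 unfolding pure_tensor_def restrict_apply'[OF x] .
 qed
next
 have add: "phi V (s \<oplus>\<^bsub>msec Wt.TD V\<^esub> t) = phi V s \<oplus>\<^bsub>msec dT V\<^esub> phi V t"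
 if V: "W.opn V" and s: "s \<in> carrier (msec Wt.TD V)" "t \<in> carrier (msec Wt.TD V)" for V s t
 unfolding dT_simps
 proof (rule Zt.TD_eqI[OF phi_ext Zt.TD_ext(2)])
 fix x assume x: "x \<in> pr V"
 obtain A c where c: "W.opn A" "A <= V" "x \<in> pr A" "Wt.gv s A c" using sec_near[OF V s(1) x] .
 obtain B d where d: "W.opn B" "B <= V" "x \<in> pr B" "Wt.gv t B d" using sec_near[OF V s(2) x] .
 let ?V = "A \<inter> B"
 have o: "W.opn ?V" using openin_Int[OF c(1) d(1)] .
 have u: "?V <= V" using c(2) by blast
 have x': "x \<in> pr ?V" using c(3) d(3) by (simp add: pre_def)
 note c' = Wt.gv_res[OF c(1) o Int_lower1 c(4)] and d' = Wt.gv_res[OF d(1) o Int_lower2 d(4)]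
 show "EX U c. x \<in> U & Zt.gv (phi V (s \<oplus>\<^bsub>msec Wt.TD V\<^esub> t)) U c & Zt.gv (phi V s \<oplus>\<^bsub>msec Zt.TD (pr V)\<^esub> phi V t) U c"
 by (rule exI[of _ "pr ?V"], rule exI)
 (rule conjI[OF x' conjI[OF phi_gv[OF o u Wt.gv_add[OF o u c' d']]
 Zt.gv_add[OF pre_open[OF o] pre_mono[OF u] phi_gv[OF o u c'] phi_gv[OF o u d']]]])
 qed
 have smult: "phi V (b \<odot>\<^bsub>msec Wt.TD V\<^esub> s) = b \<odot>\<^bsub>msec dT V\<^esub> phi V s"
 if V: "W.opn V" and b: "b \<in> W.Sc V" and s: "s \<in> carrier (msec Wt.TD V)" for V b s
 unfolding dT_simps
 proof (rule Zt.TD_eqI[OF phi_ext Zt.TD_ext(3)])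
 fix x assume x: "x \<in> pr V"
 obtain A c where c: "W.opn A" "A <= V" "x \<in> pr A" "Wt.gv s A c" using sec_near[OF V s x] .
 note g = phi_gv[OF c(1,2) Wt.gv_smult[OF V c(1,2,4) b], unfolded sm_dp com_res[OF V c(1,2) b]]
 show "EX U d. x \<in> U & Zt.gv (phi V (b \<odot>\<^bsub>msec Wt.TD V\<^esub> s)) U d &
 Zt.gv (com sg V b \<odot>\<^bsub>msec Zt.TD (pr V)\<^esub> phi V s) U d"
 by (rule exI[of _ "pr A"], rule exI)
 (rule conjI[OF c(3) conjI[OF g Zt.gv_smult[OF pre_open[OF V] pre_open[OF c(1)] pre_mono[OF c(2)] phi_gv[OF c(1,2,4)] com_closed[OF V b]]]])
 qed
 have res: "phi V' (mres Wt.TD V V' s) = mres dT V V' (phi V s)"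
 if V: "W.opn V" "W.opn V'" "V' <= V" and s: "s \<in> carrier (msec Wt.TD V)" for V V' s
 unfolding dT_simps
 proof (rule Zt.TD_eqI[OF phi_ext Zt.TD_ext(5)])
 fix x assume x: "x \<in> pr V'"
 obtain A c where c: "W.opn A" "A <= V" "x \<in> pr A" "Wt.gv s A c" using sec_near[OF V(1) s subsetD[OF pre_mono[OF V(3)] x]] .
 let ?V = "A \<inter> V'"
 have o: "W.opn ?V" using openin_Int[OF c(1) V(2)] .
 have u: "?V <= V" using c(2) by blast
 have x': "x \<in> pr ?V" using c(3) x by (simp add: pre_def)
 note c' = Wt.gv_res[OF c(1) o Int_lower1 c(4)]
 show "EX U c. x \<in> U & Zt.gv (phi V' (mres Wt.TD V V' s)) U c & Zt.gv (mres Zt.TD (pr V) (pr V') (phi V s)) U c"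
 unfolding Zt.TD_ops(5) Wt.TD_ops(5)
 by (rule exI[of _ "pr ?V"], rule exI)
 (rule conjI[OF x' conjI[OF phi_gv[OF o Int_lower2 Wt.gv_restrict[OF c' Int_lower2]]
 Zt.gv_restrict[OF phi_gv[OF o u c'] pre_mono[OF Int_lower2]]]])
 qed
 have gc: "s \<in> carrier (msec Wt.TD V)" if "W.opn V" "s \<in> mgr (msec Wt.TD V) i" for V s i
 using that(2) unfolding Wt.TD_mgr Wt.TD_carrier by blast
 have omor: "omod_mor W Wt.TD dT phi"
 unfolding omod_mor_def
 proof (intro conjI allI impI ballI subsetI; (elim conjE imageE)?)
 fix V s assume "W.opn V" "s \<in> carrier (msec Wt.TD V)"
 then show "phi V s \<in> carrier (msec dT V)" unfolding dT_simps by (rule phi_ann)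
 next
 fix V i t s assume V: "W.opn V" and t: "t = phi V s" and s: "s \<in> mgr (msec Wt.TD V) i"
 show "t \<in> mgr (msec dT V) i"
 unfolding t dT_simps using iffD1[OF phi_mgr[OF V gc[OF V s]] s] phi_ann[OF V gc[OF V s]] by (rule IntI)
 qed (rule add smult res; assumption)+
 show "dmod_iso S0 W Wt.TD dT phi"
 unfolding dmod_iso_def dmod_mor_def omod_iso_def
 proof (intro conjI omor allI impI ballI)
 fix V v s assume "W.opn V" "v \<in> carrier (W.T V)" "s \<in> carrier (msec Wt.TD V)"
 then show "phi V (conn Wt.TD V v s) = conn dT V v (phi V s)" using phi_conn by (intro sym[OF phi_conn])
 next
 fix V assume V: "W.opn V"
 show "bij_betw (phi V) (carrier (msec Wt.TD V)) (carrier (msec dT V))"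
 unfolding bij_betw_def dT_simps
 proof (intro conjI phi_inj[OF V] subset_antisym subsetI)
 fix S assume "S \<in> ann_vertical S0 Z W sg Zt.TD (pr V)"
 from phi_surj[OF V this] show "S \<in> phi V ` carrier (msec Wt.TD V)" by (elim bexE) (rule image_eqI[OF sym])
 qed (use phi_ann[OF V] in \<open>elim imageE, simp only:\<close>)
 next
 fix V i assume V: "W.opn V"
 show "phi V ` mgr (msec Wt.TD V) i = mgr (msec dT V) i"
 proof (intro subset_antisym subsetI)
 fix S assume "S \<in> mgr (msec dT V) i"
 then have S: "S \<in> mgr (msec Zt.TD (pr V)) i" "S \<in> ann_vertical S0 Z W sg Zt.TD (pr V)" unfolding dT_simps by blast+
 from phi_surj[OF V S(2)] obtain s where s: "s \<in> carrier (msec Wt.TD V)" "phi V s = S" by (elim bexE) (rule that)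
 show "S \<in> phi V ` mgr (msec Wt.TD V) i"
 using s S(1) phi_mgr[OF V s(1), of i] by blast
 next
 fix S assume "S \<in> phi V ` mgr (msec Wt.TD V) i"
 then show "S \<in> mgr (msec dT V) i" using omor V unfolding omod_mor_def by blast
 qed
 qed
qed

end

theorem proposition3:
  fixes \<tau> :: which_topology
    and \<Lambda> :: "('l, complex) superalg"
    and Z :: "('z, 'a, 'l) superspace"
    and W :: "('w, 'b, 'l) superspace"
    and \<sigma> :: "('z, 'w, 'a, 'b) smor"
  assumes "nilpotent_extension \<Lambda>"
    and "smooth_superscheme \<tau> \<Lambda> Z"
    and "smooth_superscheme \<tau> \<Lambda> W"
    and "purely_odd_submersion \<Lambda> Z W \<sigma>"
  shows
    \<comment> \<open>functor\<close>
    "(\<forall>F :: ('z, 'a, 'm) dmod. dmodule \<Lambda> Z F \<longrightarrow> dmodule \<Lambda> W (dplus \<Lambda> Z W \<sigma> F)) \<and>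
     (\<forall>(F :: ('z, 'a, 'm) dmod) (G :: ('z, 'a, 'n) dmod) f.
        dmodule \<Lambda> Z F \<and> dmodule \<Lambda> Z G \<and> dmod_mor \<Lambda> Z F G f \<longrightarrow>
        dmod_mor \<Lambda> W (dplus \<Lambda> Z W \<sigma> F) (dplus \<Lambda> Z W \<sigma> G) (dplus_mor Z \<sigma> f)) \<and>
     dplus_mor Z \<sigma> (\<lambda>U (m :: 'm). m) = (\<lambda>V m. m) \<and>
     (\<forall>(f :: 'z set \<Rightarrow> 'm \<Rightarrow> 'n) (g :: 'z set \<Rightarrow> 'n \<Rightarrow> 'k).
        dplus_mor Z \<sigma> (\<lambda>U. g U \<circ> f U) = (\<lambda>V. dplus_mor Z \<sigma> g V \<circ> dplus_mor Z \<sigma> f V)) \<and>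
     \<comment> \<open>exactness\<close>
     (\<forall>(F :: ('z, 'a, 'm) dmod) (G :: ('z, 'a, 'n) dmod) (H :: ('z, 'a, 'k) dmod) f g.
        dmodule \<Lambda> Z F \<and> dmodule \<Lambda> Z G \<and> dmodule \<Lambda> Z H \<and>
        dmod_mor \<Lambda> Z F G f \<and> dmod_mor \<Lambda> Z G H g \<and> short_exact Z F G H f g \<longrightarrow>
        short_exact W (dplus \<Lambda> Z W \<sigma> F) (dplus \<Lambda> Z W \<sigma> G) (dplus \<Lambda> Z W \<sigma> H)
          (dplus_mor Z \<sigma> f) (dplus_mor Z \<sigma> g)) \<and>
     \<comment> \<open>tensor products\<close>
     (\<forall>(F :: ('z, 'a, 'm) dmod) (G :: ('z, 'a, 'n) dmod).
        dmodule \<Lambda> Z F \<and> dmodule \<Lambda> Z G \<longrightarrow>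
        (\<exists>\<phi>. dmod_iso \<Lambda> W
               (tensor_dmod \<Lambda> W (dplus \<Lambda> Z W \<sigma> F) (dplus \<Lambda> Z W \<sigma> G))
               (dplus \<Lambda> Z W \<sigma> (tensor_dmod \<Lambda> Z F G)) \<phi> \<and>
             (\<forall>V. openin (space W) V \<longrightarrow>
                (\<forall>m\<in>carrier (msec (dplus \<Lambda> Z W \<sigma> F) V). \<forall>n\<in>carrier (msec (dplus \<Lambda> Z W \<sigma> G) V).
                   \<phi> V (pure_tensor \<Lambda> W (dplus \<Lambda> Z W \<sigma> F) (dplus \<Lambda> Z W \<sigma> G) V m n) =
                   pure_tensor \<Lambda> Z F G (pre Z \<sigma> V) m n)))) \<and>
     \<comment> \<open>local freeness and rank\<close>
     (\<forall>F :: ('z, 'a, 'm) dmod. dmodule \<Lambda> Z F \<longrightarrow>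
        (locally_free Z F \<longrightarrow> locally_free W (dplus \<Lambda> Z W \<sigma> F)) \<and>
        (\<forall>p q. locally_free_of_rank Z F p q \<longrightarrow> locally_free_of_rank W (dplus \<Lambda> Z W \<sigma> F) p q))"
proof -
  have s: "is_superspace \<Lambda> Z" "is_superspace \<Lambda> W"
    using assms(2,3) unfolding smooth_superscheme_def by blast+
  interpret osub \<Lambda> Z W \<sigma> by unfold_locales (rule s assms)+
  have free: "free_near W (dplus \<Lambda> Z W \<sigma> F) w p q"
    if "dmodule \<Lambda> Z F" "z \<in> topspace (space Z)" "pt \<sigma> z = w" "free_near Z F z p q"
    for F :: "('z, 'a, 'm) dmod" and z w p q
    using dplus_free_near[OF that(1,2,4)] unfolding that(3) .
  have lift: "\<exists>z\<in>topspace (space Z). pt \<sigma> z = w" if "w \<in> topspace (space W)" for w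
    using that unfolding surj_pt[symmetric] by blast
  show ?thesis
  proof (intro conjI allI impI)
    fix F :: "('z, 'a, 'm) dmod" assume "dmodule \<Lambda> Z F"
    then show "dmodule \<Lambda> W (dplus \<Lambda> Z W \<sigma> F)" by (rule osubm.dplus_dmodule[OF osubm])
  next
    fix F :: "('z, 'a, 'm) dmod" and G :: "('z, 'a, 'n) dmod" and f
    assume "dmodule \<Lambda> Z F \<and> dmodule \<Lambda> Z G \<and> dmod_mor \<Lambda> Z F G f"
    then show "dmod_mor \<Lambda> W (dplus \<Lambda> Z W \<sigma> F) (dplus \<Lambda> Z W \<sigma> G) (dplus_mor Z \<sigma> f)"
      by (elim conjE) (rule dplus_mor)
  next
    show "dplus_mor Z \<sigma> (\<lambda>U (m :: 'm). m) = (\<lambda>V m. m)" by (simp add: dplus_mor_def)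
  next
    fix f :: "'z set \<Rightarrow> 'm \<Rightarrow> 'n" and g :: "'z set \<Rightarrow> 'n \<Rightarrow> 'k"
    show "dplus_mor Z \<sigma> (\<lambda>U. g U \<circ> f U) = (\<lambda>V. dplus_mor Z \<sigma> g V \<circ> dplus_mor Z \<sigma> f V)"
      by (simp add: dplus_mor_def fun_eq_iff)
  next
    fix F :: "('z, 'a, 'm) dmod" and G :: "('z, 'a, 'n) dmod" and H :: "('z, 'a, 'k) dmod" and f g
    assume "dmodule \<Lambda> Z F \<and> dmodule \<Lambda> Z G \<and> dmodule \<Lambda> Z H \<and>
      dmod_mor \<Lambda> Z F G f \<and> dmod_mor \<Lambda> Z G H g \<and> short_exact Z F G H f g"
    then show "short_exact W (dplus \<Lambda> Z W \<sigma> F) (dplus \<Lambda> Z W \<sigma> G) (dplus \<Lambda> Z W \<sigma> H)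
        (dplus_mor Z \<sigma> f) (dplus_mor Z \<sigma> g)"
      by (elim conjE) (rule dplus_exact)
  next
    fix F :: "('z, 'a, 'm) dmod" and G :: "('z, 'a, 'n) dmod"
    assume "dmodule \<Lambda> Z F \<and> dmodule \<Lambda> Z G"
    then have "otens \<Lambda> Z W \<sigma> F G" by (elim conjE) (intro otens.intro osub_axioms osubm)
    then show "\<exists>\<phi>. dmod_iso \<Lambda> W
          (tensor_dmod \<Lambda> W (dplus \<Lambda> Z W \<sigma> F) (dplus \<Lambda> Z W \<sigma> G))
          (dplus \<Lambda> Z W \<sigma> (tensor_dmod \<Lambda> Z F G)) \<phi> \<and>
        (\<forall>V. openin (space W) V \<longrightarrow>
          (\<forall>m\<in>carrier (msec (dplus \<Lambda> Z W \<sigma> F) V). \<forall>n\<in>carrier (msec (dplus \<Lambda> Z W \<sigma> G) V).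
            \<phi> V (pure_tensor \<Lambda> W (dplus \<Lambda> Z W \<sigma> F) (dplus \<Lambda> Z W \<sigma> G) V m n) =
            pure_tensor \<Lambda> Z F G (pre Z \<sigma> V) m n))"
      by (rule otens.dplus_tensor)
  next
    fix F :: "('z, 'a, 'm) dmod" assume F: "dmodule \<Lambda> Z F" and l: "locally_free Z F"
    show "locally_free W (dplus \<Lambda> Z W \<sigma> F)"
      unfolding locally_free_def
    proof
      fix w assume "w \<in> topspace (space W)"
      from lift[OF this] obtain z where z: "z \<in> topspace (space Z)" "pt \<sigma> z = w" by blast
      obtain p q where "free_near Z F z p q" using l z(1) unfolding locally_free_def by blast
      from free[OF F z this] show "\<exists>p q. free_near W (dplus \<Lambda> Z W \<sigma> F) w p q" by (intro exI)
    qed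
  next
    fix F :: "('z, 'a, 'm) dmod" and p q assume F: "dmodule \<Lambda> Z F" and l: "locally_free_of_rank Z F p q"
    show "locally_free_of_rank W (dplus \<Lambda> Z W \<sigma> F) p q"
      unfolding locally_free_of_rank_def
    proof
      fix w assume "w \<in> topspace (space W)"
      from lift[OF this] obtain z where z: "z \<in> topspace (space Z)" "pt \<sigma> z = w" by blast
      have "free_near Z F z p q" using l z(1) unfolding locally_free_of_rank_def by blast
      from free[OF F z this] show "free_near W (dplus \<Lambda> Z W \<sigma> F) w p q" .
    qed
  qed
qed

end
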